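(* Let $\theta$ be an ergodic direction on a translation surface $X$. Then for Lebesgue almost any $p,p'$ in $X$ we have $$\underline{w}_{\mathrm{hit}}(\phi_\theta,p,p')=1.$$
   Context: A translation surface $X$ is a connected compact surface obtained from finitely many polygons in $\mathbb{R}^2$ by identifying, via translations, pairs of parallel sides of equal length and opposite orientation; it has a flat metric outside a finite set $\Sigma$ of conical singularities. $\phi_\theta$ is the unit speed flow on $X$ along the constant vector field $(\sin\theta,\cos\theta)$. $\theta$ is a Keane direction if there is no saddle connection (geodesic segment joining two points of $\Sigma$ with none in its interior) in direction $\theta$. An ergodic direction is a Keane direction $\theta$ such that the Lebesgue (area) measure of $X$ is ergodic for $\phi_\theta$. $R(\phi_\theta,p,p',r)=\inf\{t>r:\ \mathrm{Dist}(\phi_\theta^t(p),p')<r\}$, with $\mathrm{Dist}$ the flat distance, and $\underline{w}_{\mathrm{hit}}(\phi_\theta,p,p')=\liminf_{r\to0^+}\frac{\log R(\phi_\theta,p,p',r)}{-\log r}$. *)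

theory Defs
  imports "HOL-Analysis.Analysis"
begin

section \<open>Translation surfaces glued from polygons\<close>

text \<open>
  The plane is the type \<^typ>\<open>complex\<close>. A polygon is the list of its vertices in counterclockwise
  order (indices are read modulo the length). A pair \<open>(i, k)\<close> denotes the \<open>k\<close>-th side of the
  \<open>i\<close>-th polygon, running from vertex \<open>k\<close> to vertex \<open>k + 1\<close>; \<open>mate\<close> says which sides are
  identified with each other.
\<close>

record gluing =
  polys :: "complex list list"
  mate :: "nat \<times> nat \<Rightarrow> nat \<times> nat"

definition pvertex :: "complex list \<Rightarrow> nat \<Rightarrow> complex" where
  "pvertex vs k = vs ! (k mod length vs)"

definition pside :: "complex list \<Rightarrow> nat \<Rightarrow> complex set" where
  "pside vs k = closed_segment (pvertex vs k) (pvertex vs (Suc k))"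

definition pboundary :: "complex list \<Rightarrow> complex set" where
  "pboundary vs = (\<Union>k<length vs. pside vs k)"

definition pregion :: "complex list \<Rightarrow> complex set" where
  "pregion vs = pboundary vs \<union> inside (pboundary vs)"

text \<open>
  The boundary is a simple closed curve iff the sides without their final endpoints are pairwise
  disjoint. The last conjunct (positivity of twice the signed area) is the counterclockwise
  orientation. Angles equal to \<open>\<pi>\<close> are allowed.
\<close>

definition simple_polygon :: "complex list \<Rightarrow> bool" where
  "simple_polygon vs \<longleftrightarrow>
     3 \<le> length vs \<and> distinct vs \<and>
     disjoint_family_on (\<lambda>k. pside vs k - {pvertex vs (Suc k)}) {..<length vs} \<and>
     (\<Sum>k<length vs. Im (cnj (pvertex vs k) * pvertex vs (Suc k))) > 0"

definition sides :: "gluing \<Rightarrow> (nat \<times> nat) set" where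
  "sides X = {(i, k). i < length (polys X) \<and> k < length (polys X ! i)}"

definition side_start :: "gluing \<Rightarrow> nat \<times> nat \<Rightarrow> complex" where
  "side_start X e = pvertex (polys X ! fst e) (snd e)"

definition side_end :: "gluing \<Rightarrow> nat \<times> nat \<Rightarrow> complex" where
  "side_end X e = pvertex (polys X ! fst e) (Suc (snd e))"

text \<open>
  The disjoint union of the polygons; as \<^typ>\<open>nat\<close> is discrete, its topology as a subspace of
  \<^typ>\<open>nat \<times> complex\<close> is the disjoint union topology.
\<close>

definition poly_union :: "gluing \<Rightarrow> (nat \<times> complex) set" where
  "poly_union X = (SIGMA i:{..<length (polys X)}. pregion (polys X ! i))"

text \<open>
  The side \<open>e\<close> is mapped to \<open>mate X e\<close> by the translation that exchanges the start of one with
  the end of the other, so that the two polygons lie on opposite sides of the common edge.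
\<close>

definition glue_step :: "gluing \<Rightarrow> ((nat \<times> complex) \<times> (nat \<times> complex)) set" where
  "glue_step X = {((fst e, z), (fst (mate X e), z + (side_end X (mate X e) - side_start X e))) | e z.
      e \<in> sides X \<and> z \<in> closed_segment (side_start X e) (side_end X e)}"

definition glue_rel :: "gluing \<Rightarrow> ((nat \<times> complex) \<times> (nat \<times> complex)) set" where
  "glue_rel X = (glue_step X)\<^sup>* \<inter> (poly_union X \<times> poly_union X)"

type_synonym surface_point = "(nat \<times> complex) set"

definition points :: "gluing \<Rightarrow> surface_point set" where
  "points X = poly_union X // glue_rel X"

definition proj :: "gluing \<Rightarrow> nat \<times> complex \<Rightarrow> surface_point" where
  "proj X x = glue_rel X `` {x}"

text \<open>The quotient topology.\<close>

definition surface_topology :: "gluing \<Rightarrow> surface_point topology" where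
  "surface_topology X = topology (\<lambda>U. U \<subseteq> points X \<and>
     openin (top_of_set (poly_union X)) {x \<in> poly_union X. proj X x \<in> U})"

definition translation_surface :: "gluing \<Rightarrow> bool" where
  "translation_surface X \<longleftrightarrow>
     polys X \<noteq> [] \<and>
     (\<forall>vs \<in> set (polys X). simple_polygon vs) \<and>
     (\<forall>e \<in> sides X. mate X e \<in> sides X \<and> mate X (mate X e) = e \<and>
        side_end X (mate X e) - side_start X (mate X e) = - (side_end X e - side_start X e)) \<and>
     connected_space (surface_topology X)"

lemma istopology_surface:
  "istopology (\<lambda>U. U \<subseteq> points X \<and>
     openin (top_of_set (poly_union X)) {x \<in> poly_union X. proj X x \<in> U})"
  unfolding istopology_def
proof (rule conjI; intro allI impI)
  fix S T
  assume S: "S \<subseteq> points X \<and> openin (top_of_set (poly_union X)) {x \<in> poly_union X. proj X x \<in> S}"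
    and T: "T \<subseteq> points X \<and> openin (top_of_set (poly_union X)) {x \<in> poly_union X. proj X x \<in> T}"
  have "{x \<in> poly_union X. proj X x \<in> S \<inter> T} =
    {x \<in> poly_union X. proj X x \<in> S} \<inter> {x \<in> poly_union X. proj X x \<in> T}" by blast
  moreover have "openin (top_of_set (poly_union X))
     ({x \<in> poly_union X. proj X x \<in> S} \<inter> {x \<in> poly_union X. proj X x \<in> T})"
    by (rule openin_Int) (rule conjunct2[OF S], rule conjunct2[OF T])
  ultimately have "openin (top_of_set (poly_union X)) {x \<in> poly_union X. proj X x \<in> S \<inter> T}"
    by (simp only:)
  moreover have "S \<inter> T \<subseteq> points X"
    using conjunct1[OF S] by (rule le_infI1)
  ultimately show "S \<inter> T \<subseteq> points X \<and>
      openin (top_of_set (poly_union X)) {x \<in> poly_union X. proj X x \<in> S \<inter> T}"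
    by (rule conjI[rotated])
next
  fix K
  assume K: "\<forall>S\<in>K. S \<subseteq> points X \<and>
    openin (top_of_set (poly_union X)) {x \<in> poly_union X. proj X x \<in> S}"
  have eq: "{x \<in> poly_union X. proj X x \<in> \<Union>K} = \<Union>((\<lambda>S. {x \<in> poly_union X. proj X x \<in> S}) ` K)"
    by (rule set_eqI) blast
  have "openin (top_of_set (poly_union X)) (\<Union>((\<lambda>S. {x \<in> poly_union X. proj X x \<in> S}) ` K))"
  proof (rule openin_Union)
    fix V assume "V \<in> (\<lambda>S. {x \<in> poly_union X. proj X x \<in> S}) ` K"
    then obtain S where V: "V = {x \<in> poly_union X. proj X x \<in> S}" and "S \<in> K" by (rule imageE)
    show "openin (top_of_set (poly_union X)) V"
      unfolding V by (rule conjunct2[OF bspec[OF K \<open>S \<in> K\<close>]])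
  qed
  then have "openin (top_of_set (poly_union X)) {x \<in> poly_union X. proj X x \<in> \<Union>K}"
    by (simp only: eq)
  moreover have "\<Union>K \<subseteq> points X"
    by (rule Union_least) (rule conjunct1[OF bspec[OF K]])
  ultimately show "\<Union>K \<subseteq> points X \<and>
      openin (top_of_set (poly_union X)) {x \<in> poly_union X. proj X x \<in> \<Union>K}"
    by (rule conjI[rotated])
qed

lemma openin_surface_topology:
  "openin (surface_topology X) U \<longleftrightarrow> U \<subseteq> points X \<and>
     openin (top_of_set (poly_union X)) {x \<in> poly_union X. proj X x \<in> U}"
  unfolding surface_topology_def by (simp only: topology_inverse'[OF istopology_surface])


section \<open>Area, flat distance and conical singularities\<close>

definition area_measure :: "gluing \<Rightarrow> surface_point measure" where
  "area_measure X =
     distr (restrict_space (count_space UNIV \<Otimes>\<^sub>M lborel) (poly_union X))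
       (sigma (points X) {U. openin (surface_topology X) U}) (proj X)"

text \<open>\<open>broken_line X p q l\<close>: a path of length \<open>l\<close> from \<open>p\<close> to \<open>q\<close> consisting of finitely many
  straight segments, each contained in one polygon.\<close>

inductive broken_line :: "gluing \<Rightarrow> surface_point \<Rightarrow> surface_point \<Rightarrow> real \<Rightarrow> bool"
  for X :: gluing where
  broken_line_refl: "p \<in> points X \<Longrightarrow> broken_line X p p 0"
| broken_line_step: "broken_line X p (proj X (i, z)) l \<Longrightarrow> i < length (polys X) \<Longrightarrow>
    closed_segment z w \<subseteq> pregion (polys X ! i) \<Longrightarrow>
    broken_line X p (proj X (i, w)) (l + dist z w)"

definition flat_dist :: "gluing \<Rightarrow> surface_point \<Rightarrow> surface_point \<Rightarrow> real" where
  "flat_dist X p q = Inf {l. broken_line X p q l}"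

text \<open>
  The interior angle at vertex \<open>k\<close> is swept counterclockwise from the outgoing side to the
  incoming one; the predecessor of \<open>k\<close> is written \<open>k + (length vs - 1)\<close> modulo \<open>length vs\<close>.
\<close>

definition interior_angle :: "complex list \<Rightarrow> nat \<Rightarrow> real" where
  "interior_angle vs k =
     Arg2pi ((pvertex vs (k + (length vs - 1)) - pvertex vs k) /
             (pvertex vs (Suc k) - pvertex vs k))"

definition vertices_at :: "gluing \<Rightarrow> surface_point \<Rightarrow> (nat \<times> nat) set" where
  "vertices_at X p = {e \<in> sides X. proj X (fst e, side_start X e) = p}"

definition cone_angle :: "gluing \<Rightarrow> surface_point \<Rightarrow> real" where
  "cone_angle X p = (\<Sum>e\<in>vertices_at X p. interior_angle (polys X ! fst e) (snd e))"

text \<open>A vertex class of total angle \<open>2 * pi\<close> is a regular point of the flat metric.\<close>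

definition singularities :: "gluing \<Rightarrow> surface_point set" where
  "singularities X = {p \<in> points X. vertices_at X p \<noteq> {} \<and> cone_angle X p \<noteq> 2 * pi}"


section \<open>The directional flow\<close>

definition direction :: "real \<Rightarrow> complex" where
  "direction \<theta> = Complex (sin \<theta>) (cos \<theta>)"

text \<open>
  A curve defined on \<open>{a..b}\<close> has velocity \<open>direction \<theta>\<close> if both just after and just before
  each time it runs, inside some polygon, along a straight segment with this velocity. The two
  polygons may differ, since the curve may cross a side or a vertex. At a regular point the two
  one-sided conditions together say that the curve is a straight line in a translation chart.
\<close>

definition straight_curve :: "gluing \<Rightarrow> real \<Rightarrow> real \<Rightarrow> real \<Rightarrow> (real \<Rightarrow> surface_point) \<Rightarrow> bool" where
  "straight_curve X \<theta> a b \<gamma> \<longleftrightarrow>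
     (\<forall>t\<in>{a..b}. \<gamma> t \<in> points X) \<and>
     (\<forall>t\<in>{a..<b}. \<exists>\<epsilon>>0. \<exists>i<length (polys X). \<exists>z. \<forall>s. 0 \<le> s \<and> s < \<epsilon> \<longrightarrow>
        z + of_real s * direction \<theta> \<in> pregion (polys X ! i) \<and>
        \<gamma> (t + s) = proj X (i, z + of_real s * direction \<theta>)) \<and>
     (\<forall>t\<in>{a<..b}. \<exists>\<epsilon>>0. \<exists>i<length (polys X). \<exists>z. \<forall>s. 0 \<le> s \<and> s < \<epsilon> \<longrightarrow>
        z - of_real s * direction \<theta> \<in> pregion (polys X ! i) \<and>
        \<gamma> (t - s) = proj X (i, z - of_real s * direction \<theta>))"

text \<open>
  \<open>flow_rel X \<theta> t p q\<close>: the orbit of \<open>p\<close> is defined up to the (possibly negative) time \<open>t\<close>, i.e. it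
  meets no singularity between times \<open>0\<close> and \<open>t\<close>, and at time \<open>t\<close> it is at \<open>q\<close>.
\<close>

definition flow_rel :: "gluing \<Rightarrow> real \<Rightarrow> real \<Rightarrow> surface_point \<Rightarrow> surface_point \<Rightarrow> bool" where
  "flow_rel X \<theta> t p q \<longleftrightarrow>
     (\<exists>\<gamma>. straight_curve X \<theta> (min 0 t) (max 0 t) \<gamma> \<and>
          (\<forall>s\<in>{min 0 t..max 0 t}. \<gamma> s \<notin> singularities X) \<and> \<gamma> 0 = p \<and> \<gamma> t = q)"

definition flow_defined :: "gluing \<Rightarrow> real \<Rightarrow> real \<Rightarrow> surface_point \<Rightarrow> bool" where
  "flow_defined X \<theta> t p \<longleftrightarrow> (\<exists>q. flow_rel X \<theta> t p q)"

definition flow :: "gluing \<Rightarrow> real \<Rightarrow> real \<Rightarrow> surface_point \<Rightarrow> surface_point" where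
  "flow X \<theta> t p = (THE q. flow_rel X \<theta> t p q)"

definition saddle_connection :: "gluing \<Rightarrow> real \<Rightarrow> real \<Rightarrow> (real \<Rightarrow> surface_point) \<Rightarrow> bool" where
  "saddle_connection X \<theta> l \<gamma> \<longleftrightarrow>
     0 < l \<and> straight_curve X \<theta> 0 l \<gamma> \<and>
     \<gamma> 0 \<in> singularities X \<and> \<gamma> l \<in> singularities X \<and>
     (\<forall>t\<in>{0<..<l}. \<gamma> t \<notin> singularities X)"

definition Keane_direction :: "gluing \<Rightarrow> real \<Rightarrow> bool" where
  "Keane_direction X \<theta> \<longleftrightarrow> \<not> (\<exists>l \<gamma>. saddle_connection X \<theta> l \<gamma>)"

text \<open>
  In a Keane direction the set of points with a complete orbit is flow invariant and has full
  area; invariance of a set is therefore tested on this set.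
\<close>

definition complete_points :: "gluing \<Rightarrow> real \<Rightarrow> surface_point set" where
  "complete_points X \<theta> = {p \<in> points X. \<forall>t. flow_defined X \<theta> t p}"

definition flow_invariant :: "gluing \<Rightarrow> real \<Rightarrow> surface_point set \<Rightarrow> bool" where
  "flow_invariant X \<theta> A \<longleftrightarrow> (\<forall>t. \<forall>p \<in> complete_points X \<theta>. flow X \<theta> t p \<in> A \<longleftrightarrow> p \<in> A)"

definition ergodic_direction :: "gluing \<Rightarrow> real \<Rightarrow> bool" where
  "ergodic_direction X \<theta> \<longleftrightarrow> Keane_direction X \<theta> \<and>
     (\<forall>A \<in> sets (area_measure X). flow_invariant X \<theta> A \<longrightarrow>
        A \<in> null_sets (area_measure X) \<or> points X - A \<in> null_sets (area_measure X))"


section \<open>Hitting times\<close>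

definition hit_times :: "gluing \<Rightarrow> real \<Rightarrow> surface_point \<Rightarrow> surface_point \<Rightarrow> real \<Rightarrow> real set" where
  "hit_times X \<theta> p p' r =
     {t. t > r \<and> flow_defined X \<theta> t p \<and> flat_dist X (flow X \<theta> t p) p' < r}"

text \<open>For \<open>0 < r < 1\<close>, the infimum of the empty set is read as infinity, and so is its logarithm.\<close>

definition hit_ratio :: "gluing \<Rightarrow> real \<Rightarrow> surface_point \<Rightarrow> surface_point \<Rightarrow> real \<Rightarrow> ereal" where
  "hit_ratio X \<theta> p p' r =
     (if hit_times X \<theta> p p' r = {} then \<infinity>
      else ereal (ln (Inf (hit_times X \<theta> p p' r)) / - ln r))"

definition lower_hitting_exponent :: "gluing \<Rightarrow> real \<Rightarrow> surface_point \<Rightarrow> surface_point \<Rightarrow> ereal" where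
  "lower_hitting_exponent X \<theta> p p' = Liminf (at_right 0) (hit_ratio X \<theta> p p')"

end

theory Submission
 imports Defs
begin

text \<open>
 The lower bound \<open>1 \<le> liminf\<close> holds for every flow that preserves a
 two-dimensional area: for fixed \<open>t\<close> the pairs \<open>(x, y)\<close> for which the
 orbit of \<open>x\<close> is at time \<open>t\<close> within \<open>r\<close> of \<open>y\<close>
 have measure of order \<open>r\<^sup>2\<close>, and about \<open>T / r\<close> times
 \<open>t\<close> suffice to catch all visits before time \<open>T\<close>. With \<open>T = r powr
 (\<epsilon> - 1)\<close> and \<open>r = 2 powr (- n)\<close> this is summable and Borel-Cantelli
 applies (\<open>hitting_exponent_ge\<close>).

 For the upper bound it is enough that almost every pair has, for some \<open>\<kappa>\<close>,
 arbitrarily late times \<open>t\<close> at which the orbit of \<open>x\<close> is within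
 \<open>\<kappa> / t\<close> of \<open>y\<close>: take \<open>r = \<kappa> / t\<close>
 (\<open>hitting_exponent_le\<close>). The set of these pairs is invariant under the flow in
 \<open>x\<close> and in \<open>y\<close>, so by ergodicity, applied to its slices, it is null or
 conull (\<open>near_returns_AE\<close>), and only positive measure is needed. For this, the
 surface is cut into flow strips over a short transversal segment \<open>J\<close>. The return
 time to \<open>J\<close> is constant on each interval of \<open>J\<close> that contains no point
 whose orbit runs into a vertex or into an end of \<open>J\<close> before returning; tracing
 orbits backwards from the vertices and the two ends shows that the number of such points is
 bounded independently of the length of \<open>J\<close> (\<open>Cut_card\<close>). By recurrence
 the strips over the intervals fill the surface, so one of them has area at least a constant
 (\<open>large_strip\<close>). This strip has width times height bounded by a constant, and its
 height tends to infinity as \<open>J\<close> shrinks. A point in its lower part reaches, after a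
 time comparable to the height, the upper part within the width of any given point there
 (\<open>strip_pairs\<close>). Such pairs have measure bounded below, at arbitrarily large times.

 All of this takes place on the open polygons, which carry the full area and on which the surface
 is a union of plane pieces. There the orbit relation \<open>fl\<close> is built by moving to the
 boundary, changing to the glued side and going on. It is locally a translation
 (\<open>fl_stable\<close>), and it agrees with the flow of the surface, because straight curves
 are unique until they meet a singularity (\<open>sc_unique\<close>). That uniqueness rests on the
 geometry of the polygons: the inside lies to the left of every side (\<open>side_local\<close>),
 and around a vertex class of angle \<open>2 * pi\<close> the corners cover each direction once
 (\<open>corner_unique\<close>). Pairs of points of the surface are related to pairs in the open
 polygons by \<open>AE_area_pair\<close>.
\<close>

abbreviation ray :: "real => real => complex" where "ray th s \<equiv> of_real s * direction th"

section \<open>Planar geometry of simple polygons\<close>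

definition cross :: "complex => complex => real" where
 "cross a b = Im (cnj a * b)"

lemma cross_simps:
 "cross a (b + c) = cross a b + cross a c"
 "cross a (b - c) = cross a b - cross a c"
 "cross a (- b) = - cross a b"
 "cross (- a) b = - cross a b"
 "cross a (of_real t * b) = t * cross a b"
 "cross a a = 0" "cross a 0 = 0"
 by (simp_all add: cross_def algebra_simps)

lemma cross_eq_0_iff:
 assumes "a \<noteq> 0" shows "cross a b = 0 \<longleftrightarrow> (\<exists>t. b = of_real t * a)"
proof
 assume "cross a b = 0"
 hence im: "Im (cnj a * b) = 0" by (simp add: cross_def)
 have "b = of_real (Re (cnj a * b) / (cmod a)\<^sup>2) * a"
 proof -
  have "cnj a * b = of_real (Re (cnj a * b))" using im by (simp add: complex_eq_iff)
  moreover have "a * cnj a = of_real ((cmod a)\<^sup>2)" by (metis complex_norm_square)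
  ultimately have "of_real ((cmod a)\<^sup>2) * b = of_real (Re (cnj a * b)) * a"
   by (metis mult.assoc mult.commute)
  thus ?thesis using assms by (simp add: field_simps)
 qed
 thus "\<exists>t. b = of_real t * a" by blast
qed (auto simp: cross_simps)

lemma convex_cross_pos: "convex {w. 0 < cross a (w - z)}"
proof -
 have "{w. 0 < cross a (w - z)} = {w. inner (\<i> * a) w > inner (\<i> * a) z}"
  by (auto simp: cross_def inner_complex_def algebra_simps)
 thus ?thesis by (simp add: convex_halfspace_gt)
qed

lemma convex_cross_neg: "convex {w. cross a (w - z) < 0}"
 using convex_cross_pos[of "- a" z] by (simp add: cross_simps)

lemma cis_inj_2pi:
 assumes "of_real r * cis \<phi> = of_real s * cis \<psi>" "0 < r" "0 < s" "0 \<le> \<phi>" "\<phi> < 2 * pi" "0 \<le> \<psi>" "\<psi> < 2 * pi"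
 shows "\<phi> = \<psi>"
proof -
 have "Arg2pi (of_real r * cis \<phi>) = \<phi>" by (rule Arg2pi_unique[of r]) (use assms in \<open>auto simp: cis_conv_exp\<close>)
 moreover have "Arg2pi (of_real s * cis \<psi>) = \<psi>" by (rule Arg2pi_unique[of s]) (use assms in \<open>auto simp: cis_conv_exp\<close>)
 ultimately show ?thesis using assms by simp
qed

lemma Arg2pi_cis: "z = of_real (cmod z) * cis (Arg2pi z)"
 using Arg2pi_eq[of z] by (simp add: cis_conv_exp)

lemma cross_rotate: "cross c (of_real r * (cis h - 1) * c) = r * (cmod c)\<^sup>2 * sin h"
 unfolding cmod_power2 by (simp add: cross_def algebra_simps power2_eq_square)

lemma cross_ii: "cross c (of_real r * (\<i> * c)) = r * (cmod c)\<^sup>2"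
 unfolding cmod_power2 by (simp add: cross_def algebra_simps power2_eq_square)

lemma rotate_small: assumes "0 < e"
 shows "\<exists>d>0. \<forall>h. \<bar>h\<bar> < d --> cmod (of_real r * (cis h - 1) * c) < e"
proof -
 have "((\<lambda>h. of_real r * (cis h - 1) * c) \<longlongrightarrow> of_real r * (cis 0 - 1) * c) (at 0)"
  unfolding cis_conv_exp by (intro tendsto_intros)
 hence "\<forall>\<^sub>F h in at 0. dist (of_real r * (cis h - 1) * c) 0 < e"
  using assms tendstoD by force
 then obtain d where "d > 0" "\<forall>h. h \<noteq> 0 \<and> dist h 0 < d --> dist (of_real r * (cis h - 1) * c) 0 < e"
  unfolding eventually_at by auto
 moreover have "cmod (of_real r * (cis 0 - 1) * c) < e" using assms by simp
 ultimately show ?thesis by (intro exI[of _ d]) (metis dist_0_norm dist_commute dist_norm diff_zero real_norm_def)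
qed

locale polygon =
 fixes vs :: "complex list"
 assumes simple: "simple_polygon vs"
begin

abbreviation "n \<equiv> length vs"
abbreviation "v k \<equiv> pvertex vs k"
abbreviation "av k \<equiv> pvertex vs (Suc k) - pvertex vs k"
abbreviation "side k \<equiv> pside vs k"
abbreviation "oside k \<equiv> open_segment (v k) (v (Suc k))"
abbreviation "B \<equiv> pboundary vs"

lemma n3: "3 \<le> n" and dist: "distinct vs"
 and disj: "disjoint_family_on (\<lambda>k. pside vs k - {pvertex vs (Suc k)}) {..<length vs}"
 and area_pos: "(\<Sum>k<length vs. cross (v k) (v (Suc k))) > 0"
 using simple by (auto simp: simple_polygon_def cross_def)

lemma n0: "0 < n" using n3 by linarith

lemma v_mod [simp]: "v (k mod n) = v k" by (simp add: pvertex_def)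
lemma v_Suc_mod [simp]: "v (Suc (k mod n)) = v (Suc k)" by (simp add: pvertex_def mod_Suc_eq)
lemma side_mod [simp]: "side (k mod n) = side k" by (simp add: pside_def)

lemma v_eq_iff: "v k = v l \<longleftrightarrow> k mod n = l mod n"
 using dist n0 by (simp add: pvertex_def nth_eq_iff_index_eq)

lemma Suc_mod_neq: "Suc k mod n \<noteq> k mod n"
proof
 assume "Suc k mod n = k mod n"
 hence "n dvd Suc k - k" using mod_eq_dvd_iff_nat[of k "Suc k" n] by simp
 thus False using n3 by auto
qed

lemma Suc_Suc_mod_neq: "Suc (Suc k) mod n \<noteq> k mod n"
proof
 assume "Suc (Suc k) mod n = k mod n"
 hence "n dvd Suc (Suc k) - k" using mod_eq_dvd_iff_nat[of k "Suc (Suc k)" n] by simp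
 hence "n dvd 2" by (simp add: numeral_2_eq_2)
 hence "n \<le> 2" by (rule dvd_imp_le) simp
 thus False using n3 by auto
qed

lemma Suc_mod_cancel: "Suc k mod n = Suc l mod n \<longleftrightarrow> k mod n = l mod n"
proof
 assume *: "Suc k mod n = Suc l mod n"
 have "(Suc k + (n - 1)) mod n = (Suc l + (n - 1)) mod n"
  using * by (metis mod_add_left_eq)
 thus "k mod n = l mod n" using n0 by simp
next
 assume "k mod n = l mod n" thus "Suc k mod n = Suc l mod n" by (metis mod_Suc_eq)
qed

lemma v_neq_Suc: "v k \<noteq> v (Suc k)" using Suc_mod_neq[of k] by (simp add: v_eq_iff)

lemma av_neq0: "av k \<noteq> 0" using v_neq_Suc[of k] by auto

lemma disj': assumes "k mod n \<noteq> l mod n" "z \<in> side k" "z \<in> side l"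
 shows "z = v (Suc k) \<or> z = v (Suc l)"
proof (rule ccontr)
 assume *: "\<not> ?thesis"
 have "(pside vs (k mod n) - {pvertex vs (Suc (k mod n))}) \<inter> (pside vs (l mod n) - {pvertex vs (Suc (l mod n))}) = {}"
  using disj assms(1) n0 unfolding disjoint_family_on_def by (meson lessThan_iff mod_less_divisor)
 thus False using * assms unfolding side_mod v_Suc_mod by blast
qed

lemma v_in_side: "v k \<in> side k" "v (Suc k) \<in> side k" by (auto simp: pside_def)

lemma v_in_side_iff: "v k \<in> side l \<longleftrightarrow> l mod n = k mod n \<or> Suc l mod n = k mod n"
proof
 assume *: "v k \<in> side l"
 show "l mod n = k mod n \<or> Suc l mod n = k mod n"
 proof (cases "l mod n = k mod n")
  case False
  hence "v k = v (Suc l) \<or> v k = v (Suc k)" using disj'[of l k "v k"] * v_in_side by auto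
  thus ?thesis using v_neq_Suc by (auto simp: v_eq_iff)
 qed simp
next
 assume "l mod n = k mod n \<or> Suc l mod n = k mod n"
 thus "v k \<in> side l" using v_in_side by (metis v_eq_iff)
qed

lemma side_oside: "side k = insert (v k) (insert (v (Suc k)) (oside k))"
 by (auto simp: pside_def open_segment_def)

lemma oside_not_vertex: assumes "z \<in> oside k" shows "z \<noteq> v l"
proof
 assume "z = v l"
 hence "v l \<in> side k" using assms by (auto simp: side_oside)
 hence "v l = v k \<or> v l = v (Suc k)" unfolding v_in_side_iff v_eq_iff by auto
 thus False using assms \<open>z = v l\<close> by (auto simp: open_segment_def)
qed

lemma oside_side: assumes "z \<in> oside k" "z \<in> side l" shows "k mod n = l mod n"
 using disj'[of k l z] assms oside_not_vertex[OF assms(1)] by (auto simp: side_oside)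

lemma B_eq: "B = (\<Union>k. side k)"
proof -
 have "side k \<subseteq> B" for k
 proof -
  have "side (k mod n) \<subseteq> B" unfolding pboundary_def by (rule UN_upper) (use n0 in auto)
  thus ?thesis by simp
 qed
 thus ?thesis by (auto simp: pboundary_def)
qed

lemma side_sub_B: "side k \<subseteq> B" by (auto simp: B_eq)
lemma oside_sub_B: "oside k \<subseteq> B" using side_sub_B side_oside by blast

lemma compact_B: "compact B" unfolding pboundary_def pside_def
 by (intro compact_UN) auto

lemma closed_B: "closed B" using compact_B compact_imp_closed by blast

lemma B_cases: assumes "z \<in> B"
 obtains k where "k < n" "z = v k" | k where "k < n" "z \<in> oside k"
proof -
 obtain k where k: "k < n" "z \<in> side k" using assms by (auto simp: pboundary_def)
 then consider "z = v k" | "z = v (Suc k)" | "z \<in> oside k" by (auto simp: side_oside)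
 thus ?thesis
 proof cases
  case 2 hence "z = v (Suc k mod n)" "Suc k mod n < n" using n0 by auto
  thus ?thesis using that by blast
 qed (use k that in auto)
qed

primrec chain :: "nat => real => complex" where
 "chain 0 = linepath (v 0) (v 1)"
| "chain (Suc m) = chain m +++ linepath (v (Suc m)) (v (Suc (Suc m)))"

lemma chain: "Suc m < n ==> arc (chain m) \<and> pathstart (chain m) = v 0 \<and> pathfinish (chain m) = v (Suc m)
  \<and> path_image (chain m) = (\<Union>k\<le>m. side k)"
proof (induction m)
 case 0
 have "v 0 \<noteq> v 1" using v_neq_Suc[of 0] by simp
 thus ?case by (simp add: arc_linepath pside_def)
next
 case (Suc m)
 hence IH: "arc (chain m)" "pathstart (chain m) = v 0" "pathfinish (chain m) = v (Suc m)"
  "path_image (chain m) = (\<Union>k\<le>m. side k)" by auto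
 let ?l = "linepath (v (Suc m)) (v (Suc (Suc m)))"
 have l: "arc ?l" "path_image ?l = side (Suc m)" using v_neq_Suc[of "Suc m"] by (auto simp: pside_def)
 have sub: "path_image (chain m) \<inter> path_image ?l \<subseteq> {pathstart ?l}"
 proof
  fix z assume "z \<in> path_image (chain m) \<inter> path_image ?l"
  then obtain k where k: "k \<le> m" "z \<in> side k" "z \<in> side (Suc m)" using IH l by auto
  have kn: "k mod n = k" "Suc m mod n = Suc m" "m mod n = m" using k Suc.prems by auto
  have "z = v (Suc k) \<or> z = v (Suc (Suc m))" using disj'[OF _ k(2,3)] kn k by auto
  hence "z = v (Suc m)"
  proof
   assume z: "z = v (Suc k)"
   hence "Suc m mod n = Suc k mod n \<or> Suc (Suc m) mod n = Suc k mod n" using k(3) v_in_side_iff by auto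
   thus ?thesis using z v_eq_iff Suc_mod_cancel[of "Suc m" k] kn k by auto
  next
   assume z: "z = v (Suc (Suc m))"
   hence "k mod n = Suc (Suc m) mod n \<or> Suc k mod n = Suc (Suc m) mod n" using k(2) v_in_side_iff by auto
   moreover have "Suc k mod n \<noteq> Suc (Suc m) mod n" using Suc_mod_cancel kn k by auto
   moreover have "k mod n \<noteq> Suc (Suc m) mod n" using kn k Suc.prems
    by (cases "Suc (Suc m) = n") (auto simp: Suc_Suc_mod_neq)
   ultimately show ?thesis by auto
  qed
  thus "z \<in> {pathstart ?l}" by simp
 qed
 show ?case
  using arc_join[OF IH(1) l(1) _ sub] IH l Suc.prems
  by (auto simp: path_image_join atMost_Suc)
qed

text \<open>The boundary without its last side is an arc, so the whole is a simple closed path and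
 the Jordan curve theorem applies.\<close>

lemma Jordan:
 shows "frontier (inside B) = B" "frontier (outside B) = B" "bounded (inside B)" "connected (inside B)"
proof -
 obtain m where m: "n = Suc (Suc m)" using n3 by (metis Suc_n_not_le_n numeral_3_eq_3 not0_implies_Suc le_SucI zero_less_Suc n0 gr0_implies_Suc Suc_le_mono le_zero_eq nat.distinct(1))
 have c: "arc (chain m)" "pathstart (chain m) = v 0" "pathfinish (chain m) = v (Suc m)"
  "path_image (chain m) = (\<Union>k\<le>m. side k)" using chain[of m] m by auto
 let ?l = "linepath (v (Suc m)) (v (Suc (Suc m)))"
 have l: "arc ?l" "path_image ?l = side (Suc m)" using v_neq_Suc[of "Suc m"] by (auto simp: pside_def)
 have vn: "v (Suc (Suc m)) = v 0" by (simp add: v_eq_iff m)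
 have sub: "path_image (chain m) \<inter> path_image ?l \<subseteq> {pathstart (chain m), pathstart ?l}"
 proof
  fix z assume "z \<in> path_image (chain m) \<inter> path_image ?l"
  then obtain k where k: "k \<le> m" "z \<in> side k" "z \<in> side (Suc m)" using c l by auto
  have kn: "k mod n = k" "Suc m mod n = Suc m" "m mod n = m" "Suc k mod n = Suc k" using k m by auto
  have "z = v (Suc k) \<or> z = v (Suc (Suc m))" using disj'[OF _ k(2,3)] kn k by auto
  thus "z \<in> {pathstart (chain m), pathstart ?l}"
  proof
   assume z: "z = v (Suc k)"
   hence "Suc m mod n = Suc k mod n \<or> Suc (Suc m) mod n = Suc k mod n" using k(3) v_in_side_iff by auto
   thus ?thesis using z kn k m by auto
  next
   assume "z = v (Suc (Suc m))" thus ?thesis using vn c by simp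
  qed
 qed
 let ?c = "chain m +++ ?l"
 have simp: "simple_path ?c"
  by (rule simple_path_join_loop[OF c(1) l(1) _ _ sub]) (use c vn in auto)
 have fin: "pathfinish ?c = pathstart ?c" using c vn by simp
 have "path_image ?c = (\<Union>k\<le>m. side k) \<union> side (Suc m)" using c l by (simp add: path_image_join)
 also have "\<dots> = B" unfolding pboundary_def m by (auto simp: less_Suc_eq_le le_Suc_eq)
 finally have "path_image ?c = B" .
 thus "frontier (inside B) = B" "frontier (outside B) = B" "bounded (inside B)" "connected (inside B)"
  using Jordan_inside_outside[OF simp fin] by auto
qed

lemma open_in: "open (inside B)" "open (outside B)" using open_inside open_outside closed_B by auto

lemma connected_in_out: assumes "connected C" "C \<inter> B = {}"
 shows "C \<subseteq> inside B \<or> C \<subseteq> outside B"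
proof -
 have "C \<subseteq> inside B \<union> outside B" using assms inside_Un_outside by blast
 moreover have "inside B \<inter> outside B \<inter> C = {}" by auto
 ultimately have "inside B \<inter> C = {} \<or> outside B \<inter> C = {}"
  using connectedD[OF assms(1) open_in] by blast
 thus ?thesis using \<open>C \<subseteq> inside B \<union> outside B\<close> by blast
qed

text \<open>The disc of radius \<open>e\<close> at a point of a side is split by the side into an
 inner half and an outer half.\<close>

definition leftin :: "nat => complex => real => bool" where
 "leftin k z e \<longleftrightarrow> 0 < e \<and> (\<forall>w\<in>ball z e. (cross (av k) (w - z) > 0 --> w \<in> inside B) \<and>
   (cross (av k) (w - z) < 0 --> w \<in> outside B) \<and> (cross (av k) (w - z) = 0 --> w \<in> oside k))"

definition rightin :: "nat => complex => real => bool" where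
 "rightin k z e \<longleftrightarrow> 0 < e \<and> (\<forall>w\<in>ball z e. (cross (av k) (w - z) > 0 --> w \<in> outside B) \<and>
   (cross (av k) (w - z) < 0 --> w \<in> inside B) \<and> (cross (av k) (w - z) = 0 --> w \<in> oside k))"

lemma oside_param: "z \<in> oside k \<longleftrightarrow> (\<exists>t. 0 < t \<and> t < 1 \<and> z = v k + of_real t * av k)"
 using v_neq_Suc[of k] by (auto simp: in_segment scaleR_conv_of_real algebra_simps)

lemma side_param: "z \<in> side k \<longleftrightarrow> (\<exists>t. 0 \<le> t \<and> t \<le> 1 \<and> z = v k + of_real t * av k)"
 by (auto simp: pside_def in_segment scaleR_conv_of_real algebra_simps)

lemma side_cross: "z \<in> side k ==> w \<in> side k ==> cross (av k) (w - z) = 0"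
proof -
 assume "z \<in> side k" "w \<in> side k"
 then obtain s t where "z = v k + of_real t * av k" "w = v k + of_real s * av k"
  unfolding side_param by blast
 hence "w - z = of_real (s - t) * av k" by (simp only: of_real_diff ring_distribs) simp
 thus ?thesis by (simp only: cross_simps mult_zero_right)
qed

lemma other_sides_away: assumes "z \<in> oside k"
 shows "\<exists>e>0. ball z e \<inter> B \<subseteq> oside k \<and> (\<forall>w\<in>ball z e. cross (av k) (w - z) = 0 --> w \<in> oside k)"
proof -
 define C where "C = (\<Union>l\<in>{l. l < n \<and> l \<noteq> k mod n}. side l) \<union> {v k, v (Suc k)}"
 have "closed C" unfolding C_def pside_def by (intro closed_Un closed_UN) auto
 moreover have "z \<notin> C"
 proof
  assume "z \<in> C"
  then consider l where "l < n" "l \<noteq> k mod n" "z \<in> side l" | "z = v k" | "z = v (Suc k)" unfolding C_def by auto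
  thus False using oside_not_vertex[OF assms] oside_side[OF assms] by cases (metis mod_less)+
 qed
 ultimately obtain e1 where e1: "e1 > 0" "ball z e1 \<subseteq> - C"
  using open_contains_ball[of "- C"] by (auto simp: open_Compl)
 have sub: "ball z e1 \<inter> B \<subseteq> oside k"
 proof
  fix w assume w: "w \<in> ball z e1 \<inter> B"
  then obtain l where l: "l < n" "w \<in> side l" by (auto simp: pboundary_def)
  have "w \<notin> C" using w e1 by auto
  hence "l = k mod n" "w \<noteq> v k" "w \<noteq> v (Suc k)" using l unfolding C_def by auto
  thus "w \<in> oside k" using l side_oside[of k] by auto
 qed
 obtain t where t: "0 < t" "t < 1" "z = v k + of_real t * av k" using assms oside_param by auto
 define e where "e = min e1 (min t (1 - t) * cmod (av k))"
 have "e > 0" using e1 t av_neq0 by (auto simp: e_def)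
 moreover have "ball z e \<inter> B \<subseteq> oside k" using sub by (auto simp: e_def)
 moreover have "w \<in> oside k" if w: "w \<in> ball z e" "cross (av k) (w - z) = 0" for w
 proof -
  obtain s where s: "w - z = of_real s * av k" using cross_eq_0_iff[OF av_neq0] w(2) by blast
  have "cmod (w - z) < min t (1 - t) * cmod (av k)" using w by (auto simp: e_def dist_norm norm_minus_commute)
  hence "\<bar>s\<bar> < min t (1 - t)" using av_neq0 by (simp add: s norm_mult)
  hence "0 < t + s" "t + s < 1" by auto
  moreover have "w = v k + of_real (t + s) * av k" using s t by (simp add: algebra_simps)
  ultimately show ?thesis unfolding oside_param by blast
 qed
 ultimately show ?thesis by blast
qed

text \<open>Each open half disc misses the boundary, so it lies on one side of it. Both halves
 cannot lie on the same side, because every boundary point is a limit of inside and of outside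
 points.\<close>

lemma half_balls: assumes "z \<in> oside k"
 shows "\<exists>e. leftin k z e \<or> rightin k z e"
proof -
 obtain e where e: "e > 0" "ball z e \<inter> B \<subseteq> oside k"
  "\<And>w. w\<in>ball z e ==> cross (av k) (w - z) = 0 ==> w \<in> oside k"
  using other_sides_away[OF assms] by blast
 define L where "L = ball z e \<inter> {w. 0 < cross (av k) (w - z)}"
 define R where "R = ball z e \<inter> {w. cross (av k) (w - z) < 0}"
 have zero: "cross (av k) (w - z) = 0" if "w \<in> oside k" for w
  using side_cross[of z k w] that assms by (simp add: side_oside)
 have con: "connected L" "connected R" unfolding L_def R_def
  by (intro convex_connected convex_Int convex_cross_pos convex_cross_neg convex_ball)+
 have disj: "L \<inter> B = {}" "R \<inter> B = {}"
 proof -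
  have z0: "cross (av k) (w - z) = 0" if "w \<in> ball z e" "w \<in> B" for w using zero e(2) that by blast
  show "L \<inter> B = {}"
  proof (intro equals0I)
   fix w assume "w \<in> L \<inter> B"
   hence "w \<in> ball z e" "w \<in> B" "0 < cross (av k) (w - z)" unfolding L_def by blast+
   thus False using z0[of w] by linarith
  qed
  show "R \<inter> B = {}"
  proof (intro equals0I)
   fix w assume "w \<in> R \<inter> B"
   hence "w \<in> ball z e" "w \<in> B" "cross (av k) (w - z) < 0" unfolding R_def by blast+
   thus False using z0[of w] by linarith
  qed
 qed
 have LR: "ball z e \<subseteq> L \<union> R \<union> B"
 proof
  fix w assume "w \<in> ball z e"
  thus "w \<in> L \<union> R \<union> B" using e(3)[of w] oside_sub_B[of k]
   by (cases "cross (av k) (w - z)" "0::real" rule: linorder_cases) (auto simp: L_def R_def)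
 qed
 have zB: "z \<in> B" using assms oside_sub_B by blast
 have "ball z e \<inter> inside B \<noteq> {}" "ball z e \<inter> outside B \<noteq> {}"
  using zB Jordan(1,2) e(1) frontier_straddle[of z "inside B"] frontier_straddle[of z "outside B"]
  by (auto simp: ball_def)
 hence "(L \<union> R) \<inter> inside B \<noteq> {}" "(L \<union> R) \<inter> outside B \<noteq> {}"
  using LR inside_no_overlap[of B] outside_no_overlap[of B] by blast+
 moreover have "L \<subseteq> inside B \<or> L \<subseteq> outside B" "R \<subseteq> inside B \<or> R \<subseteq> outside B"
  using connected_in_out con disj by auto
 ultimately have "L \<subseteq> inside B \<and> R \<subseteq> outside B \<or> L \<subseteq> outside B \<and> R \<subseteq> inside B"
  using inside_Int_outside[of B] by blast
 thus ?thesis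
 proof
  assume "L \<subseteq> inside B \<and> R \<subseteq> outside B"
  hence "leftin k z e" unfolding leftin_def using e(1,3) by (simp add: L_def R_def subset_iff)
  thus ?thesis by blast
 next
  assume "L \<subseteq> outside B \<and> R \<subseteq> inside B"
  hence "rightin k z e" unfolding rightin_def using e(1,3) by (simp add: L_def R_def subset_iff)
  thus ?thesis by blast
 qed
qed

lemma leftin_not_rightin: assumes "leftin k z e" "rightin k z e'" shows False
proof -
 define c where "c = cmod (av k)"
 have c: "c > 0" using av_neq0[of k] unfolding c_def by (simp only: zero_less_norm_iff not_False_eq_True)
 have e: "0 < e" "0 < e'" using assms unfolding leftin_def rightin_def by blast+
 define r where "r = min e e' / (2 * c)"
 have r: "r > 0" "r * c < e" "r * c < e'" using e c by (auto simp: r_def)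
 define w where "w = z + of_real r * (\<i> * av k)"
 have wz: "w - z = of_real r * (\<i> * av k)" by (simp add: w_def)
 have "dist z w = cmod (w - z)" by (metis dist_commute dist_norm)
 also have "\<dots> = r * c" using r unfolding wz c_def by (simp only: norm_mult norm_of_real norm_ii mult_1_left abs_of_pos)
 finally have "w \<in> ball z e" "w \<in> ball z e'" using r by (auto simp: mem_ball)
 moreover have "cross (av k) (w - z) > 0"
  unfolding wz cross_ii c_def[symmetric] using r(1) c by (intro mult_pos_pos) auto
 ultimately have "w \<in> inside B" "w \<in> outside B" using assms unfolding leftin_def rightin_def by blast+
 thus False using inside_Int_outside by blast
qed

lemma leftin_shift: assumes "leftin k z e" "z \<in> oside k" "w \<in> oside k" "w \<in> ball z e" shows "leftin k w (e - dist z w)"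
proof -
 have "cross (av k) (w - z) = 0" using side_cross[of z k w] assms by (simp add: side_oside)
 hence "cross (av k) (u - w) = cross (av k) (u - z)" for u by (simp add: cross_simps)
 moreover have "u \<in> ball z e" if "u \<in> ball w (e - dist z w)" for u
  using that dist_triangle[of z u w] by auto
 ultimately show ?thesis using assms unfolding leftin_def by auto
qed

lemma rightin_shift: assumes "rightin k z e" "z \<in> oside k" "w \<in> oside k" "w \<in> ball z e" shows "rightin k w (e - dist z w)"
proof -
 have "cross (av k) (w - z) = 0" using side_cross[of z k w] assms by (simp add: side_oside)
 hence "cross (av k) (u - w) = cross (av k) (u - z)" for u by (simp add: cross_simps)
 moreover have "u \<in> ball z e" if "u \<in> ball w (e - dist z w)" for u
  using that dist_triangle[of z u w] by auto
 ultimately show ?thesis using assms unfolding rightin_def by auto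
qed

lemma leftin_const: assumes "leftin k z e" "z \<in> oside k" "w \<in> oside k" shows "\<exists>e. leftin k w e"
proof -
 define f where "f z = (\<exists>e. leftin k z e)" for z
 have "f z = f w"
 proof (rule connected_local_const[of "oside k"])
  show "\<forall>a\<in>oside k. eventually (\<lambda>b. f a = f b) (at a within oside k)"
  proof
   fix a assume a: "a \<in> oside k"
   obtain e where e: "leftin k a e \<or> rightin k a e" using half_balls[OF a] by blast
   hence "e > 0" by (auto simp: leftin_def rightin_def)
   have "f a = f b" if "b \<in> oside k" "b \<in> ball a e" for b
    using e leftin_shift[OF _ a that] rightin_shift[OF _ a that] leftin_not_rightin unfolding f_def by metis
   thus "eventually (\<lambda>b. f a = f b) (at a within oside k)"
    using \<open>e > 0\<close> unfolding eventually_at by (intro exI[of _ e]) (auto simp: dist_commute)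
  qed
 qed (rule convex_connected, rule convex_open_segment, rule assms(2), rule assms(3))
 thus ?thesis using assms unfolding f_def by blast
qed

definition ang :: "nat => real" where "ang k = Arg2pi (- av k / av (Suc k))"

definition pt :: "nat => real => real => complex" where
 "pt k r h = v (Suc k) + of_real r * cis h * av (Suc k)"

lemma ang_bounds: "0 \<le> ang k" "ang k < 2 * pi" unfolding ang_def using Arg2pi by auto

lemma av_ang: "\<exists>m>0. - av k = of_real m * cis (ang k) * av (Suc k) \<and> m = cmod (av k) / cmod (av (Suc k))"
proof -
 let ?q = "- av k / av (Suc k)"
 have q: "?q = of_real (cmod ?q) * cis (ang k)" unfolding ang_def by (rule Arg2pi_cis)
 have "cmod ?q = cmod (av k) / cmod (av (Suc k))" by (simp only: norm_divide norm_minus_cancel)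
 moreover have "0 < cmod (av k) / cmod (av (Suc k))" using av_neq0 by simp
 moreover have "- av k = ?q * av (Suc k)" by (simp only: times_divide_eq_left nonzero_mult_div_cancel_right[OF av_neq0])
 ultimately show ?thesis using q by metis
qed

lemma corner_away: "\<exists>e>0. ball (v (Suc k)) e \<inter> B \<subseteq> side k \<union> side (Suc k)"
proof -
 define C where "C = (\<Union>l\<in>{l. l < n \<and> l \<noteq> k mod n \<and> l \<noteq> Suc k mod n}. side l)"
 have "closed C" unfolding C_def pside_def by (intro closed_UN) auto
 moreover have "v (Suc k) \<notin> C"
  unfolding C_def using v_in_side_iff[of "Suc k"] by (auto simp: Suc_mod_cancel)
 ultimately obtain e where e: "e > 0" "ball (v (Suc k)) e \<subseteq> - C"
  using open_contains_ball[of "- C"] by (auto simp: open_Compl)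
 have "w \<in> side k \<union> side (Suc k)" if w: "w \<in> ball (v (Suc k)) e \<inter> B" for w
 proof -
  obtain l where l: "l < n" "w \<in> side l" using w by (auto simp: pboundary_def)
  have "w \<notin> C" using w e by auto
  hence "l = k mod n \<or> l = Suc k mod n" using l unfolding C_def by auto
  thus ?thesis using l side_mod[of k] side_mod[of "Suc k"] by auto
 qed
 thus ?thesis using e by blast
qed

text \<open>The two boundary segments at a vertex cut a small disc into two sectors, each of which is
 connected and hence on one side of the boundary curve.\<close>

definition sector :: "nat => real => real => real => complex set => bool" where
 "sector k r0 l u S \<longleftrightarrow> (\<forall>r h. 0 < r --> r < r0 --> l < h --> h < u --> pt k r h \<in> S)"

lemma corner:
 "\<exists>r0. 0 < ang k \<and> 0 < r0 \<and>
  (\<forall>r. 0 < r --> r < r0 --> pt k r 0 \<in> oside (Suc k)) \<and>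
  (\<forall>r. 0 < r --> r < r0 --> pt k r (ang k) \<in> oside k) \<and>
  (sector k r0 0 (ang k) (inside B) \<or> sector k r0 0 (ang k) (outside B)) \<and>
  (sector k r0 (ang k) (2 * pi) (inside B) \<or> sector k r0 (ang k) (2 * pi) (outside B))"
proof -
 obtain e1 where e1: "e1 > 0" "ball (v (Suc k)) e1 \<inter> B \<subseteq> side k \<union> side (Suc k)" using corner_away by blast
 obtain m where m: "m > 0" "- av k = of_real m * cis (ang k) * av (Suc k)" "m = cmod (av k) / cmod (av (Suc k))"
  using av_ang by blast
 define r0 where "r0 = min (min 1 m) (e1 / cmod (av (Suc k)))"
 have r0: "0 < r0" "r0 \<le> 1" "r0 \<le> m" "r0 \<le> e1 / cmod (av (Suc k))" using e1 m(1) av_neq0 by (auto simp: r0_def)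
 have c1: "pt k r 0 \<in> oside (Suc k)" if "0 < r" "r < r0" for r
  unfolding oside_param pt_def using that r0 by (intro exI[of _ r]) auto
 have mk: "of_real r * cis (ang k) * av (Suc k) = of_real (r / m) * (- av k)" for r
  unfolding m(2) using m(1) by simp
 have c2: "pt k r (ang k) \<in> oside k" if "0 < r" "r < r0" for r
 proof -
  have "pt k r (ang k) = v k + of_real (1 - r / m) * av k"
   unfolding pt_def mk by (simp only: of_real_diff of_real_1) (simp add: algebra_simps)
  moreover have "0 < 1 - r / m" "1 - r / m < 1" using that r0 m(1) by (auto simp: field_simps)
  ultimately show ?thesis unfolding oside_param by blast
 qed
 have apos: "ang k \<noteq> 0"
 proof
  assume "ang k = 0"
  hence "pt k (r0/2) 0 \<in> oside k" using c2[of "r0/2"] r0 by auto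
  moreover have "pt k (r0/2) 0 \<in> oside (Suc k)" using c1[of "r0/2"] r0 by auto
  ultimately have "k mod n = Suc k mod n" using oside_side[of _ k "Suc k"] side_oside[of "Suc k"] by blast
  thus False using Suc_mod_neq by metis
 qed
 have inball: "pt k r h \<in> ball (v (Suc k)) e1" if "0 < r" "r < r0" for r h
 proof -
  have "dist (v (Suc k)) (pt k r h) = r * cmod (av (Suc k))"
   using that by (simp add: pt_def dist_norm norm_mult)
  also have "\<dots> < r0 * cmod (av (Suc k))" using that av_neq0[of "Suc k"] by (intro mult_strict_right_mono) auto
  also have "\<dots> \<le> e1" using r0(4) av_neq0[of "Suc k"] by (simp add: field_simps)
  finally show ?thesis by simp
 qed
 have onB: "h = ang k" if r: "0 < r" "r < r0" and h: "0 < h" "h < 2 * pi" and B: "pt k r h \<in> B" for r h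
 proof -
  have "pt k r h \<in> side k \<or> pt k r h \<in> side (Suc k)" using inball[OF r] e1(2) B by blast
  thus ?thesis
  proof
   assume "pt k r h \<in> side (Suc k)"
   then obtain t where t: "0 \<le> t" "pt k r h = v (Suc k) + of_real t * av (Suc k)" unfolding side_param by blast
   hence eq: "of_real r * cis h = of_real t * cis 0" using av_neq0[of "Suc k"] by (simp add: pt_def)
   have "t \<noteq> 0" using eq r(1) by auto
   hence "h = 0" using cis_inj_2pi[OF eq] t r h by auto
   thus ?thesis using h by simp
  next
   assume "pt k r h \<in> side k"
   then obtain t where t: "0 \<le> t" "t \<le> 1" "pt k r h = v k + of_real t * av k" unfolding side_param by blast
   have "v k + of_real t * av k = v (Suc k) + of_real (1 - t) * (- av k)"
    by (simp only: of_real_diff of_real_1) (simp add: algebra_simps)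
   hence "of_real r * cis h * av (Suc k) = of_real ((1 - t) * m) * cis (ang k) * av (Suc k)"
    using t(3) m(2) unfolding pt_def by (metis add_left_cancel mult.assoc of_real_mult)
   hence eq: "of_real r * cis h = of_real ((1 - t) * m) * cis (ang k)" using av_neq0[of "Suc k"] by simp
   have "(1 - t) * m \<noteq> 0"
   proof
    assume "(1 - t) * m = 0"
    hence "of_real r * cis h = 0" using eq by (metis mult_zero_left of_real_0)
    thus False using r by simp
   qed
   hence "0 < (1 - t) * m" using t(2) m(1) by (simp add: less_le)
   thus ?thesis using cis_inj_2pi[OF eq r(1)] h ang_bounds[of k] by auto
  qed
 qed
 define S where "S l u = (\<lambda>(r,h). pt k r h) ` ({0<..<r0} \<times> {l<..<u})" for l u
 have con: "connected (S l u)" for l u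
  unfolding S_def case_prod_unfold pt_def cis_conv_exp
  by (intro connected_continuous_image continuous_intros convex_connected convex_Times) auto
 have S1: "S 0 (ang k) \<inter> B = {}" "S (ang k) (2*pi) \<inter> B = {}"
 proof -
  have "w \<notin> B" if w: "w \<in> S l u" "0 \<le> l" "u \<le> 2 * pi" "u \<le> ang k \<or> ang k \<le> l" for w l u
  proof -
   obtain r h where "w = pt k r h" "0 < r" "r < r0" "l < h" "h < u" using w(1) unfolding S_def by auto
   thus ?thesis using onB[of r h] w(2-4) by auto
  qed
  thus "S 0 (ang k) \<inter> B = {}" "S (ang k) (2*pi) \<inter> B = {}"
   using ang_bounds[of k] by (simp_all add: disjoint_iff)
 qed
 have D1: "S 0 (ang k) \<subseteq> inside B \<or> S 0 (ang k) \<subseteq> outside B" and D2: "S (ang k) (2*pi) \<subseteq> inside B \<or> S (ang k) (2*pi) \<subseteq> outside B"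
  using connected_in_out con S1 by blast+
 have memS: "pt k r h \<in> S l u" if "0 < r" "r < r0" "l < h" "h < u" for r h l u
  unfolding S_def by (rule image_eqI[of _ _ "(r,h)"]) (use that in auto)
 have sec: "sector k r0 l u T" if "S l u \<subseteq> T" for l u T
  unfolding sector_def by (intro allI impI subsetD[OF that] memS)
 have "0 < ang k" using apos ang_bounds(1)[of k] by auto
 thus ?thesis using r0(1) c1 c2 D1 D2 sec by blast
qed

lemma pt_rotate: "pt k r h = pt k r 0 + of_real r * (cis h - 1) * av (Suc k)"
 unfolding pt_def by (simp add: algebra_simps)

lemma pt_rotate': obtains m where "m > 0" "\<And>r h. pt k r (ang k + h) = pt k r (ang k) + of_real (r / m) * (cis h - 1) * (- av k)"
proof -
 obtain m where m: "m > 0" "- av k = of_real m * cis (ang k) * av (Suc k)" using av_ang by blast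
 have "pt k r (ang k + h) = pt k r (ang k) + of_real (r / m) * (cis h - 1) * (- av k)" for r h
 proof -
  have "of_real (r / m) * of_real m = (of_real r :: complex)" using m(1) by simp
  hence "of_real (r / m) * (cis h - 1) * (of_real m * cis (ang k) * av (Suc k)) = of_real r * ((cis h - 1) * cis (ang k) * av (Suc k))"
   by (metis (no_types, lifting) mult.assoc mult.left_commute)
  also have "\<dots> = of_real r * cis (ang k + h) * av (Suc k) - of_real r * cis (ang k) * av (Suc k)"
   unfolding cis_mult[symmetric] by (simp only: ring_distribs mult_ac) simp
  finally show ?thesis unfolding m(2) pt_def by (simp only: add_diff_eq[symmetric]) simp
 qed
 thus ?thesis using that m by blast
qed

lemma cross_uminus_left: "cross (v k - v (Suc k)) b = - cross (av k) b"
 by (simp add: cross_def algebra_simps)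

lemma small_angle: assumes "0 < e" "0 < d" "0 < u"
 obtains h where "0 < h" "h < d" "h < u" "h < pi" "cmod (of_real r * (cis h - 1) * c) < e" "cmod (of_real r * (cis (-h) - 1) * c) < e"
proof -
 obtain d' where "d' > 0" "\<forall>h. \<bar>h\<bar> < d' --> cmod (of_real r * (cis h - 1) * c) < e" using rotate_small[OF assms(1)] by blast
 thus ?thesis using assms pi_gt_zero
  by (intro that[of "min (min (min d u) d') pi / 2"]) (auto simp: min_def)
qed

text \<open>The sector of a small disc on the inner side of the corner touches both of its sides, on
 the left of the one exactly if on the left of the other.\<close>

lemma leftin_next: "(\<exists>z\<in>oside k. \<exists>e. leftin k z e) \<longleftrightarrow> (\<exists>z\<in>oside (Suc k). \<exists>e. leftin (Suc k) z e)"
proof -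
 obtain r0 where r0: "0 < ang k" "0 < r0"
  "\<And>r. 0 < r ==> r < r0 ==> pt k r 0 \<in> oside (Suc k)"
  "\<And>r. 0 < r ==> r < r0 ==> pt k r (ang k) \<in> oside k"
  "sector k r0 0 (ang k) (inside B) \<or> sector k r0 0 (ang k) (outside B)"
  "sector k r0 (ang k) (2 * pi) (inside B) \<or> sector k r0 (ang k) (2 * pi) (outside B)"
  using corner[of k] by blast
 define r where "r = r0 / 2"
 have r: "0 < r" "r < r0" using r0 by (auto simp: r_def)
 let ?z = "pt k r 0" and ?y = "pt k r (ang k)"
 have zy: "?z \<in> oside (Suc k)" "?y \<in> oside k" using r0 r by auto
 obtain e where e: "leftin (Suc k) ?z e \<or> rightin (Suc k) ?z e" using half_balls zy by blast
 obtain f where f: "leftin k ?y f \<or> rightin k ?y f" using half_balls zy by blast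
 have ef: "e > 0" "f > 0" using e f by (auto simp: leftin_def rightin_def)
 obtain m where m: "m > 0" "\<And>r h. pt k r (ang k + h) = pt k r (ang k) + of_real (r / m) * (cis h - 1) * (- av k)"
  using pt_rotate' by blast
 obtain h where h: "0 < h" "h < ang k" "h < pi" "cmod (of_real r * (cis h - 1) * av (Suc k)) < e"
  using small_angle[OF ef(1) r0(1) r0(1)] by metis
 obtain g where g: "0 < g" "g < ang k" "g < pi" "cmod (of_real (r / m) * (cis (-g) - 1) * (- av k)) < f"
  using small_angle[OF ef(2) r0(1) r0(1)] by metis
 have A: "pt k r h \<in> ball ?z e" unfolding pt_rotate[of k r h] using h(4) by (simp add: dist_norm)
 have A': "cross (av (Suc k)) (pt k r h - ?z) > 0"
 proof -
  have "pt k r h - ?z = of_real r * (cis h - 1) * av (Suc k)" using pt_rotate[of k r h] by simp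
  thus ?thesis unfolding cross_rotate using r h sin_gt_zero av_neq0 by (simp only: cross_rotate) simp
 qed
 have C: "pt k r (ang k - g) \<in> ball ?y f" using m(2)[of r "- g"] g(4) by (simp add: dist_norm norm_minus_commute)
 have C': "cross (av k) (pt k r (ang k - g) - ?y) > 0"
 proof -
  have "pt k r (ang k - g) - ?y = of_real (r/m) * (cis (-g) - 1) * (- av k)" using m(2)[of r "-g"] by simp
  hence "cross (- av k) (pt k r (ang k - g) - ?y) = r/m * (cmod (- av k))\<^sup>2 * sin (- g)" by (simp only: cross_rotate)
  moreover have "r/m * (cmod (- av k))\<^sup>2 * sin g > 0" using r m(1) g sin_gt_zero av_neq0[of k] by (intro mult_pos_pos) auto
  ultimately show ?thesis by (simp add: cross_uminus_left)
 qed
 have f1: "leftin k ?y f ==> pt k r (ang k - g) \<in> inside B" "rightin k ?y f ==> pt k r (ang k - g) \<in> outside B"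
  using C C' unfolding leftin_def rightin_def by blast+
 have e1: "leftin (Suc k) ?z e ==> pt k r h \<in> inside B" "rightin (Suc k) ?z e ==> pt k r h \<in> outside B"
  using A A' unfolding leftin_def rightin_def by blast+
 have io: "\<not> (w \<in> inside B \<and> w \<in> outside B)" for w using inside_Int_outside[of B] by blast
 have "(\<exists>e. leftin k ?y e) \<longleftrightarrow> pt k r (ang k - g) \<in> inside B"
  using f f1 leftin_not_rightin io by blast
 moreover have "(\<exists>e. leftin (Suc k) ?z e) \<longleftrightarrow> pt k r h \<in> inside B"
  using e e1 leftin_not_rightin io by blast
 moreover have "pt k r h \<in> inside B \<longleftrightarrow> pt k r (ang k - g) \<in> inside B"
 proof -
  have "0 < ang k - g" "ang k - g < ang k" using g by auto
  thus ?thesis using r0(5) r h io unfolding sector_def by blast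
 qed
 ultimately show ?thesis using zy leftin_const by blast
qed

lemma leftin_all_or_none: "(\<forall>k. \<forall>z\<in>oside k. \<exists>e. leftin k z e) \<or> (\<forall>k. \<forall>z\<in>oside k. \<exists>e. rightin k z e)"
proof -
 define P where "P k \<longleftrightarrow> (\<exists>z\<in>oside k. \<exists>e. leftin k z e)" for k
 have P: "P k \<longleftrightarrow> P 0" for k using leftin_next by (induction k) (auto simp: P_def)
 show ?thesis
 proof (cases "P 0")
  case True
  thus ?thesis using P leftin_const unfolding P_def by blast
 next
  case False
  hence "\<not> leftin k z e" if "z \<in> oside k" for k z e using P that unfolding P_def by blast
  thus ?thesis using half_balls by blast
 qed
qed

text \<open>If the inside were on the right of every side, each vertical line would meet the polygon
 in crossings whose signs alternate, so that the signed sum of the heights of the crossings would be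
 nonpositive. Integrated over all vertical lines this sum is the signed area, which is
 positive.\<close>

definition crossing :: "real => nat set" where
 "crossing x = {k. k < n \<and> (Re (v k) < x \<and> x < Re (v (Suc k)) \<or> Re (v (Suc k)) < x \<and> x < Re (v k))}"

definition height :: "nat => real => real" where
 "height k x = Im (v k) + (x - Re (v k)) / Re (av k) * Im (av k)"

definition sg :: "nat => real" where "sg k = - sgn (Re (av k))"

lemma finite_crossing: "finite (crossing x)" by (simp add: crossing_def)

lemma height_oside: assumes "k \<in> crossing x" shows "Complex x (height k x) \<in> oside k"
proof -
 let ?t = "(x - Re (v k)) / Re (av k)"
 have nz: "Re (av k) \<noteq> 0" using assms by (auto simp: crossing_def)
 have "0 < ?t" "?t < 1" using assms nz by (auto simp: crossing_def field_simps)
 moreover have "Complex x (height k x) = v k + of_real ?t * av k"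
  using nz by (simp add: complex_eq_iff height_def)
 ultimately show ?thesis unfolding oside_param by blast
qed

lemma on_B_crossing: assumes x: "\<And>k. x \<noteq> Re (v k)" and "Complex x y \<in> B"
 shows "\<exists>k\<in>crossing x. y = height k x"
proof -
 have "\<exists>k<n. Complex x y \<in> oside k"
  by (rule B_cases[OF assms(2)]) (use x in \<open>metis complex.sel(1)\<close>, blast)
 then obtain k where k: "k < n" "Complex x y \<in> oside k" by blast
 then obtain t where t: "0 < t" "t < 1" "Complex x y = v k + of_real t * av k" unfolding oside_param by blast
 hence xy: "x = Re (v k) + t * Re (av k)" "y = Im (v k) + t * Im (av k)" by (auto simp: complex_eq_iff)
 have nz: "Re (av k) \<noteq> 0" using xy x[of k] by auto
 have "y = height k x" unfolding height_def xy using nz by simp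
 moreover have "k \<in> crossing x"
 proof (cases "Re (av k) > 0")
  case True
  hence "0 < t * Re (av k)" "t * Re (av k) < 1 * Re (av k)" using t by (auto intro: mult_strict_right_mono simp del: minus_complex.sel)
  thus ?thesis using k xy by (auto simp: crossing_def)
 next
  case False
  hence "Re (av k) < 0" using nz by (simp del: minus_complex.sel)
  hence "t * Re (av k) < 0" "1 * Re (av k) < t * Re (av k)"
   using t by (auto intro: mult_pos_neg mult_strict_right_mono_neg simp del: minus_complex.sel)
  thus ?thesis using k xy by (auto simp: crossing_def)
 qed
 ultimately show ?thesis by blast
qed

lemma height_inj: assumes "k \<in> crossing x" "l \<in> crossing x" "height k x = height l x" shows "k = l"
proof -
 have "Complex x (height k x) \<in> oside k" "Complex x (height k x) \<in> side l"
  using height_oside[OF assms(1)] height_oside[OF assms(2)] assms(3) side_oside[of l] by auto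
 hence "k mod n = l mod n" using oside_side by blast
 thus ?thesis using assms by (auto simp: crossing_def)
qed

text \<open>Let \<open>cc y\<close> be the signed number of crossings above \<open>y\<close>, and
 \<open>inn y\<close> be 1 if the line is inside just above \<open>y\<close>. When \<open>y\<close>
 passes a crossing both change by opposite amounts, so \<open>cc + inn\<close> is constant, hence 0.
 So \<open>cc \<le> 0\<close>, and the integral of \<open>cc\<close> is the signed sum of the
 heights.\<close>

lemma slice_sum:
 assumes right: "\<And>k z. z \<in> oside k ==> \<exists>e. rightin k z e" and x: "\<And>k. x \<noteq> Re (v k)"
 shows "(\<Sum>k\<in>crossing x. sg k * height k x) \<le> 0"
proof -
 define inn where "inn y = (if \<exists>d>0. \<forall>y'. y < y' \<and> y' < y + d --> Complex x y' \<in> inside B then 1 else 0 :: real)" for y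
 define cc where "cc y = (\<Sum>k\<in>crossing x. sg k * (if y < height k x then 1 else 0))" for y
 define g where "g y = cc y + inn y" for y
 have nearby: "\<exists>e>0. \<forall>y'\<in>ball y e. \<forall>k\<in>crossing x. height k x \<noteq> y --> (y' < height k x \<longleftrightarrow> y < height k x) \<and> y' \<noteq> height k x" for y
 proof -
  define F where "F = (\<lambda>k. height k x) ` crossing x - {y}"
  have "open (- F)" unfolding F_def using finite_crossing by (intro open_Compl finite_imp_closed) auto
  then obtain e where e: "e > 0" "ball y e \<subseteq> - F" using open_contains_ball[of "- F"] unfolding F_def by blast
  have "(y' < h \<longleftrightarrow> y < h) \<and> y' \<noteq> h" if "y' \<in> ball y e" "h \<in> F" for y' h
   using that e(2) unfolding subset_iff ball_def dist_real_def mem_Collect_eq Compl_iff by smt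
  thus ?thesis using e(1) unfolding F_def by blast
 qed
 have inn_in: "inn y = 1" if "\<And>y'. y < y' ==> y' < y + d ==> Complex x y' \<in> inside B" "d > 0" for y d
  using that unfolding inn_def by auto
 have inn_out: "inn y = 0" if out: "\<And>y'. y < y' ==> y' < y + d ==> Complex x y' \<in> outside B" "d > 0" for y d
 proof -
  have "\<not> (\<forall>y'. y < y' \<and> y' < y + d' --> Complex x y' \<in> inside B)" if "d' > 0" for d'
  proof
   assume *: "\<forall>y'. y < y' \<and> y' < y + d' --> Complex x y' \<in> inside B"
   let ?y = "y + min d d' / 2"
   have "y < ?y" "?y < y + d" "?y < y + d'" using that \<open>d > 0\<close> by auto
   hence "Complex x ?y \<in> inside B" "Complex x ?y \<in> outside B" using * out by auto
   thus False using inside_Int_outside by blast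
  qed
  thus ?thesis unfolding inn_def by auto
 qed
 have dd: "dist (Complex x y) (Complex x y') = \<bar>y' - y\<bar>" for y y'
  by (simp add: dist_complex_def cmod_def real_sqrt_abs)
 have loc: "\<exists>e>0. \<forall>y'. dist y' y < e --> g y' = g y" for y
 proof -
  obtain e where e: "e > 0" "\<And>y' k. y' \<in> ball y e ==> k\<in>crossing x ==> height k x \<noteq> y ==> (y' < height k x \<longleftrightarrow> y < height k x) \<and> y' \<noteq> height k x"
   using nearby[of y] by blast
  show ?thesis
  proof (cases "\<exists>k\<in>crossing x. height k x = y")
   case False
   hence "Complex x y \<notin> B" using on_B_crossing[OF x] by blast
   hence "Complex x y \<in> inside B \<or> Complex x y \<in> outside B" using inside_Un_outside[of B] by blast
   moreover have cc: "cc y' = cc y" if "dist y' y < e" for y' unfolding cc_def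
    using e(2)[of y'] that False by (intro sum.cong) (auto simp: dist_commute)
   ultimately show ?thesis
   proof (elim disjE)
    assume "Complex x y \<in> inside B"
    then obtain d where d: "d > 0" "ball (Complex x y) d \<subseteq> inside B" using open_in(1) open_contains_ball by blast
    have "inn y' = 1" if "dist y' y < d" for y'
     by (rule inn_in[of _ "d - dist y' y"]) (use that d(2) dd in \<open>auto simp: subset_iff dist_real_def\<close>)
    hence "g y' = g y" if "dist y' y < min e d" for y' using cc[of y'] that d(1) unfolding g_def by auto
    moreover have "0 < min e d" using e(1) d(1) by simp
    ultimately show ?thesis by blast
   next
    assume "Complex x y \<in> outside B"
    then obtain d where d: "d > 0" "ball (Complex x y) d \<subseteq> outside B" using open_in(2) open_contains_ball by blast
    have "inn y' = 0" if "dist y' y < d" for y'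
     by (rule inn_out[of _ "d - dist y' y"]) (use that d(2) dd in \<open>auto simp: subset_iff dist_real_def\<close>)
    hence "g y' = g y" if "dist y' y < min e d" for y' using cc[of y'] that d(1) unfolding g_def by auto
    moreover have "0 < min e d" using e(1) d(1) by simp
    ultimately show ?thesis by blast
   qed
  next
   case True
   then obtain m where m: "m \<in> crossing x" "height m x = y" by blast
   have oth: "height k x \<noteq> y" if "k \<in> crossing x - {m}" for k using height_inj[of k x m] m that by (metis Diff_iff singletonI)
   define rest where "rest y' = (\<Sum>k\<in>crossing x - {m}. sg k * (if y' < height k x then 1 else 0))" for y'
   have cceq: "cc y' = sg m * (if y' < y then 1 else 0) + rest y'" for y'
    unfolding cc_def rest_def by (subst sum.remove[OF finite_crossing m(1)]) (simp only: m(2))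
   have rest: "rest y' = rest y" if "dist y' y < e" for y' unfolding rest_def
    using e(2)[of y'] that oth by (intro sum.cong) (auto simp: dist_commute)
   have "Complex x y \<in> oside m" using height_oside m by blast
   then obtain d where d: "rightin m (Complex x y) d" using right by blast
   hence d0: "d > 0" by (simp add: rightin_def)
   have cr: "cross (av m) (Complex x y' - Complex x y) = Re (av m) * (y' - y)" for y'
    by (simp add: cross_def)
   have nz: "Re (av m) \<noteq> 0" using m(1) by (auto simp: crossing_def)
   have io: "(Re (av m) * (y' - y) > 0 --> Complex x y' \<in> outside B) \<and> (Re (av m) * (y' - y) < 0 --> Complex x y' \<in> inside B)"
    if "\<bar>y' - y\<bar> < d" for y'
   proof -
    have "Complex x y' \<in> ball (Complex x y) d" using that dd by simp
    thus ?thesis using d unfolding rightin_def cr[symmetric] by blast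
   qed
   have val: "g y' = rest y + (if sg m > 0 then 1 else 0)" if y': "dist y' y < min e d" for y'
   proof (cases "Re (av m) > 0")
    case pos: True
    show ?thesis
    proof (cases "y' < y")
     case True
     have "inn y' = 1"
      by (rule inn_in[of _ "y - y'"]) (use True y' io pos in \<open>auto simp: dist_real_def mult_pos_neg simp del: minus_complex.sel\<close>)
     thus ?thesis unfolding g_def cceq using rest[of y'] y' True pos by (simp add: sg_def del: minus_complex.sel)
    next
     case False
     have "inn y' = 0"
      by (rule inn_out[of _ "d - (y' - y)"]) (use False y' io pos in \<open>auto simp: dist_real_def simp del: minus_complex.sel\<close>)
     thus ?thesis unfolding g_def cceq using rest[of y'] y' False pos by (simp add: sg_def del: minus_complex.sel)
    qed
   next
    case False
    hence neg: "Re (av m) < 0" using nz by auto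
    show ?thesis
    proof (cases "y' < y")
     case True
     have "inn y' = 0"
      by (rule inn_out[of _ "y - y'"]) (use True y' io neg in \<open>auto simp: dist_real_def mult_neg_neg simp del: minus_complex.sel\<close>)
     thus ?thesis unfolding g_def cceq using rest[of y'] y' True neg by (simp add: sg_def del: minus_complex.sel)
    next
     case False
     have "inn y' = 1"
      by (rule inn_in[of _ "d - (y' - y)"]) (use False y' io neg in \<open>auto simp: dist_real_def mult_neg_pos simp del: minus_complex.sel\<close>)
     thus ?thesis unfolding g_def cceq using rest[of y'] y' False neg by (simp add: sg_def del: minus_complex.sel)
    qed
   qed
   hence "g y' = g y" if "dist y' y < min e d" for y' using val[OF that] val[of y] e(1) d0 by simp
   moreover have "0 < min e d" using e(1) d0 by simp
   ultimately show ?thesis by blast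
  qed
 qed
 have gconst: "g y = g y'" for y y'
 proof (rule connected_local_const[of UNIV y y' g])
  show "\<forall>a\<in>UNIV. \<forall>\<^sub>F b in at a. g a = g b"
   using loc unfolding eventually_at by metis
 qed (rule connected_UNIV, rule UNIV_I, rule UNIV_I)
 obtain M where M: "\<And>w. w \<in> inside B ==> cmod w \<le> M" using Jordan(3) unfolding bounded_iff by blast
 obtain H where H: "\<And>k. k \<in> crossing x ==> \<bar>height k x\<bar> < H"
 proof -
  have "finite ((\<lambda>k. \<bar>height k x\<bar>) ` crossing x)" using finite_crossing by auto
  hence "\<bar>height k x\<bar> \<le> Max ((\<lambda>k. \<bar>height k x\<bar>) ` crossing x)" if "k \<in> crossing x" for k
   using that by (intro Max_ge) auto
  hence "\<bar>height k x\<bar> < Max ((\<lambda>k. \<bar>height k x\<bar>) ` crossing x) + 1" if "k \<in> crossing x" for k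
   using that by force
  thus ?thesis using that by blast
 qed
 have far: "inn y = 0" if y: "\<bar>y\<bar> > M + 1" for y
 proof (rule inn_out[of y 1])
  fix y' assume "y < y'" "y' < y + 1"
  show "Complex x y' \<in> outside B"
  proof (rule ccontr)
   assume "\<not> ?thesis"
   hence "Complex x y' \<in> inside B \<or> Complex x y' \<in> B" using inside_Un_outside[of B] by blast
   hence "Complex x y' \<in> closure (inside B)"
    using Jordan(1) closure_subset[of "inside B"] unfolding frontier_def by blast
   hence "cmod (Complex x y') \<le> M"
    using M closure_minimal[of "inside B" "cball 0 M"] by (auto simp: subset_iff)
   hence "\<bar>y'\<bar> \<le> M" using abs_Im_le_cmod[of "Complex x y'"] by simp
   thus False using y \<open>y < y'\<close> \<open>y' < y + 1\<close> by auto
  qed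
 qed simp
 define T where "T = max (max M H) 0 + 2"
 have T: "T > M + 1" "T > H" "T > 0" unfolding T_def by auto
 have "cc T = 0" unfolding cc_def by (intro sum.neutral) (use H T in \<open>fastforce simp: abs_less_iff\<close>)
 hence "g T = 0" using far[of T] T unfolding g_def by auto
 hence g0: "cc y = - inn y" for y using gconst[of y T] unfolding g_def by linarith
 have "cc (-T) = (\<Sum>k\<in>crossing x. sg k)" unfolding cc_def by (intro sum.cong) (use H T in \<open>fastforce simp: abs_less_iff\<close>)+
 hence s0: "(\<Sum>k\<in>crossing x. sg k) = 0" using g0[of "-T"] far[of "-T"] T by auto
 have int: "((\<lambda>y. sg k * (if y < height k x then 1 else 0)) has_integral sg k * (height k x + T)) {-T..T}"
  if "k \<in> crossing x" for k
 proof (rule has_integral_mult_right)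
  have b: "-T \<le> height k x" "height k x \<le> T" using H[OF that] T by auto
  have "((\<lambda>y. 1) has_integral (height k x + T)) {-T..height k x}"
   using has_integral_const_real[of "1::real" "-T" "height k x"] b by simp
  hence 1: "((\<lambda>y. if y < height k x then 1 else 0) has_integral (height k x + T)) {-T..height k x}"
   by (rule has_integral_spike_finite[of "{height k x}", rotated 2]) auto
  have 2: "((\<lambda>y. if y < height k x then 1 else 0::real) has_integral 0) {height k x..T}"
   by (rule has_integral_is_0) auto
  show "((\<lambda>y. if y < height k x then 1 else 0::real) has_integral (height k x + T)) {-T..T}"
   using has_integral_combine[OF b 1 2] by simp
 qed
 have "(cc has_integral (\<Sum>k\<in>crossing x. sg k * (height k x + T))) {-T..T}"
  unfolding cc_def by (intro has_integral_sum finite_crossing int)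
 moreover have "cc y \<le> 0" for y using g0[of y] unfolding inn_def by auto
 ultimately have "(\<Sum>k\<in>crossing x. sg k * (height k x + T)) \<le> 0"
  using has_integral_le[of cc _ "{-T..T}" "\<lambda>_. 0" 0] by auto
 also have "(\<Sum>k\<in>crossing x. sg k * (height k x + T)) = (\<Sum>k\<in>crossing x. sg k * height k x) + (\<Sum>k\<in>crossing x. sg k) * T"
  by (simp add: algebra_simps sum.distrib sum_distrib_left sum_distrib_right)
 finally show ?thesis using s0 by simp
qed

lemma slice_integral:
 assumes "\<And>j. j < n ==> \<bar>Re (v j)\<bar> \<le> L" "k < n"
 shows "((\<lambda>x. if k \<in> crossing x then sg k * height k x else 0) has_integral
   - (Re (v (Suc k)) - Re (v k)) * (Im (v k) + Im (v (Suc k))) / 2) {-L..L}"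
proof (cases "Re (av k) = 0")
 case True
 hence "k \<notin> crossing x" for x by (auto simp: crossing_def)
 thus ?thesis using True by simp
next
 case False
 define a where "a = min (Re (v k)) (Re (v (Suc k)))"
 define b where "b = max (Re (v k)) (Re (v (Suc k)))"
 have ab: "a < b" using False by (auto simp: a_def b_def)
 have "\<bar>Re (v (Suc k))\<bar> \<le> L" using assms(1)[of "Suc k mod n"] n0 by simp
 hence L: "-L \<le> a" "b \<le> L" using assms(1)[OF assms(2)] by (auto simp: a_def b_def)
 have cr: "k \<in> crossing x \<longleftrightarrow> a < x \<and> x < b" for x using assms(2) by (auto simp: crossing_def a_def b_def)
 define q where "q = Im (av k) / Re (av k)"
 have h: "height k x = Im (v k) + (x - Re (v k)) * q" for x by (simp add: height_def q_def)
 let ?F = "\<lambda>x. sg k * (Im (v k) * x + (x - Re (v k))\<^sup>2 / 2 * q)"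
 have "((\<lambda>x. sg k * height k x) has_integral ?F b - ?F a) {a..b}"
  unfolding h using ab
  by (intro fundamental_theorem_of_calculus)
    (auto simp: has_real_derivative_iff_has_vector_derivative[symmetric] intro!: derivative_eq_intros)
 moreover have "?F b - ?F a = - (Re (v (Suc k)) - Re (v k)) * (Im (v k) + Im (v (Suc k))) / 2"
 proof -
  have q: "q * Re (av k) = Im (av k)" using False by (simp add: q_def)
  define F where "F = (\<lambda>x. Im (v k) * x + (x - Re (v k))\<^sup>2 / 2 * q)"
  have "F (Re (v (Suc k))) - F (Re (v k)) = Im (v k) * Re (av k) + Re (av k) * (q * Re (av k)) / 2"
   unfolding F_def by (simp add: power2_eq_square algebra_simps)
  also have "\<dots> = Re (av k) * (Im (v k) + Im (v (Suc k))) / 2" unfolding q by (simp add: field_simps)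
  finally have F: "F (Re (v (Suc k))) - F (Re (v k)) = Re (av k) * (Im (v k) + Im (v (Suc k))) / 2" .
  show ?thesis
  proof (cases "Re (av k) > 0")
   case True
   hence "a = Re (v k)" "b = Re (v (Suc k))" "sg k = -1" by (auto simp: a_def b_def sg_def)
   thus ?thesis using F unfolding F_def by (simp add: algebra_simps)
  next
   case neg: False
   hence "b = Re (v k)" "a = Re (v (Suc k))" "sg k = 1" using False by (auto simp: a_def b_def sg_def)
   thus ?thesis using F unfolding F_def by (simp add: algebra_simps)
  qed
 qed
 ultimately have "((\<lambda>x. sg k * height k x) has_integral - (Re (v (Suc k)) - Re (v k)) * (Im (v k) + Im (v (Suc k))) / 2) {a..b}"
  by (simp only:)
 hence "((\<lambda>x. if k \<in> crossing x then sg k * height k x else 0) has_integral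
   - (Re (v (Suc k)) - Re (v k)) * (Im (v k) + Im (v (Suc k))) / 2) {a..b}"
  by (rule has_integral_spike_finite[of "{a,b}", rotated 2]) (auto simp: cr)
 thus ?thesis
  by (rule has_integral_on_superset) (use L in \<open>auto simp: cr\<close>)
qed

lemma not_all_right: "\<not> (\<forall>k. \<forall>z\<in>oside k. \<exists>e. rightin k z e)"
proof
 assume right: "\<forall>k. \<forall>z\<in>oside k. \<exists>e. rightin k z e"
 define L where "L = Max ((\<lambda>j. \<bar>Re (v j)\<bar>) ` {..<n})"
 have L: "\<bar>Re (v j)\<bar> \<le> L" if "j < n" for j unfolding L_def by (rule Max_ge) (use that in auto)
 define C where "C x = (\<Sum>k<n. if k \<in> crossing x then sg k * height k x else 0)" for x
 have Ceq: "C x = (\<Sum>k\<in>crossing x. sg k * height k x)" for x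
  unfolding C_def by (rule sum.mono_neutral_cong_right) (auto simp: crossing_def)
 have "(C has_integral (\<Sum>k<n. - (Re (v (Suc k)) - Re (v k)) * (Im (v k) + Im (v (Suc k))) / 2)) {-L..L}"
  unfolding C_def by (intro has_integral_sum slice_integral L) auto
 hence "((\<lambda>x. if x \<in> (\<lambda>k. Re (v k)) ` {..<n} then 0 else C x) has_integral (\<Sum>k<n. - (Re (v (Suc k)) - Re (v k)) * (Im (v k) + Im (v (Suc k))) / 2)) {-L..L}"
  by (rule has_integral_spike_finite[of "(\<lambda>k. Re (v k)) ` {..<n}", rotated 2]) auto
 moreover have "(if x \<in> (\<lambda>k. Re (v k)) ` {..<n} then 0 else C x) \<le> 0" for x
 proof -
  have "C x \<le> 0" if "x \<notin> (\<lambda>k. Re (v k)) ` {..<n}"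
  proof -
   have "x \<noteq> Re (v k)" for k
    using that n0 by (metis imageI lessThan_iff mod_less_divisor v_mod)
   thus ?thesis unfolding Ceq using right by (intro slice_sum) auto
  qed
  thus ?thesis by auto
 qed
 ultimately have "(\<Sum>k<n. - (Re (v (Suc k)) - Re (v k)) * (Im (v k) + Im (v (Suc k))) / 2) \<le> 0"
  using has_integral_le[of _ _ "{-L..L}" "\<lambda>_. 0" 0] by (metis (mono_tags, lifting) has_integral_0)
 hence le: "(\<Sum>k<n. - (Re (v (Suc k)) - Re (v k)) * (Im (v k) + Im (v (Suc k)))) \<le> 0"
  unfolding sum_divide_distrib[symmetric] by simp
 define p where "p k = Re (v k) * Im (v k)" for k
 have "- (Re (v (Suc k)) - Re (v k)) * (Im (v k) + Im (v (Suc k))) = cross (v k) (v (Suc k)) - (p (Suc k) - p k)" for k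
  by (simp add: cross_def p_def algebra_simps)
 hence "(\<Sum>k<n. - (Re (v (Suc k)) - Re (v k)) * (Im (v k) + Im (v (Suc k)))) = (\<Sum>k<n. cross (v k) (v (Suc k))) - (\<Sum>k<n. p (Suc k) - p k)"
  by (simp only: sum_subtractf)
 hence "(\<Sum>k<n. - (Re (v (Suc k)) - Re (v k)) * (Im (v k) + Im (v (Suc k)))) = (\<Sum>k<n. cross (v k) (v (Suc k))) - (p n - p 0)"
  by (simp only: sum_lessThan_telescope)
 moreover have "p n = p 0" unfolding p_def using v_eq_iff[of n 0] by simp
 ultimately show False using le area_pos by linarith
qed

theorem side_local: assumes "z \<in> oside k" shows "\<exists>e. leftin k z e"
 using leftin_all_or_none not_all_right assms by blast

theorem corner_local:
 obtains r0 where "0 < ang k" "0 < r0"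
  "\<And>r. 0 < r ==> r < r0 ==> pt k r 0 \<in> oside (Suc k)"
  "\<And>r. 0 < r ==> r < r0 ==> pt k r (ang k) \<in> oside k"
  "sector k r0 0 (ang k) (inside B)" "sector k r0 (ang k) (2 * pi) (outside B)"
proof -
 obtain r0 where r0: "0 < ang k" "0 < r0"
  "\<And>r. 0 < r ==> r < r0 ==> pt k r 0 \<in> oside (Suc k)"
  "\<And>r. 0 < r ==> r < r0 ==> pt k r (ang k) \<in> oside k"
  "sector k r0 0 (ang k) (inside B) \<or> sector k r0 0 (ang k) (outside B)"
  "sector k r0 (ang k) (2 * pi) (inside B) \<or> sector k r0 (ang k) (2 * pi) (outside B)"
  using corner[of k] by blast
 define r where "r = r0 / 2"
 have r: "0 < r" "r < r0" using r0 by (auto simp: r_def)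
 obtain e where e: "leftin (Suc k) (pt k r 0) e" using side_local r0(3) r by blast
 have e0: "e > 0" using e by (auto simp: leftin_def)
 have w: "0 < 2 * pi - ang k" using ang_bounds by simp
 obtain h where h: "0 < h" "h < ang k" "h < 2 * pi - ang k" "h < pi" "cmod (of_real r * (cis h - 1) * av (Suc k)) < e"
  "cmod (of_real r * (cis (-h) - 1) * av (Suc k)) < e"
  using small_angle[OF e0 r0(1) w] by metis
 have A: "pt k r h \<in> ball (pt k r 0) e" "pt k r (-h) \<in> ball (pt k r 0) e"
  unfolding pt_rotate[of k r h] pt_rotate[of k r "-h"] using h(5,6) by (simp_all add: dist_norm)
 have A': "cross (av (Suc k)) (pt k r g - pt k r 0) = r * (cmod (av (Suc k)))\<^sup>2 * sin g" for g
 proof -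
  have "pt k r g - pt k r 0 = of_real r * (cis g - 1) * av (Suc k)" using pt_rotate[of k r g] by simp
  thus ?thesis by (simp only: cross_rotate)
 qed
 have s: "r * (cmod (av (Suc k)))\<^sup>2 * sin h > 0" using r h sin_gt_zero av_neq0 by (intro mult_pos_pos) auto
 hence "cross (av (Suc k)) (pt k r h - pt k r 0) > 0" "cross (av (Suc k)) (pt k r (-h) - pt k r 0) < 0"
  unfolding A' by auto
 hence "pt k r h \<in> inside B" "pt k r (-h) \<in> outside B" using A e unfolding leftin_def by blast+
 moreover have "pt k r (- h) = pt k r (2 * pi - h)" by (simp add: pt_def cis.ctr)
 ultimately have "pt k r h \<notin> outside B" "pt k r (2 * pi - h) \<notin> inside B"
  using inside_Int_outside[of B] by (simp_all only: disjoint_iff) blast+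
 moreover have "ang k < 2 * pi - h" "2 * pi - h < 2 * pi" using h by auto
 ultimately have "\<not> sector k r0 0 (ang k) (outside B)" "\<not> sector k r0 (ang k) (2 * pi) (inside B)"
  using r h unfolding sector_def by (metis, metis)
 hence "sector k r0 0 (ang k) (inside B)" "sector k r0 (ang k) (2 * pi) (outside B)" using r0 by blast+
 thus ?thesis using r0(1-4) that by blast
qed

end

section \<open>Points of the glued surface\<close>

lemma half_min: fixes a b :: real assumes "0 < a" "0 < b"
 shows "0 < min a b / 2" "min a b / 2 < a" "min a b / 2 < b"
 using assms by (auto simp: min_def)

locale tsurf =
 fixes X :: gluing
 assumes ts: "translation_surface X"
begin

abbreviation "N \<equiv> length (polys X)"
abbreviation "P i \<equiv> polys X ! i"
abbreviation "reg i \<equiv> pregion (polys X ! i)"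
abbreviation "inn i \<equiv> inside (pboundary (polys X ! i))"
abbreviation "st e \<equiv> side_start X e"
abbreviation "en e \<equiv> side_end X e"
text \<open>The vector of a side, and the translation by which the side is glued to its
 mate.\<close>

definition sv :: "nat \<times> nat => complex" where "sv e = side_end X e - side_start X e"
definition tau :: "nat \<times> nat => complex" where "tau e = side_end X (mate X e) - side_start X e"
definition oseg :: "nat \<times> nat => complex set" where "oseg e = open_segment (side_start X e) (side_end X e)"
definition cseg :: "nat \<times> nat => complex set" where "cseg e = closed_segment (side_start X e) (side_end X e)"

lemma polygon: "i < N ==> polygon (P i)"
 using ts by (auto simp: translation_surface_def polygon_def)

lemma polygon_side: "e \<in> sides X ==> polygon (P (fst e))"
 using polygon by (auto simp: sides_def)

lemma mate: assumes "e \<in> sides X"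
 shows "mate X e \<in> sides X" "mate X (mate X e) = e" "sv (mate X e) = - sv e"
 using ts assms by (auto simp: translation_surface_def sv_def)

lemma side_fst: "e \<in> sides X ==> fst e < N" by (auto simp: sides_def)

lemma finite_sides: "finite (sides X)"
proof -
 have "sides X = (SIGMA i:{..<N}. {..<length (P i)})" by (auto simp: sides_def)
 thus ?thesis by simp
qed

lemma tau_eq: assumes "e \<in> sides X"
 shows "en (mate X e) = st e + tau e" "st (mate X e) = en e + tau e" "tau (mate X e) = - tau e"
proof -
 have *: "en (mate X e) - st (mate X e) = - (en e - st e)" using mate(3)[OF assms] by (simp only: sv_def)
 show "en (mate X e) = st e + tau e" by (simp add: tau_def)
 have "st (mate X e) = en (mate X e) + (en e - st e)" using * by (simp add: algebra_simps)
 thus s: "st (mate X e) = en e + tau e" by (simp add: tau_def)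
 show "tau (mate X e) = - tau e" unfolding tau_def mate(2)[OF assms] using s by (simp add: tau_def)
qed

lemma sv_nz: "e \<in> sides X ==> sv e \<noteq> 0"
 using polygon.av_neq0[OF polygon_side] by (simp add: sv_def side_start_def side_end_def)

lemma oseg_eq: "oseg e = open_segment (pvertex (P (fst e)) (snd e)) (pvertex (P (fst e)) (Suc (snd e)))"
 by (simp add: oseg_def side_start_def side_end_def)

lemma cseg_eq: "cseg e = pside (P (fst e)) (snd e)"
 by (simp add: cseg_def side_start_def side_end_def pside_def)

lemma oseg_cseg: "oseg e \<subseteq> cseg e" by (auto simp: oseg_def cseg_def open_segment_def)

lemma cseg_cases: "z \<in> cseg e ==> z = st e \<or> z = en e \<or> z \<in> oseg e"
 by (auto simp: oseg_def cseg_def open_segment_def)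

lemma st_en_cseg: "st e \<in> cseg e" "en e \<in> cseg e" by (auto simp: cseg_def)

lemma oseg_param: "e \<in> sides X ==> z \<in> oseg e \<longleftrightarrow> (\<exists>t. 0 < t \<and> t < 1 \<and> z = st e + of_real t * sv e)"
 using polygon.oside_param[OF polygon_side, of e z "snd e"] by (simp add: oseg_eq sv_def side_start_def side_end_def)

lemma cseg_param: "e \<in> sides X ==> z \<in> cseg e \<longleftrightarrow> (\<exists>t. 0 \<le> t \<and> t \<le> 1 \<and> z = st e + of_real t * sv e)"
 using polygon.side_param[OF polygon_side, of e z "snd e"] by (simp add: cseg_eq sv_def side_start_def side_end_def)

lemma seg_tau: assumes "e \<in> sides X"
 shows "z \<in> cseg e ==> z + tau e \<in> cseg (mate X e)" "z \<in> oseg e ==> z + tau e \<in> oseg (mate X e)"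
proof -
 have *: "st e + of_real t * sv e + tau e = st (mate X e) + of_real (1 - t) * sv (mate X e)" for t
 proof -
  have "en e = st e + sv e" by (simp add: sv_def)
  thus ?thesis unfolding mate(3)[OF assms] tau_eq(2)[OF assms] by (simp add: algebra_simps)
 qed
 show "z + tau e \<in> cseg (mate X e)" if "z \<in> cseg e"
 proof -
  obtain t where "0 \<le> t" "t \<le> 1" "z = st e + of_real t * sv e" using \<open>z \<in> cseg e\<close> cseg_param[OF assms] by blast
  hence "0 \<le> 1 - t" "1 - t \<le> 1" "z + tau e = st (mate X e) + of_real (1 - t) * sv (mate X e)" using * by auto
  thus ?thesis unfolding cseg_param[OF mate(1)[OF assms]] by blast
 qed
 show "z + tau e \<in> oseg (mate X e)" if "z \<in> oseg e"
 proof -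
  obtain t where "0 < t" "t < 1" "z = st e + of_real t * sv e" using \<open>z \<in> oseg e\<close> oseg_param[OF assms] by blast
  hence "0 < 1 - t" "1 - t < 1" "z + tau e = st (mate X e) + of_real (1 - t) * sv (mate X e)" using * by auto
  thus ?thesis unfolding oseg_param[OF mate(1)[OF assms]] by blast
 qed
qed

lemma cseg_bnd: "e \<in> sides X ==> cseg e \<subseteq> pboundary (P (fst e))"
 using polygon.side_sub_B[OF polygon_side] by (simp add: cseg_eq)

lemma reg_eq: "reg i = - outside (pboundary (P i))"
 unfolding pregion_def by (rule union_with_inside)

lemma bnd_reg: "pboundary (P i) \<subseteq> reg i" and inn_reg: "inn i \<subseteq> reg i" by (auto simp: pregion_def)

lemma cseg_reg: "e \<in> sides X ==> cseg e \<subseteq> reg (fst e)" using cseg_bnd bnd_reg by blast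

lemma inn_bnd: "z \<in> inn i ==> z \<notin> pboundary (P i)" using inside_no_overlap by blast

lemma open_inn: "i < N ==> open (inn i)" using polygon.open_in(1)[OF polygon] .

lemma poly_union_iff: "(i, z) \<in> poly_union X \<longleftrightarrow> i < N \<and> z \<in> reg i" by (auto simp: poly_union_def)

lemma side_sides: assumes "i < N" "z \<in> pboundary (P i)"
 obtains e where "e \<in> sides X" "fst e = i" "z = st e" | e where "e \<in> sides X" "fst e = i" "z \<in> oseg e"
proof -
 show thesis
 proof (rule polygon.B_cases[OF polygon[OF assms(1)] assms(2)])
  fix k assume "k < length (P i)" "z = pvertex (P i) k"
  thus thesis using that(1)[of "(i, k)"] assms by (simp add: sides_def side_start_def)
 next
  fix k assume "k < length (P i)" "z \<in> open_segment (pvertex (P i) k) (pvertex (P i) (Suc k))"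
  thus thesis using that(2)[of "(i, k)"] assms by (simp add: sides_def oseg_eq)
 qed
qed

lemma reg_cases: assumes "i < N" "z \<in> reg i"
 obtains "z \<in> inn i" | e where "e \<in> sides X" "fst e = i" "z = st e" | e where "e \<in> sides X" "fst e = i" "z \<in> oseg e"
 using assms side_sides unfolding pregion_def by blast

lemma oseg_unique: assumes "e \<in> sides X" "e' \<in> sides X" "fst e = fst e'" "z \<in> oseg e" "z \<in> cseg e'" shows "e = e'"
proof -
 have "snd e mod length (P (fst e)) = snd e' mod length (P (fst e))"
  using polygon.oside_side[OF polygon_side[OF assms(1)], of z "snd e" "snd e'"] assms by (simp add: oseg_eq cseg_eq)
 thus ?thesis using assms by (auto simp: sides_def prod_eq_iff)
qed

lemma oseg_not_st: assumes "e \<in> sides X" "e' \<in> sides X" "fst e = fst e'" "z \<in> oseg e" shows "z \<noteq> st e'" "z \<noteq> en e'"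
 using polygon.oside_not_vertex[OF polygon_side[OF assms(1)], of z "snd e"] assms
 by (simp_all add: oseg_eq side_start_def side_end_def)

lemma side_loc: assumes "e \<in> sides X" "z \<in> oseg e"
 shows "\<exists>r>0. \<forall>w\<in>ball z r. (cross (sv e) (w - z) > 0 --> w \<in> inn (fst e)) \<and>
  (cross (sv e) (w - z) < 0 --> w \<notin> reg (fst e)) \<and> (cross (sv e) (w - z) = 0 --> w \<in> oseg e)"
proof -
 interpret pg: polygon "P (fst e)" using polygon_side assms(1) .
 obtain r where "pg.leftin (snd e) z r" using pg.side_local[of z "snd e"] assms(2) unfolding oseg_eq by blast
 thus ?thesis unfolding pg.leftin_def reg_eq oseg_eq sv_def side_start_def side_end_def by blast
qed

section \<open>Corners around a vertex\<close>

text \<open>A pair \<open>c\<close> also stands for the corner at the start of the side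
 \<open>c\<close>. It is swept counterclockwise by the angle \<open>alpha c\<close> from the side
 \<open>c\<close> to the side \<open>prv c\<close>, and \<open>cpt c\<close> gives polar coordinates
 at its apex.\<close>

definition prv :: "nat \<times> nat => nat \<times> nat" where
 "prv c = (fst c, (snd c + (length (P (fst c)) - 1)) mod length (P (fst c)))"
definition nxt :: "nat \<times> nat => nat \<times> nat" where
 "nxt c = (fst c, Suc (snd c) mod length (P (fst c)))"
definition alpha :: "nat \<times> nat => real" where
 "alpha c = interior_angle (P (fst c)) (snd c)"
definition cpt :: "nat \<times> nat => real => real => complex" where
 "cpt c r h = st c + of_real r * cis h * sv c"

lemma nxt_prv: assumes "c \<in> sides X"
 shows "prv c \<in> sides X" "nxt c \<in> sides X" "nxt (prv c) = c" "prv (nxt c) = c" "en (prv c) = st c" "st (nxt c) = en c"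
proof -
 interpret pg: polygon "P (fst c)" using polygon_side assms(1) .
 have k: "snd c < pg.n" using assms by (auto simp: sides_def)
 show "prv c \<in> sides X" "nxt c \<in> sides X" using assms pg.n0 by (auto simp: sides_def prv_def nxt_def)
 show np: "nxt (prv c) = c" 
 proof -
  have "Suc ((snd c + (pg.n - 1)) mod pg.n) mod pg.n = Suc (snd c + (pg.n - 1)) mod pg.n" by (rule mod_Suc_eq)
  also have "Suc (snd c + (pg.n - 1)) = snd c + pg.n" using pg.n0 by simp
  finally show ?thesis unfolding nxt_def prv_def using k by (simp add: prod_eq_iff)
 qed
 have "(Suc (snd c) mod pg.n + (pg.n - 1)) mod pg.n = (Suc (snd c) + (pg.n - 1)) mod pg.n" by (rule mod_add_left_eq)
 also have "Suc (snd c) + (pg.n - 1) = snd c + pg.n" using pg.n0 by simp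
 finally show "prv (nxt c) = c" unfolding nxt_def prv_def using k by (simp add: prod_eq_iff)
 show e: "st (nxt c) = en c" for c by (simp add: nxt_def side_start_def side_end_def pvertex_def)
 show "en (prv c) = st c" using e[of "prv c"] np by simp
qed

lemma alpha_bounds: assumes "c \<in> sides X" shows "0 < alpha c" "alpha c < 2 * pi"
 and corner_loc: "\<exists>r0>0. \<forall>r. 0 < r \<and> r < r0 --> cpt c r 0 \<in> oseg c \<and> cpt c r (alpha c) \<in> oseg (prv c) \<and>
   (\<forall>h. 0 < h \<and> h < alpha c --> cpt c r h \<in> inn (fst c)) \<and>
   (\<forall>h. alpha c < h \<and> h < 2 * pi --> cpt c r h \<notin> reg (fst c))"
 and prv_angle: "\<exists>m>0. - sv (prv c) = of_real m * cis (alpha c) * sv c"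
proof -
 interpret pg: polygon "P (fst c)" using polygon_side assms(1) .
 define k where "k = snd c + (pg.n - 1)"
 have k: "snd c < pg.n" using assms by (auto simp: sides_def)
 have Sk: "Suc k = snd c + pg.n" using k by (simp add: k_def)
 have v1: "pvertex (P (fst c)) (Suc k) = st c" unfolding Sk by (simp add: pvertex_def side_start_def)
 have v2: "pvertex (P (fst c)) (Suc (Suc k)) = en c" unfolding Sk by (simp add: pvertex_def side_end_def mod_Suc_eq flip: add_Suc)
 have v0: "pvertex (P (fst c)) k = st (prv c)" by (simp add: pvertex_def side_start_def prv_def k_def)
 have p: "en (prv c) = st c" by (rule nxt_prv(5)[OF assms])
 have avS: "pvertex (P (fst c)) (Suc (Suc k)) - pvertex (P (fst c)) (Suc k) = sv c" unfolding v1 v2 sv_def ..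
 have av0: "pvertex (P (fst c)) (Suc k) - pvertex (P (fst c)) k = sv (prv c)" unfolding v1 v0 sv_def p ..
 have o1: "open_segment (pvertex (P (fst c)) (Suc k)) (pvertex (P (fst c)) (Suc (Suc k))) = oseg c" unfolding v1 v2 oseg_def ..
 have o0: "open_segment (pvertex (P (fst c)) k) (pvertex (P (fst c)) (Suc k)) = oseg (prv c)" unfolding v1 v0 oseg_def p ..
 have al: "pg.ang k = alpha c"
 proof -
  have f1: "- sv (prv c) = pvertex (P (fst c)) k - pvertex (P (fst c)) (snd c)" unfolding av0[symmetric] v1 by (simp add: side_start_def)
  have f2: "sv c = pvertex (P (fst c)) (Suc (snd c)) - pvertex (P (fst c)) (snd c)" by (simp add: sv_def side_start_def side_end_def)
  have "pg.ang k = Arg2pi (- sv (prv c) / sv c)" unfolding pg.ang_def avS av0 ..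
  also have "\<dots> = alpha c" unfolding f1 f2 alpha_def interior_angle_def k_def ..
  finally show ?thesis .
 qed
 have cp: "pg.pt k r h = cpt c r h" for r h
 proof -
  have "pg.pt k r h = pvertex (P (fst c)) (Suc k) + of_real r * cis h * sv c" unfolding pg.pt_def avS ..
  thus ?thesis unfolding v1 cpt_def .
 qed
 obtain r0 where r0: "0 < pg.ang k" "0 < r0"
  "\<And>r. 0 < r ==> r < r0 ==> pg.pt k r 0 \<in> oseg c"
  "\<And>r. 0 < r ==> r < r0 ==> pg.pt k r (pg.ang k) \<in> oseg (prv c)"
  "pg.sector k r0 0 (pg.ang k) (inn (fst c))" "pg.sector k r0 (pg.ang k) (2 * pi) (outside (pboundary (P (fst c))))"
  using pg.corner_local[of k] unfolding o1 o0 by blast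
 show "0 < alpha c" "alpha c < 2 * pi" using r0(1) pg.ang_bounds(2)[of k] unfolding al by auto
 show "\<exists>r0>0. \<forall>r. 0 < r \<and> r < r0 --> cpt c r 0 \<in> oseg c \<and> cpt c r (alpha c) \<in> oseg (prv c) \<and>
   (\<forall>h. 0 < h \<and> h < alpha c --> cpt c r h \<in> inn (fst c)) \<and>
   (\<forall>h. alpha c < h \<and> h < 2 * pi --> cpt c r h \<notin> reg (fst c))"
  using r0(2-6) unfolding pg.sector_def al cp reg_eq by (intro exI[of _ r0]) blast
 show "\<exists>m>0. - sv (prv c) = of_real m * cis (alpha c) * sv c"
  using pg.av_ang[of k] unfolding av0 avS al by blast
qed

lemma glue_step_iff: "((i, z), y) \<in> glue_step X \<longleftrightarrow>
  (\<exists>e\<in>sides X. fst e = i \<and> z \<in> cseg e \<and> y = (fst (mate X e), z + tau e))"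
proof
 assume "((i, z), y) \<in> glue_step X"
 then obtain e w where "(i, z) = (fst e, w)" "y = (fst (mate X e), w + (en (mate X e) - st e))"
  "e \<in> sides X" "w \<in> closed_segment (st e) (en e)" unfolding glue_step_def by blast
 thus "\<exists>e\<in>sides X. fst e = i \<and> z \<in> cseg e \<and> y = (fst (mate X e), z + tau e)"
  unfolding cseg_def tau_def by (intro bexI[of _ e]) auto
next
 assume "\<exists>e\<in>sides X. fst e = i \<and> z \<in> cseg e \<and> y = (fst (mate X e), z + tau e)"
 thus "((i, z), y) \<in> glue_step X" unfolding glue_step_def cseg_def tau_def by blast
qed

lemma glue_step_union: assumes "(x, y) \<in> glue_step X" shows "x \<in> poly_union X" "y \<in> poly_union X"
proof -
 obtain i z where x: "x = (i, z)" by (cases x)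
 then obtain e where e: "e \<in> sides X" "fst e = i" "z \<in> cseg e" "y = (fst (mate X e), z + tau e)"
  using assms glue_step_iff by blast
 show "x \<in> poly_union X" using e cseg_reg[OF e(1)] side_fst[OF e(1)] by (auto simp: x poly_union_iff)
 show "y \<in> poly_union X" using e seg_tau(1)[OF e(1,3)] cseg_reg[OF mate(1)[OF e(1)]] side_fst[OF mate(1)[OF e(1)]]
  by (auto simp: poly_union_iff)
qed

lemma sym_step: "sym (glue_step X)"
proof (rule symI)
 fix x y assume *: "(x, y) \<in> glue_step X"
 obtain i z where x: "x = (i, z)" by (cases x)
 then obtain e where e: "e \<in> sides X" "fst e = i" "z \<in> cseg e" "y = (fst (mate X e), z + tau e)"
  using * glue_step_iff by blast
 have "x = (fst (mate X (mate X e)), z + tau e + tau (mate X e))" using e mate(2)[OF e(1)] tau_eq(3)[OF e(1)] x by simp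
 thus "(y, x) \<in> glue_step X" unfolding e(4) glue_step_iff
  using mate(1)[OF e(1)] seg_tau(1)[OF e(1,3)] by blast
qed

lemma equiv_glue: "equiv (poly_union X) (glue_rel X)"
proof (rule equivI)
 show "glue_rel X \<subseteq> poly_union X \<times> poly_union X" by (auto simp: glue_rel_def)
 show "refl_on (poly_union X) (glue_rel X)" by (auto simp: refl_on_def glue_rel_def)
 show "sym (glue_rel X)" using sym_rtrancl[OF sym_step] by (auto simp: sym_def glue_rel_def)
 show "trans (glue_rel X)" using trans_rtrancl[of "glue_step X"] unfolding trans_def glue_rel_def by blast
qed

lemma proj_eq: assumes "x \<in> poly_union X" "y \<in> poly_union X"
 shows "proj X x = proj X y \<longleftrightarrow> (x, y) \<in> (glue_step X)\<^sup>*"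
 unfolding proj_def using eq_equiv_class_iff[OF equiv_glue assms] assms by (simp add: glue_rel_def)

lemma proj_points: "x \<in> poly_union X ==> proj X x \<in> points X"
 by (simp add: proj_def points_def quotientI)

lemma proj_tau: assumes "e \<in> sides X" "z \<in> cseg e"
 shows "proj X (fst e, z) = proj X (fst (mate X e), z + tau e)"
proof -
 have s: "((fst e, z), (fst (mate X e), z + tau e)) \<in> glue_step X" using assms glue_step_iff by blast
 thus ?thesis using proj_eq[OF glue_step_union[OF s]] by blast
qed

lemma closed_class: assumes "(x, y) \<in> (glue_step X)\<^sup>*" "x \<in> S" "\<And>x y. x \<in> S ==> (x, y) \<in> glue_step X ==> y \<in> S" shows "y \<in> S"
 using assms(1,2) by (induction rule: rtrancl_induct) (use assms(3) in auto)

lemma class_inn: assumes "i < N" "z \<in> inn i" "y \<in> poly_union X" "proj X (i, z) = proj X y" shows "y = (i, z)"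
proof -
 have "(i, z) \<in> poly_union X" using assms inn_reg poly_union_iff by blast
 hence "((i, z), y) \<in> (glue_step X)\<^sup>*" using assms proj_eq by blast
 hence "y \<in> {(i, z)}"
 proof (rule closed_class)
  fix x y assume "x \<in> {(i, z)}" "(x, y) \<in> glue_step X"
  then obtain e where e: "e \<in> sides X" "fst e = i" "z \<in> cseg e" using glue_step_iff by blast
  hence False using cseg_bnd[OF e(1)] inn_bnd[OF assms(2)] by blast
  thus "y \<in> {(i, z)}" ..
 qed simp
 thus ?thesis by simp
qed

lemma class_oseg: assumes "e \<in> sides X" "z \<in> oseg e" "y \<in> poly_union X" "proj X (fst e, z) = proj X y"
 shows "y = (fst e, z) \<or> y = (fst (mate X e), z + tau e)"
proof -
 have zc: "z \<in> cseg e" using assms(2) oseg_cseg by blast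
 have "(fst e, z) \<in> poly_union X" using zc cseg_reg[OF assms(1)] side_fst[OF assms(1)] poly_union_iff by blast
 hence "((fst e, z), y) \<in> (glue_step X)\<^sup>*" using assms proj_eq by blast
 hence "y \<in> {(fst e, z), (fst (mate X e), z + tau e)}"
 proof (rule closed_class)
  fix x y assume x: "x \<in> {(fst e, z), (fst (mate X e), z + tau e)}" and s: "(x, y) \<in> glue_step X"
  from x consider "x = (fst e, z)" | "x = (fst (mate X e), z + tau e)" by blast
  thus "y \<in> {(fst e, z), (fst (mate X e), z + tau e)}"
  proof cases
   case 1
   then obtain e' where e': "e' \<in> sides X" "fst e' = fst e" "z \<in> cseg e'" "y = (fst (mate X e'), z + tau e')" using s glue_step_iff by blast
   hence "e = e'" using oseg_unique[OF assms(1) e'(1) e'(2)[symmetric] assms(2) e'(3)] by simp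
   thus ?thesis using e' by simp
  next
   case 2
   then obtain e' where e': "e' \<in> sides X" "fst e' = fst (mate X e)" "z + tau e \<in> cseg e'" "y = (fst (mate X e'), z + tau e + tau e')"
    using s glue_step_iff by blast
   have "mate X e = e'" using oseg_unique[OF mate(1)[OF assms(1)] e'(1) e'(2)[symmetric] seg_tau(2)[OF assms(1,2)] e'(3)] .
   hence "y = (fst e, z)" using e'(4) mate(2)[OF assms(1)] tau_eq(3)[OF assms(1)] by auto
   thus ?thesis by simp
  qed
 qed simp
 thus ?thesis by blast
qed

text \<open>The next corner counterclockwise around the same vertex of the surface.\<close>

definition nu :: "nat \<times> nat => nat \<times> nat" where "nu c = mate X (prv c)"

lemma nu: assumes "c \<in> sides X"
 shows "nu c \<in> sides X" "st (nu c) = st c + tau (prv c)" "\<exists>m>0. sv (nu c) = of_real m * cis (alpha c) * sv c" "nu (nxt (mate X c)) = c"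
proof -
 note p = nxt_prv[OF assms] and q = nxt_prv[OF mate(1)[OF assms]]
 show "nu c \<in> sides X" unfolding nu_def using mate(1) p(1) by blast
 show "st (nu c) = st c + tau (prv c)" unfolding nu_def tau_eq(2)[OF p(1)] p(5) ..
 show "\<exists>m>0. sv (nu c) = of_real m * cis (alpha c) * sv c" unfolding nu_def mate(3)[OF p(1)] using prv_angle[OF assms] .
 show "nu (nxt (mate X c)) = c" unfolding nu_def q(4) by (rule mate(2)[OF assms])
qed

lemma nu_inj: assumes "c \<in> sides X" "c' \<in> sides X" "nu c = nu c'" shows "c = c'"
proof -
 have "prv c = prv c'" using assms mate(2) nxt_prv(1) unfolding nu_def by metis
 thus ?thesis using nxt_prv(3) assms by metis
qed

lemma nu_pow: "c \<in> sides X ==> (nu ^^ m) c \<in> sides X" by (induction m) (auto intro: nu(1))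

lemma nu_pow_inj: "c \<in> sides X ==> c' \<in> sides X ==> (nu ^^ m) c = (nu ^^ m) c' ==> c = c'"
proof (induction m)
 case (Suc m)
 hence "(nu ^^ m) c = (nu ^^ m) c'" using nu_inj nu_pow by (metis comp_apply funpow.simps(2))
 thus ?case using Suc by blast
qed simp

text \<open>A permutation of a finite set: the corners around a vertex close up.\<close>

lemma nu_period: assumes "c \<in> sides X" shows "\<exists>L>0. (nu ^^ L) c = c"
proof -
 have "\<not> inj (\<lambda>m. (nu ^^ m) c)"
 proof
  assume "inj (\<lambda>m. (nu ^^ m) c)"
  moreover have "range (\<lambda>m. (nu ^^ m) c) \<subseteq> sides X" using nu_pow[OF assms] by auto
  ultimately show False using finite_sides finite_subset finite_imageD[of "\<lambda>m. (nu ^^ m) c" UNIV] by (metis infinite_UNIV_nat)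
 qed
 then obtain a b where "a \<noteq> b" "(nu ^^ a) c = (nu ^^ b) c" unfolding inj_def by blast
 then obtain a b where ab: "a < b" "(nu ^^ a) c = (nu ^^ b) c" by (metis linorder_neqE_nat)
 hence "(nu ^^ b) c = (nu ^^ a) ((nu ^^ (b - a)) c)" by (metis comp_apply funpow_add le_add_diff_inverse less_imp_le)
 hence "(nu ^^ (b - a)) c = c" using nu_pow_inj[OF assms nu_pow[OF assms]] ab(2) by metis
 thus ?thesis using ab(1) by (intro exI[of _ "b - a"]) auto
qed

lemma proj_nu: assumes "c \<in> sides X" shows "proj X (fst (nu c), st (nu c)) = proj X (fst c, st c)"
proof -
 have "st c \<in> cseg (prv c)" using st_en_cseg(2)[of "prv c"] nxt_prv(5)[OF assms] by simp
 hence "proj X (fst (prv c), st c) = proj X (fst (mate X (prv c)), st c + tau (prv c))"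
  using proj_tau[OF nxt_prv(1)[OF assms]] by blast
 moreover have "fst (prv c) = fst c" by (simp add: prv_def)
 ultimately show ?thesis using nu(2)[OF assms] by (simp add: nu_def)
qed

lemma vertex_sides: assumes "c \<in> sides X" "e \<in> sides X" "fst e = fst c" "st c \<in> cseg e" shows "e = c \<or> e = prv c"
proof -
 have "st c = st e \<or> st c = en e"
  using cseg_cases[OF assms(4)] oseg_not_st(1)[OF assms(2) assms(1) assms(3)] by blast
 moreover have eqst: "d = d'" if "d \<in> sides X" "d' \<in> sides X" "fst d = fst d'" "st d = st d'" for d d'
 proof -
  have "snd d mod length (P (fst d)) = snd d' mod length (P (fst d))"
   using polygon.v_eq_iff[OF polygon_side[OF that(1)]] that by (simp add: side_start_def)
  thus ?thesis using that by (auto simp: sides_def prod_eq_iff)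
 qed
 moreover have "fst (nxt e) = fst e" by (simp add: nxt_def)
 ultimately show ?thesis using assms nxt_prv by metis
qed

lemma class_vertex: assumes "c \<in> sides X" "y \<in> poly_union X" "proj X (fst c, st c) = proj X y"
 obtains m where "y = (fst ((nu ^^ m) c), st ((nu ^^ m) c))"
proof -
 have "(fst c, st c) \<in> poly_union X"
  using st_en_cseg(1) cseg_reg[OF assms(1)] side_fst[OF assms(1)] poly_union_iff by blast
 hence "((fst c, st c), y) \<in> (glue_step X)\<^sup>*" using assms proj_eq by blast
 moreover have "(fst c, st c) = (fst ((nu ^^ 0) c), st ((nu ^^ 0) c))" by simp
 ultimately have "y \<in> {(fst ((nu ^^ m) c), st ((nu ^^ m) c)) | m. True}"
 proof (elim closed_class)
  fix x y assume "x \<in> {(fst ((nu ^^ m) c), st ((nu ^^ m) c)) | m. True}" and s: "(x, y) \<in> glue_step X"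
  then obtain m where m: "x = (fst ((nu ^^ m) c), st ((nu ^^ m) c))" by blast
  let ?d = "(nu ^^ m) c"
  have d: "?d \<in> sides X" using nu_pow assms by blast
  obtain e where e: "e \<in> sides X" "fst e = fst ?d" "st ?d \<in> cseg e" "y = (fst (mate X e), st ?d + tau e)"
   using s m glue_step_iff by blast
  consider "e = ?d" | "e = prv ?d" using vertex_sides[OF d e(1-3)] by blast
  thus "y \<in> {(fst ((nu ^^ m) c), st ((nu ^^ m) c)) | m. True}"
  proof cases
   case 2
   hence "y = (fst (nu ?d), st (nu ?d))" using e(4) nu(2)[OF d] by (simp add: nu_def)
   hence "y = (fst ((nu ^^ Suc m) c), st ((nu ^^ Suc m) c))" by simp
   thus ?thesis by blast
  next
   case 1
   let ?f = "nxt (mate X ?d)"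
   have f: "?f \<in> sides X" using nxt_prv(2) mate(1) d by blast
   have "nu ?f = ?d" using nu(4)[OF d] .
   obtain L where L: "L > 0" "(nu ^^ L) ?f = ?f" using nu_period[OF f] by blast
   then obtain L' where "L = Suc L'" by (cases L) auto
   hence "(nu ^^ L') ?d = ?f" using L(2) \<open>nu ?f = ?d\<close> by (simp add: funpow_swap1)
   hence ff: "(nu ^^ (L' + m)) c = ?f" by (simp add: funpow_add)
   have "st ?f = en (mate X ?d)" using nxt_prv(6)[OF mate(1)[OF d]] .
   also have "\<dots> = st ?d + tau ?d" using tau_eq(1)[OF d] .
   finally have "y = (fst ?f, st ?f)" using e(4) 1 by (simp add: nxt_def)
   thus ?thesis using ff by (metis (mono_tags, lifting) mem_Collect_eq)
  qed
 qed blast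
 thus ?thesis using that by blast
qed

text \<open>Around a vertex class of total angle \<open>2 * pi\<close> the corners tile the circle of directions, so
 exactly one corner contains a given direction.\<close>

lemma corner_unique:
 assumes c: "c \<in> sides X" and c': "c' \<in> sides X" and eq: "proj X (fst c, st c) = proj X (fst c', st c')"
  and ns: "proj X (fst c, st c) \<notin> singularities X"
  and u: "u \<noteq> 0" "Arg2pi (u / sv c) < alpha c" "Arg2pi (u / sv c') < alpha c'"
 shows "c = c'"
proof (rule ccontr)
 assume ne: "c \<noteq> c'"
 define p where "p = proj X (fst c, st c)"
 have vp: "vertices_at X p = {(nu ^^ m) c | m. True}"
 proof (intro set_eqI iffI)
  fix d assume "d \<in> vertices_at X p"
  hence d: "d \<in> sides X" "proj X (fst c, st c) = proj X (fst d, st d)" by (auto simp: vertices_at_def p_def)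
  have "(fst d, st d) \<in> poly_union X" using st_en_cseg(1) cseg_reg[OF d(1)] side_fst[OF d(1)] poly_union_iff by blast
  then obtain m where m: "(fst d, st d) = (fst ((nu ^^ m) c), st ((nu ^^ m) c))" using class_vertex[OF c _ d(2)] by blast
  let ?e = "(nu ^^ m) c"
  have e: "?e \<in> sides X" using nu_pow c by blast
  have "d = ?e \<or> d = prv ?e" using vertex_sides[OF e d(1)] m st_en_cseg(1)[of d] by (metis Pair_inject)
  moreover have "d \<noteq> prv ?e"
  proof
   assume "d = prv ?e"
   hence "en d = st ?e" using nxt_prv(5)[OF e] by simp
   thus False using sv_nz[OF d(1)] m by (simp add: sv_def)
  qed
  ultimately show "d \<in> {(nu ^^ m) c | m. True}" by blast
 next
  fix d assume "d \<in> {(nu ^^ m) c | m. True}"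
  then obtain m where m: "d = (nu ^^ m) c" by blast
  have "proj X (fst ((nu ^^ m) c), st ((nu ^^ m) c)) = p" for m
   by (induction m) (use proj_nu nu_pow c in \<open>auto simp: p_def\<close>)
  thus "d \<in> vertices_at X p" using nu_pow c by (auto simp: vertices_at_def m)
 qed
 have "p \<in> points X" unfolding p_def
  using st_en_cseg(1) cseg_reg[OF c] side_fst[OF c] poly_union_iff proj_points by blast
 moreover have "c \<in> vertices_at X p" using c by (simp add: vertices_at_def p_def)
 ultimately have ca: "cone_angle X p = 2 * pi" using ns unfolding p_def[symmetric] singularities_def by auto
 define L where "L = (LEAST L. 0 < L \<and> (nu ^^ L) c = c)"
 have L: "0 < L" "(nu ^^ L) c = c" using LeastI_ex[OF nu_period[OF c]] unfolding L_def by auto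
 have Lmin: "\<not> (0 < l \<and> (nu ^^ l) c = c)" if "l < L" for l using that not_less_Least unfolding L_def by blast
 have inj: "inj_on (\<lambda>m. (nu ^^ m) c) {..<L}"
 proof (rule linorder_inj_onI')
  fix a b assume ab: "a \<in> {..<L}" "b \<in> {..<L}" "a < b"
  show "(nu ^^ a) c \<noteq> (nu ^^ b) c"
  proof
   assume eqab: "(nu ^^ a) c = (nu ^^ b) c"
   have "(nu ^^ b) c = (nu ^^ a) ((nu ^^ (b - a)) c)" using ab(3) by (metis comp_apply funpow_add le_add_diff_inverse less_imp_le)
   hence "(nu ^^ (b - a)) c = c" using nu_pow_inj[OF c nu_pow[OF c]] eqab by metis
   moreover have "b - a < L" "0 < b - a" using ab by auto
   ultimately show False using Lmin by blast
  qed
 qed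
 have modL: "(nu ^^ m) c = (nu ^^ (m mod L)) c" for m
  using L(2) by (rule funpow_mod_eq[symmetric])
 have orb: "{(nu ^^ m) c | m. True} = (\<lambda>m. (nu ^^ m) c) ` {..<L}"
 proof (intro set_eqI iffI)
  fix d assume "d \<in> {(nu ^^ m) c | m. True}"
  then obtain m where "d = (nu ^^ (m mod L)) c" using modL by blast
  moreover have "m mod L \<in> {..<L}" using L(1) by simp
  ultimately show "d \<in> (\<lambda>m. (nu ^^ m) c) ` {..<L}" by blast
 qed blast
 define A where "A m = (\<Sum>l<m. alpha ((nu ^^ l) c))" for m
 have AL: "A L = 2 * pi" unfolding A_def ca[symmetric] cone_angle_def vp orb
  by (subst sum.reindex[OF inj]) (simp add: alpha_def)
 have Amono: "A m \<le> A m'" if "m \<le> m'" for m m' unfolding A_def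
  by (rule sum_mono2) (use that alpha_bounds(1)[OF nu_pow[OF c]] in \<open>auto intro: less_imp_le\<close>)
 have svA: "\<exists>M>0. sv ((nu ^^ m) c) = of_real M * cis (A m) * sv c" for m
 proof (induction m)
  case 0 thus ?case by (intro exI[of _ 1]) (simp add: A_def)
 next
  case (Suc m)
  then obtain M where M: "M > 0" "sv ((nu ^^ m) c) = of_real M * cis (A m) * sv c" by blast
  obtain M' where M': "M' > 0" "sv (nu ((nu ^^ m) c)) = of_real M' * cis (alpha ((nu ^^ m) c)) * sv ((nu ^^ m) c)"
   using nu(3)[OF nu_pow[OF c]] by blast
  have A: "A (Suc m) = A m + alpha ((nu ^^ m) c)" by (simp add: A_def)
  have "sv ((nu ^^ Suc m) c) = of_real (M * M') * cis (A (Suc m)) * sv c"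
   unfolding A cis_mult[symmetric] using M' M by simp
  thus ?case using M(1) M'(1) by (intro exI[of _ "M * M'"]) simp
 qed
 have "c' \<in> vertices_at X p" using c' eq by (simp add: vertices_at_def p_def)
 then obtain m where m: "m < L" "c' = (nu ^^ m) c" unfolding vp orb by blast
 have m0: "m > 0" using m ne by (cases m) auto
 obtain M where M: "M > 0" "sv c' = of_real M * cis (A m) * sv c" using svA m by blast
 let ?f0 = "Arg2pi (u / sv c)" and ?f1 = "Arg2pi (u / sv c')"
 have nz: "sv c \<noteq> 0" "sv c' \<noteq> 0" using sv_nz c c' by auto
 define r where "r = cmod (u / sv c)"
 define r' where "r' = cmod (u / sv c')"
 have r: "r > 0" "r' > 0" using nz u(1) by (auto simp: r_def r'_def)
 have e0: "u / sv c = of_real r * cis ?f0" unfolding r_def by (rule Arg2pi_cis)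
 have e1: "u / sv c' = of_real r' * cis ?f1" unfolding r'_def by (rule Arg2pi_cis)
 have "u = of_real r' * cis ?f1 * (of_real M * cis (A m) * sv c)"
  using e1 nz(2) unfolding M(2)[symmetric] by (metis nonzero_eq_divide_eq)
 hence "u / sv c = of_real r' * cis ?f1 * (of_real M * cis (A m))"
  using nz(1) by (metis nonzero_eq_divide_eq mult.assoc)
 also have "\<dots> = of_real (M * r') * cis (A m + ?f1)"
  by (simp add: cis_mult[symmetric] mult_ac)
 finally have "u / sv c = of_real (M * r') * cis (A m + ?f1)" .
 hence eqc: "of_real r * cis ?f0 = of_real (M * r') * cis (A m + ?f1)" using e0 by simp
 have A1: "A (Suc 0) = alpha c" by (simp add: A_def)
 have Am: "A (Suc m) = A m + alpha c'" using m(2) by (simp add: A_def)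
 have "alpha c \<le> A m" using Amono[of "Suc 0" m] m0 A1 by simp
 moreover have "A m + ?f1 < 2 * pi" using u(3) Am Amono[of "Suc m" L] m(1) AL by simp
 moreover have "0 \<le> A m" using Amono[of 0 m] by (simp add: A_def)
 moreover have "0 \<le> ?f0" "?f0 < 2 * pi" "0 \<le> ?f1" using Arg2pi by auto
 ultimately have "?f0 = A m + ?f1" using cis_inj_2pi[OF eqc r(1)] r(2) M(1) by auto
 thus False using u(2) \<open>alpha c \<le> A m\<close> \<open>0 \<le> ?f1\<close> by linarith
qed

text \<open>A straight segment leaves \<open>z\<close> with velocity \<open>u\<close> inside the
 \<open>i\<close>-th polygon.\<close>

definition germ :: "complex => nat => complex => bool" where
 "germ u i z \<longleftrightarrow> (\<exists>r>0. \<forall>s. 0 \<le> s \<and> s < r --> z + of_real s * u \<in> reg i)"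

lemma corner_germ: assumes c: "c \<in> sides X" and u: "u \<noteq> 0" and g: "germ u (fst c) (st c)"
 obtains c' where "c' \<in> sides X" "Arg2pi (u / sv c') < alpha c'" "proj X (fst c', st c') = proj X (fst c, st c)"
  "\<exists>r>0. \<forall>s. 0 \<le> s \<and> s < r --> proj X (fst c, st c + of_real s * u) = proj X (fst c', st c' + of_real s * u)"
proof -
 let ?f = "Arg2pi (u / sv c)"
 define q where "q = cmod (u / sv c)"
 have q: "q > 0" using u sv_nz[OF c] by (simp add: q_def)
 have uq: "u = of_real q * cis ?f * sv c"
  using Arg2pi_cis[of "u / sv c"] sv_nz[OF c] unfolding q_def by (metis nonzero_eq_divide_eq)
 have su: "st c + of_real s * u = cpt c (s * q) ?f" for s unfolding cpt_def by (subst uq) simp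
 obtain r0 where r0: "r0 > 0" "\<And>r h. 0 < r ==> r < r0 ==> alpha c < h ==> h < 2 * pi ==> cpt c r h \<notin> reg (fst c)"
   "\<And>r. 0 < r ==> r < r0 ==> cpt c r (alpha c) \<in> oseg (prv c)"
  using corner_loc[OF c] by blast
 obtain r1 where r1: "r1 > 0" "\<And>s. 0 \<le> s ==> s < r1 ==> st c + of_real s * u \<in> reg (fst c)" using g unfolding germ_def by blast
 have le: "?f \<le> alpha c"
 proof (rule ccontr)
  assume "\<not> ?f \<le> alpha c"
  define s where "s = min (r0 / q) r1 / 2"
  have s: "0 < s" "s < r1" "s < r0 / q" using half_min[of "r0 / q" r1] r0(1) r1(1) q by (auto simp: s_def)
  hence "0 < s * q" "s * q < r0" using q by (auto simp: field_simps)
  thus False using r0(2)[of "s * q" ?f] r1(2)[of s] s su[of s] Arg2pi \<open>\<not> ?f \<le> alpha c\<close> by auto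
 qed
 show thesis
 proof (cases "?f < alpha c")
  case True
  show thesis by (rule that[OF c True refl]) (auto intro: exI[of _ 1])
 next
  case False
  hence f: "?f = alpha c" using le by simp
  have n: "nu c \<in> sides X" using nu(1)[OF c] .
  obtain m where m: "m > 0" "sv (nu c) = of_real m * cis (alpha c) * sv c" using nu(3)[OF c] by blast
  have "u = of_real (q / m) * sv (nu c)" unfolding m(2) using uq f m(1) by simp
  hence "u / sv (nu c) = of_real (q / m)" using sv_nz[OF n] by simp
  hence "Arg2pi (u / sv (nu c)) = 0" using q m(1) by (simp only: Arg2pi_of_real) (simp add: divide_less_0_iff)
  hence 1: "Arg2pi (u / sv (nu c)) < alpha (nu c)" using alpha_bounds(1)[OF n] by simp
  have 2: "proj X (fst c, st c + of_real s * u) = proj X (fst (nu c), st (nu c) + of_real s * u)" if "0 \<le> s" "s < r0 / q" for s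
  proof -
   have "st c + of_real s * u \<in> cseg (prv c)"
   proof (cases "s = 0")
    case True thus ?thesis using st_en_cseg(2)[of "prv c"] nxt_prv(5)[OF c] by simp
   next
    case False
    hence "0 < s * q" "s * q < r0" using that q by (auto simp: field_simps)
    thus ?thesis using r0(3)[of "s * q"] oseg_cseg unfolding su f by blast
   qed
   from proj_tau[OF nxt_prv(1)[OF c] this] show ?thesis
    unfolding nu(2)[OF c] by (simp add: nu_def prv_def algebra_simps)
  qed
  show thesis by (rule that[OF n 1 proj_nu[OF c]]) (use 2 r0(1) q in \<open>auto intro!: exI[of _ "r0 / q"]\<close>)
 qed
qed

text \<open>A point of the surface that is not a singularity has one outgoing germ in each
 direction: on an open side the two polygons contain the same germ only if it runs along the side,
 and at a regular vertex the direction determines the corner.\<close>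

theorem germ_unique:
 assumes u: "u \<noteq> 0" and i: "i < N" "germ u i z" and j: "j < N" "germ u j w"
  and eq: "proj X (i, z) = proj X (j, w)" and ns: "proj X (i, z) \<notin> singularities X"
 shows "\<exists>r>0. \<forall>s. 0 \<le> s \<and> s < r --> proj X (i, z + of_real s * u) = proj X (j, w + of_real s * u)"
proof -
 have zr: "z \<in> reg i" "w \<in> reg j" using i j unfolding germ_def by force+
 hence ju: "(j, w) \<in> poly_union X" "(i, z) \<in> poly_union X" using i j poly_union_iff by auto
 have small: "\<exists>s. 0 < s \<and> s < r \<and> z' + of_real s * u \<in> ball z' d" if "r > 0" "d > 0" for r d z'
 proof -
  define s where "s = min r (d / cmod u) / 2"
  have s: "0 < s" "s < r" "s < d / cmod u" using half_min[of r "d / cmod u"] that u by (auto simp: s_def)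
  hence "s * cmod u < d" using u by (simp add: field_simps)
  thus ?thesis using s by (intro exI[of _ s]) (simp add: dist_norm norm_mult)
 qed
 from i(1) zr(1) show ?thesis
 proof (cases rule: reg_cases)
  case 1
  hence "(j, w) = (i, z)" using class_inn[OF i(1) _ ju(1) eq] by blast
  thus ?thesis by (intro exI[of _ 1]) auto
 next
  case (3 e)
  have "(j, w) = (i, z) \<or> (j, w) = (fst (mate X e), z + tau e)" using class_oseg[OF 3(1,3) ju(1)] eq 3(2) by simp
  thus ?thesis
  proof
   assume "(j, w) = (i, z)" thus ?thesis by (intro exI[of _ 1]) auto
  next
   assume jw: "(j, w) = (fst (mate X e), z + tau e)"
   obtain r where r: "r > 0" "\<And>w. w \<in> ball z r ==> cross (sv e) (w - z) < 0 ==> w \<notin> reg (fst e)"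
    "\<And>w. w \<in> ball z r ==> cross (sv e) (w - z) = 0 ==> w \<in> oseg e" using side_loc[OF 3(1,3)] by blast
   have m: "mate X e \<in> sides X" "w \<in> oseg (mate X e)" using mate(1)[OF 3(1)] seg_tau(2)[OF 3(1,3)] jw by auto
   obtain r' where r': "r' > 0" "\<And>v. v \<in> ball w r' ==> cross (sv (mate X e)) (v - w) < 0 ==> v \<notin> reg (fst (mate X e))"
    using side_loc[OF m] by blast
   consider "cross (sv e) u < 0" | "cross (sv e) u > 0" | "cross (sv e) u = 0" by linarith
   thus ?thesis
   proof cases
    case c1: 1
    obtain g where g: "g > 0" "\<And>s. 0 \<le> s ==> s < g ==> z + of_real s * u \<in> reg i" using i(2) unfolding germ_def by blast
    obtain s where s: "0 < s" "s < g" "z + of_real s * u \<in> ball z r" using small[OF g(1) r(1)] by blast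
    have "cross (sv e) (z + of_real s * u - z) < 0" using c1 s(1) by (simp add: cross_simps mult_pos_neg)
    thus ?thesis using r(2)[OF s(3)] g(2)[of s] s 3(2) by simp
   next
    case c2: 2
    obtain g where g: "g > 0" "\<And>s. 0 \<le> s ==> s < g ==> w + of_real s * u \<in> reg j" using j(2) unfolding germ_def by blast
    obtain s where s: "0 < s" "s < g" "w + of_real s * u \<in> ball w r'" using small[OF g(1) r'(1)] by blast
    have "cross (sv (mate X e)) (w + of_real s * u - w) < 0"
     unfolding mate(3)[OF 3(1)] using c2 s(1) by (simp add: cross_simps)
    thus ?thesis using r'(2)[OF s(3)] g(2)[of s] s jw by simp
   next
    case c3: 3
    have "proj X (i, z + of_real s * u) = proj X (j, w + of_real s * u)" if "0 \<le> s" "s < r / cmod u" for s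
    proof -
     have "s * cmod u < r" using that u by (simp add: field_simps)
     hence "z + of_real s * u \<in> ball z r" using that by (simp add: dist_norm norm_mult)
     moreover have "cross (sv e) (z + of_real s * u - z) = 0" using c3 by (simp add: cross_simps)
     ultimately have "z + of_real s * u \<in> cseg e" using r(3) oseg_cseg by blast
     from proj_tau[OF 3(1) this] show ?thesis using jw 3(2) by (simp add: algebra_simps)
    qed
    thus ?thesis using r(1) u by (intro exI[of _ "r / cmod u"]) auto
   qed
  qed
 next
  case (2 c)
  have "proj X (fst c, st c) = proj X (j, w)" using eq 2 by simp
  then obtain m where m: "(j, w) = (fst ((nu ^^ m) c), st ((nu ^^ m) c))" using class_vertex[OF 2(1) ju(1)] by blast
  define d where "d = (nu ^^ m) c"
  have d: "d \<in> sides X" "j = fst d" "w = st d" using nu_pow[OF 2(1)] m by (auto simp: d_def)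
  obtain c' where c': "c' \<in> sides X" "Arg2pi (u / sv c') < alpha c'" "proj X (fst c', st c') = proj X (fst c, st c)"
   "\<exists>r>0. \<forall>s. 0 \<le> s \<and> s < r --> proj X (fst c, st c + of_real s * u) = proj X (fst c', st c' + of_real s * u)"
   using corner_germ[OF 2(1) u] i(2) 2(2,3) by blast
  obtain d' where d': "d' \<in> sides X" "Arg2pi (u / sv d') < alpha d'" "proj X (fst d', st d') = proj X (fst d, st d)"
   "\<exists>r>0. \<forall>s. 0 \<le> s \<and> s < r --> proj X (fst d, st d + of_real s * u) = proj X (fst d', st d' + of_real s * u)"
   using corner_germ[OF d(1) u] j(2) d(2,3) by blast
  have "c' = d'" by (rule corner_unique[OF c'(1) d'(1) _ _ u c'(2) d'(2)])
   (use c'(3) d'(3) eq ns 2 d in auto)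
  obtain r1 where r1: "r1 > 0" "\<And>s. 0 \<le> s ==> s < r1 ==> proj X (fst c, st c + of_real s * u) = proj X (fst c', st c' + of_real s * u)"
   using c'(4) by blast
  obtain r2 where r2: "r2 > 0" "\<And>s. 0 \<le> s ==> s < r2 ==> proj X (fst d, st d + of_real s * u) = proj X (fst c', st c' + of_real s * u)"
   using d'(4) unfolding \<open>c' = d'\<close> by blast
  show ?thesis using r1 r2 2(2,3) d(2,3) by (intro exI[of _ "min r1 r2"]) simp
 qed
qed

end

section \<open>Straight curves and the flow\<close>

lemma direction_pi [simp]: "direction (th + pi) = - direction th"
 by (simp add: direction_def complex_eq_iff)

lemma norm_direction [simp]: "cmod (direction th) = 1"
 by (simp add: direction_def cmod_def)

lemma direction_nz [simp]: "direction th \<noteq> 0"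
 using norm_direction[of th] by (metis norm_zero zero_neq_one)

context tsurf
begin

lemma sc_points: "straight_curve X th a b \<gamma> ==> a \<le> t ==> t \<le> b ==> \<gamma> t \<in> points X"
 by (simp add: straight_curve_def)

lemma sc_right: assumes "straight_curve X th a b \<gamma>" "a \<le> t" "t < b"
 obtains r i z where "r > 0" "i < N" "\<And>s. 0 \<le> s ==> s < r ==> z + ray th s \<in> reg i"
  "\<And>s. 0 \<le> s ==> s < r ==> \<gamma> (t + s) = proj X (i, z + ray th s)"
 using assms unfolding straight_curve_def by (metis atLeastLessThan_iff)

lemma sc_left: assumes "straight_curve X th a b \<gamma>" "a < t" "t \<le> b"
 obtains r i z where "r > 0" "i < N" "\<And>s. 0 \<le> s ==> s < r ==> z - ray th s \<in> reg i"
  "\<And>s. 0 \<le> s ==> s < r ==> \<gamma> (t - s) = proj X (i, z - ray th s)"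
 using assms unfolding straight_curve_def by (metis greaterThanAtMost_iff)

lemma scI:
 assumes "\<And>t. a \<le> t ==> t \<le> b ==> \<gamma> t \<in> points X"
  and "\<And>t. a \<le> t ==> t < b ==> \<exists>r>0. \<exists>i<N. \<exists>z. \<forall>s. 0 \<le> s \<and> s < r -->
   z + ray th s \<in> reg i \<and> \<gamma> (t + s) = proj X (i, z + ray th s)"
  and "\<And>t. a < t ==> t \<le> b ==> \<exists>r>0. \<exists>i<N. \<exists>z. \<forall>s. 0 \<le> s \<and> s < r -->
   z - ray th s \<in> reg i \<and> \<gamma> (t - s) = proj X (i, z - ray th s)"
 shows "straight_curve X th a b \<gamma>"
 unfolding straight_curve_def using assms by simp

lemma sc_rightE: assumes "straight_curve X th a b \<gamma>" "a \<le> t" "t < b"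
 shows "\<exists>r>0. \<exists>i<N. \<exists>z. \<forall>s. 0 \<le> s \<and> s < r -->
   z + ray th s \<in> reg i \<and> \<gamma> (t + s) = proj X (i, z + ray th s)"
 using assms unfolding straight_curve_def by simp

lemma sc_leftE: assumes "straight_curve X th a b \<gamma>" "a < t" "t \<le> b"
 shows "\<exists>r>0. \<exists>i<N. \<exists>z. \<forall>s. 0 \<le> s \<and> s < r -->
   z - ray th s \<in> reg i \<and> \<gamma> (t - s) = proj X (i, z - ray th s)"
 using assms unfolding straight_curve_def by simp

lemma sc_restrict: "straight_curve X th a b \<gamma> ==> a \<le> a' ==> b' \<le> b ==> straight_curve X th a' b' \<gamma>"
 by (rule scI) (auto intro: sc_points sc_rightE sc_leftE)

lemma sc_shift: assumes "straight_curve X th a b \<gamma>" shows "straight_curve X th (a - c) (b - c) (\<lambda>t. \<gamma> (t + c))"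
proof (rule scI)
 fix t assume t: "a - c \<le> t" "t \<le> b - c" show "\<gamma> (t + c) \<in> points X" using assms t by (intro sc_points) auto
next
 fix t assume "a - c \<le> t" "t < b - c"
 hence "a \<le> t + c" "t + c < b" by auto
 from sc_rightE[OF assms this] show "\<exists>r>0. \<exists>i<N. \<exists>z. \<forall>s. 0 \<le> s \<and> s < r -->
   z + ray th s \<in> reg i \<and> \<gamma> (t + s + c) = proj X (i, z + ray th s)" by (simp only: add_ac)
next
 fix t assume "a - c < t" "t \<le> b - c"
 hence "a < t + c" "t + c \<le> b" by auto
 moreover have "t - s + c = t + c - s" for s by simp
 ultimately show "\<exists>r>0. \<exists>i<N. \<exists>z. \<forall>s. 0 \<le> s \<and> s < r -->
   z - ray th s \<in> reg i \<and> \<gamma> (t - s + c) = proj X (i, z - ray th s)"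
  using sc_leftE[OF assms, of "t + c"] by (simp only:)
qed

lemma sc_rev: assumes "straight_curve X th a b \<gamma>" shows "straight_curve X (th + pi) (- b) (- a) (\<lambda>t. \<gamma> (- t))"
proof (rule scI)
 fix t assume t: "- b \<le> t" "t \<le> - a" show "\<gamma> (- t) \<in> points X" using assms t by (intro sc_points) auto
next
 fix t assume "- b \<le> t" "t < - a"
 hence "a < - t" "- t \<le> b" by auto
 moreover have "- (t + s) = - t - s" for s by simp
 ultimately show "\<exists>r>0. \<exists>i<N. \<exists>z. \<forall>s. 0 \<le> s \<and> s < r -->
   z + of_real s * direction (th + pi) \<in> reg i \<and> \<gamma> (- (t + s)) = proj X (i, z + of_real s * direction (th + pi))"
  using sc_leftE[OF assms, of "- t"] by simp
next
 fix t assume "- b < t" "t \<le> - a"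
 hence "a \<le> - t" "- t < b" by auto
 moreover have "- (t - s) = - t + s" for s by simp
 ultimately show "\<exists>r>0. \<exists>i<N. \<exists>z. \<forall>s. 0 \<le> s \<and> s < r -->
   z - of_real s * direction (th + pi) \<in> reg i \<and> \<gamma> (- (t - s)) = proj X (i, z - of_real s * direction (th + pi))"
  using sc_rightE[OF assms, of "- t"] by simp
qed

lemma sc_append:
 assumes g: "straight_curve X th a b \<gamma>" and g': "straight_curve X th b c \<gamma>'" and eq: "\<gamma> b = \<gamma>' b"
 shows "straight_curve X th a c (\<lambda>t. if t \<le> b then \<gamma> t else \<gamma>' t)" (is "straight_curve X th a c ?g")
proof (rule scI)
 fix t assume "a \<le> t" "t \<le> c" thus "?g t \<in> points X" using sc_points[OF g, of t] sc_points[OF g', of t] by auto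
next
 fix t assume t: "a \<le> t" "t < c"
 show "\<exists>r>0. \<exists>i<N. \<exists>z. \<forall>s. 0 \<le> s \<and> s < r -->
   z + ray th s \<in> reg i \<and> ?g (t + s) = proj X (i, z + ray th s)"
 proof (cases "t < b")
  case True
  obtain r i z where r: "r > 0" "i < N" "\<And>s. 0 \<le> s ==> s < r ==> z + ray th s \<in> reg i"
   "\<And>s. 0 \<le> s ==> s < r ==> \<gamma> (t + s) = proj X (i, z + ray th s)" using sc_right[OF g t(1) True] by metis
  show ?thesis by (intro exI[of _ "min r (b - t)"] conjI exI[of _ i] exI[of _ z] allI impI) (use r True in simp_all)
 next
  case False
  hence bt: "b \<le> t" by simp
  obtain r i z where r: "r > 0" "i < N" "\<And>s. 0 \<le> s ==> s < r ==> z + ray th s \<in> reg i"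
   "\<And>s. 0 \<le> s ==> s < r ==> \<gamma>' (t + s) = proj X (i, z + ray th s)" using sc_right[OF g' bt t(2)] by metis
  have "?g (t + s) = \<gamma>' (t + s)" if "0 \<le> s" for s using that bt eq by (cases "t + s = b") auto
  thus ?thesis using r by (intro exI[of _ r] conjI exI[of _ i] exI[of _ z] allI impI) simp_all
 qed
next
 fix t assume t: "a < t" "t \<le> c"
 show "\<exists>r>0. \<exists>i<N. \<exists>z. \<forall>s. 0 \<le> s \<and> s < r -->
   z - ray th s \<in> reg i \<and> ?g (t - s) = proj X (i, z - ray th s)"
 proof (cases "b < t")
  case True
  obtain r i z where r: "r > 0" "i < N" "\<And>s. 0 \<le> s ==> s < r ==> z - ray th s \<in> reg i"
   "\<And>s. 0 \<le> s ==> s < r ==> \<gamma>' (t - s) = proj X (i, z - ray th s)" using sc_left[OF g' True t(2)] by metis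
  show ?thesis by (intro exI[of _ "min r (t - b)"] conjI exI[of _ i] exI[of _ z] allI impI) (use r True in simp_all)
 next
  case False
  hence bt: "t \<le> b" by simp
  obtain r i z where r: "r > 0" "i < N" "\<And>s. 0 \<le> s ==> s < r ==> z - ray th s \<in> reg i"
   "\<And>s. 0 \<le> s ==> s < r ==> \<gamma> (t - s) = proj X (i, z - ray th s)" using sc_left[OF g t(1) bt] by metis
  thus ?thesis using bt by (intro exI[of _ r] conjI exI[of _ i] exI[of _ z] allI impI) simp_all
 qed
qed

lemma sc_segment:
 assumes "i < N" "\<And>t. 0 \<le> t ==> t \<le> T ==> z + ray th t \<in> reg i"
 shows "straight_curve X th 0 T (\<lambda>t. proj X (i, z + ray th t))"
proof (rule scI)
 fix t assume "0 \<le> t" "t \<le> T"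
 thus "proj X (i, z + ray th t) \<in> points X" using assms poly_union_iff proj_points by blast
next
 fix t assume t: "0 \<le> t" "t < T"
 have "z + ray th t + ray th s = z + ray th (t + s)" for s by (simp only: of_real_add ring_distribs add.assoc)
 note e = this
 show "\<exists>r>0. \<exists>i'<N. \<exists>z'. \<forall>s. 0 \<le> s \<and> s < r -->
   z' + ray th s \<in> reg i' \<and> proj X (i, z + ray th (t + s)) = proj X (i', z' + ray th s)"
  using assms(1) t by (intro exI[of _ "T - t"] exI[of _ i] exI[of _ "z + ray th t"] conjI allI impI)
   (simp_all only: e, auto simp del: of_real_add intro!: assms(2))
next
 fix t assume t: "0 < t" "t \<le> T"
 have "z + ray th t - ray th s = z + ray th (t - s)" for s by (simp add: algebra_simps)
 note e = this
 show "\<exists>r>0. \<exists>i'<N. \<exists>z'. \<forall>s. 0 \<le> s \<and> s < r -->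
   z' - ray th s \<in> reg i' \<and> proj X (i, z + ray th (t - s)) = proj X (i', z' - ray th s)"
  using assms(1) t by (intro exI[of _ t] exI[of _ i] exI[of _ "z + ray th t"] conjI allI impI)
   (simp_all only: e, auto simp del: of_real_diff intro!: assms(2))
qed

text \<open>Two segments with the same image except possibly at their ends have ends with the same
 image. Only finitely many gluings occur, so one of them relates points arbitrarily close to the
 end, and sides are closed.\<close>

lemma proj_limit:
 assumes i: "i < N" and j: "j < N" and r: "r > 0" and u: "u \<noteq> 0"
  and z: "\<And>s. 0 \<le> s ==> s < r ==> z - of_real s * u \<in> reg i" and w: "\<And>s. 0 \<le> s ==> s < r ==> w - of_real s * u \<in> reg j"
  and eq: "\<And>s. 0 < s ==> s < r ==> proj X (i, z - of_real s * u) = proj X (j, w - of_real s * u)"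
 shows "proj X (i, z) = proj X (j, w)"
proof (rule ccontr)
 assume ne: "\<not> ?thesis"
 define C where "C = {e \<in> sides X. fst e = i \<and> (j, w) = (fst (mate X e), z + tau e)}"
 define V where "V = st ` sides X - {z}"
 have "finite V" using finite_sides by (simp add: V_def)
 hence "open (- V)" by (simp add: finite_imp_closed open_Compl)
 moreover have "z \<in> - V" by (simp add: V_def)
 ultimately obtain g where g: "g > 0" "ball z g \<subseteq> - V" using open_contains_ball by blast
 define h where "h = min r (g / cmod u)"
 have h: "h > 0" "h \<le> r" using r g u by (auto simp: h_def)
 have inC: "z - of_real s * u \<in> (\<Union>e\<in>C. cseg e)" if s: "0 < s" "s < h" for s
 proof -
  let ?p = "z - of_real s * u"
  have sr: "0 \<le> s" "s < r" using s h by auto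
  have "s < g / cmod u" using s by (simp add: h_def)
  hence "s * cmod u < g" using u by (simp add: field_simps)
  hence "?p \<in> ball z g" using s by (simp add: dist_norm norm_mult)
  hence nV: "?p \<notin> V" using g by blast
  have pz: "?p \<noteq> z" using s u by simp
  have J: "(j, w - of_real s * u) \<in> poly_union X" using w[OF sr] j poly_union_iff by blast
  have E: "proj X (i, ?p) = proj X (j, w - of_real s * u)" using eq s sr by blast
  have nosame: "(j, w - of_real s * u) \<noteq> (i, ?p)" using ne by auto
  from i z[OF sr] show ?thesis
  proof (cases rule: reg_cases)
   case 1
   thus ?thesis using class_inn[OF i 1 J E] nosame by blast
  next
   case (2 e) thus ?thesis using nV pz by (auto simp: V_def)
  next
   case (3 e)
   have "(j, w - of_real s * u) = (fst (mate X e), ?p + tau e)"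
    using class_oseg[OF 3(1,3) J] E nosame 3(2) by auto
   hence "(j, w) = (fst (mate X e), z + tau e)" by (simp add: algebra_simps)
   hence "e \<in> C" using 3 by (simp add: C_def)
   thus ?thesis using 3(3) oseg_cseg by blast
  qed
 qed
 have cl: "closed (\<Union>e\<in>C. cseg e)" by (rule closed_UN) (use finite_sides in \<open>auto simp: C_def cseg_def\<close>)
 have "z \<in> closure (\<Union>e\<in>C. cseg e)"
  unfolding closure_approachable
 proof (intro allI impI)
  fix e :: real assume e: "0 < e"
  define s where "s = min h (e / cmod u) / 2"
  have s: "0 < s" "s < h" "s < e / cmod u" unfolding s_def using half_min[of h "e / cmod u"] h e u by auto
  hence "s * cmod u < e" using u by (simp add: field_simps)
  hence "dist (z - of_real s * u) z < e" using s by (simp add: dist_norm norm_mult)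
  thus "\<exists>y\<in>\<Union>e\<in>C. cseg e. dist y z < e" using inC[OF s(1,2)] by blast
 qed
 then obtain e where "e \<in> C" "z \<in> cseg e" using cl by auto
 hence "proj X (i, z) = proj X (j, w)" using proj_tau[of e z] unfolding C_def by auto
 thus False using ne by simp
qed

text \<open>The supremum of the times until which the curves agree is a time of agreement by
 \<open>proj_limit\<close>, and agreement continues beyond it by uniqueness of germs. An initial
 stretch of agreement is assumed so that the curves may start at a singularity.\<close>

theorem sc_unique_germ:
 assumes g: "straight_curve X th 0 b \<gamma>" and g': "straight_curve X th 0 b \<gamma>'"
  and r: "0 < r" "\<And>s. 0 \<le> s ==> s < r ==> s \<le> b ==> \<gamma> s = \<gamma>' s"
  and ns: "\<And>s. 0 < s ==> s < b ==> \<gamma> s \<notin> singularities X" and t: "0 \<le> t" "t \<le> b"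
 shows "\<gamma> t = \<gamma>' t"
proof (cases "b \<le> 0")
 case True
 hence "t = 0" using t by linarith
 thus ?thesis using t r by simp
next
 case False
 define S where "S = {t. 0 \<le> t \<and> t \<le> b \<and> (\<forall>s. 0 \<le> s \<and> s \<le> t --> \<gamma> s = \<gamma>' s)}"
 define m where "m = Sup S"
 have bdd: "bdd_above S" by (auto simp: S_def bdd_above_def)
 have r2: "min r b / 2 \<in> S" using r False half_min[of r b] by (auto simp: S_def)
 hence m0: "0 < m" using cSup_upper[OF r2 bdd] half_min[of r b] r(1) False unfolding m_def by linarith
 have mb: "m \<le> b" unfolding m_def by (rule cSup_least) (use r2 in \<open>auto simp: S_def\<close>)
 have below: "\<gamma> s = \<gamma>' s" if s: "0 \<le> s" "s < m" for s
 proof -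
  obtain t where "t \<in> S" "s < t" using s(2) less_cSup_iff[of S s] bdd r2 unfolding m_def by blast
  thus ?thesis using s by (auto simp: S_def)
 qed
 obtain r1 i z where 1: "r1 > 0" "i < N" "\<And>s. 0 \<le> s ==> s < r1 ==> z - ray th s \<in> reg i"
  "\<And>s. 0 \<le> s ==> s < r1 ==> \<gamma> (m - s) = proj X (i, z - ray th s)" using sc_left[OF g m0 mb] by metis
 obtain r2 j w where 2: "r2 > 0" "j < N" "\<And>s. 0 \<le> s ==> s < r2 ==> w - ray th s \<in> reg j"
  "\<And>s. 0 \<le> s ==> s < r2 ==> \<gamma>' (m - s) = proj X (j, w - ray th s)" using sc_left[OF g' m0 mb] by metis
 define r3 where "r3 = min m (min r1 r2)"
 have r3: "r3 > 0" "r3 \<le> m" "r3 \<le> r1" "r3 \<le> r2" using m0 1 2 by (auto simp: r3_def)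
 have "proj X (i, z) = proj X (j, w)"
 proof (rule proj_limit[OF 1(2) 2(2) r3(1) direction_nz[of th]])
  fix s assume s: "0 < s" "s < r3"
  have "\<gamma> (m - s) = \<gamma>' (m - s)" using s r3 by (intro below) auto
  thus "proj X (i, z - ray th s) = proj X (j, w - ray th s)"
   using 1(4)[of s] 2(4)[of s] s r3 by auto
 qed (use 1(3) 2(3) r3 in auto)
 hence atm: "\<gamma> m = \<gamma>' m" using 1(4)[of 0] 2(4)[of 0] 1(1) 2(1) by simp
 have "m = b"
 proof (rule ccontr)
  assume "m \<noteq> b" hence mb: "m < b" using mb by simp
  obtain r1 i z where 1: "r1 > 0" "i < N" "\<And>s. 0 \<le> s ==> s < r1 ==> z + ray th s \<in> reg i"
   "\<And>s. 0 \<le> s ==> s < r1 ==> \<gamma> (m + s) = proj X (i, z + ray th s)" using sc_right[OF g less_imp_le[OF m0] mb] by metis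
  obtain r2 j w where 2: "r2 > 0" "j < N" "\<And>s. 0 \<le> s ==> s < r2 ==> w + ray th s \<in> reg j"
   "\<And>s. 0 \<le> s ==> s < r2 ==> \<gamma>' (m + s) = proj X (j, w + ray th s)" using sc_right[OF g' less_imp_le[OF m0] mb] by metis
  have "proj X (i, z) = proj X (j, w)" "proj X (i, z) \<notin> singularities X"
   using atm ns[OF m0 mb] 1(4)[of 0] 2(4)[of 0] 1(1) 2(1) by simp_all
  moreover have "germ (direction th) i z" "germ (direction th) j w" unfolding germ_def using 1 2 by blast+
  ultimately obtain r3 where r3: "r3 > 0" "\<And>s. 0 \<le> s ==> s < r3 ==> proj X (i, z + ray th s) = proj X (j, w + ray th s)"
   using germ_unique[OF direction_nz 1(2) _ 2(2)] by blast
  define h where "h = min (min (min r1 r2) r3) (b - m) / 2"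
  have h: "0 < h" "h < r1" "h < r2" "h < r3" "h < b - m" using 1(1) 2(1) r3(1) mb by (auto simp: h_def min_def)
  have "\<gamma> s = \<gamma>' s" if s: "0 \<le> s" "s \<le> m + h" for s
  proof (cases "s < m")
   case True thus ?thesis using below s by blast
  next
   case False
   hence "0 \<le> s - m" "s - m \<le> h" using s by auto
   thus ?thesis using 1(4)[of "s - m"] 2(4)[of "s - m"] r3(2)[of "s - m"] h by simp
  qed
  hence "m + h \<in> S" using m0 h by (auto simp: S_def)
  thus False using cSup_upper[OF _ bdd] h unfolding m_def by force
 qed
 thus ?thesis using below atm t by (cases "t = m") auto
qed

corollary sc_unique:
 assumes g: "straight_curve X th 0 b \<gamma>" and g': "straight_curve X th 0 b \<gamma>'" and eq: "\<gamma> 0 = \<gamma>' 0"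
  and ns: "\<And>s. 0 \<le> s ==> s < b ==> \<gamma> s \<notin> singularities X" and t: "0 \<le> t" "t \<le> b"
 shows "\<gamma> t = \<gamma>' t"
proof (cases "b \<le> 0")
 case True
 hence "t = 0" using t by linarith
 thus ?thesis using eq by simp
next
 case False
 hence b: "0 < b" by simp
 obtain r1 i z where 1: "r1 > 0" "i < N" "\<And>s. 0 \<le> s ==> s < r1 ==> z + ray th s \<in> reg i"
  "\<And>s. 0 \<le> s ==> s < r1 ==> \<gamma> (0 + s) = proj X (i, z + ray th s)" using sc_right[OF g order_refl b] by metis
 obtain r2 j w where 2: "r2 > 0" "j < N" "\<And>s. 0 \<le> s ==> s < r2 ==> w + ray th s \<in> reg j"
  "\<And>s. 0 \<le> s ==> s < r2 ==> \<gamma>' (0 + s) = proj X (j, w + ray th s)" using sc_right[OF g' order_refl b] by metis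
 have "proj X (i, z) = proj X (j, w)" "proj X (i, z) \<notin> singularities X"
  using eq ns[OF order_refl b] 1(4)[of 0] 2(4)[of 0] 1(1) 2(1) by simp_all
 moreover have "germ (direction th) i z" "germ (direction th) j w" unfolding germ_def using 1 2 by blast+
 ultimately obtain r3 where r3: "r3 > 0" "\<And>s. 0 \<le> s ==> s < r3 ==> proj X (i, z + ray th s) = proj X (j, w + ray th s)"
  using germ_unique[OF direction_nz 1(2) _ 2(2)] by blast
 show ?thesis
 proof (rule sc_unique_germ[OF g g' _ _ _ t])
  show "0 < min (min r1 r2) r3" using 1 2 r3 by simp
  fix s assume "0 \<le> s" "s < min (min r1 r2) r3"
  thus "\<gamma> s = \<gamma>' s" using 1(4)[of s] 2(4)[of s] r3(2)[of s] by simp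
 qed (use ns in auto)
qed

definition orbit_on :: "real => real => real => surface_point => (real => surface_point) => bool" where
 "orbit_on th a b p \<gamma> \<longleftrightarrow> a \<le> 0 \<and> 0 \<le> b \<and> straight_curve X th a b \<gamma> \<and> (\<forall>s\<in>{a..b}. \<gamma> s \<notin> singularities X) \<and> \<gamma> 0 = p"

lemma flow_rel_orbit: "flow_rel X th t p q \<longleftrightarrow> (\<exists>\<gamma>. orbit_on th (min 0 t) (max 0 t) p \<gamma> \<and> \<gamma> t = q)"
 unfolding flow_rel_def orbit_on_def by auto

lemma orbit_restrict: "orbit_on th a b p \<gamma> ==> a \<le> a' ==> a' \<le> 0 ==> 0 \<le> b' ==> b' \<le> b ==> orbit_on th a' b' p \<gamma>"
 unfolding orbit_on_def using sc_restrict by auto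

lemma orbit_rev: "orbit_on th a b p \<gamma> ==> orbit_on (th + pi) (- b) (- a) p (\<lambda>t. \<gamma> (- t))"
 unfolding orbit_on_def using sc_rev by auto

lemma orbit_unique_fwd: assumes "orbit_on th a b p \<gamma>" "orbit_on th a' b' p \<gamma>'" "0 \<le> t" "t \<le> b" "t \<le> b'" shows "\<gamma> t = \<gamma>' t"
proof -
 have "orbit_on th 0 t p \<gamma>" "orbit_on th 0 t p \<gamma>'"
  using orbit_restrict[OF assms(1), of 0 t] orbit_restrict[OF assms(2), of 0 t] assms unfolding orbit_on_def by auto
 thus ?thesis using sc_unique[of th t \<gamma> \<gamma>' t] assms(3) unfolding orbit_on_def by auto
qed

lemma orbit_unique: assumes "orbit_on th a b p \<gamma>" "orbit_on th a' b' p \<gamma>'" "a \<le> t" "a' \<le> t" "t \<le> b" "t \<le> b'" shows "\<gamma> t = \<gamma>' t"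
proof (cases "0 \<le> t")
 case True thus ?thesis using orbit_unique_fwd assms by blast
next
 case False
 thus ?thesis using orbit_unique_fwd[OF orbit_rev[OF assms(1)] orbit_rev[OF assms(2)], of "- t"] assms by simp
qed

lemma flow_rel_unique: assumes "flow_rel X th t p q" "flow_rel X th t p q'" shows "q = q'"
proof -
 obtain f g where f: "orbit_on th (min 0 t) (max 0 t) p f" "f t = q" and g: "orbit_on th (min 0 t) (max 0 t) p g" "g t = q'"
  using assms unfolding flow_rel_orbit by blast
 have "f t = g t" by (rule orbit_unique[OF f(1) g(1)]) auto
 thus ?thesis using f g by simp
qed

lemma flow_eq: "flow_rel X th t p q ==> flow X th t p = q"
 unfolding flow_def by (rule the_equality, assumption, rule flow_rel_unique[of th t p])

lemma orbit_common: assumes "flow_rel X th t p q" "flow_rel X th t' p q'"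
 obtains \<gamma> where "orbit_on th (min 0 (min t t')) (max 0 (max t t')) p \<gamma>" "\<gamma> t = q" "\<gamma> t' = q'"
proof -
 obtain f g where f: "orbit_on th (min 0 t) (max 0 t) p f" "f t = q" and g: "orbit_on th (min 0 t') (max 0 t') p g" "g t' = q'"
  using assms unfolding flow_rel_orbit by blast
 have u: "f s = g s" if "min 0 t \<le> s" "min 0 t' \<le> s" "s \<le> max 0 t" "s \<le> max 0 t'" for s
  using orbit_unique[OF f(1) g(1)] that by blast
 consider "0 \<le> t" "0 \<le> t'" | "t \<le> 0" "t' \<le> 0" | "t \<le> 0" "0 \<le> t'" | "0 \<le> t" "t' \<le> 0" by linarith
 thus thesis
 proof cases
  case 1
  show ?thesis
  proof (cases "t \<le> t'")
   case True
   hence e: "min 0 (min t t') = min 0 t'" "max 0 (max t t') = max 0 t'" using 1 by auto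
   have ut: "f t = g t" by (rule u) (use 1 True in auto)
   have "orbit_on th (min 0 (min t t')) (max 0 (max t t')) p g" unfolding e by (rule g(1))
   moreover have "g t = q" using ut f(2) by simp
   ultimately show thesis using that g(2) by blast
  next
   case False
   hence e: "min 0 (min t t') = min 0 t" "max 0 (max t t') = max 0 t" using 1 by auto
   have ut: "f t' = g t'" by (rule u) (use 1 False in auto)
   have "orbit_on th (min 0 (min t t')) (max 0 (max t t')) p f" unfolding e by (rule f(1))
   moreover have "f t' = q'" using ut g(2) by simp
   ultimately show thesis using that f(2) by blast
  qed
 next
  case 2
  show ?thesis
  proof (cases "t' \<le> t")
   case True
   hence e: "min 0 (min t t') = min 0 t'" "max 0 (max t t') = max 0 t'" using 2 by auto
   have ut: "f t = g t" by (rule u) (use 2 True in auto)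
   have "orbit_on th (min 0 (min t t')) (max 0 (max t t')) p g" unfolding e by (rule g(1))
   moreover have "g t = q" using ut f(2) by simp
   ultimately show thesis using that g(2) by blast
  next
   case False
   hence e: "min 0 (min t t') = min 0 t" "max 0 (max t t') = max 0 t" using 2 by auto
   have ut: "f t' = g t'" by (rule u) (use 2 False in auto)
   have "orbit_on th (min 0 (min t t')) (max 0 (max t t')) p f" unfolding e by (rule f(1))
   moreover have "f t' = q'" using ut g(2) by simp
   ultimately show thesis using that f(2) by blast
  qed
 next
  case 3
  have "orbit_on th t t' p (\<lambda>s. if s \<le> 0 then f s else g s)"
  proof -
   have "min 0 t = t" "max 0 t = 0" "min 0 t' = 0" "max 0 t' = t'" using 3 by auto
   hence f': "orbit_on th t 0 p f" and g': "orbit_on th 0 t' p g" using f g by simp_all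
   hence "straight_curve X th t t' (\<lambda>s. if s \<le> 0 then f s else g s)"
    unfolding orbit_on_def by (intro sc_append) simp_all
   thus ?thesis using f' g' unfolding orbit_on_def by auto
  qed
  moreover have "min 0 (min t t') = t" "max 0 (max t t') = t'" using 3 by auto
  moreover have "f 0 = g 0" using f g unfolding orbit_on_def by simp
  ultimately show ?thesis using f g 3 by (intro that[of "\<lambda>s. if s \<le> 0 then f s else g s"]) (auto simp: le_less)
 next
  case 4
  have "orbit_on th t' t p (\<lambda>s. if s \<le> 0 then g s else f s)"
  proof -
   have "min 0 t' = t'" "max 0 t' = 0" "min 0 t = 0" "max 0 t = t" using 4 by auto
   hence g': "orbit_on th t' 0 p g" and f': "orbit_on th 0 t p f" using f g by simp_all
   hence "straight_curve X th t' t (\<lambda>s. if s \<le> 0 then g s else f s)"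
    unfolding orbit_on_def by (intro sc_append) simp_all
   thus ?thesis using f' g' unfolding orbit_on_def by auto
  qed
  moreover have "min 0 (min t t') = t'" "max 0 (max t t') = t" using 4 by auto
  moreover have "f 0 = g 0" using f g unfolding orbit_on_def by simp
  ultimately show ?thesis using f g 4 by (intro that[of "\<lambda>s. if s \<le> 0 then g s else f s"]) (auto simp: le_less)
 qed
qed

lemma flow_rel_tri: assumes "flow_rel X th t p q" "flow_rel X th t' p q'" shows "flow_rel X th (t' - t) q q'"
proof -
 obtain \<gamma> where g: "orbit_on th (min 0 (min t t')) (max 0 (max t t')) p \<gamma>" "\<gamma> t = q" "\<gamma> t' = q'" using orbit_common[OF assms] by metis
 have sc: "straight_curve X th (min 0 (min t t')) (max 0 (max t t')) \<gamma>"
  and ns: "\<forall>s\<in>{min 0 (min t t')..max 0 (max t t')}. \<gamma> s \<notin> singularities X"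
  using g(1) unfolding orbit_on_def by blast+
 have "straight_curve X th (min t t') (max t t') \<gamma>" by (rule sc_restrict[OF sc]) auto
 hence "straight_curve X th (min t t' - t) (max t t' - t) (\<lambda>s. \<gamma> (s + t))" by (rule sc_shift)
 moreover have "min t t' - t = min 0 (t' - t)" "max t t' - t = max 0 (t' - t)" by auto
 ultimately have "straight_curve X th (min 0 (t' - t)) (max 0 (t' - t)) (\<lambda>s. \<gamma> (s + t))" by simp
 moreover have "\<gamma> (s + t) \<notin> singularities X" if "s \<in> {min 0 (t' - t)..max 0 (t' - t)}" for s
  using that by (intro bspec[OF ns]) (auto simp: min_def max_def split: if_splits)
 ultimately show ?thesis unfolding flow_rel_def using g(2,3) by (intro exI[of _ "\<lambda>s. \<gamma> (s + t)"]) auto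
qed

lemma flow_rel_0: assumes "flow_rel X th t p q" shows "flow_rel X th 0 p p"
proof -
 obtain f where f: "orbit_on th (min 0 t) (max 0 t) p f" using assms unfolding flow_rel_orbit by blast
 have "orbit_on th 0 0 p f" by (rule orbit_restrict[OF f]) auto
 moreover from this have "f 0 = p" by (simp add: orbit_on_def)
 ultimately show ?thesis unfolding flow_rel_orbit by (intro exI[of _ f]) simp
qed

lemma flow_rel_inv: "flow_rel X th t p q ==> flow_rel X th (- t) q p"
 using flow_rel_tri[of th t p q 0 p] flow_rel_0[of th t p q] by simp

lemma complete_flow: assumes "p \<in> complete_points X th"
 shows "flow_rel X th t p (flow X th t p)" "flow X th t p \<in> complete_points X th" "flow X th (- t) (flow X th t p) = p"
proof -
 have d: "\<exists>q. flow_rel X th t p q" for t using assms unfolding complete_points_def flow_defined_def by blast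
 show 1: "flow_rel X th t p (flow X th t p)" for t using d[of t] flow_eq by blast
 have "flow_rel X th s (flow X th t p) (flow X th (t + s) p)" for s
  using flow_rel_tri[OF 1[of t] 1[of "t + s"]] by simp
 moreover have "flow X th t p \<in> points X" using 1[of t] unfolding flow_rel_def
  by (metis max.cobounded2 min.cobounded2 sc_points)
 ultimately show "flow X th t p \<in> complete_points X th" unfolding complete_points_def flow_defined_def by blast
 show "flow X th (- t) (flow X th t p) = p" using flow_rel_inv[OF 1] flow_eq by blast
qed

end

section \<open>Linear flow inside the polygons\<close>

lemma compact_near:
 fixes A B :: "complex set"
 assumes "compact A" "compact B" "0 < \<eta>"
 shows "\<exists>\<delta>>0. \<forall>a\<in>A. \<forall>b\<in>B. dist a b < \<delta> --> (\<exists>v\<in>A \<inter> B. dist a v < \<eta> \<and> dist b v < \<eta>)"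
proof -
 define K where "K = (A \<times> B) \<inter> (\<Inter>v\<in>A\<inter>B. {p. \<eta> \<le> dist (fst p) v} \<union> {p. \<eta> \<le> dist (snd p) v})"
 have "closed (\<Inter>v\<in>A\<inter>B. {p::complex\<times>complex. \<eta> \<le> dist (fst p) v} \<union> {p. \<eta> \<le> dist (snd p) v})"
  by (intro closed_INT ballI closed_Un closed_Collect_le continuous_intros)
 hence K: "compact K" unfolding K_def using assms(1,2) by (intro compact_Int_closed compact_Times)
 show ?thesis
 proof (cases "K = {}")
  case True
  have "\<exists>v\<in>A \<inter> B. dist a v < \<eta> \<and> dist b v < \<eta>" if "a \<in> A" "b \<in> B" for a b
  proof (rule ccontr)
   assume "\<not> ?thesis"
   hence "(a, b) \<in> K" using that unfolding K_def by (auto simp: not_less)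
   thus False using True by simp
  qed
  thus ?thesis by (intro exI[of _ 1]) auto
 next
  case False
  obtain p where p: "p \<in> K" "\<And>q. q \<in> K ==> dist (fst p) (snd p) \<le> dist (fst q) (snd q)"
  proof -
   have "continuous_on K (\<lambda>p. dist (fst p) (snd p))" by (intro continuous_intros)
   thus ?thesis using that continuous_attains_inf[OF K False] by blast
  qed
  have "fst p \<noteq> snd p" using p(1) assms(3) unfolding K_def by (auto simp: not_le dest: bspec)
  hence "dist (fst p) (snd p) > 0" by simp
  moreover have "\<exists>v\<in>A \<inter> B. dist a v < \<eta> \<and> dist b v < \<eta>" if "a \<in> A" "b \<in> B" "dist a b < dist (fst p) (snd p)" for a b
  proof (rule ccontr)
   assume "\<not> ?thesis"
   hence "(a, b) \<in> K" using that unfolding K_def by (auto simp: not_less)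
   thus False using p(2)[of "(a, b)"] that by simp
  qed
  ultimately show ?thesis by blast
 qed
qed

context tsurf
begin

text \<open>\<open>Q\<close> consists of the interior points and \<open>Qp\<close> of the points
 from which the orbit enters the interior at once; \<open>ext\<close> is the time at which it
 reaches the boundary again. An orbit that crosses a side is represented by the point of
 \<open>Qp\<close> on the side through which it enters.\<close>

definition Q :: "(nat \<times> complex) set" where "Q = {(i, z). i < N \<and> z \<in> inn i}"
definition Qp :: "real => (nat \<times> complex) set" where
 "Qp th = {(i, z). i < N \<and> (\<exists>r>0. \<forall>s. 0 < s \<and> s < r --> z + ray th s \<in> inn i)}"
definition mv :: "real => nat \<times> complex => real => nat \<times> complex" where
 "mv th x s = (fst x, snd x + ray th s)"
definition ext :: "real => nat \<times> complex => real" where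
 "ext th x = Inf {s. 0 < s \<and> snd x + ray th s \<in> pboundary (P (fst x))}"
definition VP :: "surface_point set" where "VP = {proj X (fst c, st c) | c. c \<in> sides X}"
definition shift :: "nat \<times> complex => complex => nat \<times> complex" where "shift x u = (fst x, snd x + u)"

lemma Q_iff: "x \<in> Q \<longleftrightarrow> fst x < N \<and> snd x \<in> inn (fst x)" by (auto simp: Q_def)

lemma Q_union: "x \<in> Q ==> x \<in> poly_union X"
 using inn_reg poly_union_iff by (cases x) (auto simp: Q_iff)

lemma Qp_fst: "x \<in> Qp th ==> fst x < N" by (auto simp: Qp_def)

lemma Qp_germ: "x \<in> Qp th ==> \<exists>r>0. \<forall>s. 0 < s \<and> s < r --> snd x + ray th s \<in> inn (fst x)"
 by (auto simp: Qp_def)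

lemma QpI: "fst x < N ==> r > 0 ==> (\<And>s. 0 < s ==> s < r ==> snd x + ray th s \<in> inn (fst x)) ==> x \<in> Qp th"
 by (cases x) (auto simp: Qp_def)

lemma mv_simps [simp]: "fst (mv th x s) = fst x" "snd (mv th x s) = snd x + ray th s"
 "mv th x 0 = x" "mv th (mv th x s) t = mv th x (s + t)"
 by (simp_all add: mv_def algebra_simps)

lemma shift_simps [simp]: "fst (shift x u) = fst x" "snd (shift x u) = snd x + u" "shift x 0 = x"
 by (simp_all add: shift_def)

lemma ball_ray: assumes "open S" "z \<in> S" shows "\<exists>r>0. \<forall>s. 0 \<le> s \<and> s < r --> z + ray th s \<in> S"
proof -
 obtain r where "r > 0" "ball z r \<subseteq> S" using assms open_contains_ball by blast
 thus ?thesis by (intro exI[of _ r]) (auto simp: subset_iff dist_norm norm_mult)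
qed

lemma Q_Qp: assumes "x \<in> Q" shows "x \<in> Qp th"
proof -
 have x: "fst x < N" "snd x \<in> inn (fst x)" using assms by (auto simp: Q_iff)
 obtain r where "r > 0" "\<forall>s. 0 \<le> s \<and> s < r --> snd x + ray th s \<in> inn (fst x)"
  using ball_ray[OF open_inn[OF x(1)] x(2)] by blast
 thus ?thesis using x by (intro QpI[of x r]) auto
qed

lemma inn_connected: assumes "i < N" "connected C" "C \<inter> pboundary (P i) = {}" "c \<in> C" "c \<in> inn i" shows "C \<subseteq> inn i"
 using polygon.connected_in_out[OF polygon[OF assms(1)] assms(2,3)] assms(4,5) inside_Int_outside[of "pboundary (P i)"] by blast

lemma closed_reg: "closed (reg i)" if "i < N"
 using polygon.open_in(2)[OF polygon[OF that]] unfolding reg_eq by auto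

lemma connected_ray: assumes "convex S" shows "connected ((\<lambda>s. z + ray th s) ` S)"
 by (intro connected_continuous_image continuous_intros convex_connected assms)

lemma ext: assumes "x \<in> Qp th"
 shows "0 < ext th x" "snd x + ray th (ext th x) \<in> pboundary (P (fst x))"
  "\<And>s. 0 < s ==> s < ext th x ==> snd x + ray th s \<in> inn (fst x)"
proof -
 define i z where "i = fst x" and "z = snd x"
 let ?f = "\<lambda>s. z + ray th s"
 let ?B = "pboundary (P i)"
 have i: "i < N" using Qp_fst assms by (simp add: i_def)
 obtain r where r: "r > 0" "\<And>s. 0 < s ==> s < r ==> ?f s \<in> inn i" using Qp_germ[OF assms] unfolding i_def z_def by blast
 define A where "A = {s. 0 < s \<and> ?f s \<in> ?B}"
 have ext: "ext th x = Inf A" unfolding ext_def A_def i_def z_def ..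
 have ge: "r \<le> s" if "s \<in> A" for s
 proof (rule ccontr)
  assume "\<not> r \<le> s" thus False using r(2)[of s] that inn_bnd unfolding A_def by auto
 qed
 have ne: "A \<noteq> {}"
 proof
  assume "A = {}"
  hence "?f ` {0<..} \<inter> ?B = {}" unfolding A_def by auto
  moreover have "?f (r/2) \<in> ?f ` {0<..}" by (rule imageI) (use r in simp)
  moreover have "?f (r/2) \<in> inn i" by (rule r(2)) (use r in simp_all)
  ultimately have sub: "?f ` {0<..} \<subseteq> inn i" using inn_connected[OF i connected_ray] convex_real_interval by blast
  obtain M where M: "\<And>w. w \<in> inn i ==> cmod w \<le> M" using polygon.Jordan(3)[OF polygon[OF i]] unfolding bounded_iff by blast
  define s where "s = \<bar>M\<bar> + cmod z + 1"
  have "s > 0" unfolding s_def by (smt (verit) norm_ge_zero)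
  hence "cmod (?f s) \<le> M" using M sub by auto
  moreover have "cmod (ray th s) = s" using \<open>s > 0\<close> by (simp add: norm_mult)
  moreover have "cmod (ray th s) \<le> cmod (?f s) + cmod z"
   using norm_triangle_ineq4[of "?f s" z] by simp
  ultimately show False unfolding s_def by linarith
 qed
 have Aeq: "A = {r..} \<inter> ?f -` ?B" using ge r(1) unfolding A_def by auto
 have "closed (?f -` ?B)" by (intro closed_vimage polygon.closed_B[OF polygon[OF i]] continuous_intros)
 hence cl: "closed A" unfolding Aeq by (intro closed_Int closed_atLeast)
 have bdd: "bdd_below A" using ge by (auto simp: bdd_below_def)
 have inA: "Inf A \<in> A" by (rule closed_contains_Inf[OF ne bdd cl])
 show "0 < ext th x" "snd x + ray th (ext th x) \<in> pboundary (P (fst x))"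
  using inA unfolding ext A_def i_def[symmetric] z_def[symmetric] by auto
 fix s assume s: "0 < s" "s < ext th x"
 have notA: "t \<notin> A" if "t < ext th x" for t using that cInf_lower[OF _ bdd] unfolding ext by force
 have "?f ` {0<..<ext th x} \<inter> ?B = {}"
 proof (rule equals0I)
  fix w assume "w \<in> ?f ` {0<..<ext th x} \<inter> ?B"
  then obtain t where "0 < t" "t < ext th x" "?f t \<in> ?B" by auto
  thus False using notA[of t] unfolding A_def by auto
 qed
 moreover have "r / 2 < ext th x" "0 < r / 2" using ge[OF inA] r(1) unfolding ext by auto
 hence "?f (r/2) \<in> ?f ` {0<..<ext th x}" by (intro imageI) simp
 moreover have "?f (r/2) \<in> inn i" by (rule r(2)) (use r in simp_all)
 ultimately have "?f ` {0<..<ext th x} \<subseteq> inn i" using inn_connected[OF i connected_ray] convex_real_interval by blast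
 thus "snd x + ray th s \<in> inn (fst x)" using s unfolding i_def z_def by auto
qed

lemma ext_unique: assumes "x \<in> Qp th" "0 < T" "snd x + ray th T \<in> pboundary (P (fst x))"
  "\<And>s. 0 < s ==> s < T ==> snd x + ray th s \<in> inn (fst x)"
 shows "ext th x = T"
proof (rule linorder_cases[of "ext th x" T])
 assume "ext th x < T"
 thus ?thesis using assms(4)[of "ext th x"] ext(1,2)[OF assms(1)] inn_bnd by blast
next
 assume "T < ext th x"
 thus ?thesis using ext(3)[OF assms(1,2)] assms(3) inn_bnd by blast
qed

lemma ext_gt: assumes "x \<in> Qp th" "\<And>s. 0 < s ==> s \<le> T ==> snd x + ray th s \<in> inn (fst x)" shows "T < ext th x"
proof (rule ccontr)
 assume "\<not> ?thesis"
 thus False using assms(2)[of "ext th x"] ext(1,2)[OF assms(1)] inn_bnd by auto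
qed

lemma mv_Q: "x \<in> Qp th ==> 0 < s ==> s < ext th x ==> mv th x s \<in> Q"
 using ext(3) Qp_fst by (auto simp: Q_iff)

lemma mv_Qp: "x \<in> Qp th ==> 0 \<le> s ==> s < ext th x ==> mv th x s \<in> Qp th"
 using mv_Q Q_Qp by (cases "s = 0") auto

lemma ext_mv: assumes "x \<in> Qp th" "0 \<le> s" "s < ext th x" shows "ext th (mv th x s) = ext th x - s"
proof (rule ext_unique[OF mv_Qp[OF assms]])
 have *: "snd (mv th x s) + ray th t = snd x + ray th (s + t)" for t by (simp add: algebra_simps)
 show "snd (mv th x s) + ray th (ext th x - s) \<in> pboundary (P (fst (mv th x s)))"
  unfolding * using ext(2)[OF assms(1)] by simp
 fix t assume "0 < t" "t < ext th x - s"
 thus "snd (mv th x s) + ray th t \<in> inn (fst (mv th x s))"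
  unfolding * using ext(3)[OF assms(1), of "s + t"] assms(2) by simp
qed (use assms in auto)

lemma Qp_reg: assumes "x \<in> Qp th" "0 \<le> s" "s \<le> ext th x" shows "snd x + ray th s \<in> reg (fst x)"
proof -
 consider "s = 0" | "0 < s" "s < ext th x" | "s = ext th x" using assms by linarith
 thus ?thesis
 proof cases
  case 1
  obtain r where r: "r > 0" "\<And>s. 0 < s ==> s < r ==> snd x + ray th s \<in> inn (fst x)" using Qp_germ[OF assms(1)] by blast
  have "snd x \<in> closure (reg (fst x))"
   unfolding closure_approachable
  proof (intro allI impI)
   fix e :: real assume e: "0 < e"
   let ?s = "min r e / 2"
   have s: "0 < ?s" "?s < r" "?s < e" using half_min[OF r(1) e] by auto
   have "dist (snd x + of_real ?s * direction th) (snd x) = ?s" using s(1) by (simp add: dist_norm norm_mult)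
   thus "\<exists>y\<in>reg (fst x). dist y (snd x) < e" using r(2)[OF s(1,2)] s(3) inn_reg by (metis subsetD)
  qed
  thus ?thesis using 1 closed_reg[OF Qp_fst[OF assms(1)]] by simp
 next
  case 2 thus ?thesis using ext(3)[OF assms(1)] inn_reg by blast
 next
  case 3 thus ?thesis using ext(2)[OF assms(1)] bnd_reg by blast
 qed
qed

lemma Qp_union: assumes "x \<in> Qp th" shows "x \<in> poly_union X"
 using Qp_reg[OF assms order_refl] ext(1)[OF assms] Qp_fst[OF assms] poly_union_iff[of "fst x" "snd x"] by simp

lemma small_ray: assumes "0 < r" "0 < g" obtains s where "0 < s" "s < g" "z + ray th s \<in> ball z r" "z - ray th s \<in> ball z r"
 by (rule that[of "min r g / 2"]) (use half_min[OF assms] in \<open>auto simp: dist_norm norm_mult\<close>)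

lemma exit_side: assumes x: "x \<in> Qp th" and e: "e \<in> sides X" "fst e = fst x" "snd x + ray th (ext th x) \<in> oseg e"
 shows "cross (sv e) (direction th) < 0"
proof -
 let ?w = "snd x + ray th (ext th x)"
 obtain r where r: "r > 0" "\<And>v. v \<in> ball ?w r ==> cross (sv e) (v - ?w) < 0 ==> v \<notin> reg (fst e)"
  "\<And>v. v \<in> ball ?w r ==> cross (sv e) (v - ?w) = 0 ==> v \<in> oseg e"
  using side_loc[OF e(1,3)] by blast
 obtain s where s: "0 < s" "s < ext th x" "?w - ray th s \<in> ball ?w r" using small_ray[OF r(1) ext(1)[OF x]] by blast
 let ?v = "?w - ray th s"
 have eq: "?v = snd x + ray th (ext th x - s)" by (simp add: algebra_simps)
 have v: "?v \<in> inn (fst e)" unfolding eq e(2) by (rule ext(3)[OF x]) (use s in auto)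
 have c: "cross (sv e) (?v - ?w) = - (s * cross (sv e) (direction th))" by (simp add: cross_simps)
 have "\<not> cross (sv e) (?v - ?w) < 0" using r(2)[OF s(3)] v inn_reg by blast
 moreover have "cross (sv e) (?v - ?w) \<noteq> 0" using r(3)[OF s(3)] v inn_bnd oseg_cseg cseg_bnd[OF e(1)] by blast
 ultimately have "0 < - (s * cross (sv e) (direction th))" unfolding c by linarith
 thus ?thesis using s(1) by (simp add: mult_less_0_iff)
qed

lemma entry: assumes e: "e \<in> sides X" "w \<in> oseg e" and c: "cross (sv e) (direction th) > 0" shows "(fst e, w) \<in> Qp th"
proof -
 obtain r where r: "r > 0" "\<And>v. v \<in> ball w r ==> cross (sv e) (v - w) > 0 ==> v \<in> inn (fst e)"
  using side_loc[OF e] by blast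
 show ?thesis
 proof (rule QpI[of _ r])
  fix s assume s: "0 < s" "s < r"
  have "w + ray th s \<in> ball w r" using s by (simp add: dist_norm norm_mult)
  moreover have "cross (sv e) (w + ray th s - w) > 0" using s c by (simp add: cross_simps)
  ultimately show "snd (fst e, w) + ray th s \<in> inn (fst (fst e, w))" using r(2) by simp
 qed (use r side_fst e in auto)
qed

definition crosses :: "real => nat \<times> complex => nat \<times> nat => bool" where
 "crosses th x e \<longleftrightarrow> x \<in> Qp th \<and> e \<in> sides X \<and> fst e = fst x \<and> snd x + ray th (ext th x) \<in> oseg e"
definition nx :: "real => nat \<times> complex => nat \<times> nat => nat \<times> complex" where
 "nx th x e = (fst (mate X e), snd x + ray th (ext th x) + tau e)"

lemma nx: assumes "crosses th x e"
 shows "nx th x e \<in> Qp th" "snd (nx th x e) \<in> oseg (mate X e)" "cross (sv e) (direction th) < 0"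
  "proj X (fst x, snd x + ray th (ext th x)) = proj X (nx th x e)"
proof -
 have a: "x \<in> Qp th" "e \<in> sides X" "fst e = fst x" "snd x + ray th (ext th x) \<in> oseg e"
  using assms by (auto simp: crosses_def)
 show c: "cross (sv e) (direction th) < 0" using exit_side[OF a] .
 show o: "snd (nx th x e) \<in> oseg (mate X e)" unfolding nx_def using seg_tau(2)[OF a(2,4)] by simp
 have "cross (sv (mate X e)) (direction th) > 0" unfolding mate(3)[OF a(2)] using c by (simp add: cross_simps)
 hence "(fst (mate X e), snd (nx th x e)) \<in> Qp th" by (rule entry[OF mate(1)[OF a(2)] o])
 thus "nx th x e \<in> Qp th" by (simp add: nx_def)
 show "proj X (fst x, snd x + ray th (ext th x)) = proj X (nx th x e)"
  unfolding nx_def a(3)[symmetric] by (rule proj_tau[OF a(2)]) (use a(4) oseg_cseg in blast)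
qed

lemma nx_bnd: assumes "crosses th x e" shows "nx th x e \<notin> Q"
proof -
 have e: "e \<in> sides X" using assms by (simp add: crosses_def)
 have "snd (nx th x e) \<in> cseg (mate X e)" using nx(2)[OF assms] oseg_cseg by blast
 hence "snd (nx th x e) \<in> pboundary (P (fst (mate X e)))" using cseg_bnd[OF mate(1)[OF e]] by blast
 moreover have "fst (nx th x e) = fst (mate X e)" by (simp add: nx_def)
 ultimately show ?thesis using inn_bnd unfolding Q_iff by metis
qed

lemma crosses_unique: "crosses th x e ==> crosses th x e' ==> e = e'"
 unfolding crosses_def using oseg_unique oseg_cseg by (metis subsetD)

text \<open>\<open>fl th x t y\<close>: the orbit of \<open>x\<close> meets no vertex until time
 \<open>t\<close>, when it is at \<open>y\<close>. \<open>hits th x t c\<close>: its first vertex is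
 the apex of the corner \<open>c\<close>, reached at time \<open>t\<close> inside the polygon of
 \<open>c\<close>. Regular vertices stop it too; the points that this affects have area
 zero.\<close>

inductive fl :: "real => nat \<times> complex => real => nat \<times> complex => bool" for th where
 fl_move: "x \<in> Qp th ==> 0 \<le> t ==> t < ext th x ==> fl th x t (mv th x t)"
| fl_cross: "crosses th x e ==> fl th (nx th x e) t y ==> fl th x (ext th x + t) y"

inductive hits :: "real => nat \<times> complex => real => nat \<times> nat => bool" for th where
 hits_now: "x \<in> Qp th ==> c \<in> sides X ==> fst c = fst x ==> snd x + ray th (ext th x) = st c ==> hits th x (ext th x) c"
| hits_later: "crosses th x e ==> hits th (nx th x e) t c ==> hits th x (ext th x + t) c"

lemma fl_Qp: "fl th x t y ==> x \<in> Qp th \<and> y \<in> Qp th \<and> 0 \<le> t"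
proof (induction rule: fl.induct)
 case (fl_move x t) thus ?case using mv_Qp by blast
next
 case (fl_cross x e t y)
 hence "x \<in> Qp th" by (auto simp: crosses_def)
 thus ?case using fl_cross ext(1)[of x th] by simp
qed

lemma hits_pos: "hits th x t c ==> x \<in> Qp th \<and> c \<in> sides X \<and> 0 < t"
proof (induction rule: hits.induct)
 case (hits_now x c) thus ?case using ext(1) by blast
next
 case (hits_later x e t c)
 hence "x \<in> Qp th" by (auto simp: crosses_def)
 thus ?case using hits_later ext(1)[of x th] by simp
qed

lemma fl_cases: assumes "fl th x t y"
 obtains "t < ext th x" "y = mv th x t" "x \<in> Qp th" "0 \<le> t"
 | e where "ext th x \<le> t" "crosses th x e" "fl th (nx th x e) (t - ext th x) y"
 using assms
proof (cases rule: fl.cases)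
 case fl_move thus ?thesis using that by blast
next
 case (fl_cross e t')
 hence "0 \<le> t'" using fl_Qp by blast
 thus ?thesis using that(2)[of e] fl_cross by simp
qed

lemma fl_det: "fl th x t y ==> fl th x t y' ==> y = y'"
proof (induction arbitrary: y' rule: fl.induct)
 case (fl_move x t)
 from fl_move(4) show ?case
  by (cases rule: fl_cases) (use fl_move in auto)
next
 case (fl_cross x e t y)
 from fl_cross(4) show ?case
 proof (cases rule: fl_cases)
  case 1
  thus ?thesis using fl_Qp[OF fl_cross(2)] by simp
 next
  case (2 e')
  hence "e' = e" using crosses_unique fl_cross(1) by blast
  thus ?thesis using 2 fl_cross(3) by simp
 qed
qed

lemma fl_0: assumes "fl th x 0 y" shows "y = x"
 using assms
proof (cases rule: fl_cases)
 case (2 e) thus ?thesis using ext(1)[of x th] by (auto simp: crosses_def)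
qed simp

lemma fl_prefix: assumes "x \<in> Qp th" "0 \<le> s" "s < ext th x" "fl th (mv th x s) t z" shows "fl th x (s + t) z"
 using assms(4)
proof (cases rule: fl_cases)
 case 1
 hence "s + t < ext th x" "0 \<le> s + t" using ext_mv[OF assms(1-3)] assms(2) by auto
 thus ?thesis using fl.fl_move[OF assms(1)] 1(2) by simp
next
 case (2 e)
 have em: "ext th (mv th x s) = ext th x - s" by (rule ext_mv[OF assms(1-3)])
 have w: "snd (mv th x s) + ray th (ext th x - s) = snd x + ray th (ext th x)" by (simp add: algebra_simps)
 have c: "crosses th x e" using 2(2) assms(1) unfolding crosses_def em w by simp
 have "nx th (mv th x s) e = nx th x e" unfolding nx_def em w ..
 hence "fl th (nx th x e) (t - (ext th x - s)) z" using 2(3) em by simp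
 hence "fl th x (ext th x + (t - (ext th x - s))) z" by (rule fl.fl_cross[OF c])
 moreover have "ext th x + (t - (ext th x - s)) = s + t" by simp
 ultimately show ?thesis by metis
qed

lemma fl_trans: "fl th x s y ==> fl th y t z ==> fl th x (s + t) z"
proof (induction rule: fl.induct)
 case (fl_move x s) thus ?case using fl_prefix by blast
next
 case (fl_cross x e s y)
 thus ?case using fl.fl_cross[OF fl_cross(1)] by (simp add: add.assoc)
qed

lemma fl_split: "fl th x t y ==> 0 \<le> s ==> s \<le> t ==> \<exists>m. fl th x s m \<and> fl th m (t - s) y"
proof (induction arbitrary: s rule: fl.induct)
 case (fl_move x t)
 have "fl th x s (mv th x s)" using fl.fl_move[of x th s] fl_move by auto
 moreover have "fl th (mv th x s) (t - s) (mv th (mv th x s) (t - s))"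
  by (rule fl.fl_move[OF mv_Qp]) (use fl_move ext_mv[of x th s] in auto)
 ultimately show ?case by (intro exI[of _ "mv th x s"]) simp
next
 case (fl_cross x e t y)
 have x: "x \<in> Qp th" using fl_cross(1) by (simp add: crosses_def)
 show ?case
 proof (cases "s < ext th x")
  case True
  have em: "ext th (mv th x s) = ext th x - s" using ext_mv[OF x fl_cross(4) True] .
  have w: "snd (mv th x s) + ray th (ext th x - s) = snd x + ray th (ext th x)" by (simp add: algebra_simps)
  have c: "crosses th (mv th x s) e" using fl_cross(1) mv_Qp[OF x fl_cross(4) True] unfolding crosses_def em w by simp
  have "nx th (mv th x s) e = nx th x e" unfolding nx_def em w ..
  hence "fl th (mv th x s) (ext th x - s + t) y" using fl.fl_cross[OF c] fl_cross(2) em by simp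
  moreover have "fl th x s (mv th x s)" using fl.fl_move[OF x fl_cross(4) True] .
  moreover have "ext th x + t - s = ext th x - s + t" by simp
  ultimately show ?thesis by metis
 next
  case False
  then obtain m where m: "fl th (nx th x e) (s - ext th x) m" "fl th m (t - (s - ext th x)) y"
   using fl_cross(3)[of "s - ext th x"] fl_cross(5) by auto
  hence "fl th x s m" using fl.fl_cross[OF fl_cross(1) m(1)] by simp
  moreover have "ext th x + t - s = t - (s - ext th x)" by simp
  ultimately show ?thesis using m(2) by metis
 qed
qed

lemma endpoint_sep: obtains \<mu> where "\<mu> > 0" "\<And>e. e \<in> sides X ==> \<mu> \<le> dist (st e) (en e)"
proof -
 have "finite ((\<lambda>e. dist (st e) (en e)) ` sides X)" using finite_sides by auto
 moreover have "0 < dist (st e) (en e)" if "e \<in> sides X" for e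
  using sv_nz[OF that] unfolding sv_def by (metis eq_iff_diff_eq_0 zero_less_dist_iff)
 ultimately show ?thesis
  using that[of "Min (insert 1 ((\<lambda>e. dist (st e) (en e)) ` sides X))"] by (auto simp: Min_gr_iff)
qed

lemma sides_near: assumes "0 < \<eta>"
 obtains \<delta> where "\<delta> > 0" "\<And>e f a b. e \<in> sides X ==> f \<in> sides X ==> a \<in> cseg f ==> b \<in> cseg e ==> dist a b < \<delta> ==>
   \<exists>v\<in>cseg f \<inter> cseg e. dist a v < \<eta> \<and> dist b v < \<eta>"
proof -
 have "\<exists>\<delta>>0. \<forall>a\<in>cseg (fst p). \<forall>b\<in>cseg (snd p). dist a b < \<delta> --> (\<exists>v\<in>cseg (fst p) \<inter> cseg (snd p). dist a v < \<eta> \<and> dist b v < \<eta>)" for p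
  by (rule compact_near) (use assms in \<open>auto simp: cseg_def\<close>)
 then obtain D where D: "\<And>p. D p > 0" "\<And>p a b. a\<in>cseg (fst p) ==> b\<in>cseg (snd p) ==> dist a b < D p ==> (\<exists>v\<in>cseg (fst p) \<inter> cseg (snd p). dist a v < \<eta> \<and> dist b v < \<eta>)"
  by metis
 define S where "S = insert 1 (D ` (sides X \<times> sides X))"
 have fin: "finite S" unfolding S_def using finite_sides by auto
 have "Min S > 0" using fin D(1) by (subst Min_gr_iff) (auto simp: S_def)
 moreover have "Min S \<le> D (f, e)" if "e \<in> sides X" "f \<in> sides X" for e f
  by (rule Min_le[OF fin]) (use that in \<open>auto simp: S_def\<close>)
 ultimately show ?thesis
 proof (intro that[of "Min S"])
  fix e f a b assume *: "e \<in> sides X" "f \<in> sides X" "a \<in> cseg f" "b \<in> cseg e" "dist a b < Min S"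
  hence "dist a b < D (f, e)" using \<open>\<And>f e. e \<in> sides X ==> f \<in> sides X ==> Min S \<le> D (f, e)\<close>[of e f] by linarith
  thus "\<exists>v\<in>cseg f \<inter> cseg e. dist a v < \<eta> \<and> dist b v < \<eta>" using D(2)[of a "(f, e)" b] * by simp
 qed
qed

text \<open>Infinitely many crossings in finite time would have to wind around a vertex. Measured from the
 vertex, the position moves along one straight line, which has to tend to the vertex; but then the
 line passes through the vertex and contains the sides that it crosses.\<close>

lemma no_infinite_crossing:
 assumes cr: "\<And>n. crosses th (x n) (e n)" and nxt: "\<And>n. x (Suc n) = nx th (x n) (e n)"
  and sum: "summable (\<lambda>n. ext th (x n))"
 shows False
proof -
 define f where "f n = mate X (e n)" for n
 define w where "w n = snd (x n) + ray th (ext th (x n))" for n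
 define z where "z n = snd (x n)" for n
 have xQ: "x n \<in> Qp th" and eS: "e n \<in> sides X" and efx: "fst (e n) = fst (x n)" and wo: "w n \<in> oseg (e n)" for n
  using cr[of n] unfolding crosses_def w_def by auto
 have fS: "f n \<in> sides X" for n unfolding f_def using mate(1)[OF eS] .
 have zS: "z (Suc n) \<in> oseg (f n)" for n unfolding z_def nxt f_def using nx(2)[OF cr] .
 have zw: "z (Suc n) = w n + tau (e n)" for n unfolding z_def nxt w_def by (simp add: nx_def)
 have fe: "fst (f n) = fst (e (Suc n))" for n unfolding efx nxt f_def by (simp add: nx_def)
 have ce: "cross (sv (e n)) (direction th) < 0" for n using nx(3)[OF cr] .
 have cf: "cross (sv (f n)) (direction th) > 0" for n unfolding f_def mate(3)[OF eS] using ce[of n] by (simp add: cross_simps)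
 have ne: "f n \<noteq> e (Suc n)" for n using cf[of n] ce[of "Suc n"] by auto
 have ext_pos: "ext th (x n) > 0" for n using ext(1)[OF xQ] .
 have ext0: "(\<lambda>n. ext th (x n)) \<longlonglongrightarrow> 0" using summable_LIMSEQ_zero[OF sum] .
 have dzw: "dist (z n) (w n) = ext th (x n)" for n
  unfolding z_def w_def using ext_pos[of n] by (simp add: dist_norm norm_mult)
 obtain \<mu> where mu: "\<mu> > 0" "\<And>e. e \<in> sides X ==> \<mu> \<le> dist (st e) (en e)" using endpoint_sep by blast
 have near: "\<exists>M. \<forall>n\<ge>M. \<exists>v\<in>cseg (f n) \<inter> cseg (e (Suc n)). dist (z (Suc n)) v < \<eta> \<and> dist (w (Suc n)) v < \<eta>" if "\<eta> > 0" for \<eta>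
 proof -
  obtain \<delta> where d: "\<delta> > 0" "\<And>e f a b. e \<in> sides X ==> f \<in> sides X ==> a \<in> cseg f ==> b \<in> cseg e ==> dist a b < \<delta> ==>
   \<exists>v\<in>cseg f \<inter> cseg e. dist a v < \<eta> \<and> dist b v < \<eta>" using sides_near[OF \<open>\<eta> > 0\<close>] by metis
  have "\<forall>\<^sub>F n in sequentially. ext th (x n) < \<delta>" using order_tendstoD(2)[OF ext0 d(1)] .
  then obtain M where M: "\<And>n. n \<ge> M ==> ext th (x n) < \<delta>" unfolding eventually_sequentially by blast
  have "\<exists>v\<in>cseg (f n) \<inter> cseg (e (Suc n)). dist (z (Suc n)) v < \<eta> \<and> dist (w (Suc n)) v < \<eta>" if "n \<ge> M" for n
  proof (rule d(2)[OF eS fS])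
   show "z (Suc n) \<in> cseg (f n)" "w (Suc n) \<in> cseg (e (Suc n))" using zS wo oseg_cseg by blast+
   show "dist (z (Suc n)) (w (Suc n)) < \<delta>" unfolding dzw using M[of "Suc n"] that by simp
  qed
  thus ?thesis by blast
 qed
 have ends: "v \<in> {st (f n), en (f n)}" "v \<in> {st (e (Suc n)), en (e (Suc n))}" if v: "v \<in> cseg (f n)" "v \<in> cseg (e (Suc n))" for v n
 proof -
  have "v \<notin> oseg (f n)" using oseg_unique[OF fS eS fe _ v(2)] ne by blast
  thus "v \<in> {st (f n), en (f n)}" using cseg_cases[OF v(1)] by blast
  have "v \<notin> oseg (e (Suc n))" using oseg_unique[OF eS fS fe[symmetric] _ v(1)] ne by metis
  thus "v \<in> {st (e (Suc n)), en (e (Suc n))}" using cseg_cases[OF v(2)] by blast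
 qed
 have uniq: "v = v'" if "v \<in> {st g, en g}" "v' \<in> {st g, en g}" "g \<in> sides X" "dist a v < \<mu> / 2" "dist a v' < \<mu> / 2" for v v' g a
 proof (rule ccontr)
  assume "v \<noteq> v'"
  hence "\<mu> \<le> dist v v'" using that mu(2)[of g] by (auto simp: dist_commute)
  thus False using dist_triangle[of v v' a] that(4,5) by (simp add: dist_commute)
 qed
 obtain M where M: "\<And>n. n \<ge> M ==> \<exists>v\<in>cseg (f n) \<inter> cseg (e (Suc n)). dist (z (Suc n)) v < \<mu>/2 \<and> dist (w (Suc n)) v < \<mu>/2"
  using near[of "\<mu>/2"] mu(1) by auto
 then obtain V where V: "\<And>n. n \<ge> M ==> V n \<in> cseg (f n)" "\<And>n. n \<ge> M ==> V n \<in> cseg (e (Suc n))"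
  "\<And>n. n \<ge> M ==> dist (z (Suc n)) (V n) < \<mu>/2" "\<And>n. n \<ge> M ==> dist (w (Suc n)) (V n) < \<mu>/2" by (metis IntE)
 have Vs: "V (Suc n) = V n + tau (e (Suc n))" if n: "n \<ge> M" for n
 proof (rule uniq[of _ "f (Suc n)" _ "z (Suc (Suc n))"])
  have n': "Suc n \<ge> M" using n by simp
  show "V (Suc n) \<in> {st (f (Suc n)), en (f (Suc n))}" using ends(1)[OF V(1,2)[OF n']] .
  have "V n \<in> {st (e (Suc n)), en (e (Suc n))}" using ends(2)[OF V(1,2)[OF n]] .
  thus "V n + tau (e (Suc n)) \<in> {st (f (Suc n)), en (f (Suc n))}"
   unfolding f_def tau_eq(1,2)[OF eS] by auto
  show "dist (z (Suc (Suc n))) (V (Suc n)) < \<mu> / 2" using V(3)[OF n'] .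
  show "dist (z (Suc (Suc n))) (V n + tau (e (Suc n))) < \<mu> / 2" using V(4)[OF n] unfolding zw[of "Suc n"] by simp
 qed (rule fS)
 define \<zeta> where "\<zeta> n = z (Suc n) - V n" for n
 have zs: "\<zeta> (Suc n) = \<zeta> n + of_real (ext th (x (Suc n))) * direction th" if "n \<ge> M" for n
 proof -
  have "w (Suc n) = z (Suc n) + of_real (ext th (x (Suc n))) * direction th" by (simp add: w_def z_def)
  thus ?thesis unfolding \<zeta>_def Vs[OF that] zw[of "Suc n"] by simp
 qed
 have zlim: "\<exists>L. \<forall>n\<ge>L. cmod (\<zeta> n) < \<eta>" if "\<eta> > 0" for \<eta>
 proof -
  obtain L where L: "\<And>n. n \<ge> L ==> \<exists>v\<in>cseg (f n) \<inter> cseg (e (Suc n)). dist (z (Suc n)) v < min \<eta> (\<mu>/2) \<and> dist (w (Suc n)) v < min \<eta> (\<mu>/2)"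
   using near[of "min \<eta> (\<mu>/2)"] mu(1) \<open>\<eta> > 0\<close> by auto
  have "cmod (\<zeta> n) < \<eta>" if n: "n \<ge> max L M" for n
  proof -
   obtain v where v: "v \<in> cseg (f n)" "v \<in> cseg (e (Suc n))" "dist (z (Suc n)) v < min \<eta> (\<mu>/2)" using L[of n] n by auto
   have "v = V n" by (rule uniq[of v "f n" _ "z (Suc n)"]) (use ends(1)[OF v(1,2)] ends(1)[OF V(1,2)] fS v(3) V(3) n in auto)
   thus ?thesis using v(3) by (simp add: \<zeta>_def dist_norm)
  qed
  thus ?thesis by blast
 qed
 define c where "c = cross (sv (f M))"
 have c0: "c (\<zeta> M) = 0"
 proof -
  have "z (Suc M) \<in> cseg (f M)" "V M \<in> cseg (f M)" using zS oseg_cseg V(1) by blast+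
  then obtain s t where "z (Suc M) = st (f M) + of_real s * sv (f M)" "V M = st (f M) + of_real t * sv (f M)"
   using cseg_param[OF fS] by blast
  hence "\<zeta> M = of_real (s - t) * sv (f M)" unfolding \<zeta>_def by (simp add: algebra_simps)
  thus ?thesis unfolding c_def by (simp only: cross_simps mult_zero_right)
 qed
 define \<kappa> where "\<kappa> = c (direction th)"
 have k: "\<kappa> > 0" using cf[of M] by (simp add: \<kappa>_def c_def)
 have step: "c (\<zeta> (Suc n)) = c (\<zeta> n) + ext th (x (Suc n)) * \<kappa>" if "n \<ge> M" for n
  unfolding zs[OF that] c_def \<kappa>_def by (simp add: cross_simps)
 define a where "a = ext th (x (Suc M)) * \<kappa>"
 have a: "a > 0" using ext_pos k by (simp add: a_def)
 have ge: "c (\<zeta> (Suc M + n)) \<ge> a" for n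
 proof (induction n)
  case 0 thus ?case using step[of M] c0 by (simp add: a_def)
 next
  case (Suc n)
  thus ?case using step[of "Suc M + n"] ext_pos[of "Suc (Suc M + n)"] k by (smt (verit) add_Suc_right le_add1 le_SucI add_Suc mult_pos_pos)
 qed
 obtain L where L: "\<And>n. n \<ge> L ==> cmod (\<zeta> n) < a / (cmod (sv (f M)) + 1)"
  using zlim[of "a / (cmod (sv (f M)) + 1)"] a by (auto simp: add_nonneg_pos)
 have "c (\<zeta> (Suc M + L)) \<le> cmod (sv (f M)) * cmod (\<zeta> (Suc M + L))"
  unfolding c_def cross_def by (metis abs_Im_le_cmod abs_le_iff complex_mod_cnj norm_mult order_trans)
 also have "\<dots> \<le> (cmod (sv (f M)) + 1) * cmod (\<zeta> (Suc M + L))" by (intro mult_right_mono) auto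
 also have "\<dots> < a"
 proof -
  have "cmod (sv (f M)) + 1 > 0" by (simp add: add_nonneg_pos)
  thus ?thesis using L[of "Suc M + L"] by (simp add: field_simps)
 qed
 finally show False using ge[of L] by simp
qed

text \<open>An orbit that neither reaches time \<open>t\<close> nor hits a vertex crosses infinitely
 many sides in finite time, which \<open>no_infinite_crossing\<close> excludes.\<close>

theorem fl_or_hits: assumes "x \<in> Qp th" "0 \<le> t"
 shows "(\<exists>y. fl th x t y) \<or> (\<exists>s\<le>t. \<exists>c. hits th x s c)"
proof (rule ccontr)
 assume not: "\<not> ?thesis"
 define bad where "bad x r \<longleftrightarrow> x \<in> Qp th \<and> 0 \<le> r \<and> \<not> (\<exists>y. fl th x r y) \<and> \<not> (\<exists>s\<le>r. \<exists>c. hits th x s c)" for x r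
 have step: "\<exists>e. crosses th x e \<and> ext th x \<le> r \<and> bad (nx th x e) (r - ext th x)" if b: "bad x r" for x r
 proof -
  have x: "x \<in> Qp th" "0 \<le> r" using b by (auto simp: bad_def)
  have le: "ext th x \<le> r"
  proof (rule ccontr)
   assume "\<not> ext th x \<le> r"
   hence "fl th x r (mv th x r)" by (intro fl.fl_move x) simp
   thus False using b unfolding bad_def by blast
  qed
  obtain e where e: "e \<in> sides X" "fst e = fst x" "snd x + ray th (ext th x) \<in> oseg e"
  proof (rule side_sides[OF Qp_fst[OF x(1)] ext(2)[OF x(1)]])
   fix c assume "c \<in> sides X" "fst c = fst x" "snd x + ray th (ext th x) = st c"
   hence "hits th x (ext th x) c" using hits_now x by blast
   thus thesis using b le unfolding bad_def by blast
  qed (rule that)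
  have c: "crosses th x e" using e x by (simp add: crosses_def)
  have "\<not> fl th (nx th x e) (r - ext th x) y" for y
  proof
   assume "fl th (nx th x e) (r - ext th x) y"
   hence "fl th x (ext th x + (r - ext th x)) y" by (rule fl.fl_cross[OF c])
   hence "fl th x r y" by simp
   thus False using b unfolding bad_def by blast
  qed
  moreover have "\<not> hits th (nx th x e) s c'" if "s \<le> r - ext th x" for s c'
  proof
   assume "hits th (nx th x e) s c'"
   hence "hits th x (ext th x + s) c'" by (rule hits_later[OF c])
   moreover have "ext th x + s \<le> r" using that by simp
   ultimately show False using b unfolding bad_def by blast
  qed
  ultimately have "bad (nx th x e) (r - ext th x)" using le nx(1)[OF c] unfolding bad_def by (intro conjI) auto
  thus ?thesis using c le by blast
 qed
 have b0: "bad x t" using not assms unfolding bad_def by blast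
 obtain E where E: "\<And>x r. bad x r ==> crosses th x (E x r) \<and> ext th x \<le> r \<and> bad (nx th x (E x r)) (r - ext th x)"
  using step by metis
 define F where "F p = (nx th (fst p) (E (fst p) (snd p)), snd p - ext th (fst p))" for p
 define g where "g n = (F ^^ n) (x, t)" for n
 have gS: "g (Suc n) = F (g n)" for n by (simp add: g_def)
 have g0: "g 0 = (x, t)" by (simp add: g_def)
 have gb: "bad (fst (g n)) (snd (g n))" for n
 proof (induction n)
  case 0 thus ?case using b0 g0 by simp
 next
  case (Suc n) thus ?case using E[OF Suc] unfolding gS F_def by simp
 qed
 define e where "e n = E (fst (g n)) (snd (g n))" for n
 have e: "crosses th (fst (g n)) (e n)" "ext th (fst (g n)) \<le> snd (g n)"
  "fst (g (Suc n)) = nx th (fst (g n)) (e n)" "snd (g (Suc n)) = snd (g n) - ext th (fst (g n))" for n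
  using E[OF gb] unfolding e_def gS F_def by simp_all
 have pos: "ext th (fst (g n)) > 0" for n using e(1)[of n] ext(1) by (auto simp: crosses_def)
 have "(\<Sum>k<n. ext th (fst (g k))) = t - snd (g n)" for n
  by (induction n) (auto simp: g0 e(4))
 hence "(\<Sum>k<n. ext th (fst (g k))) \<le> t" for n using e(2)[of n] pos[of n] by simp
 hence "summable (\<lambda>n. ext th (fst (g n)))"
  by (intro summableI_nonneg_bounded[of _ t]) (use pos in \<open>auto intro: less_imp_le\<close>)
 thus False using no_infinite_crossing[of th "\<lambda>n. fst (g n)" e] e by blast
qed

end

lemma ball_add: "w + q \<in> ball w r \<longleftrightarrow> cmod q < r" for w q :: complex
 by (simp add: dist_norm)

context tsurf
begin

section \<open>Orbits as straight curves, and their local translations\<close>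

lemma singular_VP: assumes "p \<in> singularities X" shows "p \<in> VP"
proof -
 obtain c where "c \<in> vertices_at X p" using assms unfolding singularities_def by auto
 hence "c \<in> sides X" "p = proj X (fst c, st c)" unfolding vertices_at_def by auto
 thus ?thesis unfolding VP_def by blast
qed

lemma VPI: "c \<in> sides X ==> proj X (fst c, st c) \<in> VP"
 unfolding VP_def by blast

lemma not_VP_regular: "p \<notin> VP ==> p \<notin> singularities X"
 using singular_VP by blast

lemma inn_not_VP: assumes "x \<in> Q" shows "proj X x \<notin> VP"
proof
 assume "proj X x \<in> VP"
 then obtain c where c: "c \<in> sides X" "proj X x = proj X (fst c, st c)" unfolding VP_def by blast
 have u: "(fst c, st c) \<in> poly_union X" using st_en_cseg(1) cseg_reg[OF c(1)] side_fst[OF c(1)] poly_union_iff by blast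
 have x: "fst x < N" "snd x \<in> inn (fst x)" using assms by (auto simp: Q_iff)
 have "(fst c, st c) = (fst x, snd x)" using class_inn[OF x u] c(2) by simp
 moreover have "st c \<in> pboundary (P (fst c))" using subsetD[OF cseg_bnd[OF c(1)] st_en_cseg(1)[of c]] .
 ultimately have "snd x \<in> pboundary (P (fst x))" by auto
 thus False using inn_bnd[OF x(2)] by simp
qed

lemma oseg_not_VP: assumes "e \<in> sides X" "z \<in> oseg e" shows "proj X (fst e, z) \<notin> VP"
proof
 assume "proj X (fst e, z) \<in> VP"
 then obtain c where c: "c \<in> sides X" "proj X (fst e, z) = proj X (fst c, st c)" unfolding VP_def by blast
 have u: "(fst c, st c) \<in> poly_union X" using st_en_cseg(1) cseg_reg[OF c(1)] side_fst[OF c(1)] poly_union_iff by blast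
 have "(fst c, st c) = (fst e, z) \<or> (fst c, st c) = (fst (mate X e), z + tau e)" using class_oseg[OF assms u] c(2) by blast
 thus False
  using oseg_not_st(1)[OF assms(1) c(1) _ assms(2)] oseg_not_st(1)[OF mate(1)[OF assms(1)] c(1) _ seg_tau(2)[OF assms]] by auto
qed

lemma inj_Q: "x \<in> Q ==> y \<in> poly_union X ==> proj X x = proj X y ==> y = x"
 using class_inn[of "fst x" "snd x" y] by (simp add: Q_iff)

lemma ext_curve: assumes "x \<in> Qp th" "T \<le> ext th x"
 shows "straight_curve X th 0 T (\<lambda>t. proj X (mv th x t))"
 unfolding mv_def by (rule sc_segment[OF Qp_fst[OF assms(1)]]) (use Qp_reg[OF assms(1)] assms(2) in auto)

lemma sc_append0:
 assumes "straight_curve X th 0 a f" "straight_curve X th 0 b g" "f a = g 0"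
 shows "straight_curve X th 0 (a + b) (\<lambda>t. if t \<le> a then f t else g (t - a))"
proof -
 have "straight_curve X th (0 - - a) (b - - a) (\<lambda>t. g (t + - a))" by (rule sc_shift[OF assms(2)])
 hence 1: "straight_curve X th a (a + b) (\<lambda>t. g (t - a))" by (simp add: add.commute)
 have 2: "f a = (\<lambda>t. g (t - a)) a" using assms(3) by simp
 show ?thesis using sc_append[OF assms(1) 1 2] .
qed

lemma fl_curve: "fl th x t y ==> \<exists>\<gamma>. straight_curve X th 0 t \<gamma> \<and> \<gamma> 0 = proj X x \<and> \<gamma> t = proj X y \<and> (\<forall>s. 0 < s \<and> s \<le> t --> \<gamma> s \<notin> VP)"
proof (induction rule: fl.induct)
 case (fl_move x t)
 have "straight_curve X th 0 t (\<lambda>t. proj X (mv th x t))" using ext_curve fl_move by simp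
 moreover have "proj X (mv th x s) \<notin> VP" if "0 < s" "s \<le> t" for s using inn_not_VP[OF mv_Q] fl_move that by simp
 ultimately show ?case by (intro exI[of _ "\<lambda>t. proj X (mv th x t)"]) simp
next
 case (fl_cross x e t y)
 obtain g where g: "straight_curve X th 0 t g" "g 0 = proj X (nx th x e)" "g t = proj X y" "\<And>s. 0 < s ==> s \<le> t ==> g s \<notin> VP"
  using fl_cross(3) by blast
 have x: "x \<in> Qp th" and e: "e \<in> sides X" "fst e = fst x" "snd x + ray th (ext th x) \<in> oseg e"
  using fl_cross(1) by (auto simp: crosses_def)
 let ?f = "\<lambda>t. proj X (mv th x t)"
 have fg: "?f (ext th x) = g 0" unfolding g(2) nx(4)[OF fl_cross(1), symmetric] mv_def ..
 have t0: "0 \<le> t" using fl_Qp fl_cross(2) by blast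
 let ?h = "\<lambda>t. if t \<le> ext th x then ?f t else g (t - ext th x)"
 have "straight_curve X th 0 (ext th x + t) ?h"
  by (rule sc_append0[OF ext_curve[OF x order_refl] g(1) fg])
 moreover have "?h 0 = proj X x" using ext(1)[OF x] by simp
 moreover have "?h (ext th x + t) = proj X y" using g(2,3) fg t0 by (cases "t = 0") auto
 moreover have "?h s \<notin> VP" if s: "0 < s" "s \<le> ext th x + t" for s
 proof -
  consider "s < ext th x" | "s = ext th x" | "ext th x < s" by linarith
  thus ?thesis
  proof cases
   case 1 thus ?thesis using inn_not_VP[OF mv_Q[OF x s(1)]] by simp
  next
   case 2 thus ?thesis using oseg_not_VP[OF e(1,3)] e(2) by (simp add: mv_def)
  next
   case 3 thus ?thesis using g(4)[of "s - ext th x"] s by simp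
  qed
 qed
 ultimately show ?case by blast
qed

lemma hits_curve: "hits th x t c ==> \<exists>\<gamma>. straight_curve X th 0 t \<gamma> \<and> \<gamma> 0 = proj X x \<and> \<gamma> t = proj X (fst c, st c) \<and>
  (\<forall>s. 0 < s \<and> s < t --> \<gamma> s \<notin> VP) \<and> (\<exists>r>0. r \<le> t \<and> (\<forall>s. 0 \<le> s \<and> s < r --> \<gamma> (t - s) = proj X (fst c, st c - ray th s)))"
proof (induction rule: hits.induct)
 case (hits_now x c)
 let ?f = "\<lambda>t. proj X (mv th x t)"
 have "?f (ext th x - s) = proj X (fst c, st c - ray th s)" for s
  unfolding mv_def hits_now(4)[symmetric] hits_now(3) by (simp add: algebra_simps)
 moreover have "?f (ext th x) = proj X (fst c, st c)" unfolding mv_def hits_now(3,4) ..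
 ultimately show ?case
  using ext_curve[OF hits_now(1) order_refl] inn_not_VP mv_Q[OF hits_now(1)] ext(1)[OF hits_now(1)]
  by (intro exI[of _ ?f] conjI exI[of _ "ext th x"]) auto
next
 case (hits_later x e t c)
 obtain g r where g: "straight_curve X th 0 t g" "g 0 = proj X (nx th x e)" "g t = proj X (fst c, st c)" "\<And>s. 0 < s ==> s < t ==> g s \<notin> VP"
  and r: "r > 0" "r \<le> t" "\<And>s. 0 \<le> s ==> s < r ==> g (t - s) = proj X (fst c, st c - ray th s)"
  using hits_later(3) by blast
 have x: "x \<in> Qp th" and e: "e \<in> sides X" "fst e = fst x" "snd x + ray th (ext th x) \<in> oseg e"
  using hits_later(1) by (auto simp: crosses_def)
 let ?f = "\<lambda>t. proj X (mv th x t)"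
 have fg: "?f (ext th x) = g 0" unfolding g(2) nx(4)[OF hits_later(1), symmetric] mv_def ..
 have t0: "0 < t" using hits_pos hits_later(2) by blast
 let ?h = "\<lambda>t. if t \<le> ext th x then ?f t else g (t - ext th x)"
 have "straight_curve X th 0 (ext th x + t) ?h"
  by (rule sc_append0[OF ext_curve[OF x order_refl] g(1) fg])
 moreover have "?h 0 = proj X x" using ext(1)[OF x] by simp
 moreover have "?h (ext th x + t) = proj X (fst c, st c)" using g(3) t0 by simp
 moreover have "?h s \<notin> VP" if s: "0 < s" "s < ext th x + t" for s
 proof -
  consider "s < ext th x" | "s = ext th x" | "ext th x < s" by linarith
  thus ?thesis
  proof cases
   case 1 thus ?thesis using inn_not_VP[OF mv_Q[OF x s(1)]] by simp
  next
   case 2 thus ?thesis using oseg_not_VP[OF e(1,3)] e(2) by (simp add: mv_def)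
  next
   case 3 thus ?thesis using g(4)[of "s - ext th x"] s by simp
  qed
 qed
 moreover have "?h (ext th x + t - s) = proj X (fst c, st c - ray th s)" if "0 \<le> s" "s < r" for s
 proof -
  have "\<not> ext th x + t - s \<le> ext th x" using that r(2) by simp
  moreover have "ext th x + t - s - ext th x = t - s" by simp
  ultimately show ?thesis using r(3)[OF that] by simp
 qed
 moreover have "r \<le> ext th x + t" using r(2) ext(1)[OF x] by simp
 ultimately show ?case using r(1) by (intro exI[of _ ?h] conjI allI impI exI[of _ r]) blast+
qed

lemma fl_curveQ: assumes "x \<in> Q" "fl th x t y"
 obtains \<gamma> where "straight_curve X th 0 t \<gamma>" "\<gamma> 0 = proj X x" "\<gamma> t = proj X y" "\<And>s. 0 \<le> s ==> s \<le> t ==> \<gamma> s \<notin> VP"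
proof -
 obtain \<gamma> where g: "straight_curve X th 0 t \<gamma>" "\<gamma> 0 = proj X x" "\<gamma> t = proj X y" "\<forall>s. 0 < s \<and> s \<le> t --> \<gamma> s \<notin> VP"
  using fl_curve[OF assms(2)] by blast
 have "\<gamma> s \<notin> VP" if "0 \<le> s" "s \<le> t" for s using g(2,4) inn_not_VP[OF assms(1)] that by (cases "s = 0") auto
 thus ?thesis using that g by blast
qed

lemma fl_flow_rel: assumes "x \<in> Q" "fl th x t y" shows "flow_rel X th t (proj X x) (proj X y)"
proof -
 obtain \<gamma> where g: "straight_curve X th 0 t \<gamma>" "\<gamma> 0 = proj X x" "\<gamma> t = proj X y" "\<And>s. 0 \<le> s ==> s \<le> t ==> \<gamma> s \<notin> VP"
  using fl_curveQ[OF assms] by blast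
 have t: "min 0 t = 0" "max 0 t = t" using fl_Qp[OF assms(2)] by auto
 have "\<gamma> s \<notin> singularities X" if "s \<in> {0..t}" for s using g(4)[of s] that not_VP_regular by simp
 thus ?thesis unfolding flow_rel_def t using g(1-3) by (intro exI[of _ \<gamma>]) simp
qed

lemma sc_reverse0: assumes "straight_curve X th 0 s f" shows "straight_curve X (th + pi) 0 s (\<lambda>t. f (s - t))"
proof -
 have "straight_curve X (th + pi) (- s - - s) (- 0 - - s) (\<lambda>t. f (- (t + - s)))" by (rule sc_shift[OF sc_rev[OF assms]])
 thus ?thesis by simp
qed

text \<open>Backwards from a vertex there is only one orbit through a given corner.\<close>

lemma hits_inj: assumes "x \<in> Q" "x' \<in> Q" "hits th x s c" "hits th x' s c" shows "x = x'"
proof -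
 obtain f r where f: "straight_curve X th 0 s f" "f 0 = proj X x" "\<And>t. 0 < t ==> t < s ==> f t \<notin> VP"
  and r: "r > 0" "\<And>t. 0 \<le> t ==> t < r ==> f (s - t) = proj X (fst c, st c - ray th t)" using hits_curve[OF assms(3)] by blast
 obtain g r' where g: "straight_curve X th 0 s g" "g 0 = proj X x'" "\<And>t. 0 < t ==> t < s ==> g t \<notin> VP"
  and r': "r' > 0" "\<And>t. 0 \<le> t ==> t < r' ==> g (s - t) = proj X (fst c, st c - ray th t)" using hits_curve[OF assms(4)] by blast
 have s: "0 < s" using hits_pos[OF assms(3)] by auto
 have "(\<lambda>t. f (s - t)) s = (\<lambda>t. g (s - t)) s"
 proof (rule sc_unique_germ[OF sc_reverse0[OF f(1)] sc_reverse0[OF g(1)]])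
  show "0 < min r r'" using r r' by simp
  show "f (s - t) \<notin> singularities X" if "0 < t" "t < s" for t using f(3)[of "s - t"] that not_VP_regular by simp
 qed (use s r r' in auto)
 hence "proj X x = proj X x'" using f g by simp
 thus ?thesis using inj_Q[OF assms(1) Q_union[OF assms(2)]] by simp
qed

text \<open>The reversed curve is straight in the opposite direction. If the discrete orbit of
 \<open>y\<close> in that direction hit a vertex, the curve would pass through a vertex by
 uniqueness.\<close>

lemma fl_rev: assumes "x \<in> Q" "y \<in> Q" "fl th x t y" shows "fl (th + pi) y t x"
proof -
 obtain f where f: "straight_curve X th 0 t f" "f 0 = proj X x" "f t = proj X y" "\<And>s. 0 \<le> s ==> s \<le> t ==> f s \<notin> VP"
  using fl_curveQ[OF assms(1,3)] by blast
 have t: "0 \<le> t" using fl_Qp[OF assms(3)] by blast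
 note fr = sc_reverse0[OF f(1)]
 have nh: False if h: "hits (th + pi) y s c" "s \<le> t" for s c
 proof -
  obtain g where g: "straight_curve X (th + pi) 0 s g" "g 0 = proj X y" "g s = proj X (fst c, st c)" using hits_curve[OF h(1)] by blast
  have s: "0 < s" "c \<in> sides X" using hits_pos[OF h(1)] by auto
  have "(\<lambda>u. f (t - u)) s = g s"
  proof (rule sc_unique[OF sc_restrict[OF fr] g(1)])
   show "f (t - u) \<notin> singularities X" if "0 \<le> u" "u < s" for u
    using f(4)[of "t - u"] that h(2) not_VP_regular by simp
  qed (use f(3) g(2) s h(2) in auto)
  hence "f (t - s) \<in> VP" using g(3) VPI[OF s(2)] by simp
  thus False using f(4)[of "t - s"] s h(2) by simp
 qed
 then obtain x' where x': "fl (th + pi) y t x'" using fl_or_hits[OF Q_Qp[OF assms(2)] t, of "th + pi"] by blast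
 obtain g where g: "straight_curve X (th + pi) 0 t g" "g 0 = proj X y" "g t = proj X x'" "\<And>s. 0 \<le> s ==> s \<le> t ==> g s \<notin> VP"
  using fl_curveQ[OF assms(2) x'] by blast
 have "(\<lambda>u. f (t - u)) t = g t"
 proof (rule sc_unique[OF fr g(1)])
  show "f (t - u) \<notin> singularities X" if "0 \<le> u" "u < t" for u
   using f(4)[of "t - u"] that not_VP_regular by simp
 qed (use f(3) g(2) t in auto)
 hence "proj X x = proj X x'" using f(2) g(3) by simp
 hence "x' = x" using inj_Q[OF assms(1) Qp_union] fl_Qp[OF x'] by blast
 thus ?thesis using x' by simp
qed

lemma fl_pi2: "fl (th + pi + pi) = fl th"
proof -
 have d: "direction (th + pi + pi) = direction th" by (simp only: direction_pi minus_minus)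
 have Qpe: "Qp (th + pi + pi) = Qp th" unfolding Qp_def d ..
 have e: "ext (th + pi + pi) = ext th" unfolding ext_def d ..
 have c: "crosses (th + pi + pi) = crosses th" unfolding crosses_def Qpe e d ..
 have n: "nx (th + pi + pi) = nx th" unfolding nx_def e d ..
 have m: "mv (th + pi + pi) = mv th" unfolding mv_def d ..
 have "fl (th + pi + pi) x t y ==> fl th x t y" for x t y
 proof (induction rule: fl.induct)
  case (fl_move x t)
  thus ?case using fl.fl_move[of x th t] unfolding Qpe e m by blast
 next
  case (fl_cross x e' t y)
  thus ?case using fl.fl_cross[of th x e' t y] unfolding e c n by blast
 qed
 moreover have "fl th x t y ==> fl (th + pi + pi) x t y" for x t y
 proof (induction rule: fl.induct)
  case (fl_move x t)
  thus ?case using fl.fl_move[of x "th + pi + pi" t] unfolding Qpe e m by blast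
 next
  case (fl_cross x e' t y)
  thus ?case using fl.fl_cross[of "th + pi + pi" x e' t y] unfolding e c n by blast
 qed
 ultimately show ?thesis by (intro HOL.ext iffI) blast+
qed

lemma fl_rev_iff: assumes "x \<in> Q" "y \<in> Q" shows "fl (th + pi) y t x \<longleftrightarrow> fl th x t y"
 using fl_rev[OF assms] fl_rev[OF assms(2,1), of "th + pi" t] unfolding fl_pi2 by blast

lemma fl_cancel: assumes "fl th x s y" "fl th x t z" "s \<le> t" shows "fl th y (t - s) z"
 using fl_split[OF assms(2), of s] fl_Qp[OF assms(1)] assms(3) fl_det[OF assms(1)] by blast

lemma fl_inj: assumes "x \<in> Q" "x' \<in> Q" "y \<in> Q" "fl th x t y" "fl th x' t y" shows "x = x'"
 using fl_det[OF fl_rev[OF assms(1,3,4)] fl_rev[OF assms(2,3,5)]] .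

lemma shift_Q: assumes "x \<in> Q" shows "\<exists>\<epsilon>>0. \<forall>u. cmod u < \<epsilon> --> shift x u \<in> Q"
proof -
 have x: "fst x < N" "snd x \<in> inn (fst x)" using assms by (auto simp: Q_iff)
 obtain r where "r > 0" "ball (snd x) r \<subseteq> inn (fst x)" using open_inn[OF x(1)] x(2) open_contains_ball by blast
 thus ?thesis using x(1) by (intro exI[of _ r]) (auto simp: Q_iff subset_iff dist_norm)
qed

lemma segment_margin: assumes i: "i < N" and sub: "\<And>s. a \<le> s ==> s \<le> b ==> z + ray th s \<in> inn i"
 shows "\<exists>\<epsilon>>0. \<forall>s u. a \<le> s --> s \<le> b --> cmod u < \<epsilon> --> z + ray th s + u \<in> inn i"
proof -
 let ?K = "(\<lambda>s. z + ray th s) ` {a..b}"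
 have "compact ?K" by (intro compact_continuous_image continuous_intros) auto
 moreover have "?K \<subseteq> inn i" using sub by auto
 ultimately obtain \<epsilon> where e: "\<epsilon> > 0" "(\<Union>x\<in>?K. ball x \<epsilon>) \<subseteq> inn i"
  using compact_subset_open_imp_ball_epsilon_subset[of ?K "inn i"] open_inn[OF i] by blast
 have "z + ray th s + u \<in> inn i" if "a \<le> s" "s \<le> b" "cmod u < \<epsilon>" for s u
 proof (rule subsetD[OF e(2)], rule UN_I)
  show "z + ray th s \<in> ?K" using that by auto
  show "z + ray th s + u \<in> ball (z + ray th s) \<epsilon>" using that by (simp add: dist_norm)
 qed
 thus ?thesis using e(1) by blast
qed

text \<open>The induction starts a moment \<open>\<delta>\<close> after \<open>x\<close>, because
 after a crossing the orbit starts on a side, where displacements can leave the polygon.\<close>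

lemma fl_stable_gen: "fl th x t y ==> y \<in> Q ==> \<exists>\<delta>0>0. \<forall>\<delta>. 0 < \<delta> --> \<delta> < \<delta>0 --> \<delta> < t -->
  (\<exists>\<epsilon>>0. \<forall>u. cmod u < \<epsilon> --> fl th (shift (mv th x \<delta>) u) (t - \<delta>) (shift y u))"
proof (induction rule: fl.induct)
 case (fl_move x t)
 have i: "fst x < N" using Qp_fst[OF fl_move(1)] .
 have "\<exists>\<epsilon>>0. \<forall>u. cmod u < \<epsilon> --> fl th (shift (mv th x \<delta>) u) (t - \<delta>) (shift (mv th x t) u)" if d: "0 < \<delta>" "\<delta> < t" for \<delta>
 proof -
  have "snd x + ray th s \<in> inn (fst x)" if "\<delta> \<le> s" "s \<le> t" for s
   using ext(3)[OF fl_move(1), of s] that d fl_move by simp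
  from segment_margin[OF i this] obtain \<epsilon> where e: "\<epsilon> > 0" "\<And>s u. \<delta> \<le> s ==> s \<le> t ==> cmod u < \<epsilon> ==> snd x + ray th s + u \<in> inn (fst x)" by blast
  have "fl th (shift (mv th x \<delta>) u) (t - \<delta>) (shift (mv th x t) u)" if u: "cmod u < \<epsilon>" for u
  proof -
   let ?x = "shift (mv th x \<delta>) u"
   have Q: "?x \<in> Q" using e(2)[OF order_refl less_imp_le[OF d(2)] u] i by (simp add: Q_iff)
   have "t - \<delta> < ext th ?x"
   proof (rule ext_gt[OF Q_Qp[OF Q]])
    fix s assume s: "0 < s" "s \<le> t - \<delta>"
    have eq: "snd ?x + ray th s = snd x + ray th (\<delta> + s) + u" by (simp add: algebra_simps)
    show "snd ?x + ray th s \<in> inn (fst ?x)" unfolding eq using e(2)[of "\<delta> + s" u] s u by (simp del: of_real_add)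
   qed
   hence "fl th ?x (t - \<delta>) (mv th ?x (t - \<delta>))" by (intro fl.fl_move Q_Qp Q) (use d in auto)
   moreover have "mv th ?x (t - \<delta>) = shift (mv th x t) u" by (simp add: prod_eq_iff algebra_simps)
   ultimately show ?thesis by simp
  qed
  thus ?thesis using e(1) by blast
 qed
 thus ?case by (intro exI[of _ 1]) auto
next
 case (fl_cross x e t y)
 let ?d = "direction th"
 define T where "T = ext th x"
 define w where "w = snd x + of_real T * ?d"
 define x' where "x' = nx th x e"
 have x: "x \<in> Qp th" and e: "e \<in> sides X" "fst e = fst x" "w \<in> oseg e" using fl_cross(1) by (auto simp: crosses_def w_def T_def)
 have i: "fst x < N" using Qp_fst[OF x] .
 have T0: "T > 0" using ext(1)[OF x] by (simp add: T_def)
 have x'eq: "x' = (fst (mate X e), w + tau e)" by (simp add: x'_def nx_def w_def T_def)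
 have k: "cross (sv e) ?d < 0" using nx(3)[OF fl_cross(1)] .
 define \<kappa> where "\<kappa> = - cross (sv e) ?d"
 have kp: "\<kappa> > 0" using k by (simp add: \<kappa>_def)
 have tpos: "t > 0"
 proof -
  have "0 \<le> t" using fl_Qp[OF fl_cross(2)] by blast
  moreover have "t \<noteq> 0" using fl_0[of th "nx th x e" y] fl_cross(2,4) nx_bnd[OF fl_cross(1)] by auto
  ultimately show ?thesis by simp
 qed
 obtain \<delta>' where d': "\<delta>' > 0" "\<And>\<delta>. 0 < \<delta> ==> \<delta> < \<delta>' ==> \<delta> < t ==>
  \<exists>\<epsilon>>0. \<forall>u. cmod u < \<epsilon> --> fl th (shift (mv th x' \<delta>) u) (t - \<delta>) (shift y u)"
  using fl_cross(3)[OF fl_cross(4)] unfolding x'_def by blast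
 obtain r where r: "r > 0" "\<And>v. v \<in> ball w r ==> cross (sv e) (v - w) > 0 ==> v \<in> inn (fst e)"
  "\<And>v. v \<in> ball w r ==> cross (sv e) (v - w) = 0 ==> v \<in> oseg e" using side_loc[OF e(1,3)] by blast
 have wm: "w + tau e \<in> oseg (mate X e)" using seg_tau(2)[OF e(1,3)] .
 obtain r' where r': "r' > 0" "\<And>v. v \<in> ball (w + tau e) r' ==> cross (sv (mate X e)) (v - (w + tau e)) > 0 ==> v \<in> inn (fst (mate X e))"
  using side_loc[OF mate(1)[OF e(1)] wm] by blast
 have main: "\<exists>\<epsilon>>0. \<forall>u. cmod u < \<epsilon> --> fl th (shift (mv th x \<delta>) u) (T + t - \<delta>) (shift y u)" if d: "0 < \<delta>" "\<delta> < T" for \<delta>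
 proof -
  define \<eta> where "\<eta> = min (min r (T - \<delta>)) (min (min \<delta>' t) r') / 4"
  have eta: "\<eta> > 0" "4 * \<eta> \<le> r" "4 * \<eta> \<le> T - \<delta>" "4 * \<eta> \<le> \<delta>'" "4 * \<eta> \<le> t" "4 * \<eta> \<le> r'"
   using r(1) r'(1) d d'(1) tpos unfolding \<eta>_def by (auto simp: min_def)
  have "snd x + of_real s * ?d \<in> inn (fst x)" if "\<delta> \<le> s" "s \<le> T - \<eta>" for s
   using ext(3)[OF x, of s] that d eta(1) by (simp add: T_def)
  from segment_margin[OF i this] obtain \<epsilon>1 where e1: "\<epsilon>1 > 0"
   "\<And>s u. \<delta> \<le> s ==> s \<le> T - \<eta> ==> cmod u < \<epsilon>1 ==> snd x + of_real s * ?d + u \<in> inn (fst x)" by blast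
  have "2 * \<eta> < \<delta>'" "2 * \<eta> < t" using eta by auto
  then obtain \<epsilon>2 where e2: "\<epsilon>2 > 0" "\<And>u. cmod u < \<epsilon>2 ==> fl th (shift (mv th x' (2 * \<eta>)) u) (t - 2 * \<eta>) (shift y u)"
   using d'(2)[of "2 * \<eta>"] eta(1) by auto
  define \<epsilon>3 where "\<epsilon>3 = \<eta> * \<kappa> / cmod (sv e)"
  have svp: "cmod (sv e) > 0" using sv_nz[OF e(1)] by simp
  have e3: "\<epsilon>3 > 0" using eta(1) kp svp by (simp add: \<epsilon>3_def)
  define \<epsilon> where "\<epsilon> = min (min \<epsilon>1 \<epsilon>2) (min \<epsilon>3 \<eta>)"
  have e0: "\<epsilon> > 0" "\<epsilon> \<le> \<epsilon>1" "\<epsilon> \<le> \<epsilon>2" "\<epsilon> \<le> \<epsilon>3" "\<epsilon> \<le> \<eta>" using e1 e2 e3 eta(1) by (auto simp: \<epsilon>_def)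
  have "fl th (shift (mv th x \<delta>) u) (T + t - \<delta>) (shift y u)" if u: "cmod u < \<epsilon>" for u
  proof -
   \<comment> \<open>The displaced orbit meets the side later by \<open>s0\<close>.\<close>
   define s0 where "s0 = cross (sv e) u / \<kappa>"
   have cu: "cross (sv e) u = s0 * \<kappa>" using kp by (simp add: s0_def)
   have "\<bar>cross (sv e) u\<bar> \<le> cmod (sv e) * cmod u" unfolding cross_def by (metis abs_Im_le_cmod complex_mod_cnj norm_mult)
   also have "\<dots> < cmod (sv e) * \<epsilon>3" using u e0 svp by (intro mult_strict_left_mono) auto
   also have "\<dots> = \<eta> * \<kappa>" using svp by (simp add: \<epsilon>3_def)
   finally have "\<bar>s0\<bar> * \<kappa> < \<eta> * \<kappa>" unfolding cu abs_mult using kp by simp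
   hence s0: "\<bar>s0\<bar> < \<eta>" using kp by simp
   have crs: "cross (sv e) (of_real s * ?d + u) = \<kappa> * (s0 - s)" for s
   proof -
    have "cross (sv e) (of_real s * ?d + u) = s * cross (sv e) ?d + cross (sv e) u" by (simp only: cross_simps)
    thus ?thesis using cu by (simp add: \<kappa>_def algebra_simps)
   qed
   have nrm: "cmod (of_real s * ?d + u) < 4 * \<eta>" if "\<bar>s\<bar> \<le> 3 * \<eta>" for s
   proof -
    have "cmod (of_real s * ?d + u) \<le> \<bar>s\<bar> + cmod u" using norm_triangle_ineq[of "of_real s * ?d" u] by (simp add: norm_mult)
    thus ?thesis using that u e0 by linarith
   qed
   let ?x = "shift (mv th x \<delta>) u"
   have pos: "snd ?x + of_real s * ?d = snd x + of_real (\<delta> + s) * ?d + u" for s by (simp add: algebra_simps)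
   have pos2: "snd ?x + of_real s * ?d = w + (of_real (\<delta> + s - T) * ?d + u)" for s by (simp add: algebra_simps w_def)
   have Q: "?x \<in> Q" using e1(2)[of \<delta> u] u e0 i eta by (simp add: Q_iff)
   have exT: "ext th ?x = T - \<delta> + s0"
   proof (rule ext_unique[OF Q_Qp[OF Q]])
    show "0 < T - \<delta> + s0" using s0 eta by linarith
    have eq: "snd ?x + of_real (T - \<delta> + s0) * ?d = w + (of_real s0 * ?d + u)" unfolding pos2 by simp
    have "w + (of_real s0 * ?d + u) \<in> oseg e"
     by (rule r(3)) (use nrm[of s0] s0 eta crs[of s0] in \<open>auto simp: ball_add simp del: mem_ball\<close>)
    hence "w + (of_real s0 * ?d + u) \<in> pboundary (P (fst e))" using oseg_cseg cseg_bnd[OF e(1)] by blast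
    thus "snd ?x + of_real (T - \<delta> + s0) * ?d \<in> pboundary (P (fst ?x))" unfolding eq e(2) by simp
    fix s assume s: "0 < s" "s < T - \<delta> + s0"
    show "snd ?x + of_real s * ?d \<in> inn (fst ?x)"
    proof (cases "\<delta> + s \<le> T - \<eta>")
     case True
     thus ?thesis unfolding pos using e1(2)[of "\<delta> + s" u] s u e0 by simp
    next
     case False
     have "w + (of_real (\<delta> + s - T) * ?d + u) \<in> inn (fst e)"
     proof (rule r(2))
      show "w + (of_real (\<delta> + s - T) * ?d + u) \<in> ball w r"
       unfolding ball_add by (rule less_le_trans[OF nrm]) (use False s s0 eta in linarith)+
      have "\<delta> + s - T < s0" using s by simp
      thus "cross (sv e) (w + (of_real (\<delta> + s - T) * ?d + u) - w) > 0"
       unfolding add_diff_cancel_left' crs using kp by simp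
     qed
     thus ?thesis unfolding pos2 using e(2) by simp
    qed
   qed
   have exit: "snd ?x + of_real (ext th ?x) * ?d = w + (of_real s0 * ?d + u)" unfolding exT pos2 by simp
   have "w + (of_real s0 * ?d + u) \<in> oseg e"
    by (rule r(3)) (use nrm[of s0] s0 eta crs[of s0] in \<open>auto simp: ball_add simp del: mem_ball\<close>)
   hence c: "crosses th ?x e" unfolding crosses_def exit using Q_Qp[OF Q] e(1,2) by simp
   define x'' where "x'' = nx th ?x e"
   have x''eq: "x'' = (fst (mate X e), w + tau e + (of_real s0 * ?d + u))" unfolding x''_def nx_def exit by (simp add: algebra_simps)
   have x''Q: "x'' \<in> Qp th" unfolding x''_def by (rule nx(1)[OF c])
   have mveq: "mv th x'' (2 * \<eta> - s0) = shift (mv th x' (2 * \<eta>)) u"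
    unfolding x''eq x'eq by (simp add: prod_eq_iff algebra_simps)
   have lt: "2 * \<eta> - s0 < ext th x''"
   proof (rule ext_gt[OF x''Q])
    fix s assume s: "0 < s" "s \<le> 2 * \<eta> - s0"
    have eq: "snd x'' + of_real s * ?d = w + tau e + (of_real (s0 + s) * ?d + u)" unfolding x''eq by (simp add: algebra_simps)
    have "w + tau e + (of_real (s0 + s) * ?d + u) \<in> inn (fst (mate X e))"
    proof (rule r'(2))
     show "w + tau e + (of_real (s0 + s) * ?d + u) \<in> ball (w + tau e) r'"
      unfolding ball_add by (rule less_le_trans[OF nrm]) (use s s0 eta in linarith)+
     have "cross (sv (mate X e)) (of_real (s0 + s) * ?d + u) = \<kappa> * s"
      unfolding mate(3)[OF e(1)] using crs[of "s0 + s"] by (simp add: cross_simps)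
     thus "cross (sv (mate X e)) (w + tau e + (of_real (s0 + s) * ?d + u) - (w + tau e)) > 0"
      unfolding add_diff_cancel_left' using kp s by simp
    qed
    thus "snd x'' + of_real s * ?d \<in> inn (fst x'')" unfolding eq by (simp add: x''eq)
   qed
   have "fl th (mv th x'' (2 * \<eta> - s0)) (t - 2 * \<eta>) (shift y u)" unfolding mveq using e2(2) u e0 by simp
   moreover have "0 \<le> 2 * \<eta> - s0" using s0 eta by linarith
   ultimately have "fl th x'' (2 * \<eta> - s0 + (t - 2 * \<eta>)) (shift y u)" using fl_prefix[OF x''Q _ lt] by blast
   hence "fl th x'' (t - s0) (shift y u)" by (simp add: algebra_simps)
   hence "fl th ?x (ext th ?x + (t - s0)) (shift y u)" unfolding x''_def by (rule fl.fl_cross[OF c])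
   moreover have "ext th ?x + (t - s0) = T + t - \<delta>" unfolding exT by simp
   ultimately show ?thesis by simp
  qed
  thus ?thesis using e0(1) by blast
 qed
 thus ?case using T0 unfolding T_def by blast
qed

text \<open>Being inside a polygon and crossing a given open side are stable, and displacements are
 carried along unchanged.\<close>

theorem fl_stable: assumes "x \<in> Q" "y \<in> Q" "fl th x t y"
 shows "\<exists>\<epsilon>>0. \<forall>u. cmod u < \<epsilon> --> shift x u \<in> Q \<and> shift y u \<in> Q \<and> fl th (shift x u) t (shift y u)"
proof -
 obtain e1 where e1: "e1 > 0" "\<And>u. cmod u < e1 ==> shift x u \<in> Q" using shift_Q[OF assms(1)] by blast
 obtain e2 where e2: "e2 > 0" "\<And>u. cmod u < e2 ==> shift y u \<in> Q" using shift_Q[OF assms(2)] by blast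
 have x: "x \<in> Qp th" using Q_Qp assms(1) .
 have t: "0 \<le> t" using fl_Qp assms(3) by blast
 show ?thesis
 proof (cases "t = 0")
  case True
  hence "y = x" using fl_0 assms(3) by blast
  have "fl th (shift x u) 0 (shift x u)" if "cmod u < e1" for u
   using fl.fl_move[OF Q_Qp[OF e1(2)[OF that]] order_refl ext(1)[OF Q_Qp[OF e1(2)[OF that]]]] by simp
  thus ?thesis using e1 True \<open>y = x\<close> by blast
 next
  case False
  hence t: "t > 0" using t by simp
  obtain \<delta>0 where d0: "\<delta>0 > 0" "\<And>\<delta>. 0 < \<delta> ==> \<delta> < \<delta>0 ==> \<delta> < t ==>
   \<exists>\<epsilon>>0. \<forall>u. cmod u < \<epsilon> --> fl th (shift (mv th x \<delta>) u) (t - \<delta>) (shift y u)"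
   using fl_stable_gen[OF assms(3,2)] by blast
  define \<delta> where "\<delta> = min (min \<delta>0 t) (ext th x) / 2"
  have d: "0 < \<delta>" "\<delta> < \<delta>0" "\<delta> < t" "\<delta> < ext th x" using d0(1) t ext(1)[OF x] unfolding \<delta>_def by (auto simp: min_def)
  obtain e3 where e3: "e3 > 0" "\<And>u. cmod u < e3 ==> fl th (shift (mv th x \<delta>) u) (t - \<delta>) (shift y u)" using d0(2)[OF d(1-3)] by blast
  have i: "fst x < N" using assms(1) by (simp add: Q_iff)
  have "snd x + ray th s \<in> inn (fst x)" if "0 \<le> s" "s \<le> \<delta>" for s
   using ext(3)[OF x, of s] that d assms(1) by (cases "s = 0") (auto simp: Q_iff)
  from segment_margin[OF i this] obtain e4 where e4: "e4 > 0"
   "\<And>s u. 0 \<le> s ==> s \<le> \<delta> ==> cmod u < e4 ==> snd x + ray th s + u \<in> inn (fst x)" by blast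
  define e5 where "e5 = min (min e1 e2) (min e3 e4)"
  have e5: "e5 > 0" "e5 \<le> e1" "e5 \<le> e2" "e5 \<le> e3" "e5 \<le> e4" using e1 e2 e3 e4 by (auto simp: e5_def)
  have "fl th (shift x u) t (shift y u)" if u: "cmod u < e5" for u
  proof -
   have xu: "shift x u \<in> Qp th" using Q_Qp e1(2) u e5 by simp
   have "\<delta> < ext th (shift x u)"
   proof (rule ext_gt[OF xu])
    fix s assume "0 < s" "s \<le> \<delta>"
    thus "snd (shift x u) + ray th s \<in> inn (fst (shift x u))"
     using e4(2)[of s u] u e5 by (simp add: algebra_simps)
   qed
   note lt = this
   have "mv th (shift x u) \<delta> = shift (mv th x \<delta>) u" by (simp add: prod_eq_iff algebra_simps)
   hence "fl th (mv th (shift x u) \<delta>) (t - \<delta>) (shift y u)" using e3(2)[of u] u e5 by simp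
   hence "fl th (shift x u) (\<delta> + (t - \<delta>)) (shift y u)" by (rule fl_prefix[OF xu less_imp_le[OF d(1)] lt])
   thus ?thesis by simp
  qed
  thus ?thesis using e1 e2 e5 by (intro exI[of _ e5]) auto
 qed
qed

end

section \<open>Area\<close>

text \<open>Area on the disjoint union of the polygons; there are infinitely many planes in this
 measure space, but only finitely many meet the polygons.\<close>

definition mu :: "(nat \<times> complex) measure" where "mu = count_space UNIV \<Otimes>\<^sub>M lborel"
abbreviation "mu2 \<equiv> mu \<Otimes>\<^sub>M mu"

lemma sets_mu [simp, measurable_cong]: "sets mu = sets borel"
proof -
 have "sets mu = sets ((borel :: nat measure) \<Otimes>\<^sub>M (borel :: complex measure))"
  unfolding mu_def by (intro sets_pair_measure_cong) (auto simp: sets_borel_eq_count_space)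
 thus ?thesis unfolding borel_prod .
qed

lemma space_mu [simp]: "space mu = UNIV" by (simp add: mu_def space_pair_measure)

lemma emeasure_mu_Times: assumes "A \<in> sets borel" shows "emeasure mu ({i} \<times> A) = emeasure lborel A"
 unfolding mu_def using assms by (subst lborel.emeasure_pair_measure_Times) auto

lemma sigma_finite_mu: "sigma_finite_measure mu"
proof -
 interpret pair_sigma_finite "count_space (UNIV :: nat set)" "lborel :: complex measure"
  unfolding pair_sigma_finite_def by (simp add: sigma_finite_measure_count_space lborel.sigma_finite_measure_axioms)
 show ?thesis unfolding mu_def by (rule sigma_finite_measure_axioms)
qed

interpretation mu: sigma_finite_measure mu by (rule sigma_finite_mu)
interpretation mumu: pair_sigma_finite mu mu by (simp add: pair_sigma_finite_def sigma_finite_mu)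

lemma sets_mumu: "sets mu2 = sets borel"
proof -
 have "sets mu2 = sets ((borel :: (nat \<times> complex) measure) \<Otimes>\<^sub>M (borel :: (nat \<times> complex) measure))"
  by (intro sets_pair_measure_cong) auto
 thus ?thesis unfolding borel_prod .
qed

lemma open_nat_Times: assumes "open S" shows "open ({i::nat} \<times> S)"
 by (intro open_Times assms) (simp add: open_discrete)

lemma closed_nat_Times: assumes "closed S" shows "closed ({i::nat} \<times> S)"
 by (intro closed_Times assms) simp

lemma line_null: assumes "d \<noteq> 0" shows "{i} \<times> {z. cross d (z - a) = 0} \<in> null_sets mu"
proof -
 have eq: "{z. cross d (z - a) = 0} = {z. inner (\<i> * d) z = inner (\<i> * d) a}"
  by (auto simp: cross_def inner_complex_def algebra_simps)
 have cl: "closed {z. cross d (z - a) = 0}" unfolding eq by (rule closed_hyperplane)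
 have "negligible {z. cross d (z - a) = 0}" unfolding eq by (rule negligible_hyperplane) (use assms in simp)
 hence "{z. cross d (z - a) = 0} \<in> null_sets lborel"
  unfolding negligible_iff_null_sets using null_sets_completion_iff[of "{z. cross d (z - a) = 0}" lborel] cl by simp
 hence "emeasure mu ({i} \<times> {z. cross d (z - a) = 0}) = 0"
  using emeasure_mu_Times cl by (auto simp: null_sets_def)
 thus ?thesis using closed_nat_Times[OF cl, of i] by (auto intro!: null_setsI)
qed

context tsurf
begin

lemma shift_open: assumes "\<And>x. x \<in> S ==> \<exists>\<epsilon>>0. \<forall>u. cmod u < \<epsilon> --> shift x u \<in> S" shows "open S"
proof (subst open_subopen, intro ballI)
 fix x assume "x \<in> S"
 then obtain e where e: "e > 0" "\<And>u. cmod u < e ==> shift x u \<in> S" using assms by blast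
 have "open ({fst x} \<times> ball (snd x) e)" by (intro open_nat_Times open_ball)
 moreover have "x \<in> {fst x} \<times> ball (snd x) e" using e(1) by (cases x) simp
 moreover have "{fst x} \<times> ball (snd x) e \<subseteq> S"
 proof
  fix y assume "y \<in> {fst x} \<times> ball (snd x) e"
  hence "fst y = fst x" "cmod (snd y - snd x) < e" by (auto simp: dist_norm norm_minus_commute)
  hence "shift x (snd y - snd x) \<in> S" using e(2) by blast
  moreover have "shift x (snd y - snd x) = y" using \<open>fst y = fst x\<close> by (simp add: prod_eq_iff)
  ultimately show "y \<in> S" by simp
 qed
 ultimately show "\<exists>T. open T \<and> x \<in> T \<and> T \<subseteq> S" by (intro exI[of _ "{fst x} \<times> ball (snd x) e"] conjI)
qed

lemma open_Q: "open Q" by (rule shift_open) (use shift_Q in blast)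

lemma poly_union_eq: "poly_union X = (\<Union>i<N. {i} \<times> reg i)" by (auto simp: poly_union_def)

lemma closed_poly_union: "closed (poly_union X)"
 unfolding poly_union_eq by (intro closed_UN) (auto intro: closed_nat_Times closed_reg)

lemma borel_PU: "poly_union X \<in> sets borel" using closed_poly_union by simp

lemma bounded_reg: assumes "i < N" shows "bounded (reg i)"
 unfolding pregion_def using polygon.Jordan(3)[OF polygon[OF assms]] polygon.compact_B[OF polygon[OF assms]]
 by (simp add: compact_imp_bounded)

lemma mu_PU_finite: "emeasure mu (poly_union X) < \<infinity>"
proof -
 have "emeasure mu (poly_union X) \<le> (\<Sum>i<N. emeasure mu ({i} \<times> reg i))"
  unfolding poly_union_eq by (rule emeasure_subadditive_finite) (auto intro!: borel_closed closed_nat_Times closed_reg)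
 also have "\<dots> = (\<Sum>i<N. emeasure lborel (reg i))"
  by (intro sum.cong emeasure_mu_Times) (auto intro!: borel_closed closed_reg)
 also have "\<dots> < \<infinity>"
  using emeasure_bounded_finite bounded_reg by (auto simp: less_top[symmetric])
 finally show ?thesis .
qed

lemma boundary_null: "poly_union X - Q \<in> null_sets mu"
proof (rule null_sets_subset)
 have "{fst e} \<times> {z. cross (sv e) (z - st e) = 0} \<in> null_sets mu" if "e \<in> sides X" for e
  by (rule line_null[OF sv_nz[OF that]])
 thus "(\<Union>e\<in>sides X. {fst e} \<times> {z. cross (sv e) (z - st e) = 0}) \<in> null_sets mu"
  by (intro null_sets.finite_UN finite_sides)
 show "poly_union X - Q \<in> sets mu" using borel_PU open_Q by simp
 show "poly_union X - Q \<subseteq> (\<Union>e\<in>sides X. {fst e} \<times> {z. cross (sv e) (z - st e) = 0})"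
 proof
  fix x assume "x \<in> poly_union X - Q"
  hence x: "fst x < N" "snd x \<in> reg (fst x)" "snd x \<notin> inn (fst x)" using poly_union_iff[of "fst x" "snd x"] by (auto simp: Q_iff)
  have "snd x \<in> pboundary (P (fst x))" using x by (auto simp: pregion_def)
  then obtain e where e: "e \<in> sides X" "fst e = fst x" "snd x \<in> cseg e"
   using side_sides[OF x(1)] st_en_cseg(1) oseg_cseg by (metis subsetD)
  then obtain t where "snd x = st e + of_real t * sv e" using cseg_param by blast
  hence "cross (sv e) (snd x - st e) = 0" by (simp add: cross_simps)
  thus "x \<in> (\<Union>e\<in>sides X. {fst e} \<times> {z. cross (sv e) (z - st e) = 0})"
   using e by (intro UN_I[of e]) (auto simp: mem_Times_iff)
 qed
qed

abbreviation "area \<equiv> area_measure X"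

lemma space_area: "space area = points X"
 unfolding area_measure_def space_distr by (rule space_measure_of) (auto simp: openin_surface_topology)

lemma sets_area: "sets area = sigma_sets (points X) {U. openin (surface_topology X) U}"
 unfolding area_measure_def sets_distr by (rule sets_measure_of) (auto simp: openin_surface_topology)

lemma proj_measurable: "proj X \<in> measurable (restrict_space mu (poly_union X)) (sigma (points X) {U. openin (surface_topology X) U})"
proof (rule measurable_measure_of)
 show "{U. openin (surface_topology X) U} \<subseteq> Pow (points X)" by (auto simp: openin_surface_topology)
 show "proj X \<in> space (restrict_space mu (poly_union X)) \<rightarrow> points X" using proj_points by (auto simp: space_restrict_space)
 fix U assume "U \<in> {U. openin (surface_topology X) U}"
 hence "openin (top_of_set (poly_union X)) {x \<in> poly_union X. proj X x \<in> U}" by (simp add: openin_surface_topology)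
 then obtain T where T: "open T" "{x \<in> poly_union X. proj X x \<in> U} = poly_union X \<inter> T" unfolding openin_open by blast
 have "proj X -` U \<inter> space (restrict_space mu (poly_union X)) = poly_union X \<inter> T"
  using T(2) by (auto simp: space_restrict_space)
 thus "proj X -` U \<inter> space (restrict_space mu (poly_union X)) \<in> sets (restrict_space mu (poly_union X))"
  using T(1) by (auto simp: sets_restrict_space)
qed

lemma emeasure_area: assumes "A \<in> sets area" shows "emeasure area A = emeasure mu {x \<in> poly_union X. proj X x \<in> A}"
proof -
 have A: "A \<in> sets (sigma (points X) {U. openin (surface_topology X) U})" using assms by (simp add: area_measure_def)
 have "emeasure area A = emeasure (restrict_space mu (poly_union X)) (proj X -` A \<inter> space (restrict_space mu (poly_union X)))"
  unfolding area_measure_def mu_def[symmetric] by (rule emeasure_distr[OF proj_measurable A])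
 also have "\<dots> = emeasure mu (proj X -` A \<inter> space (restrict_space mu (poly_union X)))"
  by (rule emeasure_restrict_space) (use borel_PU in \<open>auto simp: space_restrict_space\<close>)
 also have "proj X -` A \<inter> space (restrict_space mu (poly_union X)) = {x \<in> poly_union X. proj X x \<in> A}"
  by (auto simp: space_restrict_space)
 finally show ?thesis .
qed

lemma area_finite: "finite_measure area"
proof (rule finite_measureI)
 have "emeasure area (points X) = emeasure mu {x \<in> poly_union X. proj X x \<in> points X}"
  by (rule emeasure_area) (use sets.top[of area] space_area in simp)
 also have "{x \<in> poly_union X. proj X x \<in> points X} = poly_union X" using proj_points by auto
 finally show "emeasure area (space area) \<noteq> \<infinity>" using mu_PU_finite space_area by simp
qed

text \<open>A compact set of polygon points becomes closed in the surface: its saturation is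
 compact, since it is obtained by translating its intersections with the finitely many sides and
 adding vertices.\<close>

lemma closed_image: assumes K: "compact K" "K \<subseteq> poly_union X" shows "proj X ` K \<in> sets area" "openin (surface_topology X) (points X - proj X ` K)"
proof -
 define V where "V = {x \<in> (\<lambda>c. (fst c, st c)) ` sides X. proj X x \<in> proj X ` K}"
 define S where "S = K \<union> (\<Union>e\<in>sides X. (\<lambda>x. (fst (mate X e), snd x + tau e)) ` (K \<inter> ({fst e} \<times> cseg e))) \<union> V"
 have "compact (K \<inter> ({fst e} \<times> cseg e))" for e
  by (intro compact_Int_closed K closed_nat_Times) (simp add: cseg_def)
 hence "compact ((\<lambda>x. (fst (mate X e), snd x + tau e)) ` (K \<inter> ({fst e} \<times> cseg e)))" for e
  by (intro compact_continuous_image continuous_intros)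
 moreover have "finite V" unfolding V_def using finite_sides by simp
 ultimately have clS: "closed S" unfolding S_def
  using K(1) finite_sides by (intro closed_Un closed_UN) (auto simp: compact_imp_closed finite_imp_closed)
 have sub: "{x \<in> poly_union X. proj X x \<in> proj X ` K} \<subseteq> S"
 proof
  fix x assume "x \<in> {x \<in> poly_union X. proj X x \<in> proj X ` K}"
  then obtain k where x: "x \<in> poly_union X" and k: "k \<in> K" "proj X k = proj X x" by auto
  obtain i z where iz: "k = (i, z)" by (cases k)
  have kr: "i < N" "z \<in> reg i" using k K(2) poly_union_iff iz by auto
  from kr show "x \<in> S"
  proof (cases rule: reg_cases)
   case 1
   hence "x = k" using class_inn[OF kr(1) 1 x] k(2) iz by simp
   thus ?thesis using k(1) by (simp add: S_def)
  next
   case (2 c)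
   then obtain m where m: "x = (fst ((nu ^^ m) c), st ((nu ^^ m) c))" using class_vertex[OF 2(1) x] k(2) iz by auto
   have "x \<in> V" unfolding V_def using m nu_pow[OF 2(1)] k by (auto simp: image_iff)
   thus ?thesis by (simp add: S_def)
  next
   case (3 e)
   hence "x = k \<or> x = (fst (mate X e), z + tau e)" using class_oseg[OF 3(1,3) x] k(2) iz by simp
   thus ?thesis
   proof
    assume "x = k" thus ?thesis using k(1) by (simp add: S_def)
   next
    assume "x = (fst (mate X e), z + tau e)"
    moreover have "k \<in> K \<inter> ({fst e} \<times> cseg e)" using k(1) iz 3(1,2) subsetD[OF oseg_cseg 3(3)] by auto
    ultimately have "x \<in> (\<lambda>x. (fst (mate X e), snd x + tau e)) ` (K \<inter> ({fst e} \<times> cseg e))" using iz by (intro image_eqI[of _ _ k]) auto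
    thus ?thesis using 3(1) unfolding S_def by blast
   qed
  qed
 qed
 have sup: "x \<in> poly_union X \<and> proj X x \<in> proj X ` K" if "x \<in> S" for x
 proof -
  consider "x \<in> K" | e k where "e \<in> sides X" "k \<in> K" "fst k = fst e" "snd k \<in> cseg e" "x = (fst (mate X e), snd k + tau e)" | "x \<in> V"
   using \<open>x \<in> S\<close> unfolding S_def by (auto simp: mem_Times_iff)
  thus ?thesis
  proof cases
   case 1 thus ?thesis using K(2) by blast
  next
   case (2 e k)
   have "proj X (fst e, snd k) = proj X x" using proj_tau[OF 2(1,4)] 2(5) by simp
   moreover have "(fst e, snd k) = k" using 2(3) by (simp add: prod_eq_iff)
   moreover have "snd k + tau e \<in> reg (fst (mate X e))" using seg_tau(1)[OF 2(1,4)] cseg_reg[OF mate(1)[OF 2(1)]] by blast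
   hence "x \<in> poly_union X" using 2(5) side_fst[OF mate(1)[OF 2(1)]] poly_union_iff by blast
   ultimately show ?thesis using 2(2) by (metis imageI)
  next
   case 3
   then obtain c where "c \<in> sides X" "x = (fst c, st c)" "proj X x \<in> proj X ` K" unfolding V_def by blast
   moreover from this have "x \<in> poly_union X" using st_en_cseg(1) cseg_reg side_fst poly_union_iff by blast
   ultimately show ?thesis by blast
  qed
 qed
 have "{x \<in> poly_union X. proj X x \<in> points X - proj X ` K} = poly_union X \<inter> - S"
  using sub sup proj_points by blast
 hence "openin (top_of_set (poly_union X)) {x \<in> poly_union X. proj X x \<in> points X - proj X ` K}"
  using clS openin_open_Int[of "- S" "poly_union X"] by (simp add: open_Compl)
 thus o: "openin (surface_topology X) (points X - proj X ` K)" unfolding openin_surface_topology by blast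
 hence "points X - proj X ` K \<in> sets area" unfolding sets_area by (intro sigma_sets.Basic) simp
 hence "points X - (points X - proj X ` K) \<in> sets area" using sets.compl_sets space_area by metis
 moreover have "proj X ` K \<subseteq> points X" using K(2) proj_points by blast
 ultimately show "proj X ` K \<in> sets area" by (simp add: double_diff)
qed

text \<open>Images of compact sets are closed, and for an injective map the class of sets with
 measurable image is a sigma-algebra.\<close>

lemma borel_image:
 assumes K: "\<And>n::nat. compact (K n)" "\<And>n. K n \<subseteq> poly_union X" and inj: "inj_on (proj X) (\<Union>n. K n)"
  and B: "B \<in> sets borel"
 shows "proj X ` (B \<inter> (\<Union>n. K n)) \<in> sets area"
proof -
 define L where "L = (\<Union>n. K n)"
 have "B \<in> sigma_sets UNIV (Collect closed)"
  using B unfolding borel_eq_closed by simp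
 hence "proj X ` (B \<inter> L) \<in> sets area"
 proof (induction rule: sigma_sets.induct)
  case (Basic C)
  have "proj X ` (C \<inter> K n) \<in> sets area" for n
  proof (rule closed_image)
   show "compact (C \<inter> K n)" using K(1)[of n] Basic compact_Int_closed[of "K n" C] by (simp add: Int_commute)
   show "C \<inter> K n \<subseteq> poly_union X" using K(2) by blast
  qed
  hence "(\<Union>n. proj X ` (C \<inter> K n)) \<in> sets area" by blast
  moreover have "proj X ` (C \<inter> L) = (\<Union>n. proj X ` (C \<inter> K n))" unfolding L_def by blast
  ultimately show ?case by simp
 next
  case Empty thus ?case by simp
 next
  case (Compl C)
  have "proj X ` L = (\<Union>n. proj X ` K n)" unfolding L_def by blast
  hence "proj X ` L \<in> sets area" using closed_image(1)[OF K] by simp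
  hence "proj X ` L - proj X ` (C \<inter> L) \<in> sets area" using Compl by blast
  moreover have "proj X ` ((UNIV - C) \<inter> L) = proj X ` L - proj X ` (C \<inter> L)"
  proof -
   have "(UNIV - C) \<inter> L = L - (C \<inter> L)" by blast
   thus ?thesis using inj_on_image_set_diff[OF inj[folded L_def], of L "C \<inter> L"] by simp
  qed
  ultimately show ?case by simp
 next
  case (Union A)
  hence "(\<Union>i. proj X ` (A i \<inter> L)) \<in> sets area" by blast
  moreover have "proj X ` (\<Union> (range A) \<inter> L) = (\<Union>i. proj X ` (A i \<inter> L))" by blast
  ultimately show ?case by simp
 qed
 thus ?thesis by (simp add: L_def)
qed

lemma inj_on_Q: "inj_on (proj X) Q" by (rule inj_onI) (metis inj_Q Q_union)

lemma Q_sigma_compact: obtains K where "\<And>n::nat. compact (K n)" "\<And>n. K n \<subseteq> Q" "(\<Union>n. K n) = Q"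
proof -
 define K where "K n = poly_union X \<inter> {x. \<forall>w. (fst x, w) \<notin> Q --> 1 / real (Suc n) \<le> dist (snd x) w}" for n
 have eq: "K n = (\<Union>i<N. {i} \<times> (reg i \<inter> (\<Inter>w\<in>{w. (i, w) \<notin> Q}. {z. 1 / real (Suc n) \<le> dist z w})))" for n
  unfolding K_def poly_union_eq by auto
 have "compact (reg i \<inter> (\<Inter>w\<in>{w. (i, w) \<notin> Q}. {z. 1 / real (Suc n) \<le> dist z w}))" if "i < N" for i n
  using bounded_reg[OF that] closed_reg[OF that]
  by (intro compact_Int_closed closed_INT ballI closed_Collect_le continuous_intros) (simp add: compact_eq_bounded_closed)
 hence "compact (K n)" for n unfolding eq by (intro compact_UN compact_Times) auto
 moreover have KQ: "K n \<subseteq> Q" for n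
 proof
  fix x assume "x \<in> K n"
  hence *: "\<And>w. (fst x, w) \<notin> Q ==> 1 / real (Suc n) \<le> dist (snd x) w" by (auto simp: K_def)
  show "x \<in> Q" using *[of "snd x"] by (cases "x \<in> Q") auto
 qed
 moreover have "Q \<subseteq> (\<Union>n. K n)"
 proof
  fix x assume x: "x \<in> Q"
  obtain e where e: "e > 0" "\<And>u. cmod u < e ==> shift x u \<in> Q" using shift_Q[OF x] by blast
  obtain n where n: "1 / real (Suc n) < e" using nat_approx_posE[OF e(1)] by blast
  have "1 / real (Suc n) \<le> dist (snd x) w" if w: "(fst x, w) \<notin> Q" for w
  proof (rule ccontr)
   assume "\<not> ?thesis"
   hence "cmod (w - snd x) < e" using n by (simp add: dist_norm norm_minus_commute)
   hence "shift x (w - snd x) \<in> Q" using e(2) by blast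
   thus False using w by (simp add: shift_def)
  qed
  hence "x \<in> K n" using Q_union[OF x] by (simp add: K_def)
  thus "x \<in> (\<Union>n. K n)" by blast
 qed
 ultimately show ?thesis using that by blast
qed

lemma image_Q: assumes "B \<in> sets borel" "B \<subseteq> Q" shows "proj X ` B \<in> sets area" "emeasure area (proj X ` B) = emeasure mu B"
proof -
 obtain K where K: "\<And>n::nat. compact (K n)" "\<And>n. K n \<subseteq> Q" "(\<Union>n. K n) = Q" using Q_sigma_compact by blast
 have KP: "\<And>n. K n \<subseteq> poly_union X" using K(2) Q_union by blast
 have "proj X ` (B \<inter> (\<Union>n. K n)) \<in> sets area" by (rule borel_image[OF K(1) KP _ assms(1)]) (use inj_on_Q K(3) in simp)
 moreover have "B \<inter> (\<Union>n. K n) = B" using assms(2) K(3) by blast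
 ultimately show s: "proj X ` B \<in> sets area" by simp
 have "{x \<in> poly_union X. proj X x \<in> proj X ` B} = B" using assms(2) Q_union inj_Q by blast
 thus "emeasure area (proj X ` B) = emeasure mu B" unfolding emeasure_area[OF s] by simp
qed

lemma oseg_sigma_compact: assumes "e \<in> sides X"
 obtains K where "\<And>n::nat. compact (K n)" "\<And>n. K n \<subseteq> poly_union X" "(\<Union>n. K n) = {fst e} \<times> oseg e"
proof -
 define K where "K n = (\<lambda>t. (fst e, st e + of_real t * sv e)) ` {1 / real (Suc n)..1 - 1 / real (Suc n)}" for n
 have "compact (K n)" for n unfolding K_def by (intro compact_continuous_image continuous_intros) auto
 moreover have sub: "K n \<subseteq> {fst e} \<times> oseg e" for n
 proof
  fix x assume "x \<in> K n"
  then obtain t where t: "1 / real (Suc n) \<le> t" "t \<le> 1 - 1 / real (Suc n)" "x = (fst e, st e + of_real t * sv e)" by (auto simp: K_def)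
  have "0 < 1 / real (Suc n)" by simp
  hence "0 < t" "t < 1" using t(1,2) by linarith+
  thus "x \<in> {fst e} \<times> oseg e" unfolding mem_Times_iff oseg_param[OF assms] using t(3) by auto
 qed
 moreover have "K n \<subseteq> poly_union X" for n
 proof
  fix x assume "x \<in> K n"
  hence x: "fst x = fst e" "snd x \<in> oseg e" using sub[of n] by (auto simp: mem_Times_iff)
  hence "snd x \<in> reg (fst x)" using subsetD[OF cseg_reg[OF assms] subsetD[OF oseg_cseg x(2)]] by simp
  moreover have "fst x < N" unfolding x(1) by (rule side_fst[OF assms])
  ultimately have "(fst x, snd x) \<in> poly_union X" unfolding poly_union_iff by blast
  thus "x \<in> poly_union X" unfolding prod.collapse .
 qed
 moreover have "{fst e} \<times> oseg e \<subseteq> (\<Union>n. K n)"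
 proof
  fix x assume "x \<in> {fst e} \<times> oseg e"
  then obtain t where t: "0 < t" "t < 1" "x = (fst e, st e + of_real t * sv e)" unfolding mem_Times_iff oseg_param[OF assms] by (auto simp: prod_eq_iff)
  have "0 < min t (1 - t)" using t by simp
  then obtain n where "1 / real (Suc n) < min t (1 - t)" using nat_approx_posE by blast
  hence "x \<in> K n" unfolding K_def using t(3) by auto
  thus "x \<in> (\<Union>n. K n)" by blast
 qed
 ultimately show ?thesis using that by blast
qed

lemma image_oseg: assumes "e \<in> sides X" "B \<in> sets borel" shows "proj X ` (B \<inter> ({fst e} \<times> oseg e)) \<in> sets area"
proof -
 obtain K where K: "\<And>n::nat. compact (K n)" "\<And>n. K n \<subseteq> poly_union X" "(\<Union>n. K n) = {fst e} \<times> oseg e" using oseg_sigma_compact[OF assms(1)] by blast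
 have "inj_on (proj X) ({fst e} \<times> oseg e)"
 proof (rule inj_onI)
  fix x y assume xy: "x \<in> {fst e} \<times> oseg e" "y \<in> {fst e} \<times> oseg e" "proj X x = proj X y"
  have x: "x = (fst e, snd x)" "snd x \<in> oseg e" and y: "fst y = fst e" "snd y \<in> oseg e" using xy by auto
  have yp: "y \<in> poly_union X" using xy(2) K(2,3) by blast
  have "y = (fst e, snd x) \<or> y = (fst (mate X e), snd x + tau e)" by (rule class_oseg[OF assms(1) x(2) yp]) (use x(1) xy(3) in simp)
  moreover have "y \<noteq> (fst (mate X e), snd x + tau e)"
  proof
   assume eq: "y = (fst (mate X e), snd x + tau e)"
   hence "snd y \<in> oseg (mate X e)" using seg_tau(2)[OF assms(1) x(2)] by simp
   hence "e = mate X e" using oseg_unique[OF assms(1) mate(1)[OF assms(1)] _ y(2)] subsetD[OF oseg_cseg, of "snd y" "mate X e"] eq y(1) by auto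
   hence "sv e = - sv e" using mate(3)[OF assms(1)] by simp
   thus False using sv_nz[OF assms(1)] by simp
  qed
  ultimately show "x = y" using x(1) by simp
 qed
 hence "proj X ` (B \<inter> (\<Union>n. K n)) \<in> sets area"
  by (intro borel_image[where K = K] K(1,2) assms(2)) (simp add: K(3))
 thus ?thesis unfolding K(3) .
qed

text \<open>The projection is injective on the interior points and on each open side, and there are
 finitely many vertices.\<close>

lemma image_PU: assumes B: "B \<in> sets borel" "B \<subseteq> poly_union X" shows "proj X ` B \<in> sets area"
proof -
 define W where "W = B \<inter> (\<lambda>c. (fst c, st c)) ` sides X"
 have eq: "B = (B \<inter> Q) \<union> (\<Union>e\<in>sides X. B \<inter> ({fst e} \<times> oseg e)) \<union> W"
 proof (intro equalityI subsetI)
  fix x assume x: "x \<in> B"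
  hence xp: "fst x < N" "snd x \<in> reg (fst x)" using B(2) poly_union_iff[of "fst x" "snd x"] by auto
  from xp show "x \<in> (B \<inter> Q) \<union> (\<Union>e\<in>sides X. B \<inter> ({fst e} \<times> oseg e)) \<union> W"
  proof (cases rule: reg_cases)
   case 1 thus ?thesis using x xp by (simp add: Q_iff)
  next
   case (2 c)
   hence "x = (fst c, st c)" by (simp add: prod_eq_iff)
   thus ?thesis using x 2(1) by (auto simp: W_def)
  next
   case (3 e)
   hence "x \<in> B \<inter> ({fst e} \<times> oseg e)" using x by (auto simp: mem_Times_iff)
   thus ?thesis using 3(1) by blast
  qed
 qed (auto simp: W_def)
 have "proj X ` (B \<inter> Q) \<in> sets area" using B(1) open_Q by (intro image_Q) auto
 moreover have "(\<Union>e\<in>sides X. proj X ` (B \<inter> ({fst e} \<times> oseg e))) \<in> sets area"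
  by (intro sets.finite_UN finite_sides image_oseg B)
 moreover have "proj X ` W \<in> sets area" by (rule closed_image) (use finite_sides B(2) in \<open>auto simp: W_def intro: finite_imp_compact\<close>)
 ultimately have "proj X ` (B \<inter> Q) \<union> (\<Union>e\<in>sides X. proj X ` (B \<inter> ({fst e} \<times> oseg e))) \<union> proj X ` W \<in> sets area" by blast
 moreover have "proj X ` B = proj X ` (B \<inter> Q) \<union> (\<Union>e\<in>sides X. proj X ` (B \<inter> ({fst e} \<times> oseg e))) \<union> proj X ` W"
  by (subst eq) (simp only: image_Un image_UN)
 ultimately show ?thesis by simp
qed

lemma area_null_compl: assumes "B \<in> sets borel" "B \<subseteq> Q" "Q - B \<in> null_sets mu" shows "points X - proj X ` B \<in> null_sets area"
proof -
 have s: "points X - proj X ` B \<in> sets area" using sets.compl_sets[OF image_Q(1)[OF assms(1,2)]] space_area by metis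
 have "{x \<in> poly_union X. proj X x \<in> points X - proj X ` B} \<subseteq> (poly_union X - Q) \<union> (Q - B)" by blast
 moreover have n: "(poly_union X - Q) \<union> (Q - B) \<in> null_sets mu" by (rule null_sets.Un[OF boundary_null assms(3)])
 ultimately have "emeasure mu {x \<in> poly_union X. proj X x \<in> points X - proj X ` B} \<le> emeasure mu ((poly_union X - Q) \<union> (Q - B))"
  by (intro emeasure_mono null_setsD2)
 hence "emeasure mu {x \<in> poly_union X. proj X x \<in> points X - proj X ` B} = 0"
  unfolding null_setsD1[OF n] by simp
 thus ?thesis using s emeasure_area[OF s] by (intro null_setsI) auto
qed

lemma AE_area: assumes "Z \<in> null_sets mu" "\<And>x. x \<in> Q ==> x \<notin> Z ==> R (proj X x)" shows "AE p in area. R p"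
proof -
 have Z: "Z \<in> sets borel" using assms(1) null_setsD2 by force
 have "Q - (Q - Z) \<in> null_sets mu" using null_sets_subset[OF assms(1), of "Q \<inter> Z"] Z open_Q by (simp add: Diff_Diff_Int)
 hence "points X - proj X ` (Q - Z) \<in> null_sets area" using Z open_Q by (intro area_null_compl) auto
 moreover have "{p \<in> space area. \<not> R p} \<subseteq> points X - proj X ` (Q - Z)" using assms(2) space_area by auto
 ultimately show ?thesis by (rule AE_I')
qed

text \<open>The surface minus the image of \<open>Q\<close> is null, and the projection preserves
 area on \<open>Q\<close>.\<close>

theorem AE_area_pair:
 assumes Z: "Z \<in> null_sets mu2" and R: "\<And>x y. x \<in> Q ==> y \<in> Q ==> (x, y) \<notin> Z ==> R (proj X x) (proj X y)"
 shows "AE (p, p') in area \<Otimes>\<^sub>M area. R p p'"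
proof -
 interpret a: finite_measure area by (rule area_finite)
 interpret aa: pair_sigma_finite area area by unfold_locales
 define rep where "rep p = (if p \<in> proj X ` Q then the_inv_into Q (proj X) p else (0, 0))" for p
 have rep: "rep (proj X x) = x" if "x \<in> Q" for x using that by (simp add: rep_def the_inv_into_f_f[OF inj_on_Q])
 have QI: "proj X ` Q \<in> sets area" using open_Q by (intro image_Q) auto
 have rep_m [measurable]: "rep \<in> borel_measurable area"
 proof (rule measurableI)
  fix B :: "(nat \<times> complex) set" assume B: "B \<in> sets borel"
  have 1: "proj X ` (B \<inter> Q) \<in> sets area" using B open_Q by (intro image_Q) auto
  have 2: "space area - proj X ` Q \<in> sets area" using QI by (rule sets.compl_sets)
  have "rep -` B \<inter> space area = proj X ` (B \<inter> Q) \<union> (if (0, 0) \<in> B then space area - proj X ` Q else {})"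
  proof (intro equalityI subsetI)
   fix p assume p: "p \<in> rep -` B \<inter> space area"
   show "p \<in> proj X ` (B \<inter> Q) \<union> (if (0, 0) \<in> B then space area - proj X ` Q else {})"
   proof (cases "p \<in> proj X ` Q")
    case True
    then obtain x where "x \<in> Q" "p = proj X x" by blast
    thus ?thesis using p rep by auto
   next
    case False thus ?thesis using p by (auto simp: rep_def)
   qed
  next
   fix p assume p: "p \<in> proj X ` (B \<inter> Q) \<union> (if (0, 0) \<in> B then space area - proj X ` Q else {})"
   show "p \<in> rep -` B \<inter> space area"
   proof (cases "p \<in> proj X ` (B \<inter> Q)")
    case True
    then obtain x where "x \<in> Q" "x \<in> B" "p = proj X x" by blast
    thus ?thesis using rep proj_points[OF Q_union] space_area by auto
   next
    case False
    hence "(0, 0) \<in> B" "p \<in> space area - proj X ` Q" using p by (auto split: if_splits)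
    thus ?thesis by (auto simp: rep_def)
   qed
  qed
  thus "rep -` B \<inter> space area \<in> sets area" using 1 2 by auto
 qed auto
 have Zb: "Z \<in> sets borel" using Z null_setsD2 sets_mumu by blast
 define G where "G = {pp \<in> space (area \<Otimes>\<^sub>M area). fst pp \<in> proj X ` Q \<and> snd pp \<in> proj X ` Q \<and> (rep (fst pp), rep (snd pp)) \<notin> Z}"
 have "(\<lambda>pp. (rep (fst pp), rep (snd pp))) \<in> measurable (area \<Otimes>\<^sub>M area) (borel \<Otimes>\<^sub>M borel)" by measurable
 hence "(\<lambda>pp. (rep (fst pp), rep (snd pp))) \<in> borel_measurable (area \<Otimes>\<^sub>M area)" by (simp add: borel_prod)
 from measurable_sets[OF this Zb]
 have m1: "{pp \<in> space (area \<Otimes>\<^sub>M area). (rep (fst pp), rep (snd pp)) \<in> Z} \<in> sets (area \<Otimes>\<^sub>M area)"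
  by (simp add: vimage_def Int_def conj_commute)
 have m2: "proj X ` Q \<times> proj X ` Q \<in> sets (area \<Otimes>\<^sub>M area)" using QI by simp
 have "G = (proj X ` Q \<times> proj X ` Q) - {pp \<in> space (area \<Otimes>\<^sub>M area). (rep (fst pp), rep (snd pp)) \<in> Z}"
  using sets.sets_into_space[OF m2] unfolding G_def by (auto simp: mem_Times_iff)
 hence G: "G \<in> sets (area \<Otimes>\<^sub>M area)" using m1 m2 by auto
 have ZA: "AE x in mu. AE y in mu. (x, y) \<notin> Z"
  by (rule mumu.AE_pair) (use AE_not_in[OF Z] in simp)
 then obtain Z1 where Z1': "{x \<in> space mu. \<not> (AE y in mu. (x, y) \<notin> Z)} \<subseteq> Z1" "emeasure mu Z1 = 0" "Z1 \<in> sets mu"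
  by (rule AE_E)
 hence Z1: "Z1 \<in> null_sets mu" "\<And>x. x \<notin> Z1 ==> AE y in mu. (x, y) \<notin> Z"
  by (auto intro: null_setsI)
 have "AE p in area. AE p' in area. (p, p') \<in> G"
 proof (rule AE_area[OF Z1(1)])
  fix x assume x: "x \<in> Q" "x \<notin> Z1"
  obtain Z2 where Z2': "{y \<in> space mu. \<not> (x, y) \<notin> Z} \<subseteq> Z2" "emeasure mu Z2 = 0" "Z2 \<in> sets mu"
   using Z1(2)[OF x(2)] by (rule AE_E)
  hence Z2: "Z2 \<in> null_sets mu" "\<And>y. y \<notin> Z2 ==> (x, y) \<notin> Z"
   by (auto intro: null_setsI)
  show "AE p' in area. (proj X x, p') \<in> G"
  proof (rule AE_area[OF Z2(1)])
   fix y assume "y \<in> Q" "y \<notin> Z2"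
   thus "(proj X x, proj X y) \<in> G" using x Z2(2) rep proj_points[OF Q_union] space_area
    by (auto simp: G_def space_pair_measure)
  qed
 qed
 hence "AE pp in area \<Otimes>\<^sub>M area. pp \<in> G"
  by (intro aa.AE_pair_measure) (use G sets.sets_into_space[OF G] in \<open>auto simp: Int_absorb1 Collect_conj_eq\<close>)
 thus ?thesis
 proof (rule AE_mp, intro AE_I2 impI)
  fix pp assume "pp \<in> G"
  then obtain x y where "x \<in> Q" "y \<in> Q" "fst pp = proj X x" "snd pp = proj X y" "(rep (fst pp), rep (snd pp)) \<notin> Z" by (auto simp: G_def)
  thus "case pp of (p, p') => R p p'" using R rep by (cases pp) auto
 qed
qed

section \<open>Flat distance\<close>

lemma bl_nonneg: "broken_line X p q l ==> 0 \<le> l"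
 by (induction rule: broken_line.induct) auto

lemma bl_trans: assumes "broken_line X q r m" "broken_line X p q l" shows "broken_line X p r (l + m)"
 using assms
proof (induction rule: broken_line.induct)
 case (broken_line_step q i z m w)
 hence "broken_line X p (proj X (i, w)) (l + m + dist z w)" by (intro broken_line.broken_line_step) auto
 thus ?case by (simp add: add.assoc)
qed simp

lemma bl_segment: assumes "i < N" "closed_segment z w \<subseteq> reg i" shows "broken_line X (proj X (i, z)) (proj X (i, w)) (dist z w)"
proof -
 have "(i, z) \<in> poly_union X" using assms poly_union_iff by auto
 hence "broken_line X (proj X (i, z)) (proj X (i, z)) 0" using broken_line_refl proj_points by blast
 from broken_line_step[OF this assms] show ?thesis by simp
qed

lemma bl_sym: "broken_line X p q l ==> broken_line X q p l"
proof (induction rule: broken_line.induct)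
 case (broken_line_refl p) thus ?case by (rule broken_line.broken_line_refl)
next
 case (broken_line_step p i z l w)
 have "broken_line X (proj X (i, w)) (proj X (i, z)) (dist w z)"
  using bl_segment[of i w z] broken_line_step by (simp add: closed_segment_commute)
 from bl_trans[OF broken_line_step(4) this] show ?case by (simp add: dist_commute add.commute)
qed

definition joined :: "surface_point => surface_point => bool" where "joined p q \<longleftrightarrow> (\<exists>l. broken_line X p q l)"

lemma joined_sym: "joined p q ==> joined q p" unfolding joined_def using bl_sym by blast
lemma joined_trans: "joined p q ==> joined q r ==> joined p r" unfolding joined_def using bl_trans by blast

lemma joined_inn: assumes "i < N" "z \<in> inn i" "w \<in> inn i" shows "joined (proj X (i, z)) (proj X (i, w))"
proof (rule connected_equivalence_relation[of "inn i" z w "\<lambda>z w. joined (proj X (i, z)) (proj X (i, w))"])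
 show "connected (inn i)" using polygon.Jordan(4)[OF polygon[OF assms(1)]] .
 fix a assume a: "a \<in> inn i"
 obtain r where r: "r > 0" "ball a r \<subseteq> inn i" using open_inn[OF assms(1)] a open_contains_ball by blast
 have "joined (proj X (i, a)) (proj X (i, x))" if "x \<in> ball a r" for x
 proof -
  have "closed_segment a x \<subseteq> ball a r" using that r(1) by (intro closed_segment_subset) auto
  thus ?thesis unfolding joined_def using bl_segment[OF assms(1), of a x] r(2) inn_reg by blast
 qed
 moreover have "openin (top_of_set (inn i)) (ball a r)" using r(2) open_inn[OF assms(1)] by (simp add: openin_open_eq)
 ultimately show "\<exists>T. openin (top_of_set (inn i)) T \<and> a \<in> T \<and> (\<forall>x\<in>T. joined (proj X (i, a)) (proj X (i, x)))"
  using r(1) by (intro exI[of _ "ball a r"]) auto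
qed (use assms joined_sym joined_trans in blast)+

lemma joined_to_inn: assumes "i < N" "z \<in> reg i" shows "\<exists>w\<in>inn i. joined (proj X (i, z)) (proj X (i, w))"
 using assms
proof (cases rule: reg_cases)
 case 1
 thus ?thesis using joined_inn[OF assms(1)] by blast
next
 case (2 c)
 obtain r0 where r0: "r0 > 0" "\<And>r h. 0 < r ==> r < r0 ==> 0 < h ==> h < alpha c ==> cpt c r h \<in> inn (fst c)" using corner_loc[OF 2(1)] by blast
 let ?h = "alpha c / 2"
 have h: "0 < ?h" "?h < alpha c" using alpha_bounds[OF 2(1)] by auto
 let ?w = "cpt c (r0 / 2) ?h"
 have w: "?w \<in> inn i" using r0 h 2(2) by simp
 have "closed_segment z ?w \<subseteq> reg i"
 proof
  fix x assume "x \<in> closed_segment z ?w"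
  then obtain t where t: "0 \<le> t" "t \<le> 1" "x = (1 - t) *\<^sub>R z + t *\<^sub>R ?w" by (auto simp: in_segment)
  have x: "x = cpt c (t * (r0 / 2)) ?h" unfolding t(3) 2(3) cpt_def by (simp add: scaleR_conv_of_real algebra_simps)
  show "x \<in> reg i"
  proof (cases "t = 0")
   case True thus ?thesis using t(3) assms(2) by simp
  next
   case False
   have "t * (r0 / 2) \<le> 1 * (r0 / 2)" using t r0(1) by (intro mult_right_mono) auto
   hence "x \<in> inn (fst c)" unfolding x using r0(2)[of "t * (r0/2)" ?h] h t False r0(1) by simp
   thus ?thesis using inn_reg 2(2) by blast
  qed
 qed
 thus ?thesis using bl_segment[OF assms(1)] w unfolding joined_def by blast
next
 case (3 e)
 obtain r where r: "r > 0" "\<And>v. v \<in> ball z r ==> cross (sv e) (v - z) > 0 ==> v \<in> inn (fst e)"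
  using side_loc[OF 3(1,3)] by blast
 have sp: "cmod (sv e) > 0" using sv_nz[OF 3(1)] by simp
 define \<rho> where "\<rho> = r / (2 * cmod (sv e))"
 have rho: "\<rho> > 0" "\<rho> * cmod (sv e) = r / 2" using r(1) sp by (auto simp: \<rho>_def)
 have io: "z + of_real s * (\<i> * sv e) \<in> inn i" if s: "0 < s" "s \<le> \<rho>" for s
 proof -
  have "cmod (of_real s * (\<i> * sv e)) = s * cmod (sv e)" using s by (simp add: norm_mult)
  also have "\<dots> \<le> \<rho> * cmod (sv e)" using s by (intro mult_right_mono) auto
  finally have "z + of_real s * (\<i> * sv e) \<in> ball z r" unfolding ball_add using rho r(1) by simp
  moreover have "cross (sv e) (z + of_real s * (\<i> * sv e) - z) > 0"
   unfolding add_diff_cancel_left' cross_ii using s sp by simp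
  ultimately show ?thesis using r(2) 3(2) by blast
 qed
 let ?w = "z + of_real \<rho> * (\<i> * sv e)"
 have "closed_segment z ?w \<subseteq> reg i"
 proof
  fix x assume "x \<in> closed_segment z ?w"
  then obtain t where t: "0 \<le> t" "t \<le> 1" "x = (1 - t) *\<^sub>R z + t *\<^sub>R ?w" by (auto simp: in_segment)
  have x: "x = z + of_real (t * \<rho>) * (\<i> * sv e)" unfolding t(3) by (simp add: scaleR_conv_of_real algebra_simps)
  show "x \<in> reg i"
  proof (cases "t = 0")
   case True thus ?thesis using t(3) assms(2) by simp
  next
   case False
   have "t * \<rho> \<le> 1 * \<rho>" using t rho(1) by (intro mult_right_mono) auto
   moreover have "0 < t * \<rho>" using False t rho(1) by simp
   ultimately show ?thesis unfolding x using io[of "t * \<rho>"] inn_reg by auto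
  qed
 qed
 thus ?thesis using bl_segment[OF assms(1)] io[of \<rho>] rho(1) unfolding joined_def by blast
qed

text \<open>The points joined to a given one by a broken line form a union of whole polygons, so
 connectedness of the surface joins any two points.\<close>

lemma joined_all: assumes "p \<in> points X" "q \<in> points X" shows "joined p q"
proof -
 define C where "C = {r \<in> points X. joined p r}"
 have whole: "joined p (proj X (i, w))" if h: "i < N" "z \<in> reg i" "w \<in> reg i" "joined p (proj X (i, z))" for i z w
 proof -
  obtain a where a: "a \<in> inn i" "joined (proj X (i, z)) (proj X (i, a))" using joined_to_inn[OF h(1,2)] by blast
  obtain b where b: "b \<in> inn i" "joined (proj X (i, w)) (proj X (i, b))" using joined_to_inn[OF h(1,3)] by blast
  have "joined (proj X (i, a)) (proj X (i, b))" using joined_inn a(1) b(1) h(1) by blast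
  from joined_trans[OF joined_trans[OF joined_trans[OF h(4) a(2)] this] joined_sym[OF b(2)]] show ?thesis .
 qed
 define I where "I = {i. i < N \<and> (\<exists>z\<in>reg i. joined p (proj X (i, z)))}"
 have pre: "{x \<in> poly_union X. proj X x \<in> C} = poly_union X \<inter> (I \<times> UNIV)"
 proof (intro equalityI subsetI)
  fix x assume "x \<in> {x \<in> poly_union X. proj X x \<in> C}"
  thus "x \<in> poly_union X \<inter> (I \<times> UNIV)" by (cases x) (auto simp: I_def C_def poly_union_iff)
 next
  fix x assume x: "x \<in> poly_union X \<inter> (I \<times> UNIV)"
  then obtain z where "fst x < N" "z \<in> reg (fst x)" "joined p (proj X (fst x, z))" by (auto simp: I_def)
  moreover have "snd x \<in> reg (fst x)" using x poly_union_iff[of "fst x" "snd x"] by simp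
  ultimately have "joined p (proj X (fst x, snd x))" using whole by blast
  thus "x \<in> {x \<in> poly_union X. proj X x \<in> C}" using x proj_points by (simp add: C_def)
 qed
 have pre': "{x \<in> poly_union X. proj X x \<in> points X - C} = poly_union X \<inter> ((- I) \<times> UNIV)"
 proof -
  have "{x \<in> poly_union X. proj X x \<in> points X - C} = poly_union X - {x \<in> poly_union X. proj X x \<in> C}" using proj_points by auto
  also have "\<dots> = poly_union X \<inter> ((- I) \<times> UNIV)" unfolding pre by auto
  finally show ?thesis .
 qed
 have op: "open (J \<times> (UNIV :: complex set))" for J :: "nat set" by (intro open_Times open_UNIV) (simp add: open_discrete)
 have o1: "openin (surface_topology X) C" unfolding openin_surface_topology pre
  using op openin_open_Int by (auto simp: C_def)
 have o2: "openin (surface_topology X) (points X - C)" unfolding openin_surface_topology pre'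
  using op openin_open_Int by auto
 have top: "topspace (surface_topology X) = points X"
 proof -
  have "openin (surface_topology X) (points X)"
  proof -
   have "{x \<in> poly_union X. proj X x \<in> points X} = poly_union X" using proj_points by auto
   thus ?thesis unfolding openin_surface_topology by simp
  qed
  from openin_subset[OF this] have "points X \<subseteq> topspace (surface_topology X)" .
  moreover have "topspace (surface_topology X) \<subseteq> points X" using openin_topspace[of "surface_topology X"] openin_surface_topology by blast
  ultimately show ?thesis by (rule subset_antisym[rotated])
 qed
 have "connected_space (surface_topology X)" using ts by (simp add: translation_surface_def)
 moreover have "points X \<subseteq> C \<union> (points X - C)" "C \<inter> (points X - C) = {}" by blast+
 ultimately have "C = {} \<or> points X - C = {}"
  using o1 o2 unfolding connected_space_def top by meson
 moreover have "p \<in> C" using assms(1) broken_line_refl by (auto simp: C_def joined_def)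
 ultimately show ?thesis using assms(2) by (auto simp: C_def)
qed

text \<open>A broken line shorter than \<open>r\<close> that starts at \<open>y\<close> cannot leave
 the disc of radius \<open>r\<close>, where the surface is flat.\<close>

lemma flat_dist_locate:
 assumes y: "y \<in> Q" "ball (snd y) r \<subseteq> inn (fst y)" and q: "q \<in> points X" "flat_dist X q (proj X y) < r"
 obtains w where "q = proj X (fst y, w)" "dist (snd y) w < r"
proof -
 have iN: "fst y < N" using y by (simp add: Q_iff)
 have yp: "proj X y \<in> points X" using proj_points Q_union y(1) by blast
 have loc: "broken_line X p q l ==> p = proj X y ==> l < r ==> \<exists>w. q = proj X (fst y, w) \<and> dist (snd y) w \<le> l" for p q l
 proof (induction rule: broken_line.induct)
  case (broken_line_refl p) thus ?case by (intro exI[of _ "snd y"]) simp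
 next
  case (broken_line_step p i z l w')
  hence "l < r" using zero_le_dist[of z w'] by linarith
  then obtain w where w: "proj X (i, z) = proj X (fst y, w)" "dist (snd y) w \<le> l" using broken_line_step by blast
  have "w \<in> inn (fst y)" using w(2) \<open>l < r\<close> y(2) by (auto simp: subset_iff)
  moreover have "(i, z) \<in> poly_union X" using broken_line_step(2,3) poly_union_iff by auto
  ultimately have "(i, z) = (fst y, w)" using class_inn[OF iN] w(1) by metis
  thus ?case using w(2) dist_triangle[of "snd y" w' w] by (intro exI[of _ w']) auto
 qed
 have "{l. broken_line X q (proj X y) l} \<noteq> {}" using joined_all[OF q(1) yp] by (auto simp: joined_def)
 from cInf_lessD[OF this q(2)[unfolded flat_dist_def]]
 obtain l where l: "broken_line X q (proj X y) l" "l < r" by blast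
 obtain w where w: "q = proj X (fst y, w)" "dist (snd y) w \<le> l" using loc[OF bl_sym[OF l(1)] refl l(2)] by blast
 show ?thesis by (rule that[OF w(1)]) (use w(2) l(2) in linarith)
qed

lemma flat_dist_le: assumes "i < N" "closed_segment z w \<subseteq> reg i" shows "flat_dist X (proj X (i, z)) (proj X (i, w)) \<le> dist z w"
 unfolding flat_dist_def using bl_segment[OF assms] bl_nonneg by (intro cInf_lower) (auto simp: bdd_below_def)

section \<open>Points with vertex-free orbits\<close>

text \<open>Interior points whose orbit ends at a vertex, singular or not.\<close>

definition Hit :: "real => (nat \<times> complex) set" where "Hit th = {x \<in> Q. \<exists>s c. hits th x s c}"

lemma hits_mv: assumes "hits th x s c" "0 \<le> d" "d < ext th x" shows "hits th (mv th x d) (s - d) c"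
proof -
 have x: "x \<in> Qp th" using hits_pos assms(1) by blast
 have em: "ext th (mv th x d) = ext th x - d" using ext_mv[OF x assms(2,3)] .
 have w: "snd (mv th x d) + ray th (ext th x - d) = snd x + ray th (ext th x)" by (simp add: algebra_simps)
 show ?thesis using assms(1)
 proof (cases rule: hits.cases)
  case hits_now
  hence "hits th (mv th x d) (ext th (mv th x d)) c"
   using mv_Qp[OF x assms(2,3)] w by (intro hits.hits_now) (simp_all only: em mv_simps)
  thus ?thesis using hits_now(1) em by simp
 next
  case (hits_later e t)
  have c: "crosses th (mv th x d) e" using hits_later(2) mv_Qp[OF x assms(2,3)] unfolding crosses_def em w by simp
  have "nx th (mv th x d) e = nx th x e" unfolding nx_def em w ..
  hence "hits th (mv th x d) (ext th x - d + t) c" using hits.hits_later[OF c] hits_later(3) em by simp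
  moreover have "ext th x - d + t = s - d" using hits_later(1) by simp
  ultimately show ?thesis by metis
 qed
qed

text \<open>A point whose orbit hits a vertex lies on a segment whose points hit it too, one of them at a
 rational time; by backward uniqueness those are countably many.\<close>

lemma Hit_null: "\<exists>Z\<in>null_sets mu. Hit th \<subseteq> Z"
proof -
 define W where "W q c = {x \<in> Q. hits th x q c}" for q c
 define Ln where "Ln x = {fst x} \<times> {z. cross (direction th) (z - snd x) = 0}" for x :: "nat \<times> complex"
 have cW: "countable (W q c)" for q c
 proof (cases "W q c = {}")
  case False
  then obtain x where "x \<in> W q c" by blast
  hence "W q c \<subseteq> {x}" using hits_inj unfolding W_def by blast
  thus ?thesis by (rule countable_subset) simp
 qed simp
 define Z where "Z = (\<Union>q\<in>\<rat>. \<Union>c\<in>sides X. \<Union>x\<in>W q c. Ln x)"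
 have "Z \<in> null_sets mu" unfolding Z_def
  using countable_rat finite_sides cW line_null[OF direction_nz]
  by (intro null_sets_UN') (auto simp: Ln_def countable_finite)
 moreover have "Hit th \<subseteq> Z"
 proof
  fix x assume "x \<in> Hit th"
  then obtain s c where x: "x \<in> Q" "hits th x s c" by (auto simp: Hit_def)
  have xQ: "x \<in> Qp th" using Q_Qp x(1) .
  have "s - ext th x < s" using ext(1)[OF xQ] by simp
  then obtain q where q: "q \<in> \<rat>" "s - ext th x < q" "q < s" using Rats_dense_in_real by blast
  let ?d = "s - q"
  have d: "0 < ?d" "?d < ext th x" using q by auto
  have "hits th (mv th x ?d) q c" using hits_mv[OF x(2), of ?d] d by simp
  hence "mv th x ?d \<in> W q c" using mv_Q[OF xQ d] by (simp add: W_def)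
  moreover have "x \<in> Ln (mv th x ?d)" unfolding Ln_def mem_Times_iff
   by (simp add: cross_simps flip: of_real_diff)
  moreover have "c \<in> sides X" using hits_pos x(2) by blast
  ultimately show "x \<in> Z" unfolding Z_def using q(1) by blast
 qed
 ultimately show ?thesis by blast
qed

text \<open>\<open>Gf\<close>: the forward orbit is infinite and meets no vertex. Arbitrarily late
 visits to the interior are demanded because this makes the set a countable intersection of open
 sets. \<open>Gam\<close>: both half orbits have this property.\<close>

definition Gf :: "real => (nat \<times> complex) set" where "Gf th = {x \<in> Q. \<forall>n::nat. \<exists>T>real n. \<exists>y\<in>Q. fl th x T y}"
definition Gam :: "real => (nat \<times> complex) set" where "Gam th = Gf th \<inter> Gf (th + pi)"

lemma fl_into_Q: assumes "fl th x t y" "0 < e" obtains T z where "t < T" "T < t + e" "z \<in> Q" "fl th x T z"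
proof -
 have y: "y \<in> Qp th" using fl_Qp assms(1) by blast
 define s where "s = min e (ext th y) / 2"
 have s: "0 < s" "s < e" "s < ext th y" unfolding s_def using half_min[OF assms(2) ext(1)[OF y]] by auto
 have "fl th x (t + s) (mv th y s)" using fl_trans[OF assms(1) fl.fl_move[OF y less_imp_le[OF s(1)] s(3)]] .
 thus ?thesis using that[of "t + s" "mv th y s"] s mv_Q[OF y s(1,3)] by simp
qed

lemma Gf_fl: assumes "x \<in> Gf th" "0 \<le> t" shows "\<exists>y. fl th x t y"
proof -
 obtain n :: nat where "t < real n" using reals_Archimedean2 by blast
 moreover obtain T y where "T > real n" "fl th x T y" using assms(1) unfolding Gf_def by blast
 ultimately show ?thesis using fl_split[of th x T y t] assms(2) by auto
qed

lemma Q_Hit_Gf: assumes "x \<in> Q" "x \<notin> Hit th" shows "x \<in> Gf th"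
proof -
 have "\<exists>T>real n. \<exists>y\<in>Q. fl th x T y" for n
 proof -
  have "\<not> hits th x s c" for s c using assms unfolding Hit_def by blast
  then obtain y where "fl th x (real n) y" using fl_or_hits[OF Q_Qp[OF assms(1)] of_nat_0_le_iff] by blast
  from fl_into_Q[OF this zero_less_one] show ?thesis by metis
 qed
 thus ?thesis using assms(1) by (simp add: Gf_def)
qed

lemma borel_Gf: "Gf th \<in> sets borel"
proof -
 have "open {x \<in> Q. \<exists>T>r. \<exists>y\<in>Q. fl th x T y}" for r
 proof (rule shift_open)
  fix x assume "x \<in> {x \<in> Q. \<exists>T>r. \<exists>y\<in>Q. fl th x T y}"
  then obtain T y where "x \<in> Q" "T > r" "y \<in> Q" "fl th x T y" by blast
  thus "\<exists>\<epsilon>>0. \<forall>u. cmod u < \<epsilon> --> shift x u \<in> {x \<in> Q. \<exists>T>r. \<exists>y\<in>Q. fl th x T y}" using fl_stable by blast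
 qed
 hence "(\<Inter>n::nat. {x \<in> Q. \<exists>T>real n. \<exists>y\<in>Q. fl th x T y}) \<in> sets borel" by (intro sets.countable_INT) auto
 moreover have "Gf th = (\<Inter>n::nat. {x \<in> Q. \<exists>T>real n. \<exists>y\<in>Q. fl th x T y})" unfolding Gf_def by auto
 ultimately show ?thesis by simp
qed

lemma borel_Gam: "Gam th \<in> sets borel" unfolding Gam_def using borel_Gf by blast

lemma Gam_Q: "Gam th \<subseteq> Q" by (auto simp: Gam_def Gf_def)

lemma Gam_conull: "Q - Gam th \<in> null_sets mu"
proof -
 obtain Z Z' where Z: "Z \<in> null_sets mu" "Hit th \<subseteq> Z" and Z': "Z' \<in> null_sets mu" "Hit (th + pi) \<subseteq> Z'" using Hit_null by meson
 have "Q - Gam th \<subseteq> Z \<union> Z'" using Q_Hit_Gf Z(2) Z'(2) unfolding Gam_def by blast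
 thus ?thesis using open_Q borel_Gam by (intro null_sets_subset[OF null_sets.Un[OF Z(1) Z'(1)]]) auto
qed

section \<open>The ergodic alternative\<close>

lemma flow_rel_regular: "flow_rel X th t p q ==> p \<notin> singularities X"
 unfolding flow_rel_orbit orbit_on_def by auto

lemma mv_flow_rel: assumes "x \<in> Qp th" "proj X x \<notin> singularities X" "0 \<le> s" "s < ext th x"
 shows "flow_rel X th s (proj X x) (proj X (mv th x s))"
proof -
 have m: "min 0 s = 0" "max 0 s = s" using assms(3) by auto
 have "straight_curve X th 0 s (\<lambda>t. proj X (mv th x t))" using ext_curve[OF assms(1)] assms(4) by simp
 moreover have "proj X (mv th x t) \<notin> singularities X" if "0 \<le> t" "t \<le> s" for t
  using assms(2) not_VP_regular[OF inn_not_VP[OF mv_Q[OF assms(1)]]] that assms(4) by (cases "t = 0") auto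
 ultimately show ?thesis unfolding flow_rel_def m by (intro exI[of _ "\<lambda>t. proj X (mv th x t)"]) auto
qed

lemma borel_Qp: "Qp th \<in> sets borel"
proof -
 define O' where "O' a b = {x. fst x < N \<and> (\<forall>s. a \<le> s \<and> s \<le> b --> snd x + ray th s \<in> inn (fst x))}" for a b
 have "open (O' a b)" for a b
 proof (rule shift_open)
  fix x assume "x \<in> O' a b"
  hence x: "fst x < N" "\<And>s. a \<le> s ==> s \<le> b ==> snd x + ray th s \<in> inn (fst x)" by (auto simp: O'_def)
  obtain e where "e > 0" "\<And>s u. a \<le> s ==> s \<le> b ==> cmod u < e ==> snd x + ray th s + u \<in> inn (fst x)"
   using segment_margin[OF x] by blast
  thus "\<exists>\<epsilon>>0. \<forall>u. cmod u < \<epsilon> --> shift x u \<in> O' a b"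
   using x(1) by (intro exI[of _ e]) (auto simp: O'_def algebra_simps)
 qed
 hence "(\<Union>m::nat. \<Inter>k::nat. O' (1 / real (Suc k)) (1 / real (Suc m))) \<in> sets borel"
  by (intro sets.countable_UN sets.countable_INT) auto
 moreover have "Qp th = (\<Union>m::nat. \<Inter>k::nat. O' (1 / real (Suc k)) (1 / real (Suc m)))"
 proof (intro equalityI subsetI)
  fix x assume x: "x \<in> Qp th"
  obtain m where m: "1 / real (Suc m) < ext th x" using nat_approx_posE[OF ext(1)[OF x]] by blast
  hence "x \<in> O' (1 / real (Suc k)) (1 / real (Suc m))" for k
   unfolding O'_def
  proof (intro CollectI conjI allI impI)
   fix s assume s: "1 / real (Suc k) \<le> s \<and> s \<le> 1 / real (Suc m)"
   have "0 < 1 / real (Suc k)" by simp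
   hence "0 < s" using s by linarith
   moreover have "s < ext th x" using s m by linarith
   ultimately show "snd x + ray th s \<in> inn (fst x)" by (rule ext(3)[OF x])
  qed (rule Qp_fst[OF x])
  thus "x \<in> (\<Union>m::nat. \<Inter>k::nat. O' (1 / real (Suc k)) (1 / real (Suc m)))" by blast
 next
  fix x assume "x \<in> (\<Union>m::nat. \<Inter>k::nat. O' (1 / real (Suc k)) (1 / real (Suc m)))"
  then obtain m where m: "\<And>k. x \<in> O' (1 / real (Suc k)) (1 / real (Suc m))" by blast
  show "x \<in> Qp th"
  proof (rule QpI[of _ "1 / real (Suc m)"])
   show "fst x < N" using m[of 0] by (simp add: O'_def)
   fix s :: real assume s: "0 < s" "s < 1 / real (Suc m)"
   obtain k where "1 / real (Suc k) < s" using nat_approx_posE[OF s(1)] by blast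
   thus "snd x + ray th s \<in> inn (fst x)" using m[of k] s unfolding O'_def by auto
  qed simp
 qed
 ultimately show ?thesis by simp
qed

text \<open>Ergodicity concerns invariant sets of the surface. The set \<open>S\<close> of interior
 points is extended to sides and vertices by declaring a boundary point a member if its orbit is in
 \<open>S\<close> immediately afterwards; the image of this extension is invariant along all
 complete orbits.\<close>

theorem ergodic_dichotomy:
 assumes erg: "ergodic_direction X th" and S: "S \<in> sets borel" "S \<subseteq> Gam th"
  and inv: "\<And>x y t. x \<in> Q ==> y \<in> Q ==> fl th x t y ==> x \<in> S \<longleftrightarrow> y \<in> S"
 shows "S \<in> null_sets mu \<or> Q - S \<in> null_sets mu"
proof -
 define E where "E = {x \<in> Qp th. \<exists>m0. \<forall>m\<ge>m0. mv th x (1 / real (Suc m)) \<in> S}"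
 define A where "A = proj X ` E"
 have SQ: "S \<subseteq> Q" using S(2) Gam_Q by blast
 have mvm: "(\<lambda>x. mv th x s) -` S \<in> sets borel" for s
 proof -
  have "(\<lambda>x. mv th x s) \<in> borel_measurable borel" unfolding mv_def
   by (intro borel_measurable_continuous_onI continuous_intros)
  from measurable_sets[OF this S(1)] show ?thesis by simp
 qed
 have "E = Qp th \<inter> (\<Union>m0. \<Inter>m\<in>{m0..}. (\<lambda>x. mv th x (1 / real (Suc m))) -` S)" unfolding E_def by auto
 hence Eb: "E \<in> sets borel" using borel_Qp mvm by auto
 have EP: "E \<subseteq> poly_union X" using Qp_union by (auto simp: E_def)
 have A: "A \<in> sets area" unfolding A_def by (rule image_PU[OF Eb EP])
 have E_hit: "\<exists>s. 0 < s \<and> s < ext th x \<and> mv th x s \<in> S" if xE: "x \<in> E" for x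
 proof -
  have x: "x \<in> Qp th" using xE by (simp add: E_def)
  obtain m0 where m0: "\<And>m. m \<ge> m0 ==> mv th x (1 / real (Suc m)) \<in> S" using xE unfolding E_def by blast
  obtain k where k: "1 / real (Suc k) < ext th x" using nat_approx_posE[OF ext(1)[OF x]] by blast
  have "1 / real (Suc (max k m0)) \<le> 1 / real (Suc k)" by (intro divide_left_mono) auto
  hence "1 / real (Suc (max k m0)) < ext th x" using k by linarith
  thus ?thesis using m0[of "max k m0"] by (intro exI[of _ "1 / real (Suc (max k m0))"]) auto
 qed
 have E_I: "y \<in> E" if y: "y \<in> Qp th" and yS: "\<And>s. 0 < s ==> s < ext th y ==> mv th y s \<in> S" for y
 proof -
  obtain k where k: "1 / real (Suc k) < ext th y" using nat_approx_posE[OF ext(1)[OF y]] by blast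
  have "mv th y (1 / real (Suc m)) \<in> S" if "m \<ge> k" for m
  proof (rule yS)
   have "1 / real (Suc m) \<le> 1 / real (Suc k)" using that by (intro divide_left_mono) auto
   thus "1 / real (Suc m) < ext th y" using k by linarith
  qed simp
  thus ?thesis using y unfolding E_def by blast
 qed
 have E_S: "x \<in> E \<longleftrightarrow> x \<in> S" if xQ: "x \<in> Q" for x
 proof -
  have x: "x \<in> Qp th" using Q_Qp[OF xQ] .
  have *: "mv th x s \<in> S \<longleftrightarrow> x \<in> S" if "0 < s" "s < ext th x" for s
   using inv[OF xQ mv_Q[OF x that] fl.fl_move[OF x less_imp_le[OF that(1)] that(2)]] by simp
  show ?thesis using E_hit[of x] E_I[OF x] * by blast
 qed
 have key: "q \<in> A" if yS: "y \<in> S" and f: "flow_rel X th t (proj X y) q" for y t q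
 proof -
  have yQ: "y \<in> Q" using yS SQ by blast
  obtain n :: nat where n: "\<bar>t\<bar> < real n" using reals_Archimedean2 by blast
  have "y \<in> Gf (th + pi)" using yS S(2) by (auto simp: Gam_def)
  then obtain T z where T: "T > real n" and z: "z \<in> Q" "fl (th + pi) y T z" unfolding Gf_def by blast
  have zy: "fl th z T y" using fl_rev_iff[OF z(1) yQ] z(2) by blast
  have zS: "z \<in> S" using inv[OF z(1) yQ zy] yS by blast
  have tT: "0 \<le> T + t" using T n by linarith
  have "z \<in> Gf th" using zS S(2) by (auto simp: Gam_def)
  then obtain y' where y': "fl th z (T + t) y'" using Gf_fl tT by blast
  have "flow_rel X th (- T) (proj X y) (proj X z)" using flow_rel_inv[OF fl_flow_rel[OF z(1) zy]] .
  from flow_rel_tri[OF this f] have "flow_rel X th (T + t) (proj X z) q" by (simp add: add.commute)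
  hence q: "q = proj X y'" using flow_rel_unique fl_flow_rel[OF z(1) y'] by blast
  have y'Q: "y' \<in> Qp th" using fl_Qp y' by blast
  have "y' \<in> E"
  proof (rule E_I[OF y'Q])
   fix s assume s: "0 < s" "s < ext th y'"
   have "fl th z (T + t + s) (mv th y' s)" using fl_trans[OF y' fl.fl_move[OF y'Q less_imp_le[OF s(1)] s(2)]] .
   thus "mv th y' s \<in> S" using inv[OF z(1) mv_Q[OF y'Q s]] zS by blast
  qed
  thus ?thesis unfolding q A_def by blast
 qed
 have fwd: "flow X th t p \<in> A" if p: "p \<in> complete_points X th" "p \<in> A" for p t
 proof -
  obtain x where x: "x \<in> E" "p = proj X x" using p(2) unfolding A_def by blast
  obtain s where s: "0 < s" "s < ext th x" "mv th x s \<in> S" using E_hit[OF x(1)] by blast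
  have xQ: "x \<in> Qp th" using x(1) by (simp add: E_def)
  have f: "flow_rel X th t p (flow X th t p)" by (rule complete_flow(1)[OF p(1)])
  have "proj X x \<notin> singularities X" using flow_rel_regular[OF f] x(2) by simp
  hence "flow_rel X th s p (proj X (mv th x s))" using mv_flow_rel[OF xQ] s x(2) by simp
  from flow_rel_tri[OF this f] show ?thesis using key[OF s(3)] by blast
 qed
 have "flow_invariant X th A" unfolding flow_invariant_def
 proof (intro allI ballI iffI)
  fix t p assume p: "p \<in> complete_points X th"
  show "flow X th t p \<in> A" if "p \<in> A" using fwd p that by blast
  show "p \<in> A" if "flow X th t p \<in> A" using fwd[OF complete_flow(2)[OF p] that, of "- t"] complete_flow(3)[OF p] by simp
 qed
 then consider "A \<in> null_sets area" | "points X - A \<in> null_sets area" using erg A unfolding ergodic_direction_def by blast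
 thus ?thesis
 proof cases
  case 1
  have "proj X ` S \<subseteq> A" using E_S SQ unfolding A_def by blast
  hence "emeasure area (proj X ` S) \<le> emeasure area A" using A by (intro emeasure_mono)
  hence "emeasure mu S = 0" using image_Q(2)[OF S(1) SQ] null_setsD1[OF 1] by simp
  thus ?thesis using S(1) by (intro disjI1 null_setsI) auto
 next
  case 2
  have b: "Q - S \<in> sets borel" "Q - S \<subseteq> Q" using S(1) open_Q by auto
  have "proj X ` (Q - S) \<subseteq> points X - A"
  proof
   fix p assume "p \<in> proj X ` (Q - S)"
   then obtain x where x: "x \<in> Q" "x \<notin> S" "p = proj X x" by blast
   have "p \<notin> A"
   proof
    assume "p \<in> A"
    then obtain x' where x': "x' \<in> E" "proj X x = proj X x'" using x(3) unfolding A_def by blast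
    hence "x' = x" using inj_Q[OF x(1)] EP by blast
    thus False using E_S[OF x(1)] x'(1) x(2) by blast
   qed
   thus "p \<in> points X - A" using x proj_points Q_union by blast
  qed
  hence "emeasure area (proj X ` (Q - S)) \<le> emeasure area (points X - A)" using 2 by (intro emeasure_mono) auto
  hence "emeasure mu (Q - S) = 0" using image_Q(2)[OF b] null_setsD1[OF 2] by simp
  thus ?thesis using b by (intro disjI2 null_setsI) auto
 qed
qed

section \<open>Two bounds on the hitting exponent\<close>

lemma shift_open2:
 assumes "\<And>x y. (x, y) \<in> S ==> \<exists>\<epsilon>>0. \<forall>u w. cmod u < \<epsilon> --> cmod w < \<epsilon> --> (shift x u, shift y w) \<in> S"
 shows "S \<in> sets mu2"
proof -
 have "open S"
 proof (subst open_subopen, intro ballI)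
  fix p assume p: "p \<in> S"
  obtain x y where xy: "p = (x, y)" by (cases p)
  obtain e where e: "e > 0" "\<And>u w. cmod u < e ==> cmod w < e ==> (shift x u, shift y w) \<in> S" using assms p xy by blast
  let ?B = "\<lambda>x. {fst x} \<times> ball (snd x) e :: (nat \<times> complex) set"
  have o: "open (?B x \<times> ?B y)" by (intro open_Times open_nat_Times open_ball)
  have m: "p \<in> ?B x \<times> ?B y" using e(1) by (cases x, cases y) (simp add: xy)
  have B: "\<exists>u. cmod u < e \<and> x' = shift x u" if "x' \<in> ?B x" for x x'
   using that by (intro exI[of _ "snd x' - snd x"]) (auto simp: prod_eq_iff dist_norm norm_minus_commute)
  have "?B x \<times> ?B y \<subseteq> S"
  proof
   fix q assume "q \<in> ?B x \<times> ?B y"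
   hence q: "fst q \<in> ?B x" "snd q \<in> ?B y" unfolding mem_Times_iff by blast+
   obtain u where u: "cmod u < e" "fst q = shift x u" using B[OF q(1)] by blast
   obtain w where w: "cmod w < e" "snd q = shift y w" using B[OF q(2)] by blast
   have "(fst q, snd q) \<in> S" unfolding u(2) w(2) by (rule e(2)[OF u(1) w(1)])
   thus "q \<in> S" unfolding prod.collapse .
  qed
  thus "\<exists>T. open T \<and> p \<in> T \<and> T \<subseteq> S" using o m by blast
 qed
 thus ?thesis unfolding sets_mumu by (rule borel_open)
qed

lemma Q_ball: assumes "y \<in> Q" obtains r where "r > 0" "ball (snd y) r \<subseteq> inn (fst y)"
 using assms open_inn open_contains_ball unfolding Q_iff by blast

lemma chart_Q: "y \<in> Q ==> ball (snd y) r \<subseteq> inn (fst y) ==> fst v = fst y ==> dist (snd v) (snd y) < r ==> v \<in> Q"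
 by (auto simp: Q_iff subset_iff dist_commute)

lemma chart_move: assumes "y \<in> Q" "ball (snd y) r \<subseteq> inn (fst y)" "fst v = fst y" "0 \<le> s" "dist (snd v) (snd y) + s < r"
 shows "fl th v s (mv th v s)" "mv th v s \<in> Q"
proof -
 have d: "dist (snd v + ray th t) (snd y) < r" if "0 \<le> t" "t \<le> s" for t
 proof -
  have "dist (snd v + ray th t) (snd y) \<le> dist (snd v + ray th t) (snd v) + dist (snd v) (snd y)" by (rule dist_triangle)
  also have "dist (snd v + ray th t) (snd v) = t" using that by (simp add: dist_norm norm_mult)
  finally show ?thesis using that assms(5) by linarith
 qed
 have v: "v \<in> Q" using chart_Q[OF assms(1-3)] assms(4,5) by simp
 have "s < ext th v"
 proof (rule ext_gt[OF Q_Qp[OF v]])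
  fix t assume "0 < t" "t \<le> s"
  thus "snd v + ray th t \<in> inn (fst v)" using d[of t] assms(2,3) by (auto simp: subset_iff dist_commute)
 qed
 thus "fl th v s (mv th v s)" using fl.fl_move[OF Q_Qp[OF v] assms(4)] by blast
 show "mv th v s \<in> Q" by (rule chart_Q[OF assms(1,2)]) (use assms(3,4) d[of s] in auto)
qed

lemma flow_fl: assumes "x \<in> Q" "fl th x t v" shows "flow X th t (proj X x) = proj X v" "flow_defined X th t (proj X x)"
 using flow_eq[OF fl_flow_rel[OF assms]] fl_flow_rel[OF assms] unfolding flow_defined_def by blast+

text \<open>Pairs such that the orbit of \<open>x\<close> is at time \<open>t\<close> in the disc of
 radius \<open>\<rho>\<close> around \<open>y\<close>, measured inside one polygon.\<close>

definition NB :: "real => real => real => ((nat \<times> complex) \<times> (nat \<times> complex)) set" where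
 "NB th t \<rho> = {(x, y). x \<in> Q \<and> y \<in> Q \<and> (\<exists>v\<in>Q. fl th x t v \<and> fst v = fst y \<and> dist (snd v) (snd y) < \<rho>)}"

lemma NB_nbhd: assumes "(x, y) \<in> NB th t \<rho>"
 shows "\<exists>\<epsilon>>0. \<forall>u w. cmod u < \<epsilon> --> cmod w < \<epsilon> --> (shift x u, shift y w) \<in> NB th t \<rho>"
proof -
 from assms obtain v where v: "x \<in> Q" "y \<in> Q" "v \<in> Q" "fl th x t v" "fst v = fst y" "dist (snd v) (snd y) < \<rho>" unfolding NB_def by blast
 obtain e where e: "e > 0" "\<And>u. cmod u < e ==> shift x u \<in> Q \<and> shift v u \<in> Q \<and> fl th (shift x u) t (shift v u)" using fl_stable[OF v(1,3,4)] by blast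
 obtain e' where e': "e' > 0" "\<And>u. cmod u < e' ==> shift y u \<in> Q" using shift_Q[OF v(2)] by blast
 let ?e = "min (min e e') ((\<rho> - dist (snd v) (snd y)) / 2)"
 have "(shift x u, shift y w) \<in> NB th t \<rho>" if h: "cmod u < ?e" "cmod w < ?e" for u w
 proof -
  have "dist (snd v + u) (snd y + w) \<le> dist (snd v) (snd y) + (cmod u + cmod w)"
  proof -
   have "dist (snd v + u) (snd y + w) = cmod ((snd v - snd y) + (u - w))" by (simp add: dist_norm algebra_simps)
   also have "\<dots> \<le> cmod (snd v - snd y) + cmod (u - w)" by (rule norm_triangle_ineq)
   finally show ?thesis using norm_triangle_ineq4[of u w] by (simp add: dist_norm)
  qed
  also have "\<dots> < \<rho>" using h by simp
  finally have "dist (snd (shift v u)) (snd (shift y w)) < \<rho>" by simp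
  moreover have "shift x u \<in> Q" "shift v u \<in> Q" "fl th (shift x u) t (shift v u)" "shift y w \<in> Q" "fst (shift v u) = fst (shift y w)"
   using e(2)[of u] e'(2)[of w] h v(5) by simp_all
  ultimately show ?thesis unfolding NB_def by blast
 qed
 thus ?thesis using e(1) e'(1) v(6) by (intro exI[of _ ?e]) simp
qed

lemma NB_sets: "NB th t \<rho> \<in> sets mu2"
 by (rule shift_open2) (rule NB_nbhd)

lemma mu_Q_finite: "emeasure mu Q < \<infinity>"
proof -
 have "emeasure mu Q \<le> emeasure mu (poly_union X)" using Q_union borel_PU by (intro emeasure_mono) auto
 thus ?thesis using mu_PU_finite by (rule le_less_trans)
qed

lemma mu_Q_measure: "emeasure mu Q = ennreal (measure mu Q)"
 using mu_Q_finite by (intro emeasure_eq_ennreal_measure) simp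

lemma NB_le: assumes "0 \<le> \<rho>" shows "emeasure mu2 (NB th t \<rho>) \<le> ennreal (pi * \<rho>\<^sup>2 * measure mu Q)"
proof -
 have "emeasure mu (Pair x -` NB th t \<rho>) \<le> ennreal (pi * \<rho>\<^sup>2) * indicator Q x" for x
 proof (cases "\<exists>v\<in>Q. x \<in> Q \<and> fl th x t v")
  case True
  then obtain v where v: "v \<in> Q" "x \<in> Q" "fl th x t v" by blast
  have "Pair x -` NB th t \<rho> \<subseteq> {fst v} \<times> ball (snd v) \<rho>"
   using fl_det[OF v(3)] unfolding NB_def by (auto simp: mem_Times_iff)
  hence "emeasure mu (Pair x -` NB th t \<rho>) \<le> emeasure mu ({fst v} \<times> ball (snd v) \<rho>)"
   by (rule emeasure_mono) (simp add: borel_open open_nat_Times)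
  also have "\<dots> = ennreal (pi * \<rho>\<^sup>2)" by (simp add: emeasure_mu_Times emeasure_ball unit_ball_vol_2 assms)
  finally show ?thesis using v(2) by simp
 next
  case False
  hence "Pair x -` NB th t \<rho> = {}" unfolding NB_def by blast
  thus ?thesis by simp
 qed
 hence "emeasure mu2 (NB th t \<rho>) \<le> (\<integral>\<^sup>+x. ennreal (pi * \<rho>\<^sup>2) * indicator Q x \<partial>mu)"
  unfolding mu.emeasure_pair_measure_alt[OF NB_sets] by (intro nn_integral_mono)
 also have "\<dots> = ennreal (pi * \<rho>\<^sup>2) * emeasure mu Q" using open_Q by (intro nn_integral_cmult_indicator) simp
 also have "\<dots> = ennreal (pi * \<rho>\<^sup>2 * measure mu Q)" unfolding mu_Q_measure by (rule ennreal_mult[symmetric]) auto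
 finally show ?thesis .
qed

text \<open>Within a time step of \<open>1 / 2 ^ n\<close> an orbit moves by at most \<open>1 / 2 ^
 n\<close>. So a visit to the disc of this radius before time \<open>T n\<close> is still seen at
 the next multiple of the time step, in the disc of twice the radius. The measure of \<open>E
 n\<close> is of order \<open>T n / 2 ^ n\<close>, hence of order \<open>2 powr (- \<epsilon> *
 n)\<close>. The factor \<open>Suc n\<close> in \<open>T\<close> allows for radii between \<open>1 /
 2 ^ Suc n\<close> and \<open>1 / 2 ^ n\<close>.\<close>

theorem hitting_exponent_ge:
 assumes \<epsilon>: "0 < \<epsilon>" "\<epsilon> < 1"
 shows "\<exists>Z\<in>null_sets mu2. \<forall>x\<in>Q - Hit th. \<forall>y\<in>Q. (x, y) \<notin> Z -->
  ereal (1 - \<epsilon>) \<le> lower_hitting_exponent X th (proj X x) (proj X y)"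
proof -
 define T where "T n = 2 powr (real (Suc n) * (1 - \<epsilon>))" for n :: nat
 define K where "K n = nat \<lceil>T n * 2 ^ n\<rceil>" for n
 define E where "E n = (\<Union>k\<le>K n. NB th (real k / 2 ^ n) (2 / 2 ^ n))" for n
 have Es: "E n \<in> sets mu2" for n unfolding E_def by (intro sets.finite_UN NB_sets) auto
 define C where "C = 4 * pi * measure mu Q"
 have C: "0 \<le> C" by (simp add: C_def)
 have Tpos: "0 < T n" for n by (simp add: T_def)
 have Ebound: "emeasure mu2 (E n) \<le> ennreal (C * (T n / 2 ^ n + 2 / 4 ^ n))" for n
 proof -
  have "emeasure mu2 (E n) \<le> (\<Sum>k\<le>K n. emeasure mu2 (NB th (real k / 2 ^ n) (2 / 2 ^ n)))"
   unfolding E_def using NB_sets by (intro emeasure_subadditive_finite) blast+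
  also have "\<dots> \<le> (\<Sum>k\<le>K n. ennreal (C / 4 ^ n))"
  proof (rule sum_mono)
   fix k
   have "(2 / 2 ^ n)\<^sup>2 = (4 / 4 ^ n :: real)" by (simp add: power_divide power_mult_distrib power_even_eq flip: power_mult)
     (simp add: power_mult power2_eq_square flip: power_mult_distrib)
   hence "pi * (2 / 2 ^ n)\<^sup>2 * measure mu Q = C / 4 ^ n" by (simp add: C_def)
   thus "emeasure mu2 (NB th (real k / 2 ^ n) (2 / 2 ^ n)) \<le> ennreal (C / 4 ^ n)"
    using NB_le[of "2 / 2 ^ n" th "real k / 2 ^ n"] by simp
  qed
  also have "\<dots> = ennreal ((real (K n) + 1) * (C / 4 ^ n))" using C by (subst sum_ennreal) (auto simp: algebra_simps)
  also have "\<dots> \<le> ennreal ((T n * 2 ^ n + 2) * (C / 4 ^ n))"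
  proof (intro ennreal_leI mult_right_mono)
   have "0 \<le> T n * 2 ^ n" using Tpos[of n] by simp
   thus "real (K n) + 1 \<le> T n * 2 ^ n + 2" unfolding K_def by linarith
  qed (use C in simp)
  also have "(T n * 2 ^ n + 2) * (C / 4 ^ n) = C * (T n / 2 ^ n + 2 / 4 ^ n)"
  proof -
   have "(4 :: real) ^ n = 2 ^ n * 2 ^ n" by (simp flip: power_mult_distrib)
   thus ?thesis by (simp add: field_simps)
  qed
  finally show ?thesis .
 qed
 have sm: "summable (\<lambda>n. measure mu2 (E n))"
 proof (rule summable_comparison_test')
  have "T n / 2 ^ n = 2 powr (1 - \<epsilon>) * (2 powr (- \<epsilon>)) ^ n" for n
  proof -
   have "T n / 2 ^ n = 2 powr (real (Suc n) * (1 - \<epsilon>)) / 2 powr real n" by (simp add: T_def powr_realpow)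
   also have "\<dots> = 2 powr ((1 - \<epsilon>) + (- \<epsilon>) * real n)" by (simp add: powr_diff[symmetric] algebra_simps)
   also have "\<dots> = 2 powr (1 - \<epsilon>) * (2 powr (- \<epsilon>)) ^ n" by (simp only: powr_add powr_powr[symmetric] powr_realpow[OF powr_gt_zero[THEN iffD2]])
   finally show ?thesis .
  qed
  moreover have "2 / 4 ^ n = 2 * (1 / 4 :: real) ^ n" for n by (simp add: power_divide)
  moreover have "summable (\<lambda>n. C * (2 powr (1 - \<epsilon>) * (2 powr (- \<epsilon>)) ^ n + 2 * (1 / 4 :: real) ^ n))"
  proof -
   have "2 powr (- \<epsilon>) < (1 :: real)" using powr_less_mono[of "- \<epsilon>" 0 2] \<epsilon> by simp
   thus ?thesis by (intro summable_mult summable_add summable_geometric) auto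
  qed
  ultimately show "summable (\<lambda>n. C * (T n / 2 ^ n + 2 / 4 ^ n))" by simp
  fix n :: nat
  have "0 \<le> C * (T n / 2 ^ n + 2 / 4 ^ n)" using C Tpos[of n] by simp
  thus "norm (measure mu2 (E n)) \<le> C * (T n / 2 ^ n + 2 / 4 ^ n)"
   using Ebound[of n] unfolding measure_def by (simp add: enn2real_leI)
 qed
 have fin: "emeasure mu2 (E n) < \<infinity>" for n using Ebound[of n] by (rule le_less_trans) simp
 have "AE p in mu2. eventually (\<lambda>n. p \<in> space mu2 - E n) sequentially"
  by (rule borel_cantelli_AE1[OF Es fin sm])
 then obtain Z where Z: "Z \<in> null_sets mu2" "{p \<in> space mu2. \<not> eventually (\<lambda>n. p \<in> space mu2 - E n) sequentially} \<subseteq> Z"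
  unfolding eventually_ae_filter by blast
 have "ereal (1 - \<epsilon>) \<le> lower_hitting_exponent X th (proj X x) (proj X y)"
  if x: "x \<in> Q" "x \<notin> Hit th" and y: "y \<in> Q" and nZ: "(x, y) \<notin> Z" for x y
 proof -
  have "(x, y) \<in> space mu2" by (simp add: space_pair_measure)
  hence "eventually (\<lambda>n. (x, y) \<in> space mu2 - E n) sequentially" using Z(2) nZ by blast
  hence "eventually (\<lambda>n. (x, y) \<notin> E n) sequentially" by (rule eventually_mono) blast
  then obtain n0 where n0: "\<And>n. n0 \<le> n ==> (x, y) \<notin> E n" unfolding eventually_sequentially by blast
  obtain r0 where r0: "r0 > 0" "ball (snd y) r0 \<subseteq> inn (fst y)" using Q_ball[OF y] by blast
  define b where "b = min (r0 / 4) ((1 / 2) ^ Suc n0)"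
  have b: "b > 0" "b \<le> r0 / 4" "b \<le> (1 / 2) ^ Suc n0" using r0 by (auto simp: b_def)
  have "ereal (1 - \<epsilon>) \<le> hit_ratio X th (proj X x) (proj X y) r" if r: "0 < r" "r < b" for r
  proof -
   define m where "m = (LEAST m. (1 / 2) ^ m \<le> r)"
   obtain m' where "(1 / 2) ^ m' < r" using real_arch_pow_inv[OF r(1), of "1 / 2"] by auto
   hence "(1 / 2) ^ m' \<le> r" by (rule less_imp_le)
   hence m: "(1 / 2) ^ m \<le> r" unfolding m_def by (rule LeastI[of "\<lambda>m. (1 / 2) ^ m \<le> r" m'])
   have "Suc n0 < m"
   proof (rule ccontr)
    assume "\<not> Suc n0 < m"
    hence "(1 / 2 :: real) ^ Suc n0 \<le> (1 / 2) ^ m" by (intro power_decreasing) auto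
    thus False using m b(3) r(2) by linarith
   qed
   then obtain n where n: "m = Suc n" "n0 \<le> n" by (cases m) auto
   have "\<not> (1 / 2) ^ n \<le> r" using not_less_Least[of n "\<lambda>m. (1 / 2) ^ m \<le> r"] n(1) unfolding m_def by simp
   hence rn: "r < 1 / 2 ^ n" by (simp add: power_one_over)
   have rn': "1 / 2 ^ n \<le> 2 * r" using m n(1) by (simp add: power_one_over)
   have r1: "r < 1" using rn by (rule less_le_trans) simp
   let ?H = "hit_times X th (proj X x) (proj X y) r"
   have HT: "T n < t" if t: "t \<in> ?H" for t
   proof (rule ccontr)
    assume "\<not> T n < t"
    hence tT: "t \<le> T n" by simp
    have t: "r < t" "flow_defined X th t (proj X x)" "flat_dist X (flow X th t (proj X x)) (proj X y) < r"
     using t unfolding hit_times_def by auto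
    obtain v where v: "fl th x t v" using Gf_fl[OF Q_Hit_Gf[OF x]] t(1) r(1) by (meson less_imp_le less_trans)
    have vQp: "v \<in> Qp th" using fl_Qp v by blast
    note f = flow_fl(1)[OF x(1) v]
    have "ball (snd y) r \<subseteq> inn (fst y)" using r0(2) subset_ball[of r r0 "snd y"] r b(2) by auto
    then obtain w where w: "proj X v = proj X (fst y, w)" "dist (snd y) w < r"
     using flat_dist_locate[OF y _ proj_points[OF Qp_union[OF vQp]]] t(3) unfolding f by blast
    have "(fst y, w) \<in> Q" by (rule chart_Q[OF y r0(2)]) (use w(2) r b(2) in \<open>auto simp: dist_commute\<close>)
    hence vw: "v = (fst y, w)" using inj_Q[OF _ Qp_union[OF vQp]] w(1) by metis
    define k where "k = nat \<lceil>t * 2 ^ n\<rceil>"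
    have "0 \<le> t * 2 ^ n" using t(1) r(1) by simp
    hence k: "t * 2 ^ n \<le> real k" "real k < t * 2 ^ n + 1" unfolding k_def by linarith+
    define s where "s = real k / 2 ^ n - t"
    have "t \<le> real k / 2 ^ n" using k(1) by (simp add: pos_le_divide_eq)
    moreover have "real k / 2 ^ n < (t * 2 ^ n + 1) / 2 ^ n" using k(2) by (intro divide_strict_right_mono) auto
    ultimately have s: "0 \<le> s" "s < 1 / 2 ^ n" by (auto simp: s_def add_divide_distrib)
    have dd: "dist (snd v) (snd y) + s < 2 / 2 ^ n" using w(2) rn s(2) vw by (simp add: dist_commute)
    have "2 / 2 ^ n \<le> r0" using rn' r(2) b(2) by linarith
    hence lt: "dist (snd v) (snd y) + s < r0" using dd by linarith
    have fv: "fst v = fst y" using vw by simp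
    note cm = chart_move[OF y r0(2) fv s(1) lt, of th]
    have "fl th x (real k / 2 ^ n) (mv th v s)" using fl_trans[OF v cm(1)] by (simp add: s_def)
    moreover have "dist (snd (mv th v s)) (snd y) < 2 / 2 ^ n"
    proof -
     have "dist (snd (mv th v s)) (snd y) \<le> dist (snd (mv th v s)) (snd v) + dist (snd v) (snd y)" by (rule dist_triangle)
     also have "dist (snd (mv th v s)) (snd v) = s" using s(1) by (simp add: dist_norm norm_mult)
     finally show ?thesis using dd by linarith
    qed
    ultimately have "(x, y) \<in> NB th (real k / 2 ^ n) (2 / 2 ^ n)" unfolding NB_def using x(1) y cm(2) fv by auto
    moreover have "k \<le> K n" unfolding k_def K_def using tT by (intro nat_mono ceiling_mono mult_right_mono) auto
    ultimately have "(x, y) \<in> E n" unfolding E_def by blast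
    thus False using n0[OF n(2)] by blast
   qed
   show ?thesis
   proof (cases "?H = {}")
    case False
    hence "T n \<le> Inf ?H" using HT by (intro cInf_greatest) (auto intro: less_imp_le)
    hence "ln (T n) \<le> ln (Inf ?H)" using Tpos[of n] by (intro ln_mono) auto
    moreover have "ln (T n) = real (Suc n) * (1 - \<epsilon>) * ln 2" unfolding T_def by (simp add: ln_powr)
    ultimately have 1: "(1 - \<epsilon>) * (real (Suc n) * ln 2) \<le> ln (Inf ?H)" by (simp add: mult_ac)
    have "ln ((1 / 2) ^ Suc n) \<le> ln r" using m n(1) r(1) by (intro ln_mono) auto
    moreover have "ln ((1 / 2) ^ Suc n) = real (Suc n) * ln (1 / 2 :: real)" by (rule ln_realpow)
    moreover have "ln (1 / 2) = - ln (2 :: real)" by (simp add: ln_div)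
    ultimately have "- ln r \<le> real (Suc n) * ln 2" by (simp add: algebra_simps)
    hence "(1 - \<epsilon>) * (- ln r) \<le> (1 - \<epsilon>) * (real (Suc n) * ln 2)" using \<epsilon> by (intro mult_left_mono) auto
    hence "(1 - \<epsilon>) * (- ln r) \<le> ln (Inf ?H)" using 1 by linarith
    moreover have "0 < - ln r" using r(1) r1 by simp
    ultimately have "1 - \<epsilon> \<le> ln (Inf ?H) / (- ln r)" by (simp only: pos_le_divide_eq)
    thus ?thesis unfolding hit_ratio_def using False by simp
   qed (simp add: hit_ratio_def)
  qed
  thus ?thesis unfolding lower_hitting_exponent_def
   by (intro Liminf_bounded) (use b(1) eventually_at_right[of 0 b] in blast)
 qed
 thus ?thesis using Z(1) by blast
qed

text \<open>Pairs such that the orbit of \<open>x\<close> is within \<open>\<kappa> / t\<close> of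
 \<open>y\<close> at some time \<open>t > n\<close>.\<close>

definition Vs :: "real => real => nat => ((nat \<times> complex) \<times> (nat \<times> complex)) set" where
 "Vs th \<kappa> n = (\<Union>t\<in>{real n<..}. NB th t (\<kappa> / t))"

lemma Vs_sets: "Vs th \<kappa> n \<in> sets mu2"
proof (rule shift_open2)
 fix x y assume "(x, y) \<in> Vs th \<kappa> n"
 then obtain t where t: "t \<in> {real n<..}" "(x, y) \<in> NB th t (\<kappa> / t)" unfolding Vs_def by (rule UN_E)
 have "NB th t (\<kappa> / t) \<subseteq> Vs th \<kappa> n" unfolding Vs_def using t(1) by (rule UN_upper)
 thus "\<exists>\<epsilon>>0. \<forall>u w. cmod u < \<epsilon> --> cmod w < \<epsilon> --> (shift x u, shift y w) \<in> Vs th \<kappa> n"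
  using NB_nbhd[OF t(2)] by (meson subsetD)
qed

lemma Vs_iff: "(x, y) \<in> Vs th \<kappa> n \<longleftrightarrow> x \<in> Q \<and> y \<in> Q \<and>
 (\<exists>t>real n. \<exists>v\<in>Q. fl th x t v \<and> fst v = fst y \<and> t * dist (snd v) (snd y) < \<kappa>)"
proof -
 have "dist (snd v) (snd y) < \<kappa> / t \<longleftrightarrow> t * dist (snd v) (snd y) < \<kappa>" if "real n < t" for t and v :: "nat \<times> complex"
 proof -
  have "0 < t" using that by (rule le_less_trans[rotated]) simp
  thus ?thesis by (simp add: pos_less_divide_eq mult.commute)
 qed
 hence "(x, y) \<in> NB th t (\<kappa> / t) \<longleftrightarrow> x \<in> Q \<and> y \<in> Q \<and> (\<exists>v\<in>Q. fl th x t v \<and> fst v = fst y \<and> t * dist (snd v) (snd y) < \<kappa>)" if "real n < t" for t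
  using that by (simp add: NB_def)
 moreover have "(x, y) \<in> Vs th \<kappa> n \<longleftrightarrow> (\<exists>t>real n. (x, y) \<in> NB th t (\<kappa> / t))" unfolding Vs_def by blast
 ultimately show ?thesis by blast
qed

text \<open>At radius \<open>\<kappa> / t\<close> the hitting time is at most \<open>t\<close>, and
 \<open>ln t / (ln t - ln \<kappa>)\<close> tends to 1.\<close>

lemma hitting_exponent_le:
 assumes x: "x \<in> Q" and y: "y \<in> Q" and \<kappa>: "0 < \<kappa>" and V: "\<And>n. (x, y) \<in> Vs th \<kappa> n"
 shows "lower_hitting_exponent X th (proj X x) (proj X y) \<le> 1"
proof (rule ccontr)
 assume "\<not> ?thesis"
 hence "1 < lower_hitting_exponent X th (proj X x) (proj X y)" by simp
 then obtain e' where e': "1 < e'" "e' < lower_hitting_exponent X th (proj X x) (proj X y)" using dense by blast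
 define e where "e = real_of_ereal e' - 1"
 have "e' \<noteq> \<infinity>" "e' \<noteq> - \<infinity>" using e' by auto
 hence ee: "e' = ereal (1 + e)" "0 < e" using e'(1) by (cases e'; simp add: e_def one_ereal_def)+
 have "eventually (\<lambda>r. e' < hit_ratio X th (proj X x) (proj X y) r) (at_right 0)"
  using e'(2) unfolding lower_hitting_exponent_def by (rule less_LiminfD)
 then obtain b where b: "b > 0" "\<And>r. 0 < r ==> r < b ==> e' < hit_ratio X th (proj X x) (proj X y) r"
  using eventually_at_right[of "0::real" 1] by auto
 obtain r0 where r0: "r0 > 0" "ball (snd y) r0 \<subseteq> inn (fst y)" using Q_ball[OF y] by blast
 obtain n :: nat where n: "max (max 1 (\<kappa> + 1)) (max (\<kappa> / min b r0) (exp ((1 + e) * ln \<kappa> / e))) < real n" using reals_Archimedean2 by blast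
 obtain t v where t: "t > real n" "v \<in> Q" "fl th x t v" "fst v = fst y" "t * dist (snd v) (snd y) < \<kappa>" using V[of n] unfolding Vs_iff by blast
 have tt: "1 < t" "\<kappa> + 1 < t" "\<kappa> / min b r0 < t" "exp ((1 + e) * ln \<kappa> / e) < t" using n t(1) by auto
 define r where "r = \<kappa> / t"
 have t0: "0 < t" using tt by linarith
 have r: "0 < r" "r < 1" using \<kappa> tt t0 by (auto simp: r_def)
 have "r < min b r0" 
 proof -
  have "0 < min b r0" using b(1) r0(1) by simp
  hence "\<kappa> < t * min b r0" using tt(3) by (simp only: pos_divide_less_eq)
  hence "\<kappa> < min b r0 * t" by (simp only: mult.commute)
  thus ?thesis unfolding r_def by (simp only: pos_divide_less_eq[OF t0])
 qed
 hence rb: "r < b" "r < r0" by auto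
 have dr: "dist (snd v) (snd y) < r" using t(5) t0 unfolding r_def by (simp add: pos_less_divide_eq mult.commute)
 let ?H = "hit_times X th (proj X x) (proj X y) r"
 note f = flow_fl[OF x t(3)]
 have "closed_segment (snd v) (snd y) \<subseteq> ball (snd y) r0" using dr rb r0(1) by (intro closed_segment_subset) (auto simp: dist_commute)
 hence "closed_segment (snd v) (snd y) \<subseteq> reg (fst y)" using r0(2) inn_reg by blast
 moreover have "fst y < N" using y by (simp add: Q_iff)
 ultimately have "flat_dist X (proj X (fst y, snd v)) (proj X (fst y, snd y)) \<le> dist (snd v) (snd y)" by (intro flat_dist_le)
 hence "flat_dist X (proj X v) (proj X y) < r" using dr unfolding t(4)[symmetric] prod.collapse unfolding t(4) prod.collapse by linarith
 hence tH: "t \<in> ?H" using f r tt unfolding hit_times_def by auto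
 have bd: "bdd_below ?H" unfolding hit_times_def bdd_below_def by (auto intro: less_imp_le)
 have le: "Inf ?H \<le> t" using tH bd by (rule cInf_lower)
 have "r \<le> Inf ?H" using tH by (intro cInf_greatest) (auto simp: hit_times_def)
 hence "ln (Inf ?H) \<le> ln t" using le r by (intro ln_mono) auto
 moreover have lr: "0 < - ln r" using r by simp
 moreover have "ln t \<le> (1 + e) * (- ln r)"
 proof -
  have "(1 + e) * ln \<kappa> / e < ln t" using tt(4) t0 by (metis exp_less_cancel_iff exp_ln)
  hence "(1 + e) * ln \<kappa> < e * ln t" using ee(2) by (simp add: pos_divide_less_eq mult.commute)
  moreover have "- ln r = ln t - ln \<kappa>" using \<kappa> t0 by (simp add: r_def ln_div)
  ultimately show ?thesis by (simp add: algebra_simps)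
 qed
 ultimately have "ln (Inf ?H) / (- ln r) \<le> 1 + e" by (simp only: pos_divide_le_eq)
 hence "hit_ratio X th (proj X x) (proj X y) r \<le> e'" unfolding hit_ratio_def ee(1) using tH by auto
 thus False using b(2)[OF r(1) rb(1)] by simp
qed

end

lemma Rats_pos_below: assumes "0 < (a::real)" obtains q where "q \<in> \<rat>" "0 < q" "q < a"
 using Rats_dense_in_real[OF assms] by blast

context tsurf
begin

section \<open>The flow preserves area\<close>

lemma mv_inj: "mv th a s = mv th b s ==> a = b"
 by (simp add: mv_def prod_eq_iff)

lemma fl_mv_cancel: assumes "fl th a t y" "0 \<le> s" "s \<le> t" "s < ext th a" shows "fl th (mv th a s) (t - s) y"
proof -
 have "fl th a s (mv th a s)" by (rule fl.fl_move) (use fl_Qp[OF assms(1)] assms in auto)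
 from fl_cancel[OF this assms(1,3)] show ?thesis .
qed

text \<open>Both orbits leave the sides at once, so they can be compared at interior points.\<close>

lemma fl_inj_Qp: assumes "fl th a t y" "fl th b t y" "y \<in> Q" shows "a = b"
proof (cases "t = 0")
 case True
 thus ?thesis using fl_0 assms by metis
next
 case False
 have Qp: "a \<in> Qp th" "b \<in> Qp th" and t: "0 < t" using fl_Qp[OF assms(1)] fl_Qp[OF assms(2)] False by simp_all
 define s where "s = min t (min (ext th a) (ext th b)) / 2"
 have "0 < min t (min (ext th a) (ext th b))" using t ext(1)[OF Qp(1)] ext(1)[OF Qp(2)] by simp
 hence s: "0 < s" "s < t" "s < ext th a" "s < ext th b" unfolding s_def by linarith+
 have "fl th (mv th a s) (t - s) y" "fl th (mv th b s) (t - s) y"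
  by (rule fl_mv_cancel, use assms s in simp_all)+
 hence "mv th a s = mv th b s" using fl_inj mv_Q[OF Qp(1) s(1,3)] mv_Q[OF Qp(2) s(1,4)] assms(3) by blast
 thus ?thesis by (rule mv_inj)
qed

lemma hits_inj_Qp: assumes "hits th a t c" "hits th b t c" shows "a = b"
proof -
 have Qp: "a \<in> Qp th" "b \<in> Qp th" using hits_pos assms by blast+
 define s where "s = min (ext th a) (ext th b) / 2"
 have "0 < min (ext th a) (ext th b)" using ext(1)[OF Qp(1)] ext(1)[OF Qp(2)] by simp
 hence s: "0 < s" "s < ext th a" "s < ext th b" unfolding s_def by linarith+
 have "hits th (mv th a s) (t - s) c" "hits th (mv th b s) (t - s) c"
  by (rule hits_mv, use assms s in simp_all)+
 hence "mv th a s = mv th b s" using hits_inj mv_Q[OF Qp(1) s(1,2)] mv_Q[OF Qp(2) s(1,3)] by blast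
 thus ?thesis by (rule mv_inj)
qed

lemma open_shift: assumes "open S" "x \<in> S" shows "\<exists>\<epsilon>>0. \<forall>u. cmod u < \<epsilon> --> shift x u \<in> S"
proof -
 have "open (shift x -` S)" unfolding shift_def by (intro open_vimage assms(1) continuous_intros)
 moreover have "0 \<in> shift x -` S" using assms(2) by simp
 ultimately obtain e where e: "e > 0" "ball 0 e \<subseteq> shift x -` S" using open_contains_ball by blast
 have "shift x u \<in> S" if "cmod u < e" for u using subsetD[OF e(2), of u] that by simp
 thus ?thesis using e(1) by blast
qed

lemma mu_translate: assumes A: "A \<in> sets borel" "A \<subseteq> {i} \<times> UNIV"
 shows "(\<lambda>x. (j, snd x + v)) ` A \<in> sets borel" "emeasure mu ((\<lambda>x. (j, snd x + v)) ` A) = emeasure mu A"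
proof -
 define A' where "A' = Pair i -` A"
 have A': "A' \<in> sets borel"
  using measurable_sets[OF borel_measurable_continuous_onI[of "Pair i :: complex => _"] A(1)] by (simp add: A'_def continuous_intros)
 have Aeq: "A = {i} \<times> A'" using A(2) by (auto simp: A'_def)
 have img: "(\<lambda>x. (j, snd x + v)) ` A = {j} \<times> ((+) (- v) -` A')"
  unfolding Aeq by (auto simp: image_iff algebra_simps intro!: bexI[of _ "_ - v"])
 have m: "(+) (- v) -` A' \<in> sets borel"
  using measurable_sets[OF borel_measurable_continuous_onI[of "(+) (- v)"] A'] by (simp add: continuous_intros)
 thus "(\<lambda>x. (j, snd x + v)) ` A \<in> sets borel" unfolding img by (intro borel_Times) auto
 have "emeasure lborel ((+) (- v) -` A') = emeasure (distr lborel borel ((+) (- v))) A'"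
  using A' by (subst emeasure_distr) auto
 hence "emeasure lborel ((+) (- v) -` A') = emeasure lborel A'" by (simp add: lborel_distr_plus)
 moreover have "emeasure mu A = emeasure lborel A'" unfolding Aeq by (rule emeasure_mu_Times[OF A'])
 ultimately show "emeasure mu ((\<lambda>x. (j, snd x + v)) ` A) = emeasure mu A" unfolding img emeasure_mu_Times[OF m] by simp
qed

definition fimg :: "real => real => (nat \<times> complex) set => (nat \<times> complex) set" where
 "fimg th t B = {y \<in> Q. \<exists>x\<in>B. fl th x t y}"

text \<open>On countably many discs covering its domain, the time \<open>t\<close> map is a
 translation.\<close>

lemma fimg_le: assumes B: "B \<in> sets borel" "B \<subseteq> Q"
 shows "fimg th t B \<in> sets borel" "emeasure mu (fimg th t B) \<le> emeasure mu B"
proof -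
 define D where "D = {x \<in> Q. \<exists>y\<in>Q. fl th x t y}"
 define good where "good x e y \<longleftrightarrow> 0 < e \<and> (\<forall>u. cmod u < e --> shift y u \<in> Q \<and> fl th (shift x u) t (shift y u))" for x e y
 have "\<exists>e y. good x e y" if "x \<in> D" for x
  using that fl_stable unfolding D_def good_def by blast
 then obtain e y where ey: "\<And>x. x \<in> D ==> good x (e x) (y x)" by metis
 let ?U = "\<lambda>x. {fst x} \<times> ball (snd x) (e x)"
 have self: "x \<in> ?U x" if "x \<in> D" for x using ey[OF that] unfolding good_def by (simp add: mem_Times_iff)
 obtain F where F: "F \<subseteq> ?U ` D" "countable F" "\<Union>F = (\<Union>x\<in>D. ?U x)"
 proof -
  have "open S" if "S \<in> ?U ` D" for S using that by (auto intro: open_nat_Times)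
  from Lindelof[of "?U ` D", OF this] that show ?thesis by blast
 qed
 obtain I where I: "countable I" "I \<subseteq> D" "F = ?U ` I" using F(1,2) countable_subset_image[of F ?U D] by auto
 have "fimg th t B \<in> sets borel \<and> emeasure mu (fimg th t B) \<le> emeasure mu B"
 proof (cases "I = {}")
  case True
  hence "D = {}" using F(3) I(3) self by blast
  hence "fimg th t B = {}" using B(2) unfolding D_def fimg_def by blast
  thus ?thesis by simp
 next
  case False
  define z where "z = from_nat_into I"
  have zD: "z n \<in> D" for n using from_nat_into[OF False] I(2) unfolding z_def by blast
  define A where "A = disjointed (\<lambda>n. B \<inter> ?U (z n))"
  have Ub: "?U (z n) \<in> sets borel" for n by (intro borel_open open_nat_Times open_ball)
  have Ab: "A n \<in> sets borel" for n
   unfolding A_def using Ub B(1) sets.range_disjointed_sets[of "\<lambda>n. B \<inter> ?U (z n)" borel] by blast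
  have Asub: "A n \<subseteq> B \<inter> ?U (z n)" for n unfolding A_def by (rule disjointed_subset)
  have UA: "(\<Union>n. A n) = (\<Union>n. B \<inter> ?U (z n))" unfolding A_def by (rule UN_disjointed_eq)
  have img: "fimg th t (A n) = (\<lambda>x. (fst (y (z n)), snd x + (snd (y (z n)) - snd (z n)))) ` A n" for n
  proof -
   have f: "fl th x t (fst (y (z n)), snd x + (snd (y (z n)) - snd (z n)))" "(fst (y (z n)), snd x + (snd (y (z n)) - snd (z n))) \<in> Q"
    if x: "x \<in> A n" for x
   proof -
    let ?u = "snd x - snd (z n)"
    have "fst x = fst (z n)" "cmod ?u < e (z n)" using Asub x by (force simp: dist_norm norm_minus_commute)+
    hence "shift (z n) ?u = x" "shift (y (z n)) ?u = (fst (y (z n)), snd x + (snd (y (z n)) - snd (z n)))"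
     by (simp_all add: prod_eq_iff)
    moreover have "shift (y (z n)) ?u \<in> Q" "fl th (shift (z n) ?u) t (shift (y (z n)) ?u)"
     using ey[OF zD[of n]] \<open>cmod ?u < e (z n)\<close> unfolding good_def by blast+
    ultimately show "fl th x t (fst (y (z n)), snd x + (snd (y (z n)) - snd (z n)))" "(fst (y (z n)), snd x + (snd (y (z n)) - snd (z n))) \<in> Q" by simp_all
   qed
   show ?thesis unfolding fimg_def using f fl_det[OF f(1)] by blast
  qed
  have tr: "fimg th t (A n) \<in> sets borel" "emeasure mu (fimg th t (A n)) = emeasure mu (A n)" for n
   unfolding img by (rule mu_translate[OF Ab, of _ "fst (z n)"], use Asub[of n] in blast)+
  have "fimg th t B = (\<Union>n. fimg th t (A n))"
  proof (intro equalityI subsetI)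
   fix w assume "w \<in> fimg th t B"
   then obtain x where x: "w \<in> Q" "x \<in> B" "fl th x t w" unfolding fimg_def by blast
   have xD: "x \<in> D" using x B(2) unfolding D_def by blast
   have "x \<in> \<Union>F" unfolding F(3) using xD self[OF xD] by (rule UN_I)
   then obtain i where i: "i \<in> I" "x \<in> ?U i" unfolding I(3) by (elim UnionE imageE) simp
   obtain n where "i = z n" using from_nat_into_surj[OF I(1) i(1)] unfolding z_def by metis
   hence "x \<in> B \<inter> ?U (z n)" using x(2) i(2) by simp
   hence "x \<in> (\<Union>n. A n)" unfolding UA by (rule UN_I[OF UNIV_I])
   thus "w \<in> (\<Union>n. fimg th t (A n))" using x unfolding fimg_def by blast
  next
   fix w assume "w \<in> (\<Union>n. fimg th t (A n))"
   thus "w \<in> fimg th t B" using Asub unfolding fimg_def by blast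
  qed
  moreover have "emeasure mu (\<Union>n. fimg th t (A n)) \<le> (\<Sum>n. emeasure mu (fimg th t (A n)))"
   using tr(1) by (intro emeasure_subadditive_countably) auto
  moreover have "(\<Sum>n. emeasure mu (fimg th t (A n))) = emeasure mu (\<Union>n. A n)"
   unfolding tr(2) by (rule suminf_emeasure) (use Ab disjoint_family_disjointed in \<open>auto simp: A_def\<close>)
  moreover have "emeasure mu (\<Union>n. A n) \<le> emeasure mu B" using B(1) UA by (intro emeasure_mono) auto
  ultimately show ?thesis using tr(1) by auto
 qed
 thus "fimg th t B \<in> sets borel" "emeasure mu (fimg th t B) \<le> emeasure mu B" by blast+
qed

lemma fimg_null: assumes "B \<in> null_sets mu" "B \<subseteq> Q" shows "fimg th t B \<in> null_sets mu"
proof -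
 have b: "B \<in> sets borel" "emeasure mu B = 0" using assms(1) by (auto simp: null_sets_def)
 thus ?thesis using fimg_le[OF b(1) assms(2), of th t] by (intro null_setsI) auto
qed

text \<open>Orbits that sit on a side at time \<open>t\<close> are, a moment later, on a translate
 of a side.\<close>

definition past_side :: "real => real => (nat \<times> complex) set" where
 "past_side th s = Q \<inter> (\<Union>e\<in>sides X. {fst e} \<times> {z. cross (sv e) (z - (st e + ray th s)) = 0})"

lemma past_side_null: "past_side th s \<in> null_sets mu"
proof -
 have "(\<Union>e\<in>sides X. {fst e} \<times> {z. cross (sv e) (z - (st e + ray th s)) = 0}) \<in> null_sets mu"
  by (intro null_sets.finite_UN finite_sides line_null sv_nz)
 thus ?thesis unfolding past_side_def using open_Q by (intro null_set_Int1) auto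
qed

lemma past_side: assumes "x \<in> Qp th" "x \<notin> Q" "0 < s" "s < ext th x" shows "mv th x s \<in> past_side th s"
proof -
 have x: "fst x < N" "snd x \<in> reg (fst x)" using Qp_union[OF assms(1)] poly_union_iff[of "fst x" "snd x"] by simp_all
 have "\<exists>e\<in>sides X. fst e = fst x \<and> cross (sv e) (snd x - st e) = 0"
  using x
 proof (cases rule: reg_cases)
  case 1
  thus ?thesis using assms(2) x(1) by (simp add: Q_iff)
 next
  case (2 c)
  thus ?thesis by (intro bexI[of _ c]) (auto simp: cross_def)
 next
  case (3 e)
  then obtain t where "snd x = st e + of_real t * sv e" unfolding oseg_param[OF 3(1)] by blast
  thus ?thesis using 3 by (intro bexI[of _ e]) (auto simp: cross_def algebra_simps)
 qed
 then obtain e where e: "e \<in> sides X" "fst e = fst x" "cross (sv e) (snd x - st e) = 0" by blast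
 have eq: "snd (mv th x s) - (st e + ray th s) = snd x - st e" by simp
 have "mv th x s \<in> {fst e} \<times> {z. cross (sv e) (z - (st e + ray th s)) = 0}"
  unfolding mem_Times_iff mem_Collect_eq eq using e by simp
 with e(1) have "mv th x s \<in> (\<Union>e\<in>sides X. {fst e} \<times> {z. cross (sv e) (z - (st e + ray th s)) = 0})" by (rule UN_I)
 thus ?thesis unfolding past_side_def by (rule IntI[OF mv_Q[OF assms(1,3,4)]])
qed

lemma into_side_null: "\<exists>Z\<in>null_sets mu. \<forall>x\<in>Q. \<forall>y. fl th x t y --> y \<notin> Q --> x \<in> Z"
proof
 let ?Z = "\<Union>q\<in>\<rat>. fimg (th + pi) (t + q) (past_side th q)"
 show "?Z \<in> null_sets mu" using fimg_null[OF past_side_null] past_side_def by (intro null_sets_UN' countable_rat) blast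
 show "\<forall>x\<in>Q. \<forall>y. fl th x t y --> y \<notin> Q --> x \<in> ?Z"
 proof (intro ballI allI impI)
  fix x y assume x: "x \<in> Q" "fl th x t y" "y \<notin> Q"
  have y: "y \<in> Qp th" using fl_Qp x(2) by blast
  obtain q where q: "q \<in> \<rat>" "0 < q" "q < ext th y" using Rats_pos_below[OF ext(1)[OF y]] by blast
  have "fl th x (t + q) (mv th y q)" using fl_trans[OF x(2) fl.fl_move[OF y]] q by simp
  hence "fl (th + pi) (mv th y q) (t + q) x" using fl_rev_iff[OF x(1) mv_Q[OF y q(2,3)]] by blast
  hence "x \<in> fimg (th + pi) (t + q) (past_side th q)" using past_side[OF y x(3) q(2,3)] x(1) unfolding fimg_def by blast
  thus "x \<in> ?Z" by (rule UN_I[OF q(1)])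
 qed
qed

lemma from_side_null: "\<exists>Z\<in>null_sets mu. \<forall>y\<in>Q. \<forall>x. fl th x t y --> x \<notin> Q --> y \<in> Z"
proof
 let ?Z = "\<Union>q\<in>\<rat>. fimg th (t - q) (past_side th q)"
 show "?Z \<in> null_sets mu" using fimg_null[OF past_side_null] past_side_def by (intro null_sets_UN' countable_rat) blast
 show "\<forall>y\<in>Q. \<forall>x. fl th x t y --> x \<notin> Q --> y \<in> ?Z"
 proof (intro ballI allI impI)
  fix x y assume y: "y \<in> Q" "fl th x t y" "x \<notin> Q"
  have x: "x \<in> Qp th" "0 \<le> t" using fl_Qp y(2) by blast+
  have "t \<noteq> 0" using y fl_0 by blast
  hence "0 < min t (ext th x)" using x(2) ext(1)[OF x(1)] by simp
  then obtain q where q: "q \<in> \<rat>" "0 < q" "q < min t (ext th x)" using Rats_pos_below by blast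
  have "fl th (mv th x q) (t - q) y" by (rule fl_mv_cancel[OF y(2)]) (use q in auto)
  hence "y \<in> fimg th (t - q) (past_side th q)" using past_side[OF x(1) y(3) q(2)] y(1) q(3) unfolding fimg_def by auto
  thus "y \<in> ?Z" by (rule UN_I[OF q(1)])
 qed
qed

text \<open>Points whose orbit is on a side at time \<open>t\<close> are not seen by
 \<open>fimg\<close>, but they form a null set.\<close>

lemma mu_le_fimg: assumes B: "B \<in> sets borel" "B \<subseteq> Q" and d: "\<And>x. x \<in> B ==> \<exists>y. fl th x t y"
 shows "emeasure mu B \<le> emeasure mu (fimg th t B)"
proof -
 obtain Z where Z: "Z \<in> null_sets mu" "\<And>x y. x \<in> Q ==> fl th x t y ==> y \<notin> Q ==> x \<in> Z" using into_side_null by meson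
 have c: "fimg th t B \<in> sets borel" "fimg th t B \<subseteq> Q" using fimg_le[OF B] by (auto simp: fimg_def)
 have "B \<subseteq> Z \<union> fimg (th + pi) t (fimg th t B)"
 proof
  fix x assume x: "x \<in> B"
  then obtain y where y: "fl th x t y" using d by blast
  have xQ: "x \<in> Q" using x B(2) by blast
  show "x \<in> Z \<union> fimg (th + pi) t (fimg th t B)"
  proof (cases "y \<in> Q")
   case True
   hence "fl (th + pi) y t x" using fl_rev_iff[OF xQ True] y by blast
   thus ?thesis using True x xQ y unfolding fimg_def by blast
  qed (use Z(2) xQ y in blast)
 qed
 hence "emeasure mu B \<le> emeasure mu (Z \<union> fimg (th + pi) t (fimg th t B))"
  using Z(1) fimg_le(1)[OF c] by (intro emeasure_mono) auto
 also have "\<dots> = emeasure mu (fimg (th + pi) t (fimg th t B))"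
  using Z(1) fimg_le(1)[OF c] by (subst Un_commute) (intro emeasure_Un_null_set, simp_all)
 also have "\<dots> \<le> emeasure mu (fimg th t B)" by (rule fimg_le(2)[OF c])
 finally show ?thesis .
qed

lemma mu_le_preimage: assumes B: "B \<in> sets borel" "B \<subseteq> Q" and Y: "Y \<in> sets borel" "Y \<subseteq> Q"
  and d: "\<And>y. y \<in> Y ==> \<exists>x. fl th x t y \<and> (x \<in> Q --> x \<in> B)"
 shows "emeasure mu Y \<le> emeasure mu B"
proof -
 obtain Z where Z: "Z \<in> null_sets mu" "\<And>x y. y \<in> Q ==> fl th x t y ==> x \<notin> Q ==> y \<in> Z" using from_side_null by meson
 have "Y \<subseteq> Z \<union> fimg th t B"
 proof
  fix y assume y: "y \<in> Y"
  then obtain x where "fl th x t y" "x \<in> Q --> x \<in> B" using d by blast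
  thus "y \<in> Z \<union> fimg th t B" using Z(2)[of y x] y Y(2) unfolding fimg_def by blast
 qed
 hence "emeasure mu Y \<le> emeasure mu (Z \<union> fimg th t B)" using Z(1) fimg_le(1)[OF B] by (intro emeasure_mono) auto
 also have "\<dots> = emeasure mu (fimg th t B)" using Z(1) fimg_le(1)[OF B] by (subst Un_commute) (intro emeasure_Un_null_set, simp_all)
 also have "\<dots> \<le> emeasure mu B" by (rule fimg_le(2)[OF B])
 finally show ?thesis .
qed

section \<open>Recurrence to an open set\<close>

lemma Gf_iff: "x \<in> Gf th \<longleftrightarrow> x \<in> Q \<and> (\<forall>t\<ge>0. \<exists>y. fl th x t y)"
proof
 assume r: "x \<in> Q \<and> (\<forall>t\<ge>0. \<exists>y. fl th x t y)"
 have "\<exists>T>real n. \<exists>y\<in>Q. fl th x T y" for n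
 proof -
  obtain y where "fl th x (real n) y" using r of_nat_0_le_iff by blast
  from fl_into_Q[OF this zero_less_one] show ?thesis by metis
 qed
 thus "x \<in> Gf th" using r by (simp add: Gf_def)
qed (use Gf_fl in \<open>auto simp: Gf_def\<close>)

lemma Gf_inv: assumes "x \<in> Q" "y \<in> Q" "fl th x t y" shows "x \<in> Gf th \<longleftrightarrow> y \<in> Gf th"
proof
 assume x: "x \<in> Gf th"
 have "\<exists>z. fl th y s z" if s: "0 \<le> s" for s
 proof -
  have t: "0 \<le> t" using fl_Qp assms(3) by blast
  then obtain z where "fl th x (t + s) z" using x s unfolding Gf_iff by (meson add_nonneg_nonneg)
  from fl_cancel[OF assms(3) this] s have "fl th y s z" by simp
  thus ?thesis by blast
 qed
 thus "y \<in> Gf th" using assms(2) unfolding Gf_iff by blast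
next
 assume y: "y \<in> Gf th"
 have "\<exists>z. fl th x s z" if s: "0 \<le> s" for s
 proof -
  have t: "0 \<le> t" using fl_Qp assms(3) by blast
  obtain z where "fl th y s z" using y s unfolding Gf_iff by blast
  hence "fl th x (t + s) z" by (rule fl_trans[OF assms(3)])
  from fl_split[OF this s] t show ?thesis by auto
 qed
 thus "x \<in> Gf th" using assms(1) unfolding Gf_iff by blast
qed

lemma Gam_inv: assumes "x \<in> Q" "y \<in> Q" "fl th x t y" shows "x \<in> Gam th \<longleftrightarrow> y \<in> Gam th"
 unfolding Gam_def using Gf_inv[OF assms] Gf_inv[OF assms(2,1) fl_rev[OF assms]] by blast

lemma mu_Gam: assumes "B \<in> sets borel" "B \<subseteq> Q" shows "emeasure mu (B \<inter> Gam th) = emeasure mu B"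
proof (rule antisym)
 show "emeasure mu (B \<inter> Gam th) \<le> emeasure mu B" using assms(1) by (intro emeasure_mono) auto
 have "emeasure mu B \<le> emeasure mu ((B \<inter> Gam th) \<union> (Q - Gam th))"
  using assms borel_Gam open_Q by (intro emeasure_mono) auto
 also have "\<dots> = emeasure mu (B \<inter> Gam th)" using assms(1) borel_Gam Gam_conull by (intro emeasure_Un_null_set) auto
 finally show "emeasure mu B \<le> emeasure mu (B \<inter> Gam th)" .
qed

lemma mu_open_pos: assumes "open S" "x \<in> S" shows "0 < emeasure mu S"
proof -
 obtain e where e: "e > 0" "\<And>u. cmod u < e ==> shift x u \<in> S" using open_shift[OF assms] by blast
 have "{fst x} \<times> ball (snd x) e \<subseteq> S"
 proof
  fix y assume "y \<in> {fst x} \<times> ball (snd x) e"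
  hence y: "fst y = fst x" "cmod (snd y - snd x) < e" by (auto simp: dist_norm norm_minus_commute)
  have "shift x (snd y - snd x) = y" using y(1) by (simp add: prod_eq_iff)
  thus "y \<in> S" using e(2)[OF y(2)] by simp
 qed
 hence "emeasure mu ({fst x} \<times> ball (snd x) e) \<le> emeasure mu S" using assms(1) by (intro emeasure_mono) auto
 moreover have "0 < emeasure mu ({fst x} \<times> ball (snd x) e)" using e(1) by (simp add: emeasure_mu_Times emeasure_ball unit_ball_vol_2)
 ultimately show ?thesis by (rule less_le_trans[rotated])
qed

lemma Q_fin_measure: "S \<subseteq> Q ==> emeasure mu S \<noteq> \<infinity>"
 using emeasure_mono[of S Q mu] open_Q mu_Q_finite by (auto simp: top_unique)

text \<open>Poincare recurrence: the sets of points that visited \<open>U\<close> at least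
 \<open>n\<close> time units ago decrease, but all have the same measure, as the flow maps each into
 the next. Their intersection is invariant and not null.\<close>

theorem backward_recurrence:
 assumes erg: "ergodic_direction X th" and U: "open U" "U \<subseteq> Q" "U \<noteq> {}"
 shows "\<exists>Z\<in>null_sets mu. \<forall>x\<in>Q - Z. \<forall>n::nat. \<exists>t\<ge>real n. \<exists>b\<in>U. fl th b t x"
proof -
 define V where "V n = {x \<in> Q. \<exists>t\<ge>real n. \<exists>b\<in>U. fl th b t x}" for n :: nat
 have Vo: "open (V n)" for n
 proof (rule shift_open)
  fix x assume "x \<in> V n"
  then obtain t b where x: "x \<in> Q" "t \<ge> real n" "b \<in> U" "fl th b t x" unfolding V_def by blast
  have bQ: "b \<in> Q" using x(3) U(2) by blast
  obtain e where e: "e > 0" "\<And>u. cmod u < e ==> shift b u \<in> Q \<and> shift x u \<in> Q \<and> fl th (shift b u) t (shift x u)"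
   using fl_stable[OF bQ x(1,4)] by blast
  obtain e' where e': "e' > 0" "\<And>u. cmod u < e' ==> shift b u \<in> U" using open_shift[OF U(1) x(3)] by blast
  have "shift x u \<in> V n" if "cmod u < min e e'" for u
   using e(2)[of u] e'(2)[of u] that x(2) unfolding V_def by auto
  thus "\<exists>\<epsilon>>0. \<forall>u. cmod u < \<epsilon> --> shift x u \<in> V n" using e(1) e'(1) by (intro exI[of _ "min e e'"]) auto
 qed
 have VQ: "V n \<subseteq> Q" for n unfolding V_def by blast
 have dec: "V (Suc n) \<subseteq> V n" for n
 proof
  fix x assume "x \<in> V (Suc n)"
  then obtain t b where "x \<in> Q" "t \<ge> real (Suc n)" "b \<in> U" "fl th b t x" unfolding V_def by blast
  moreover have "real n \<le> t" using \<open>t \<ge> real (Suc n)\<close> by simp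
  ultimately show "x \<in> V n" unfolding V_def by blast
 qed
 have inc: "emeasure mu (V n) \<le> emeasure mu (V (Suc n))" for n
 proof -
  have b: "V n \<inter> Gam th \<in> sets borel" "V n \<inter> Gam th \<subseteq> Q" using Vo borel_Gam VQ by auto
  have "emeasure mu (V n) = emeasure mu (V n \<inter> Gam th)" using mu_Gam[of "V n" th] Vo VQ by simp
  also have "\<dots> \<le> emeasure mu (fimg th 1 (V n \<inter> Gam th))"
   by (rule mu_le_fimg[OF b]) (use Gf_fl[of _ th 1] in \<open>auto simp: Gam_def\<close>)
  also have "\<dots> \<le> emeasure mu (V (Suc n))"
  proof (rule emeasure_mono)
   show "fimg th 1 (V n \<inter> Gam th) \<subseteq> V (Suc n)"
   proof
    fix y assume "y \<in> fimg th 1 (V n \<inter> Gam th)"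
    then obtain x t b where y: "y \<in> Q" "fl th x 1 y" "t \<ge> real n" "b \<in> U" "fl th b t x" unfolding fimg_def V_def by blast
    have "fl th b (t + 1) y" using fl_trans[OF y(5,2)] .
    moreover have "real (Suc n) \<le> t + 1" using y(3) by simp
    ultimately show "y \<in> V (Suc n)" using y(1,4) unfolding V_def by blast
   qed
  qed (use Vo in simp)
  finally show ?thesis .
 qed
 obtain b where b: "b \<in> U" using U(3) by blast
 have bQ: "b \<in> Q" using b U(2) by blast
 have "fl th b 0 (mv th b 0)" by (rule fl.fl_move[OF Q_Qp[OF bQ] order_refl ext(1)[OF Q_Qp[OF bQ]]])
 hence "fl th b 0 b" by simp
 hence "b \<in> V 0" using b bQ unfolding V_def by force
 hence pos: "0 < emeasure mu (V 0)" using mu_open_pos[OF Vo] by blast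
 have ge: "emeasure mu (V 0) \<le> emeasure mu (V n)" for n by (induction n) (use inc order_trans in blast)+
 have "emeasure mu (\<Inter>n. V n) = (INF n. emeasure mu (V n))"
  by (rule INF_emeasure_decseq[symmetric]) (use Vo dec Q_fin_measure[OF VQ] in \<open>auto simp: decseq_Suc_iff\<close>)
 hence "emeasure mu (V 0) \<le> emeasure mu (\<Inter>n. V n)" using ge by (simp add: le_INF_iff)
 hence nn: "0 < emeasure mu (\<Inter>n. V n)" using pos by (rule less_le_trans[rotated])
 define W where "W = (\<Inter>n. V n) \<inter> Gam th"
 have Wb: "W \<in> sets borel" unfolding W_def using Vo borel_Gam by (intro sets.Int sets.countable_INT) auto
 have sub: "(\<Inter>n. V n) \<subseteq> Q" using VQ[of 0] by blast
 have "emeasure mu W = emeasure mu (\<Inter>n. V n)" unfolding W_def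
  using Vo by (intro mu_Gam sets.countable_INT sub) auto
 hence "W \<notin> null_sets mu" using nn by (auto simp: null_sets_def)
 moreover have "W \<in> null_sets mu \<or> Q - W \<in> null_sets mu"
 proof (rule ergodic_dichotomy[OF erg Wb])
  fix x y t assume h: "x \<in> Q" "y \<in> Q" "fl th x t y"
  have t: "0 \<le> t" using fl_Qp h(3) by blast
  have "y \<in> V n" if xV: "x \<in> V n" for n
  proof -
   obtain s b where sb: "s \<ge> real n" "b \<in> U" "fl th b s x" using xV unfolding V_def by blast
   have "fl th b (s + t) y" using fl_trans[OF sb(3) h(3)] .
   moreover have "real n \<le> s + t" using sb(1) t by simp
   ultimately show ?thesis using sb(2) h(2) unfolding V_def by blast
  qed
  moreover have "x \<in> V n" if yV: "\<And>n. y \<in> V n" for n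
  proof -
   obtain m :: nat where m: "real n + t \<le> real m" using real_arch_simple by blast
   obtain s b where sb: "s \<ge> real m" "b \<in> U" "fl th b s y" using yV[of m] unfolding V_def by blast
   have st: "0 \<le> s - t" "s - t \<le> s" using sb(1) m t by linarith+
   obtain m' where m': "fl th b (s - t) m'" "fl th m' t y" using fl_split[OF sb(3) st] by auto
   have "m' = x" using fl_inj_Qp[OF m'(2) h(3,2)] .
   moreover have "real n \<le> s - t" using sb(1) m by linarith
   ultimately show ?thesis using sb(2) m'(1) h(1) unfolding V_def by blast
  qed
  ultimately show "x \<in> W \<longleftrightarrow> y \<in> W" using Gam_inv[OF h] unfolding W_def by blast
 qed (use W_def in blast)
 ultimately have "Q - W \<in> null_sets mu" by blast
 moreover have "\<exists>t\<ge>real n. \<exists>b\<in>U. fl th b t x" if "x \<in> Q - (Q - W)" for x and n :: nat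
  using that unfolding W_def V_def by blast
 ultimately show ?thesis by blast
qed

end

section \<open>Rectangles swept out by a transversal\<close>

lemma gap_least:
 fixes S :: "real set"
 assumes "S \<noteq> {}" "\<And>t. t \<in> S ==> 0 \<le> t" "0 < \<eta>" and gap: "\<And>s t. s \<in> S ==> t \<in> S ==> s < t ==> \<eta> \<le> t - s"
 shows "\<exists>m\<in>S. \<forall>t\<in>S. m \<le> t"
proof -
 have bd: "bdd_below S" using assms(2) unfolding bdd_below_def by blast
 obtain m where m: "m \<in> S" "m < Inf S + \<eta>" using cInf_lessD[OF assms(1), of "Inf S + \<eta>"] assms(3) by auto
 have "m \<le> t" if t: "t \<in> S" for t
 proof (rule ccontr)
  assume "\<not> m \<le> t"
  hence "\<eta> \<le> m - t" using gap[OF t m(1)] by simp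
  thus False using cInf_lower[OF t bd] m(2) by linarith
 qed
 thus ?thesis using m(1) by blast
qed

lemma interval_clopen:
 fixes l b :: real
 assumes y: "\<And>u. u \<in> {l<..<b} ==> R u ==> \<exists>e>0. \<forall>a. \<bar>a\<bar> < e --> u + a \<in> {l<..<b} --> R (u + a)"
  and n: "\<And>u. u \<in> {l<..<b} ==> \<not> R u ==> \<exists>e>0. \<forall>a. \<bar>a\<bar> < e --> u + a \<in> {l<..<b} --> \<not> R (u + a)"
  and u: "u \<in> {l<..<b}" "v \<in> {l<..<b}" "R u"
 shows "R v"
proof (rule ccontr)
 assume nv: "\<not> R v"
 have op: "open {w \<in> {l<..<b}. S w}"
  if S: "\<And>u. u \<in> {l<..<b} ==> S u ==> \<exists>e>0. \<forall>a. \<bar>a\<bar> < e --> u + a \<in> {l<..<b} --> S (u + a)" for S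
 proof (unfold open_dist, intro ballI)
  fix w assume w: "w \<in> {w \<in> {l<..<b}. S w}"
  then obtain e where e: "e > 0" "\<And>a. \<bar>a\<bar> < e ==> w + a \<in> {l<..<b} ==> S (w + a)" using S by blast
  obtain e' where e': "e' > 0" "ball w e' \<subseteq> {l<..<b}" using w open_contains_ball[of "{l<..<b}"] open_greaterThanLessThan by blast
  have "x \<in> {w \<in> {l<..<b}. S w}" if "dist x w < min e e'" for x
  proof -
   have "x \<in> {l<..<b}" using e'(2) that by (auto simp: subset_iff dist_commute)
   thus ?thesis using e(2)[of "x - w"] that by (simp add: dist_real_def)
  qed
  thus "\<exists>e>0. \<forall>y. dist y w < e --> y \<in> {w \<in> {l<..<b}. S w}" using e(1) e'(1) by (intro exI[of _ "min e e'"]) auto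
 qed
 have "{w \<in> {l<..<b}. R w} \<inter> {l<..<b} = {} \<or> {w \<in> {l<..<b}. \<not> R w} \<inter> {l<..<b} = {}"
  by (rule connectedD[OF connected_Ioo op[OF y] op[OF n]]) blast+
 thus False using u nv by blast
qed

context tsurf
begin

lemma fl_defined_le: assumes "fl th x s z" "0 \<le> t" "t \<le> s" shows "\<exists>y. fl th x t y"
 using fl_split[OF assms] by blast

lemma hits_split: "hits th x t c ==> 0 \<le> r ==> r < t ==> \<exists>m. fl th x r m \<and> hits th m (t - r) c"
proof (induction arbitrary: r rule: hits.induct)
 case (hits_now x c)
 have "hits th x (ext th x) c" by (rule hits.hits_now[OF hits_now(1-4)])
 from hits_mv[OF this hits_now(5,6)] fl.fl_move[OF hits_now(1,5,6)] show ?case by blast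
next
 case (hits_later x e t c)
 have x: "x \<in> Qp th" using hits_later(1) by (simp add: crosses_def)
 show ?case
 proof (cases "r < ext th x")
  case True
  from hits_mv[OF hits.hits_later[OF hits_later(1,2)] hits_later(4) True] fl.fl_move[OF x hits_later(4) True] show ?thesis by blast
 next
  case False
  hence "0 \<le> r - ext th x" "r - ext th x < t" using hits_later(5) by auto
  then obtain m where m: "fl th (nx th x e) (r - ext th x) m" "hits th m (t - (r - ext th x)) c" using hits_later(3) by blast
  have eq: "ext th x + (r - ext th x) = r" "t - (r - ext th x) = ext th x + t - r" by simp_all
  have "fl th x r m" using fl.fl_cross[OF hits_later(1) m(1)] unfolding eq .
  thus ?thesis using m(2) unfolding eq by blast
 qed
qed

text \<open>If orbits of points near \<open>x\<close> come near \<open>z\<close> at times near \<open>t\<close>, and the orbit of \<open>x\<close> lives until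
 time \<open>t\<close>, then it is at \<open>z\<close> at that time: compare with its position just after \<open>t\<close>.\<close>

lemma fl_limit:
 assumes x: "x \<in> Q" and z: "z \<in> Q" and w: "fl th x t w"
  and lim: "\<And>\<epsilon>. 0 < \<epsilon> ==> \<exists>u v t'. cmod u < \<epsilon> \<and> cmod v < \<epsilon> \<and> \<bar>t' - t\<bar> < \<epsilon> \<and> fl th (shift x u) t' (shift z v)"
 shows "fl th x t z"
proof -
 obtain \<delta> where \<delta>: "\<delta> > 0" "ball (snd z) \<delta> \<subseteq> inn (fst z)" using Q_ball[OF z] by blast
 have t: "0 \<le> t" using fl_Qp w by blast
 have "0 < \<delta> / 2" using \<delta>(1) by simp
 from fl_into_Q[OF w this] obtain T w' where T: "t < T" "T < t + \<delta> / 2" "w' \<in> Q" "fl th x T w'" by blast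
 define \<sigma> where "\<sigma> = T - t"
 have \<sigma>: "0 < \<sigma>" "\<sigma> < \<delta> / 2" using T by (auto simp: \<sigma>_def)
 obtain e where e: "e > 0" "\<And>u. cmod u < e ==> fl th (shift x u) T (shift w' u)" using fl_stable[OF x T(3,4)] by blast
 define g where "g = cmod (snd w' - (snd z + of_real \<sigma> * direction th))"
 have key: "fst w' = fst z \<and> g < 3 * \<epsilon>" if \<epsilon>: "0 < \<epsilon>" for \<epsilon>
 proof -
  let ?e = "min (min \<epsilon> e) (min (\<delta> / 4) \<sigma>)"
  have "0 < ?e" using \<epsilon> e(1) \<delta>(1) \<sigma>(1) by simp
  from lim[OF this] obtain u v t' where h: "cmod u < ?e" "cmod v < ?e" "\<bar>t' - t\<bar> < ?e" "fl th (shift x u) t' (shift z v)" by blast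
  have uv: "cmod u < \<epsilon>" "cmod u < e" "cmod v < \<epsilon>" "cmod v < \<delta> / 4" "\<bar>t' - t\<bar> < \<epsilon>" "\<bar>t' - t\<bar> < \<delta> / 4" "\<bar>t' - t\<bar> < \<sigma>" using h(1-3) by simp_all
  have t'T: "t' \<le> T" using uv(7) \<sigma>_def by linarith
  have 1: "fl th (shift z v) (T - t') (shift w' u)" by (rule fl_cancel[OF h(4) e(2)[OF uv(2)] t'T])
  have "T - t' < \<delta> / 2 + \<delta> / 4" using uv(6) \<sigma>(2) \<sigma>_def by linarith
  hence "dist (snd (shift z v)) (snd z) + (T - t') < \<delta>" using uv(4) by (simp add: dist_norm)
  hence "fl th (shift z v) (T - t') (mv th (shift z v) (T - t'))" using t'T by (intro chart_move(1)[OF z \<delta>(2)]) simp_all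
  from fl_det[OF 1 this] have eq: "shift w' u = mv th (shift z v) (T - t')" .
  have f: "fst w' = fst z" using arg_cong[OF eq, of fst] by simp
  have "snd w' + u = snd z + v + ray th (T - t')" using arg_cong[OF eq, of snd] by simp
  hence "snd w' - (snd z + of_real \<sigma> * direction th) = v - u + ray th (t - t')"
   by (simp add: \<sigma>_def algebra_simps)
  hence "g \<le> cmod (v - u) + \<bar>t - t'\<bar>" unfolding g_def using norm_triangle_ineq[of "v - u" "ray th (t - t')"] by (simp add: norm_mult del: of_real_diff)
  thus ?thesis using f norm_triangle_ineq4[of v u] uv by linarith
 qed
 have "g = 0"
 proof (rule ccontr)
  assume "g \<noteq> 0"
  hence "0 < g / 3" by (simp add: g_def)
  from key[OF this] show False by simp
 qed
 hence w': "w' = mv th z \<sigma>" using key[OF zero_less_one] unfolding g_def by (simp add: prod_eq_iff)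
 have 2: "fl th z \<sigma> w'" unfolding w' by (rule chart_move(1)[OF z \<delta>(2)]) (use \<sigma> in auto)
 obtain m where m: "fl th x t m" "fl th m (T - t) w'" using fl_split[OF T(4) t] T(1) by auto
 have "m = z" using fl_inj_Qp[OF m(2) _ T(3)] 2 unfolding \<sigma>_def by blast
 thus ?thesis using m(1) by simp
qed

end

section \<open>Returns to a transversal\<close>

text \<open>The transversal is \<open>J u\<close> for \<open>u\<close> between 0 and
 \<open>\<rho>\<close>, perpendicular to the flow, in a disc that leaves room to flow for the time
 \<open>\<eta>\<close>. The bounds that matter below depend on \<open>\<eta>\<close> but not on
 \<open>\<rho>\<close>.\<close>

locale tower = tsurf +
 fixes th :: real and x0 :: "nat \<times> complex" and \<eta> \<rho> :: real
 assumes x0: "x0 \<in> Q" and \<eta>: "0 < \<eta>" "ball (snd x0) (3 * \<eta>) \<subseteq> inn (fst x0)" and \<rho>: "0 < \<rho>" "\<rho> \<le> \<eta>"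
begin

abbreviation "dd \<equiv> direction th"
definition hh :: complex where "hh = - \<i> * dd"
definition J :: "real => nat \<times> complex" where "J u = shift x0 (of_real u * hh)"
definition aco :: "complex => real" where "aco w = Re (w * cnj hh)"
definition bco :: "complex => real" where "bco w = Re (w * cnj dd)"

lemma hh: "cmod hh = 1" by (simp add: hh_def norm_mult)

lemma dd_sq: "Re dd * Re dd + Im dd * Im dd = 1"
 using norm_direction[of th] by (simp add: cmod_def power2_eq_square)

lemma co: "aco (of_real u * hh + of_real s * dd) = u" "bco (of_real u * hh + of_real s * dd) = s"
proof -
 have "aco (of_real u * hh + of_real s * dd) = u * (Re dd * Re dd + Im dd * Im dd)" by (simp add: aco_def hh_def algebra_simps)
 thus "aco (of_real u * hh + of_real s * dd) = u" using dd_sq by simp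
 have "bco (of_real u * hh + of_real s * dd) = s * (Re dd * Re dd + Im dd * Im dd)" by (simp add: bco_def hh_def algebra_simps)
 thus "bco (of_real u * hh + of_real s * dd) = s" using dd_sq by simp
qed

lemma decomp: "w = of_real (aco w) * hh + of_real (bco w) * dd"
proof -
 have "of_real (aco w) * hh + of_real (bco w) * dd = of_real (Re dd * Re dd + Im dd * Im dd) * w"
  by (simp add: complex_eq_iff aco_def bco_def hh_def algebra_simps)
 thus ?thesis using dd_sq by simp
qed

lemma co_le: "\<bar>aco w\<bar> \<le> cmod w" "\<bar>bco w\<bar> \<le> cmod w"
 unfolding aco_def bco_def using abs_Re_le_cmod[of "w * cnj hh"] abs_Re_le_cmod[of "w * cnj dd"] hh norm_direction by (simp_all add: norm_mult)

lemma J_simps: "fst (J u) = fst x0" "snd (J u) = snd x0 + of_real u * hh" by (simp_all add: J_def)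

lemma J_inj: "J u = J v ==> u = v" using hh by (auto simp: J_def shift_def)

lemma J_shift: "shift (J u) (of_real a * hh) = J (u + a)" by (simp add: J_def shift_def algebra_simps)

lemma J_dist: "dist (snd (mv th (J u) s)) (snd x0) \<le> \<bar>u\<bar> + \<bar>s\<bar>"
proof -
 have "dist (snd (mv th (J u) s)) (snd x0) = cmod (of_real u * hh + of_real s * dd)" by (simp add: dist_norm J_simps)
 also have "\<dots> \<le> cmod (of_real u * hh) + cmod (of_real s * dd)" by (rule norm_triangle_ineq)
 finally show ?thesis by (simp add: norm_mult hh)
qed

lemma J_chart: assumes "\<bar>u\<bar> + \<bar>s\<bar> < 3 * \<eta>" shows "mv th (J u) s \<in> Q"
 by (rule chart_Q[OF x0 \<eta>(2)]) (use assms J_dist[of u s] in \<open>auto simp: J_simps\<close>)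

lemma J_Q: assumes "\<bar>u\<bar> \<le> \<eta>" shows "J u \<in> Q"
 using J_chart[of u 0] assms \<eta>(1) by simp

lemma J_move: assumes "\<bar>u\<bar> + \<bar>s\<bar> + t < 3 * \<eta>" "0 \<le> t" shows "fl th (mv th (J u) s) t (mv th (J u) (s + t))"
proof -
 have "fl th (mv th (J u) s) t (mv th (mv th (J u) s) t)"
  by (rule chart_move(1)[OF x0 \<eta>(2)]) (use assms J_dist[of u s] in \<open>auto simp: J_simps\<close>)
 thus ?thesis by simp
qed

lemma J_move0: assumes "\<bar>u\<bar> \<le> \<eta>" "0 \<le> t" "t \<le> \<eta>" shows "fl th (J u) t (mv th (J u) t)"
 using J_move[of u 0 t] assms \<eta>(1) by simp

lemma base_adjust: assumes "\<bar>u\<bar> \<le> \<eta>" "\<bar>s\<bar> < \<eta>" "fl th (mv th (J u) s) t y" "\<bar>s\<bar> \<le> t" shows "fl th (J u) (t + s) y"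
proof (cases "0 \<le> s")
 case True
 have "fl th (J u) s (mv th (J u) s)" by (rule J_move0) (use True assms in auto)
 from fl_trans[OF this assms(3)] show ?thesis by (simp add: add.commute)
next
 case False
 have "fl th (mv th (J u) s) (- s) (mv th (J u) (s + - s))" by (rule J_move) (use False assms \<eta>(1) in auto)
 hence "fl th (mv th (J u) s) (- s) (J u)" by simp
 from fl_cancel[OF this assms(3)] False assms(4) show ?thesis by simp
qed

text \<open>Return times, and the points that do not return until time \<open>s\<close>.\<close>

definition Ret :: "real => real set" where "Ret u = {t. 0 < t \<and> (\<exists>v\<in>{0..\<rho>}. fl th (J u) t (J v))}"
definition Alive :: "real => real set" where "Alive s = {u \<in> {0<..<\<rho>}. \<forall>t\<in>Ret u. s < t}"

text \<open>The points whose orbit runs into a vertex or an end of the transversal before it comes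
 back.\<close>

definition reach :: "real => real => (nat \<times> nat) + real => bool" where
 "reach u s p = (case p of Inl c => hits th (J u) s c | Inr v => 0 < s \<and> fl th (J u) s (J v))"
definition Cut :: "real set" where
 "Cut = {u \<in> {0<..<\<rho>}. \<exists>s. \<exists>p\<in>Inl ` sides X \<union> Inr ` {0, \<rho>}. reach u s p \<and> (\<forall>t\<in>Ret u. s \<le> t)}"

lemma seg_abs: "u \<in> {0..\<rho>} ==> \<bar>u\<bar> \<le> \<eta>" "u \<in> {0<..<\<rho>} ==> \<bar>u\<bar> \<le> \<eta>" using \<rho> by auto

lemma Ret_ge: assumes "t \<in> Ret u" "\<bar>u\<bar> \<le> \<eta>" shows "\<eta> \<le> t"
proof (rule ccontr)
 assume "\<not> \<eta> \<le> t"
 obtain v where v: "0 < t" "fl th (J u) t (J v)" using assms(1) unfolding Ret_def by blast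
 have "fl th (J u) t (mv th (J u) t)" by (rule J_move0) (use assms(2) v(1) \<open>\<not> \<eta> \<le> t\<close> in auto)
 from fl_det[OF v(2) this] have "J v = mv th (J u) t" .
 hence "snd x0 + of_real v * hh = snd x0 + (of_real u * hh + of_real t * dd)" by (auto simp: J_def shift_def mv_def)
 hence "of_real v * hh + of_real 0 * dd = of_real u * hh + of_real t * dd" by simp
 hence "bco (of_real v * hh + of_real 0 * dd) = bco (of_real u * hh + of_real t * dd)" by (rule arg_cong)
 thus False unfolding co using v(1) by simp
qed

lemma merge: assumes "fl th (J u) s y" "fl th (J v) t y" "y \<in> Q" "s < t" "u \<in> {0..\<rho>}" shows "t - s \<in> Ret v"
proof -
 have s: "0 \<le> s" using fl_Qp assms(1) by blast
 obtain m where m: "fl th (J v) (t - s) m" "fl th m s y" using fl_split[OF assms(2), of "t - s"] s assms(4) by auto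
 have "m = J u" using fl_inj_Qp[OF m(2) assms(1,3)] .
 thus ?thesis unfolding Ret_def using m(1) assms(4,5) by auto
qed

lemma Ret_least: assumes "Ret u \<noteq> {}" shows "\<exists>m\<in>Ret u. \<forall>t\<in>Ret u. m \<le> t"
proof (rule gap_least[OF assms _ \<eta>(1)])
 fix s t assume st: "s \<in> Ret u" "t \<in> Ret u" "s < t"
 obtain v w where v: "v \<in> {0..\<rho>}" "fl th (J u) s (J v)" and w: "w \<in> {0..\<rho>}" "fl th (J u) t (J w)" using st unfolding Ret_def by blast
 have "fl th (J v) (t - s) (J w)" using fl_cancel[OF v(2) w(2)] st(3) by simp
 hence "t - s \<in> Ret v" unfolding Ret_def using st(3) w(1) by auto
 thus "\<eta> \<le> t - s" by (rule Ret_ge) (rule seg_abs(1)[OF v(1)])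
qed (auto simp: Ret_def)

text \<open>Orbits are determined backwards by their target. If two points of the transversal had
 the same target, the one with the longer way would pass the other first, that is, return before
 reaching the target.\<close>

lemma reach_inj: assumes "reach u s p" "reach v t p" "s \<le> t" "u \<in> {0<..<\<rho>}" "\<forall>r\<in>Ret v. t \<le> r" "p \<in> Inl ` sides X \<union> Inr ` {0, \<rho>}" shows "u = v"
proof (cases p)
 case (Inl c)
 hence h: "hits th (J u) s c" "hits th (J v) t c" using assms(1,2) by (simp_all add: reach_def)
 have s: "0 < s" using hits_pos h(1) by blast
 obtain m where m: "fl th (J v) (t - s) m" "hits th m s c" using hits_split[OF h(2), of "t - s"] s assms(3) by auto
 have mJ: "m = J u" using hits_inj_Qp[OF m(2) h(1)] .
 have "\<not> s < t"
 proof
  assume "s < t"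
  hence "t - s \<in> Ret v" unfolding Ret_def using m(1) mJ assms(4) by auto
  thus False using assms(5) s by auto
 qed
 hence "t - s = 0" using assms(3) by simp
 hence "J u = J v" using fl_0 m(1) mJ by metis
 thus ?thesis by (rule J_inj)
next
 case (Inr w)
 hence h: "fl th (J u) s (J w)" "fl th (J v) t (J w)" "0 < s" using assms(1,2) by (simp_all add: reach_def)
 have wQ: "J w \<in> Q" using assms(6) Inr \<rho> by (intro J_Q) auto
 have "\<not> s < t"
 proof
  assume st: "s < t"
  have "t - s \<in> Ret v" by (rule merge[OF h(1,2) wQ st]) (use assms(4) in auto)
  thus False using assms(5) h(3) by auto
 qed
 hence "t = s" using assms(3) by simp
 hence "J u = J v" using fl_inj_Qp[OF h(1) _ wQ] h(2) by blast
 thus ?thesis by (rule J_inj)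
qed

lemma Cut_card: "finite Cut" "card Cut \<le> card (sides X) + 2"
proof -
 define Tg where "Tg = Inl ` sides X \<union> Inr ` {0, \<rho>}"
 have "\<forall>u\<in>Cut. \<exists>p. p \<in> Tg \<and> (\<exists>s. reach u s p \<and> (\<forall>t\<in>Ret u. s \<le> t))" unfolding Cut_def Tg_def by blast
 then obtain f where f: "\<And>u. u \<in> Cut ==> f u \<in> Tg \<and> (\<exists>s. reach u s (f u) \<and> (\<forall>t\<in>Ret u. s \<le> t))" by metis
 have "inj_on f Cut"
 proof (rule inj_onI)
  fix u v assume uv: "u \<in> Cut" "v \<in> Cut" "f u = f v"
  obtain s where s: "reach u s (f u)" "\<forall>t\<in>Ret u. s \<le> t" using f[OF uv(1)] by blast
  obtain t where t: "reach v t (f u)" "\<forall>r\<in>Ret v. t \<le> r" using f[OF uv(2)] uv(3) by auto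
  have m: "u \<in> {0<..<\<rho>}" "v \<in> {0<..<\<rho>}" "f u \<in> Inl ` sides X \<union> Inr ` {0, \<rho>}" using uv(1,2) f[OF uv(1)] unfolding Cut_def Tg_def by blast+
  show "u = v"
  proof (cases "s \<le> t")
   case True
   show ?thesis by (rule reach_inj[OF s(1) t(1) True m(1) t(2) m(3)])
  next
   case False
   hence "t \<le> s" by simp
   show ?thesis by (rule sym, rule reach_inj[OF t(1) s(1) \<open>t \<le> s\<close> m(2) s(2) m(3)])
  qed
 qed
 moreover have "f ` Cut \<subseteq> Tg" using f by blast
 moreover have fT: "finite Tg" unfolding Tg_def using finite_sides by simp
 ultimately show "finite Cut" by (meson finite_imageD finite_subset)
 have "card Cut \<le> card Tg" by (rule card_inj_on_le[OF \<open>inj_on f Cut\<close> \<open>f ` Cut \<subseteq> Tg\<close> fT])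
 also have "\<dots> \<le> card (Inl ` sides X :: ((nat \<times> nat) + real) set) + card (Inr ` {0, \<rho>} :: ((nat \<times> nat) + real) set)" unfolding Tg_def by (rule card_Un_le)
 also have "\<dots> \<le> card (sides X) + 2"
  by (intro add_mono card_image_le finite_sides order.trans[OF card_image_le]) (auto simp: card_insert_if)
 finally show "card Cut \<le> card (sides X) + 2" .
qed

lemma Alive_flows: assumes "u \<in> Alive s" "u \<notin> Cut" "0 \<le> s" shows "\<exists>z. fl th (J u) s z"
proof (rule ccontr)
 assume "\<not> ?thesis"
 moreover have u: "u \<in> {0<..<\<rho>}" "\<forall>t\<in>Ret u. s < t" using assms(1) by (auto simp: Alive_def)
 ultimately obtain r c where h: "r \<le> s" "hits th (J u) r c" using fl_or_hits[OF Q_Qp[OF J_Q[OF seg_abs(2)[OF u(1)]]] assms(3)] by blast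
 have "c \<in> sides X" using hits_pos h(2) by blast
 hence p: "Inl c \<in> Inl ` sides X \<union> Inr ` {0, \<rho>}" by blast
 have q: "\<forall>t\<in>Ret u. r \<le> t" using u(2) h(1) by (meson less_imp_le order_trans)
 have "reach u r (Inl c)" using h(2) by (simp add: reach_def)
 hence "u \<in> Cut" unfolding Cut_def using u(1) p q by blast
 thus False using assms(2) by blast
qed

text \<open>If returns until time \<open>s\<close> occurred arbitrarily close to \<open>u\<close>,
 their times and places would accumulate, and by \<open>fl_limit\<close> the orbit of
 \<open>u\<close> itself would return.\<close>

lemma Alive_open: assumes u: "u \<in> Alive s" "u \<notin> Cut" and s: "0 < s"
 shows "\<exists>e>0. \<forall>a. \<bar>a\<bar> < e --> u + a \<in> {0<..<\<rho>} --> u + a \<in> Alive s"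
proof (rule ccontr)
 assume neg: "\<not> ?thesis"
 have uI: "u \<in> {0<..<\<rho>}" "\<forall>t\<in>Ret u. s < t" using u(1) by (auto simp: Alive_def)
 have "\<exists>a t v. \<bar>a\<bar> < 1 / real (Suc n) \<and> t \<in> {\<eta>..s} \<and> v \<in> {0..\<rho>} \<and> fl th (J (u + a)) t (J v)" for n
 proof -
  have "0 < 1 / real (Suc n)" by simp
  then obtain a where a: "\<bar>a\<bar> < 1 / real (Suc n)" "u + a \<in> {0<..<\<rho>}" "u + a \<notin> Alive s" using neg by blast
  then obtain t where t: "t \<in> Ret (u + a)" "\<not> s < t" unfolding Alive_def by blast
  have "\<eta> \<le> t" by (rule Ret_ge[OF t(1) seg_abs(2)[OF a(2)]])
  hence "t \<in> {\<eta>..s}" using t(2) by simp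
  moreover obtain v where "v \<in> {0..\<rho>}" "fl th (J (u + a)) t (J v)" using t(1) unfolding Ret_def by blast
  ultimately show ?thesis using a(1) by blast
 qed
 then obtain a t v where atv: "\<And>n. \<bar>a n\<bar> < 1 / real (Suc n)" "\<And>n. t n \<in> {\<eta>..s}" "\<And>n. v n \<in> {0..\<rho>}" "\<And>n. fl th (J (u + a n)) (t n) (J (v n))"
  by metis
 have "seq_compact ({\<eta>..s} \<times> {0..\<rho>})" by (intro compact_imp_seq_compact compact_Times compact_Icc)
 moreover have "\<forall>n. (t n, v n) \<in> {\<eta>..s} \<times> {0..\<rho>}" using atv(2,3) by blast
 ultimately obtain l r where l: "l \<in> {\<eta>..s} \<times> {0..\<rho>}" "strict_mono r" "((\<lambda>n. (t n, v n)) \<circ> r) \<longlonglongrightarrow> l"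
  by (rule seq_compactE)
 define T V where "T = fst l" and "V = snd l"
 have TV: "T \<in> {\<eta>..s}" "V \<in> {0..\<rho>}" using l(1) unfolding T_def V_def mem_Times_iff by blast+
 have lt: "(\<lambda>n. t (r n)) \<longlonglongrightarrow> T" using tendsto_fst[OF l(3)] by (simp add: o_def T_def)
 have lv: "(\<lambda>n. v (r n)) \<longlonglongrightarrow> V" using tendsto_snd[OF l(3)] by (simp add: o_def V_def)
 obtain z where z: "fl th (J u) s z" using Alive_flows[OF u] s by auto
 obtain w where w: "fl th (J u) T w" using fl_defined_le[OF z, of T] TV(1) \<eta>(1) by auto
 have "fl th (J u) T (J V)"
 proof (rule fl_limit[OF J_Q[OF seg_abs(2)[OF uI(1)]] J_Q[OF seg_abs(1)[OF TV(2)]] w])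
  fix \<epsilon> :: real assume \<epsilon>: "0 < \<epsilon>"
  have "eventually (\<lambda>n. dist (t (r n)) T < \<epsilon>) sequentially" using lt \<epsilon> by (rule tendstoD)
  moreover have "eventually (\<lambda>n. dist (v (r n)) V < \<epsilon>) sequentially" using lv \<epsilon> by (rule tendstoD)
  moreover have "eventually (\<lambda>n. 1 / real (Suc n) < \<epsilon>) sequentially"
   by (rule order_tendstoD(2)[OF _ \<epsilon>]) (rule lim_1_over_n[THEN LIMSEQ_Suc])
  ultimately have "eventually (\<lambda>n. dist (t (r n)) T < \<epsilon> \<and> dist (v (r n)) V < \<epsilon> \<and> 1 / real (Suc n) < \<epsilon>) sequentially"
   by eventually_elim blast
  then obtain n where n: "dist (t (r n)) T < \<epsilon>" "dist (v (r n)) V < \<epsilon>" "1 / real (Suc n) < \<epsilon>"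
   using eventually_happens'[OF sequentially_bot] by blast
  have "n \<le> r n" using l(2) by (rule seq_suble)
  hence "1 / real (Suc (r n)) \<le> 1 / real (Suc n)" by (intro divide_left_mono) auto
  hence an: "\<bar>a (r n)\<bar> < \<epsilon>" using atv(1)[of "r n"] n(3) by linarith
  let ?u = "of_real (a (r n)) * hh" and ?v = "of_real (v (r n) - V) * hh"
  have "fl th (shift (J u) ?u) (t (r n)) (shift (J V) ?v)" unfolding J_shift using atv(4)[of "r n"] by simp
  moreover have "cmod ?u < \<epsilon>" using an by (simp add: norm_mult hh)
  moreover have "cmod ?v < \<epsilon>" using n(2) unfolding norm_mult hh norm_of_real by (simp add: dist_real_def)
  moreover have "\<bar>t (r n) - T\<bar> < \<epsilon>" using n(1) by (simp add: dist_real_def)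
  ultimately show "\<exists>u' v' t'. cmod u' < \<epsilon> \<and> cmod v' < \<epsilon> \<and> \<bar>t' - T\<bar> < \<epsilon> \<and> fl th (shift (J u) u') t' (shift (J V) v')" by blast
 qed
 hence "T \<in> Ret u" unfolding Ret_def using TV \<eta>(1) by auto
 thus False using uI(2) TV(1) by auto
qed

text \<open>The first return happens inside the transversal, as \<open>u\<close> is no exceptional
 point; so neighbours return at the same time.\<close>

lemma Alive_closed: assumes u: "u \<in> {0<..<\<rho>}" "u \<notin> Alive s" "u \<notin> Cut"
 shows "\<exists>e>0. \<forall>a. \<bar>a\<bar> < e --> u + a \<notin> Alive s"
proof -
 obtain t where t: "t \<in> Ret u" "t \<le> s" using u(1,2) unfolding Alive_def by force
 then obtain m where m: "m \<in> Ret u" "\<forall>t\<in>Ret u. m \<le> t" using Ret_least by blast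
 obtain v where v: "0 < m" "v \<in> {0..\<rho>}" "fl th (J u) m (J v)" using m(1) unfolding Ret_def by blast
 have nv: "v \<notin> {0, \<rho>}"
 proof
  assume "v \<in> {0, \<rho>}"
  hence p: "Inr v \<in> Inl ` sides X \<union> Inr ` {0, \<rho>}" by blast
  have "reach u m (Inr v)" using v by (simp add: reach_def)
  hence "u \<in> Cut" unfolding Cut_def using u(1) p m(2) by blast
  thus False using u(3) by blast
 qed
 obtain e where e: "e > 0" "\<And>w. cmod w < e ==> fl th (shift (J u) w) m (shift (J v) w)"
  using fl_stable[OF J_Q[OF seg_abs(2)[OF u(1)]] J_Q[OF seg_abs(1)[OF v(2)]] v(3)] by blast
 let ?e = "min e (min v (\<rho> - v))"
 have "u + a \<notin> Alive s" if a: "\<bar>a\<bar> < ?e" for a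
 proof -
  have "fl th (J (u + a)) m (J (v + a))" using e(2)[of "of_real a * hh"] a unfolding J_shift by (simp add: norm_mult hh)
  moreover have "v + a \<in> {0..\<rho>}" using a by auto
  ultimately have "m \<in> Ret (u + a)" unfolding Ret_def using v(1) by blast
  moreover have "m \<le> s" using m(2) t by force
  ultimately show ?thesis unfolding Alive_def by force
 qed
 moreover have "0 < ?e" using e(1) v(2) nv by auto
 ultimately show ?thesis by blast
qed

text \<open>The points passed by orbits from \<open>K\<close> between the times \<open>a\<close> and
 \<open>b\<close>.\<close>

definition strip :: "real set => real => real => (nat \<times> complex) set" where
 "strip K a b = {x \<in> Q. \<exists>u\<in>K. \<exists>t. a < t \<and> t < b \<and> fl th (J u) t x}"

end

context tsurf
begin

text \<open>Each point of the orbit is followed by one at a rational time, on the same line in the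
 direction of the flow.\<close>

lemma orbit_null: "\<exists>Z\<in>null_sets mu. \<forall>x\<in>Q. \<forall>t. fl th a t x --> x \<in> Z"
proof
 define Ln where "Ln x = {fst x} \<times> {z. cross (direction th) (z - snd x) = 0}" for x :: "nat \<times> complex"
 let ?Z = "\<Union>q\<in>\<rat>. \<Union>y\<in>{y. fl th a q y}. Ln y"
 have "countable {y. fl th a q y}" for q
 proof (cases "{y. fl th a q y} = {}")
  case False
  then obtain y where "fl th a q y" by blast
  hence "{y. fl th a q y} \<subseteq> {y}" using fl_det by blast
  thus ?thesis by (rule countable_subset) simp
 next
  case True
  show ?thesis unfolding True by (rule countable_empty)
 qed
 thus "?Z \<in> null_sets mu" unfolding Ln_def by (intro null_sets_UN' countable_rat line_null direction_nz)
 show "\<forall>x\<in>Q. \<forall>t. fl th a t x --> x \<in> ?Z"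
 proof (intro ballI allI impI)
  fix x t assume x: "x \<in> Q" "fl th a t x"
  have xQ: "x \<in> Qp th" using Q_Qp x(1) .
  have "t < t + ext th x" using ext(1)[OF xQ] by simp
  then obtain q where q: "q \<in> \<rat>" "t < q" "q < t + ext th x" using Rats_dense_in_real by blast
  have d: "0 \<le> q - t" "q - t < ext th x" using q by auto
  have "fl th a q (mv th x (q - t))" using fl_trans[OF x(2) fl.fl_move[OF xQ d]] by simp
  moreover have "x \<in> Ln (mv th x (q - t))" unfolding Ln_def mem_Times_iff
   by (simp add: cross_simps flip: of_real_diff)
  ultimately have "x \<in> (\<Union>y\<in>{y. fl th a q y}. Ln y)" by blast
  thus "x \<in> ?Z" by (rule UN_I[OF q(1)])
 qed
qed

text \<open>An open rectangle based on the transversal, written without reference to its length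
 bound.\<close>

definition window :: "real => nat \<times> complex => real => real => (nat \<times> complex) set" where
 "window th p \<eta> r = {fst p} \<times> {z. 0 < Re ((z - snd p) * cnj (- \<i> * direction th)) \<and> Re ((z - snd p) * cnj (- \<i> * direction th)) < r \<and>
   0 < Re ((z - snd p) * cnj (direction th)) \<and> Re ((z - snd p) * cnj (direction th)) < \<eta>}"

lemma open_window: "open (window th p \<eta> r)"
 unfolding window_def by (intro open_nat_Times open_Collect_conj open_Collect_less continuous_intros)

end

context tower
begin

lemma window_iff: "x \<in> window th x0 \<eta> r \<longleftrightarrow> (\<exists>u s. 0 < u \<and> u < r \<and> 0 < s \<and> s < \<eta> \<and> x = mv th (J u) s)"
proof
 assume x: "x \<in> window th x0 \<eta> r"
 let ?w = "snd x - snd x0"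
 have "x = mv th (J (aco ?w)) (bco ?w)"
 proof (rule prod_eqI)
  show "fst x = fst (mv th (J (aco ?w)) (bco ?w))" using x by (simp add: window_def mem_Times_iff J_simps)
  have "snd (mv th (J (aco ?w)) (bco ?w)) = snd x0 + (of_real (aco ?w) * hh + of_real (bco ?w) * dd)" by (simp add: J_simps)
  thus "snd x = snd (mv th (J (aco ?w)) (bco ?w))" unfolding decomp[of ?w, symmetric] by simp
 qed
 moreover have "0 < aco ?w" "aco ?w < r" "0 < bco ?w" "bco ?w < \<eta>" using x unfolding window_def aco_def bco_def hh_def by auto
 ultimately show "\<exists>u s. 0 < u \<and> u < r \<and> 0 < s \<and> s < \<eta> \<and> x = mv th (J u) s" by blast
next
 assume "\<exists>u s. 0 < u \<and> u < r \<and> 0 < s \<and> s < \<eta> \<and> x = mv th (J u) s"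
 then obtain u s where x: "0 < u" "u < r" "0 < s" "s < \<eta>" "x = mv th (J u) s" by blast
 have w: "snd x - snd x0 = of_real u * hh + of_real s * dd" using x(5) by (simp add: J_simps)
 have "aco (snd x - snd x0) = u" "bco (snd x - snd x0) = s" unfolding w by (rule co)+
 thus "x \<in> window th x0 \<eta> r" using x unfolding window_def aco_def bco_def hh_def by (simp add: mem_Times_iff J_simps)
qed

lemma window_Q: assumes "r \<le> \<eta>" shows "window th x0 \<eta> r \<subseteq> Q"
proof
 fix x assume "x \<in> window th x0 \<eta> r"
 then obtain u s where x: "0 < u" "u < r" "0 < s" "s < \<eta>" "x = mv th (J u) s" unfolding window_iff by blast
 show "x \<in> Q" unfolding x(5) by (rule J_chart) (use x \<eta>(1) assms in auto)
qed

lemma shrinking_window: assumes "0 < c" "0 < r0" shows "\<exists>r. 0 < r \<and> r < r0 \<and> r \<le> \<eta> \<and> emeasure mu (window th x0 \<eta> r) < c"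
proof -
 define B where "B k = window th x0 \<eta> (\<eta> / real (Suc k))" for k
 have le: "\<eta> / real (Suc k) \<le> \<eta>" for k using \<eta>(1) by (simp add: field_simps)
 have mono: "window th x0 \<eta> r \<subseteq> window th x0 \<eta> r'" if "r \<le> r'" for r r' using that by (auto simp: window_def)
 have dec: "decseq B" unfolding B_def by (intro decseq_SucI mono divide_left_mono) (use \<eta>(1) in auto)
 have Bo: "B k \<in> sets borel" and Bf: "emeasure mu (B k) \<noteq> \<infinity>" for k
  unfolding B_def by (rule borel_open[OF open_window], rule Q_fin_measure[OF window_Q[OF le]])
 have emp: "(\<Inter>k. B k) = {}"
 proof (rule ccontr)
  assume "(\<Inter>k. B k) \<noteq> {}"
  then obtain x where x: "\<And>k. x \<in> B k" by blast
  define a where "a = Re ((snd x - snd x0) * cnj (- \<i> * direction th))"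
  have a: "0 < a" "\<And>k. a < \<eta> / real (Suc k)" using x unfolding B_def window_def a_def by (auto simp: mem_Times_iff)
  have "0 < a / \<eta>" using a(1) \<eta>(1) by simp
  then obtain k where "1 / real (Suc k) < a / \<eta>" using nat_approx_posE by blast
  hence "\<eta> / real (Suc k) < a" using \<eta>(1) by (simp add: field_simps)
  thus False using a(2)[of k] by simp
 qed
 have "(\<lambda>k. emeasure mu (B k)) \<longlonglongrightarrow> emeasure mu (\<Inter>k. B k)"
  by (rule Lim_emeasure_decseq[OF _ dec]) (use Bo Bf in auto)
 hence "(\<lambda>k. emeasure mu (B k)) \<longlonglongrightarrow> 0" unfolding emp by simp
 hence "eventually (\<lambda>k. emeasure mu (B k) < c) sequentially" using assms(1) by (rule order_tendstoD(2))
 moreover have "eventually (\<lambda>k. \<eta> / real (Suc k) < r0) sequentially"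
  by (rule order_tendstoD(2)[OF _ assms(2)]) (rule LIMSEQ_Suc[OF lim_const_over_n])
 ultimately have "eventually (\<lambda>k. emeasure mu (B k) < c \<and> \<eta> / real (Suc k) < r0) sequentially" by eventually_elim blast
 then obtain k where k: "emeasure mu (B k) < c" "\<eta> / real (Suc k) < r0" using eventually_happens'[OF sequentially_bot] by blast
 thus ?thesis using le[of k] \<eta>(1) unfolding B_def by (intro exI[of _ "\<eta> / real (Suc k)"]) simp
qed

lemma strip_Q: "strip K a b \<subseteq> Q" by (auto simp: strip_def)

lemma strip_open: assumes K: "open K" "K \<subseteq> {0<..<\<rho>}" and a: "0 \<le> a" shows "open (strip K a b)"
proof (rule shift_open)
 fix x assume "x \<in> strip K a b"
 then obtain u t where x: "x \<in> Q" "u \<in> K" "a < t" "t < b" "fl th (J u) t x" unfolding strip_def by blast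
 have uQ: "J u \<in> Q" using x(2) K(2) by (intro J_Q seg_abs(2)) blast
 obtain e where e: "e > 0" "\<And>w. cmod w < e ==> shift x w \<in> Q \<and> fl th (shift (J u) w) t (shift x w)" using fl_stable[OF uQ x(1,5)] by blast
 obtain e' where e': "e' > 0" "ball u e' \<subseteq> K" using K(1) x(2) open_contains_ball by blast
 let ?e = "min (min e e') (min \<eta> (min (t - a) (b - t)))"
 have "shift x w \<in> strip K a b" if w: "cmod w < ?e" for w
 proof -
  have c: "\<bar>aco w\<bar> < ?e" "\<bar>bco w\<bar> < ?e" using co_le[of w] w by linarith+
  have uK: "u + aco w \<in> K" by (rule subsetD[OF e'(2)]) (use c(1) in \<open>simp add: dist_real_def\<close>)
  have "shift (J u) w = mv th (J (u + aco w)) (bco w)"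
  proof (rule prod_eqI)
   have "snd (shift (J u) w) = snd x0 + of_real u * hh + (of_real (aco w) * hh + of_real (bco w) * dd)"
    unfolding decomp[of w, symmetric] by (simp add: J_simps)
   thus "snd (shift (J u) w) = snd (mv th (J (u + aco w)) (bco w))" by (simp add: J_simps algebra_simps)
  qed (simp add: J_simps)
  hence f: "fl th (mv th (J (u + aco w)) (bco w)) t (shift x w)" using e(2)[of w] w by simp
  have "fl th (J (u + aco w)) (t + bco w) (shift x w)"
   by (rule base_adjust[OF _ _ f]) (use seg_abs(2) uK K(2) c(2) a x(3) in auto)
  moreover have "a < t + bco w" "t + bco w < b" using c(2) by auto
  ultimately show ?thesis unfolding strip_def using e(2)[of w] w uK by auto
 qed
 thus "\<exists>\<epsilon>>0. \<forall>w. cmod w < \<epsilon> --> shift x w \<in> strip K a b" using e(1) e'(1) \<eta>(1) x(3,4) by (intro exI[of _ ?e]) simp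
qed

lemma strip_le: assumes K: "open K" "K \<subseteq> {0<..<\<rho>}" and a: "0 \<le> a" "0 \<le> c"
 shows "emeasure mu (strip K (a + c) (b + c)) \<le> emeasure mu (strip K a b)"
proof (rule mu_le_preimage[where th = th and t = c])
 fix y assume "y \<in> strip K (a + c) (b + c)"
 then obtain u t where y: "y \<in> Q" "u \<in> K" "a + c < t" "t < b + c" "fl th (J u) t y" unfolding strip_def by blast
 obtain x where x: "fl th (J u) (t - c) x" "fl th x c y" using fl_split[OF y(5), of "t - c"] y(3) a by auto
 have "x \<in> Q --> x \<in> strip K a b" unfolding strip_def using x(1) y(2-4) by force
 thus "\<exists>x. fl th x c y \<and> (x \<in> Q --> x \<in> strip K a b)" using x(2) by blast
qed (use strip_open[OF K] a strip_Q in auto)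

lemma strip_ge: assumes K: "open K" "K \<subseteq> {0<..<\<rho>}" "K \<inter> Cut = {}" and a: "0 \<le> a" "0 \<le> c"
  and G: "\<And>s. s < h ==> K \<subseteq> Alive s" "b + c \<le> h"
 shows "emeasure mu (strip K a b) \<le> emeasure mu (strip K (a + c) (b + c))"
proof -
 have d: "\<exists>y. fl th x c y" "\<And>y. fl th x c y ==> y \<in> Q ==> y \<in> strip K (a + c) (b + c)" if xs: "x \<in> strip K a b" for x
 proof -
  obtain u t where x: "u \<in> K" "a < t" "t < b" "fl th (J u) t x" using xs unfolding strip_def by blast
  have "u \<in> Alive (t + c)" using G(1)[of "t + c"] G(2) x(1,3) by auto
  then obtain z where "fl th (J u) (t + c) z" using Alive_flows[of u "t + c"] K(3) x(1,2) a by auto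
  from fl_cancel[OF x(4) this] a have "fl th x c z" by simp
  thus "\<exists>y. fl th x c y" by blast
  show "y \<in> strip K (a + c) (b + c)" if "fl th x c y" "y \<in> Q" for y
   using fl_trans[OF x(4) that(1)] that(2) x(1-3) unfolding strip_def by force
 qed
 have o: "strip K a b \<in> sets borel" using strip_open[OF K(1,2) a(1)] by simp
 have "emeasure mu (strip K a b) \<le> emeasure mu (fimg th c (strip K a b))"
  by (rule mu_le_fimg[OF o strip_Q d(1)])
 also have "\<dots> \<le> emeasure mu (strip K (a + c) (b + c))"
  using d(2) strip_open[OF K(1,2), of "a + c"] a by (intro emeasure_mono) (auto simp: fimg_def)
 finally show ?thesis .
qed

lemma strip_disjoint: assumes K: "K \<subseteq> {0<..<\<rho>}" and "0 \<le> a" "b \<le> a'" "b' \<le> h" and G: "\<And>s. s < h ==> K \<subseteq> Alive s"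
 shows "strip K a b \<inter> strip K a' b' = {}"
proof (rule ccontr)
 assume "strip K a b \<inter> strip K a' b' \<noteq> {}"
 then obtain x where x: "x \<in> strip K a b" "x \<in> strip K a' b'" by blast
 obtain u t where u: "x \<in> Q" "u \<in> K" "a < t" "t < b" "fl th (J u) t x" using x(1) unfolding strip_def by blast
 obtain v t' where v: "v \<in> K" "a' < t'" "t' < b'" "fl th (J v) t' x" using x(2) unfolding strip_def by blast
 have "t' - t \<in> Ret v" by (rule merge[OF u(5) v(4) u(1)]) (use u v assms(3) K in auto)
 moreover have "v \<in> Alive t'" using G[of t'] v(1,3) assms(4) by auto
 ultimately have "t' < t' - t" unfolding Alive_def by blast
 thus False using u(3) assms(2) by simp
qed

lemma strip_disc: assumes K: "{l<..<b} \<subseteq> {0<..<\<rho>}" "l < b"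
 shows "ennreal (pi * ((b - l) / 2)\<^sup>2) \<le> emeasure mu (strip {l<..<b} 0 (b - l))"
proof -
 have lb: "0 \<le> l" "b \<le> \<rho>" using K greaterThanLessThan_subseteq_greaterThanLessThan[of l b 0 \<rho>] by auto
 let ?r = "(b - l) / 2"
 let ?c = "snd x0 + (of_real ((l + b) / 2) * hh + of_real ?r * dd)"
 have "{fst x0} \<times> ball ?c ?r \<subseteq> strip {l<..<b} 0 (b - l)"
 proof
  fix x assume "x \<in> {fst x0} \<times> ball ?c ?r"
  hence x: "fst x = fst x0" "cmod (snd x - ?c) < ?r" by (auto simp: dist_norm norm_minus_commute)
  define w where "w = snd x - ?c"
  have c: "\<bar>aco w\<bar> < ?r" "\<bar>bco w\<bar> < ?r" using co_le[of w] x(2) unfolding w_def by linarith+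
  let ?u = "(l + b) / 2 + aco w" and ?t = "?r + bco w"
  have "snd x = ?c + (of_real (aco w) * hh + of_real (bco w) * dd)" unfolding decomp[of w, symmetric] by (simp add: w_def)
  hence xe: "x = mv th (J ?u) ?t" using x(1) by (intro prod_eqI) (simp_all add: J_simps algebra_simps)
  have ut: "?u \<in> {l<..<b}" "0 < ?t" "?t < b - l" using c by (auto simp: field_simps abs_less_iff)
  have "\<bar>?u\<bar> \<le> \<eta>" using ut(1) K(1) seg_abs(2) by blast
  moreover have "?t \<le> \<eta>" using ut(3) lb \<rho> by linarith
  ultimately have "fl th (J ?u) ?t x" "x \<in> Q" unfolding xe using J_move0[of ?u ?t] J_chart[of ?u ?t] ut(2) \<eta>(1) by auto
  thus "x \<in> strip {l<..<b} 0 (b - l)" unfolding strip_def using ut by blast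
 qed
 hence "emeasure mu ({fst x0} \<times> ball ?c ?r) \<le> emeasure mu (strip {l<..<b} 0 (b - l))"
  using strip_open[OF open_greaterThanLessThan K(1)] by (intro emeasure_mono) auto
 moreover have "emeasure mu ({fst x0} \<times> ball ?c ?r) = ennreal (pi * ?r\<^sup>2)"
  using K(2) by (simp add: emeasure_mu_Times emeasure_ball unit_ball_vol_2)
 ultimately show ?thesis by simp
qed

text \<open>Stacking squares: the flow carries the bottom square of a strip to disjoint
 ones.\<close>

lemma height_bound: assumes K: "{l<..<b} \<subseteq> {0<..<\<rho>}" "l < b" "{l<..<b} \<inter> Cut = {}"
  and h: "0 < h" "\<And>s. s < h ==> {l<..<b} \<subseteq> Alive s"
 shows "h * (b - l) \<le> 2 * measure mu Q + \<eta>\<^sup>2"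
proof -
 let ?K = "{l<..<b}" and ?d = "b - l"
 have d: "0 < ?d" "?d \<le> \<eta>" using K(2) \<rho> greaterThanLessThan_subseteq_greaterThanLessThan[of l b 0 \<rho>] K(1) by auto
 define n where "n = nat \<lfloor>h / ?d\<rfloor>"
 have "0 \<le> h / ?d" using h d by simp
 hence n: "real n \<le> h / ?d" "h / ?d < real n + 1" unfolding n_def by linarith+
 have nd: "real n * ?d \<le> h" "h < (real n + 1) * ?d" using n d by (simp_all add: pos_le_divide_eq pos_divide_less_eq)
 define S where "S j = strip ?K (0 + real j * ?d) (?d + real j * ?d)" for j
 have So: "open (S j)" for j unfolding S_def using d by (intro strip_open[OF open_greaterThanLessThan K(1)]) simp
 have top: "?d + real j * ?d \<le> h" if "j < n" for j
 proof -
  have "(real j + 1) * ?d \<le> real n * ?d" using that d by (intro mult_right_mono) auto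
  thus ?thesis using nd(1) by (simp add: algebra_simps)
 qed
 have dis: "S i \<inter> S j = {}" if "i < j" "j < n" for i j
 proof -
  have "(real i + 1) * ?d \<le> real j * ?d" using that d by (intro mult_right_mono) auto
  hence "?d + real i * ?d \<le> 0 + real j * ?d" by (simp add: algebra_simps)
  moreover have "0 \<le> 0 + real i * ?d" using d by simp
  ultimately show ?thesis unfolding S_def by (intro strip_disjoint[OF K(1) _ _ top[OF that(2)] h(2)])
 qed
 have df: "disjoint_family_on S {..<n}" unfolding disjoint_family_on_def
 proof (intro ballI impI)
  fix i j assume ij: "i \<in> {..<n}" "j \<in> {..<n}" "i \<noteq> j"
  then consider "i < j" | "j < i" by linarith
  thus "S i \<inter> S j = {}" using dis ij by cases auto
 qed
 have ge: "ennreal (pi * (?d / 2)\<^sup>2) \<le> emeasure mu (S j)" if "j < n" for j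
  unfolding S_def
 proof (rule order_trans[OF strip_disc[OF K(1,2)]], rule strip_ge[OF open_greaterThanLessThan K(1,3) _ _ _ top[OF that]])
  show "{l<..<b} \<subseteq> Alive s" if "s < h" for s using h(2)[OF that] .
 qed (use d in auto)
 have "ennreal (real n * (pi * (?d / 2)\<^sup>2)) = (\<Sum>j<n. ennreal (pi * (?d / 2)\<^sup>2))"
  by (subst sum_ennreal) (auto simp: algebra_simps)
 also have "\<dots> \<le> (\<Sum>j<n. emeasure mu (S j))" by (intro sum_mono ge) simp
 also have "\<dots> = emeasure mu (\<Union>j<n. S j)" by (rule sum_emeasure) (use So df in auto)
 also have "\<dots> \<le> emeasure mu Q" using open_Q strip_Q unfolding S_def by (intro emeasure_mono) auto
 finally have "real n * (pi * (?d / 2)\<^sup>2) \<le> measure mu Q" unfolding mu_Q_measure by (simp add: ennreal_le_iff)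
 moreover have "real n * (2 * (?d / 2)\<^sup>2) \<le> real n * (pi * (?d / 2)\<^sup>2)" using pi_ge_two by (intro mult_left_mono mult_right_mono) auto
 ultimately have 1: "real n * ?d\<^sup>2 \<le> 2 * measure mu Q" by (simp add: power_divide)
 have "h * ?d \<le> (real n + 1) * ?d * ?d" using nd(2) d by (intro mult_right_mono) auto
 also have "\<dots> = real n * ?d\<^sup>2 + ?d\<^sup>2" by (simp add: power2_eq_square algebra_simps)
 finally have "h * ?d \<le> real n * ?d\<^sup>2 + ?d\<^sup>2" .
 moreover have "?d\<^sup>2 \<le> \<eta>\<^sup>2" using d by (intro power_mono) auto
 ultimately show ?thesis using 1 by linarith
qed

lemma strip_cover: assumes K: "open K" "K \<subseteq> {0<..<\<rho>}" and w: "0 < w" "h \<le> real k * (w / 2)"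
 shows "emeasure mu (strip K 0 h) \<le> of_nat k * emeasure mu (strip K 0 w)"
proof -
 define S where "S j = strip K (0 + real j * (w / 2)) (w + real j * (w / 2))" for j
 have So: "open (S j)" for j unfolding S_def using w by (intro strip_open[OF K]) simp
 have "strip K 0 h \<subseteq> (\<Union>j<k. S j)"
 proof
  fix x assume "x \<in> strip K 0 h"
  then obtain u t where x: "x \<in> Q" "u \<in> K" "0 < t" "t < h" "fl th (J u) t x" unfolding strip_def by blast
  define j where "j = nat (\<lceil>t / (w / 2)\<rceil> - 1)"
  have "0 < t / (w / 2)" using x(3) w(1) by simp
  hence j: "real j < t / (w / 2)" "t / (w / 2) \<le> real j + 1" unfolding j_def by linarith+
  have jt: "real j * (w / 2) < t" "t \<le> (real j + 1) * (w / 2)" using j w(1) by (simp_all only: pos_less_divide_eq pos_divide_le_eq half_gt_zero)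
  have "real j * (w / 2) < real k * (w / 2)" using jt(1) x(4) w(2) by linarith
  hence "j < k" using w(1) by simp
  moreover have "t < w + real j * (w / 2)" using jt(2) w(1) by (simp add: algebra_simps)
  ultimately show "x \<in> (\<Union>j<k. S j)" using x jt(1) unfolding S_def strip_def by auto
 qed
 hence "emeasure mu (strip K 0 h) \<le> emeasure mu (\<Union>j<k. S j)" using So by (intro emeasure_mono) auto
 also have "\<dots> \<le> (\<Sum>j<k. emeasure mu (S j))" using So by (intro emeasure_subadditive_finite) auto
 also have "\<dots> \<le> (\<Sum>j<k. emeasure mu (strip K 0 w))"
  unfolding S_def using w(1) by (intro sum_mono strip_le[OF K]) simp_all
 finally show ?thesis by simp
qed

text \<open>The set of points \<open>u\<close> of the interval for which this holds is open by
 stability and closed by \<open>fl_limit\<close>. The disc around \<open>y\<close> keeps the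
 translated points inside one polygon.\<close>

lemma strip_translate: assumes K: "{l<..<b} \<subseteq> {0<..<\<rho>}" "{l<..<b} \<inter> Cut = {}" "{l<..<b} \<subseteq> Alive t" "0 \<le> t"
  and y: "y \<in> Q" "ball (snd y) \<delta> \<subseteq> inn (fst y)" "\<rho> \<le> \<delta>" and uv: "u \<in> {l<..<b}" "v \<in> {l<..<b}" "fl th (J v) t y"
 shows "fl th (J u) t (shift y (of_real (u - v) * hh))" "shift y (of_real (u - v) * hh) \<in> Q"
proof -
 let ?y = "\<lambda>w. shift y (of_real (w - v) * hh)"
 have yQ: "?y w \<in> Q" if "w \<in> {l<..<b}" for w
 proof (rule chart_Q[OF y(1,2)])
  have "w \<in> {0<..<\<rho>}" "v \<in> {0<..<\<rho>}" using that uv(2) K(1) by blast+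
  hence "\<bar>w - v\<bar> < \<rho>" by auto
  moreover have "dist (snd (?y w)) (snd y) = \<bar>w - v\<bar>" by (simp add: dist_norm norm_mult hh del: of_real_diff)
  ultimately show "dist (snd (?y w)) (snd y) < \<delta>" using y(3) by simp
 qed simp
 have JQ: "J w \<in> Q" if "w \<in> {l<..<b}" for w using that K(1) by (intro J_Q seg_abs(2)) blast
 have sh: "shift (?y w) (of_real a * hh) = ?y (w + a)" for w a by (simp add: shift_def algebra_simps)
 have "fl th (J u) t (?y u)"
 proof (rule interval_clopen[where R = "\<lambda>w. fl th (J w) t (?y w)", OF _ _ uv(2,1)])
  fix w assume w: "w \<in> {l<..<b}" "fl th (J w) t (?y w)"
  obtain e where e: "e > 0" "\<And>z. cmod z < e ==> fl th (shift (J w) z) t (shift (?y w) z)" using fl_stable[OF JQ[OF w(1)] yQ[OF w(1)] w(2)] by blast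
  have "fl th (J (w + a)) t (?y (w + a))" if "\<bar>a\<bar> < e" for a using e(2)[of "of_real a * hh"] that unfolding J_shift sh by (simp add: norm_mult hh)
  thus "\<exists>e>0. \<forall>a. \<bar>a\<bar> < e --> w + a \<in> {l<..<b} --> fl th (J (w + a)) t (?y (w + a))" using e(1) by blast
 next
  fix w assume w: "w \<in> {l<..<b}" "\<not> fl th (J w) t (?y w)"
  have "w \<in> Alive t" "w \<notin> Cut" using w(1) K(2,3) by blast+
  then obtain z where z: "fl th (J w) t z" using Alive_flows[OF _ _ K(4)] by blast
  show "\<exists>e>0. \<forall>a. \<bar>a\<bar> < e --> w + a \<in> {l<..<b} --> \<not> fl th (J (w + a)) t (?y (w + a))"
  proof (rule ccontr)
   assume neg: "\<not> ?thesis"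
   have "fl th (J w) t (?y w)"
   proof (rule fl_limit[OF JQ[OF w(1)] yQ[OF w(1)] z])
    fix \<epsilon> :: real assume \<epsilon>: "0 < \<epsilon>"
    then obtain a where a: "\<bar>a\<bar> < \<epsilon>" "fl th (J (w + a)) t (?y (w + a))" using neg by blast
    have "fl th (shift (J w) (of_real a * hh)) t (shift (?y w) (of_real a * hh))" unfolding J_shift sh by (rule a(2))
    moreover have "cmod (of_real a * hh) < \<epsilon>" using a(1) by (simp add: norm_mult hh)
    moreover have "\<bar>t - t\<bar> < \<epsilon>" using \<epsilon> by simp
    ultimately show "\<exists>u v t'. cmod u < \<epsilon> \<and> cmod v < \<epsilon> \<and> \<bar>t' - t\<bar> < \<epsilon> \<and> fl th (shift (J w) u) t' (shift (?y w) v)" by blast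
   qed
   thus False using w(2) by blast
  qed
 next
  show "fl th (J v) t (?y v)" using uv(3) by simp
 qed
 thus "fl th (J u) t (?y u)" .
 show "?y u \<in> Q" by (rule yQ[OF uv(1)])
qed

lemma Alive_all: assumes K: "{l<..<b} \<subseteq> {0<..<\<rho>}" "{l<..<b} \<inter> Cut = {}" "0 < s"
  and u: "u \<in> {l<..<b}" "u \<in> Alive s"
 shows "{l<..<b} \<subseteq> Alive s"
proof
 fix v assume v: "v \<in> {l<..<b}"
 show "v \<in> Alive s"
 proof (rule interval_clopen[where R = "\<lambda>w. w \<in> Alive s", OF _ _ u(1) v u(2)])
  fix w assume w: "w \<in> {l<..<b}" "w \<in> Alive s"
  have "w \<notin> Cut" using w(1) K(2) by blast
  from Alive_open[OF w(2) this K(3)] obtain e where "e > 0" "\<forall>a. \<bar>a\<bar> < e --> w + a \<in> {0<..<\<rho>} --> w + a \<in> Alive s" by blast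
  thus "\<exists>e>0. \<forall>a. \<bar>a\<bar> < e --> w + a \<in> {l<..<b} --> w + a \<in> Alive s" using K(1) by blast
 next
  fix w assume w: "w \<in> {l<..<b}" "w \<notin> Alive s"
  have "w \<notin> Cut" "w \<in> {0<..<\<rho>}" using w(1) K(1,2) by blast+
  from Alive_closed[OF this(2) w(2) this(1)] show "\<exists>e>0. \<forall>a. \<bar>a\<bar> < e --> w + a \<in> {l<..<b} --> w + a \<notin> Alive s" by blast
 qed
qed

lemma Alive_mono: "s \<le> t ==> Alive t \<subseteq> Alive s" by (force simp: Alive_def)

text \<open>No point of the interval returns before the time \<open>h\<close> and no point survives
 beyond it: the surviving points form an open and closed subset of the interval, which is all or
 nothing.\<close>

lemma height: assumes K: "{l<..<b} \<subseteq> {0<..<\<rho>}" "{l<..<b} \<inter> Cut = {}" "l < b"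
 shows "\<exists>h>0. (\<forall>s<h. {l<..<b} \<subseteq> Alive s) \<and> (\<forall>s>h. {l<..<b} \<inter> Alive s = {})"
proof -
 define S where "S = {s. 0 < s \<and> {l<..<b} \<subseteq> Alive s}"
 have half: "\<eta> / 2 \<in> S"
 proof -
  have "{l<..<b} \<subseteq> Alive (\<eta> / 2)"
  proof
   fix u assume "u \<in> {l<..<b}"
   hence u: "u \<in> {0<..<\<rho>}" using K(1) by blast
   have "\<eta> / 2 < t" if "t \<in> Ret u" for t using Ret_ge[OF that seg_abs(2)[OF u]] \<eta>(1) by linarith
   thus "u \<in> Alive (\<eta> / 2)" using u unfolding Alive_def by blast
  qed
  thus ?thesis using \<eta>(1) by (simp add: S_def)
 qed
 have bd: "bdd_above S"
 proof (rule bdd_aboveI)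
  fix s assume s: "s \<in> S"
  have "s * (b - l) \<le> 2 * measure mu Q + \<eta>\<^sup>2"
  proof (rule height_bound[OF K(1,3,2)])
   show "0 < s" using s by (simp add: S_def)
   show "{l<..<b} \<subseteq> Alive r" if "r < s" for r using Alive_mono[of r s] that s unfolding S_def by auto
  qed
  thus "s \<le> (2 * measure mu Q + \<eta>\<^sup>2) / (b - l)" using K(3) by (simp add: pos_le_divide_eq)
 qed
 have "\<eta> / 2 \<le> Sup S" by (rule cSup_upper[OF half bd])
 hence "0 < Sup S" using \<eta>(1) by linarith
 moreover have "{l<..<b} \<subseteq> Alive s" if lt: "s < Sup S" for s
 proof -
  obtain s' where "s' \<in> S" "s < s'" using less_cSupD[OF _ lt] half by blast
  thus ?thesis using Alive_mono[of s s'] unfolding S_def by auto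
 qed
 moreover have "{l<..<b} \<inter> Alive s = {}" if gt: "Sup S < s" for s
 proof (rule ccontr)
  assume "{l<..<b} \<inter> Alive s \<noteq> {}"
  then obtain u where u: "u \<in> {l<..<b}" "u \<in> Alive s" by blast
  have "0 < s" using gt \<open>0 < Sup S\<close> by linarith
  hence "s \<in> S" using Alive_all[OF K(1,2) _ u] by (simp add: S_def)
  thus False using cSup_upper[OF _ bd, of s] gt by simp
 qed
 ultimately show ?thesis by blast
qed

lemma last_visit:
 assumes x: "x \<in> Q" "0 \<le> t0" "v \<in> {0..\<rho>}" "fl th (J v) t0 x"
 shows "\<exists>u t. 0 \<le> t \<and> u \<in> {0..\<rho>} \<and> fl th (J u) t x \<and> (\<forall>r\<in>Ret u. t \<le> r)"
proof -
 define S where "S = {t. 0 \<le> t \<and> (\<exists>u\<in>{0..\<rho>}. fl th (J u) t x)}"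
 have "\<exists>m\<in>S. \<forall>t\<in>S. m \<le> t"
 proof (rule gap_least[OF _ _ \<eta>(1)])
  show "S \<noteq> {}" using x unfolding S_def by blast
  show "0 \<le> t" if "t \<in> S" for t using that by (simp add: S_def)
  fix s t assume st: "s \<in> S" "t \<in> S" "s < t"
  obtain u where u: "u \<in> {0..\<rho>}" "fl th (J u) s x" using st(1) unfolding S_def by blast
  obtain w where w: "w \<in> {0..\<rho>}" "fl th (J w) t x" using st(2) unfolding S_def by blast
  show "\<eta> \<le> t - s" by (rule Ret_ge[OF merge[OF u(2) w(2) x(1) st(3) u(1)] seg_abs(1)[OF w(1)]])
 qed
 then obtain m where m: "m \<in> S" "\<And>t. t \<in> S ==> m \<le> t" by blast
 obtain u where u: "u \<in> {0..\<rho>}" "fl th (J u) m x" using m(1) unfolding S_def by blast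
 have "m \<le> r" if r: "r \<in> Ret u" for r
 proof (rule ccontr)
  assume lt: "\<not> m \<le> r"
  obtain w where w: "0 < r" "w \<in> {0..\<rho>}" "fl th (J u) r (J w)" using r unfolding Ret_def by blast
  have "fl th (J w) (m - r) x" using fl_cancel[OF w(3) u(2)] lt by simp
  hence "m - r \<in> S" using w(2) lt unfolding S_def by auto
  thus False using m(2)[of "m - r"] w(1) by simp
 qed
 moreover have "0 \<le> m" using m(1) by (simp add: S_def)
 ultimately show ?thesis using u by blast
qed

text \<open>Almost every orbit met the transversal in the past, so the strips over the intervals cut out
 by the exceptional points fill the surface; there are few of them, hence one is large.\<close>

theorem large_strip:
 assumes erg: "ergodic_direction X th"
 obtains l b h where "{l<..<b} \<subseteq> {0<..<\<rho>}" "{l<..<b} \<inter> Cut = {}" "l < b" "0 < h" "\<And>s. s < h ==> {l<..<b} \<subseteq> Alive s"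
  "ennreal (measure mu Q / (real (card (sides X)) + 4)) \<le> emeasure mu (strip {l<..<b} 0 h)"
proof -
 define L where "L = insert 0 Cut"
 define B where "B l = Min (insert \<rho> {d \<in> Cut. l < d})" for l
 let ?K = "\<lambda>l. {l<..<B l}"
 have fin: "finite (insert \<rho> {d \<in> Cut. l < d})" for l using Cut_card(1) by simp
 have Cutsub: "Cut \<subseteq> {0<..<\<rho>}" by (auto simp: Cut_def)
 have L0: "0 \<le> l" "l < \<rho>" if "l \<in> L" for l using that Cutsub \<rho>(1) unfolding L_def by auto
 have B1: "l < B l" if "l \<in> L" for l unfolding B_def using fin L0(2)[OF that] by (subst Min_gr_iff) auto
 have B2: "B l \<le> \<rho>" "\<And>d. d \<in> Cut ==> l < d ==> B l \<le> d" for l unfolding B_def using fin by (auto intro: Min_le)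
 have K1: "?K l \<subseteq> {0<..<\<rho>}" if "l \<in> L" for l using L0[OF that] B2(1)[of l] by auto
 have K2: "?K l \<inter> Cut = {}" for l using B2(2)[of _ l] by force
 have "\<forall>l\<in>L. \<exists>h>0. (\<forall>s<h. ?K l \<subseteq> Alive s) \<and> (\<forall>s>h. ?K l \<inter> Alive s = {})" using height[OF K1 K2 B1] by blast
 then obtain h where h: "\<And>l. l \<in> L ==> 0 < h l" "\<And>l s. l \<in> L ==> s < h l ==> ?K l \<subseteq> Alive s" "\<And>l s. l \<in> L ==> h l < s ==> ?K l \<inter> Alive s = {}"
  by metis
 obtain Z1 where Z1: "Z1 \<in> null_sets mu" "\<forall>x\<in>Q - Z1. \<forall>n::nat. \<exists>t\<ge>real n. \<exists>b\<in>window th x0 \<eta> \<rho>. fl th b t x"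
 proof -
  have "mv th (J (\<rho> / 2)) (\<eta> / 2) \<in> window th x0 \<eta> \<rho>" unfolding window_iff using \<rho>(1) \<eta>(1)
   by (intro exI[of _ "\<rho> / 2"] exI[of _ "\<eta> / 2"]) auto
  hence "window th x0 \<eta> \<rho> \<noteq> {}" by blast
  from backward_recurrence[OF erg open_window window_Q[OF \<rho>(2)] this] that show ?thesis by blast
 qed
 define Z2 where "Z2 = {fst x0} \<times> {z. cross hh (z - snd x0) = 0}"
 have Z2: "Z2 \<in> null_sets mu" unfolding Z2_def by (rule line_null) (use hh in auto)
 have JZ2: "J u \<in> Z2" for u unfolding Z2_def mem_Times_iff by (simp add: J_simps cross_simps)
 have "\<forall>w. \<exists>Z\<in>null_sets mu. \<forall>x\<in>Q. \<forall>t. fl th (J w) t x --> x \<in> Z" using orbit_null by blast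
 then obtain Y where Y: "\<And>w. Y w \<in> null_sets mu" "\<And>w x t. x \<in> Q ==> fl th (J w) t x ==> x \<in> Y w" by metis
 define Z where "Z = Z1 \<union> Z2 \<union> (\<Union>w\<in>insert \<rho> L. Y w) \<union> (\<Union>l\<in>L. fimg th (h l) (Z2 \<inter> Q))"
 have finL: "finite L" unfolding L_def using Cut_card(1) by simp
 have Z2Q: "Z2 \<inter> Q \<in> null_sets mu" using Z2 open_Q by (intro null_set_Int2) auto
 have Zn: "Z \<in> null_sets mu" unfolding Z_def
  using Z1(1) Z2 Y(1) finL fimg_null[OF Z2Q] by (intro null_sets.Un null_sets.finite_UN) auto
 have "Q \<subseteq> Z \<union> (\<Union>l\<in>L. strip (?K l) 0 (h l))"
 proof
  fix x assume xQ: "x \<in> Q"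
  show "x \<in> Z \<union> (\<Union>l\<in>L. strip (?K l) 0 (h l))"
  proof (rule ccontr)
   assume nx: "x \<notin> Z \<union> (\<Union>l\<in>L. strip (?K l) 0 (h l))"
   hence "x \<in> Q - Z1" using xQ unfolding Z_def by blast
   then obtain t b where tb: "t \<ge> real 0" "b \<in> window th x0 \<eta> \<rho>" "fl th b t x" using Z1(2) by blast
   obtain v s where vs: "0 < v" "v < \<rho>" "0 < s" "s < \<eta>" "b = mv th (J v) s" using tb(2) unfolding window_iff by blast
   have "fl th (J v) s (mv th (J v) s)" by (rule J_move0) (use vs \<rho> in auto)
   hence "fl th (J v) (s + t) x" using fl_trans tb(3) vs(5) by blast
   then obtain u m where um: "0 \<le> m" "u \<in> {0..\<rho>}" "fl th (J u) m x" "\<forall>r\<in>Ret u. m \<le> r"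
    using last_visit[OF xQ, of "s + t" v] vs tb(1) by auto
   have "x \<notin> Y w" if "w \<in> insert \<rho> L" for w using nx that unfolding Z_def by blast
   hence uL: "u \<notin> insert \<rho> L" using Y(2)[OF xQ um(3)] by blast
   hence u: "u \<in> {0<..<\<rho>}" "u \<notin> Cut" using um(2) unfolding L_def by auto
   have "m \<noteq> 0"
   proof
    assume "m = 0"
    hence "x = J u" using fl_0 um(3) by blast
    thus False using JZ2 nx unfolding Z_def by blast
   qed
   hence m0: "0 < m" using um(1) by simp
   define l where "l = Max {d \<in> L. d < u}"
   have "{d \<in> L. d < u} \<noteq> {}" using u(1) unfolding L_def by auto
   hence "l \<in> {d \<in> L. d < u}" unfolding l_def using finL by (intro Max_in) auto
   hence l: "l \<in> L" "l < u" by auto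
   have "u < B l" unfolding B_def
   proof (subst Min_gr_iff[OF fin], simp, intro ballI)
    fix d assume d: "d \<in> insert \<rho> {d \<in> Cut. l < d}"
    show "u < d"
    proof (rule ccontr)
     assume "\<not> u < d"
     hence "d < u" "d \<in> Cut" "l < d" using d u by (auto simp: not_less le_less)
     hence "d \<le> l" unfolding l_def L_def using Cut_card(1) by (intro Max_ge) auto
     thus False using \<open>l < d\<close> by simp
    qed
   qed
   hence uK: "u \<in> ?K l" using l(2) by simp
   have "m \<le> h l"
   proof (rule ccontr)
    assume "\<not> m \<le> h l"
    then obtain s where s: "h l < s" "s < m" using dense[of "h l" m] by auto
    have "u \<in> Alive s" using u(1) um(4) s(2) unfolding Alive_def by force
    thus False using h(3)[OF l(1) s(1)] uK by blast
   qed
   moreover have "m \<noteq> h l"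
   proof
    assume "m = h l"
    moreover have "J u \<in> Z2 \<inter> Q" using JZ2 J_Q[OF seg_abs(2)[OF u(1)]] by blast
    ultimately have "x \<in> fimg th (h l) (Z2 \<inter> Q)" unfolding fimg_def using um(3) xQ by blast
    hence "x \<in> (\<Union>l\<in>L. fimg th (h l) (Z2 \<inter> Q))" by (rule UN_I[OF l(1)])
    thus False using nx unfolding Z_def by blast
   qed
   ultimately have "m < h l" by simp
   hence "x \<in> strip (?K l) 0 (h l)" unfolding strip_def using xQ uK um(3) m0 by blast
   thus False using nx l(1) by blast
  qed
 qed
 moreover have so: "strip (?K l) 0 (h l) \<in> sets borel" if "l \<in> L" for l
  using strip_open[OF open_greaterThanLessThan K1[OF that]] by simp
 ultimately have "emeasure mu Q \<le> emeasure mu ((\<Union>l\<in>L. strip (?K l) 0 (h l)) \<union> Z)"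
  using Zn finL by (intro emeasure_mono sets.Un) (auto simp: sets.finite_UN)
 also have "\<dots> = emeasure mu (\<Union>l\<in>L. strip (?K l) 0 (h l))" using so finL Zn by (intro emeasure_Un_null_set) auto
 also have "\<dots> \<le> (\<Sum>l\<in>L. emeasure mu (strip (?K l) 0 (h l)))" using so finL by (intro emeasure_subadditive_finite) auto
 finally have sum: "ennreal (measure mu Q) \<le> (\<Sum>l\<in>L. emeasure mu (strip (?K l) 0 (h l)))" unfolding mu_Q_measure .
 let ?c = "measure mu Q / (real (card (sides X)) + 4)"
 have "\<exists>l\<in>L. ennreal ?c \<le> emeasure mu (strip (?K l) 0 (h l))"
 proof (rule ccontr)
  assume "\<not> ?thesis"
  hence lt: "emeasure mu (strip (?K l) 0 (h l)) < ennreal ?c" if "l \<in> L" for l using that by (auto simp: not_le)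
  have "0 \<in> L" by (simp add: L_def)
  \<comment> \<open>The constant 4 exceeds the 3 in the bound for the number of intervals, which makes the final inequality strict.\<close>
  from le_less_trans[OF zero_le lt[OF this]] have c: "0 < ?c" by (simp only: ennreal_less_zero_iff)
  have "(\<Sum>l\<in>L. emeasure mu (strip (?K l) 0 (h l))) \<le> (\<Sum>l\<in>L. ennreal ?c)" using lt by (intro sum_mono less_imp_le)
  also have "\<dots> = ennreal (real (card L) * ?c)" using c by (subst sum_ennreal) auto
  also have "\<dots> < ennreal (measure mu Q)"
  proof (rule ennreal_lessI)
   have q: "0 < measure mu Q" using c by (simp add: zero_less_divide_iff)
   thus "0 < measure mu Q" .
   have "card L \<le> card (sides X) + 3" unfolding L_def using Cut_card by (simp add: card_insert_if)
   hence "real (card L) * ?c < (real (card (sides X)) + 4) * ?c" using c by (intro mult_strict_right_mono) auto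
   thus "real (card L) * ?c < measure mu Q" by simp
  qed
  finally show False using sum by simp
 qed
 then obtain l where l: "l \<in> L" "ennreal ?c \<le> emeasure mu (strip (?K l) 0 (h l))" by blast
 show ?thesis by (rule that[OF K1[OF l(1)] K2 B1[OF l(1)] h(1)[OF l(1)] h(2)[OF l(1)] l(2)])
qed

text \<open>A point low in the strip flows to within the width of the strip of every point high in
 it.\<close>

theorem strip_pairs:
 assumes erg: "ergodic_direction X th" and c: "c = measure mu Q / (real (card (sides X)) + 4)" "0 < c"
  and A: "A \<in> sets borel" "A \<subseteq> Q" "\<And>y. y \<in> A ==> ball (snd y) \<delta> \<subseteq> inn (fst y)" "\<rho> \<le> \<delta>" "emeasure mu (Q - A) \<le> ennreal (c / 10)"
  and k: "5 * real n \<le> real k * (\<eta> / 2)" "of_nat k * emeasure mu (window th x0 \<eta> \<rho>) < ennreal c"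
  and \<kappa>: "2 * measure mu Q + \<eta>\<^sup>2 < \<kappa>"
 shows "ennreal (c / 5 * (c / 10)) \<le> emeasure mu2 (Vs th \<kappa> n)"
proof -
 obtain l b h where K: "{l<..<b} \<subseteq> {0<..<\<rho>}" "{l<..<b} \<inter> Cut = {}" "l < b" and h: "0 < h" "\<And>s. s < h ==> {l<..<b} \<subseteq> Alive s"
  and ch: "ennreal c \<le> emeasure mu (strip {l<..<b} 0 h)" using large_strip[OF erg] unfolding c(1) by blast
 let ?K = "{l<..<b}"
 note oK = open_greaterThanLessThan[of l b]
 have h5: "5 * real n < h"
 proof (rule ccontr)
  assume "\<not> 5 * real n < h"
  hence "h \<le> real k * (\<eta> / 2)" using k(1) by linarith
  from strip_cover[OF oK K(1) \<eta>(1) this] ch have "ennreal c \<le> of_nat k * emeasure mu (strip ?K 0 \<eta>)" by (rule order_trans[rotated])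
  also have "\<dots> \<le> of_nat k * emeasure mu (window th x0 \<eta> \<rho>)"
  proof (intro mult_left_mono emeasure_mono)
   show "strip ?K 0 \<eta> \<subseteq> window th x0 \<eta> \<rho>"
   proof
    fix x assume "x \<in> strip ?K 0 \<eta>"
    then obtain u t where x: "u \<in> ?K" "0 < t" "t < \<eta>" "fl th (J u) t x" unfolding strip_def by blast
    have u: "u \<in> {0<..<\<rho>}" using x(1) K(1) by blast
    have "fl th (J u) t (mv th (J u) t)" by (rule J_move0[OF seg_abs(2)[OF u]]) (use x in auto)
    from fl_det[OF x(4) this] show "x \<in> window th x0 \<eta> \<rho>" unfolding window_iff using u x(2,3) by auto
   qed
  qed (use open_window in auto)
  finally show False using k(2) by simp
 qed
 \<comment> \<open>The lowest and the highest two fifths; five windows of this size, shifted by half of it, cover the strip.\<close>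
 let ?L = "strip ?K 0 (2 * h / 5)" and ?U = "strip ?K (3 * h / 5) h"
 have oL: "?L \<in> sets borel" "?U \<in> sets borel" using strip_open[OF oK K(1), of 0] strip_open[OF oK K(1), of "3 * h / 5"] h(1) by simp_all
 define mL where "mL = measure mu ?L"
 have mL: "emeasure mu ?L = ennreal mL" unfolding mL_def using Q_fin_measure[OF strip_Q] by (intro emeasure_eq_ennreal_measure) auto
 have "emeasure mu (strip ?K 0 h) \<le> of_nat 5 * emeasure mu ?L" by (rule strip_cover[OF oK K(1)]) (use h(1) in auto)
 hence "ennreal c \<le> of_nat 5 * ennreal mL" using ch unfolding mL by (rule order_trans[rotated])
 also have "of_nat 5 * ennreal mL = ennreal (5 * mL)" by (simp add: ennreal_mult mL_def)
 finally have cL: "c / 5 \<le> mL" by (simp add: ennreal_le_iff mL_def)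
 have "emeasure mu ?L \<le> emeasure mu (strip ?K (0 + 3 * h / 5) (2 * h / 5 + 3 * h / 5))"
  by (rule strip_ge[OF oK K(1,2) _ _ h(2)]) (use h(1) in auto)
 also have "\<dots> = emeasure mu ?U" by (simp add: field_simps)
 also have "\<dots> \<le> emeasure mu ((?U \<inter> A) \<union> (Q - A))" 
 proof (rule emeasure_mono)
  show "?U \<subseteq> (?U \<inter> A) \<union> (Q - A)" using strip_Q[of ?K "3 * h / 5" h] by blast
 qed (use oL A(1) open_Q in simp)
 also have "\<dots> \<le> emeasure mu (?U \<inter> A) + emeasure mu (Q - A)" using oL A(1) open_Q by (intro emeasure_subadditive) auto
 also have "\<dots> \<le> emeasure mu (?U \<inter> A) + ennreal (c / 10)" by (rule add_left_mono[OF A(5)])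
 finally have LU: "ennreal mL \<le> emeasure mu (?U \<inter> A) + ennreal (c / 10)" unfolding mL .
 define mU where "mU = measure mu (?U \<inter> A)"
 have mU: "emeasure mu (?U \<inter> A) = ennreal mU" unfolding mU_def using Q_fin_measure[of "?U \<inter> A"] A(2) by (intro emeasure_eq_ennreal_measure) auto
 have mUn: "0 \<le> mU" by (simp add: mU_def)
 have "ennreal mL \<le> ennreal (mU + c / 10)" using LU mUn c(2) unfolding mU by (simp add: ennreal_plus)
 hence "mL \<le> mU + c / 10" using mUn c(2) by (subst (asm) ennreal_le_iff) auto
 hence cU: "c / 10 \<le> mU" using cL by linarith
 have sub: "?L \<times> (?U \<inter> A) \<subseteq> Vs th \<kappa> n"
 proof
  fix p assume p: "p \<in> ?L \<times> (?U \<inter> A)"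
  obtain x y where xy: "p = (x, y)" by (cases p)
  have x: "x \<in> ?L" and y: "y \<in> ?U" "y \<in> A" using p unfolding xy by blast+
  obtain u t where u: "x \<in> Q" "u \<in> ?K" "0 < t" "t < 2 * h / 5" "fl th (J u) t x" using x unfolding strip_def by blast
  obtain v t' where v: "y \<in> Q" "v \<in> ?K" "3 * h / 5 < t'" "t' < h" "fl th (J v) t' y" using y(1) unfolding strip_def by blast
  have t'0: "0 \<le> t'" using v(3) h(1) by linarith
  let ?y = "shift y (of_real (u - v) * hh)"
  note st = strip_translate[OF K(1,2) h(2)[OF v(4)] t'0 v(1) A(3)[OF y(2)] A(4) u(2) v(2,5)]
  have tt: "t \<le> t'" "real n < t' - t" using u(3,4) v(3) h5 h(1) by linarith+
  have f: "fl th x (t' - t) ?y" by (rule fl_cancel[OF u(5) st(1) tt(1)])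
  have "dist (snd ?y) (snd y) = \<bar>u - v\<bar>" by (simp add: dist_norm norm_mult hh del: of_real_diff)
  moreover have "\<bar>u - v\<bar> \<le> b - l" using u(2) v(2) by auto
  ultimately have "(t' - t) * dist (snd ?y) (snd y) \<le> h * (b - l)" using tt(1) u(3) v(4) by (intro mult_mono) auto
  also have "\<dots> \<le> 2 * measure mu Q + \<eta>\<^sup>2" by (rule height_bound[OF K(1,3,2) h])
  finally have "(t' - t) * dist (snd ?y) (snd y) < \<kappa>" using \<kappa> by linarith
  moreover have "fst ?y = fst y" by simp
  ultimately show "p \<in> Vs th \<kappa> n" unfolding xy Vs_iff using u(1) v(1) tt(2) st(2) f by blast
 qed
 have "ennreal (c / 5 * (c / 10)) \<le> ennreal (mL * mU)" using cL cU c(2) by (intro ennreal_leI mult_mono) auto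
 also have "\<dots> = emeasure mu ?L * emeasure mu (?U \<inter> A)" unfolding mL mU using mUn by (intro ennreal_mult) (auto simp: mL_def)
 also have "\<dots> = emeasure mu2 (?L \<times> (?U \<inter> A))" using oL A(1) by (intro mu.emeasure_pair_measure_Times[symmetric]) auto
 also have "\<dots> \<le> emeasure mu2 (Vs th \<kappa> n)" by (rule emeasure_mono[OF sub Vs_sets])
 finally show ?thesis .
qed

end

context tsurf
begin

lemma Q_nonempty: "Q \<noteq> {}"
proof -
 have N: "0 < N" using ts by (simp add: translation_surface_def)
 hence "polys X ! 0 \<in> set (polys X)" by simp
 hence "3 \<le> length (polys X ! 0)" using ts by (auto simp: translation_surface_def simple_polygon_def)
 hence e: "(0, 0) \<in> sides X" using N by (auto simp: sides_def)
 have "\<exists>z. z \<in> reg 0"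
 proof -
  have "st (0, 0) \<in> cseg (0, 0)" by (simp add: cseg_def)
  hence "st (0, 0) \<in> reg (fst (0 :: nat, 0 :: nat))" using cseg_reg[OF e] by blast
  thus ?thesis by auto
 qed
 then obtain w where "w \<in> inn 0" using joined_to_inn[OF N] by blast
 hence "(0, w) \<in> Q" using N by (simp add: Q_iff)
 thus ?thesis by blast
qed

theorem near_returns_positive:
 assumes erg: "ergodic_direction X th"
 shows "\<exists>\<kappa>>0. \<exists>c>0. \<forall>n. ennreal c \<le> emeasure mu2 (Vs th \<kappa> n)"
proof -
 obtain x0 where x0: "x0 \<in> Q" using Q_nonempty by blast
 obtain r where r: "r > 0" "ball (snd x0) r \<subseteq> inn (fst x0)" using Q_ball[OF x0] by blast
 define \<eta> where "\<eta> = r / 3"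
 have \<eta>: "0 < \<eta>" "ball (snd x0) (3 * \<eta>) \<subseteq> inn (fst x0)" using r by (auto simp: \<eta>_def)
 interpret t: tower X th x0 \<eta> \<eta> by unfold_locales (use x0 \<eta> in auto)
 have mQ: "0 < measure mu Q" using mu_open_pos[OF open_Q x0] unfolding mu_Q_measure by (simp only: ennreal_less_zero_iff)
 define c where "c = measure mu Q / (real (card (sides X)) + 4)"
 have c: "0 < c" using mQ by (simp add: c_def)
 define \<kappa> where "\<kappa> = 2 * measure mu Q + \<eta>\<^sup>2 + 1"
 have \<kappa>: "0 < \<kappa>" "2 * measure mu Q + \<eta>\<^sup>2 < \<kappa>" using mQ by (auto simp: \<kappa>_def intro!: add_pos_nonneg add_nonneg_pos)
 \<comment> \<open>Points that are not too close to the boundary, where a translation by less than the width of the strip stays inside the polygon.\<close>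
 define G where "G j = {y \<in> Q. \<exists>r>1 / real (Suc j). ball (snd y) r \<subseteq> inn (fst y)}" for j
 have Go: "open (G j)" for j
 proof (rule shift_open)
  fix y assume "y \<in> G j"
  then obtain r where y: "y \<in> Q" "1 / real (Suc j) < r" "ball (snd y) r \<subseteq> inn (fst y)" unfolding G_def by blast
  obtain r' where r': "1 / real (Suc j) < r'" "r' < r" using dense[OF y(2)] by blast
  have "shift y u \<in> G j" if u: "cmod u < r - r'" for u
  proof -
   have "0 < 1 / real (Suc j)" by simp
   hence "cmod u < r" using r' u by linarith
   hence "shift y u \<in> Q" by (intro chart_Q[OF y(1,3)]) (simp_all add: dist_norm)
   moreover have "ball (snd (shift y u)) r' \<subseteq> inn (fst (shift y u))"
   proof
    fix z assume "z \<in> ball (snd (shift y u)) r'"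
    hence z: "dist (snd y + u) z < r'" by simp
    have "dist (snd y) z \<le> dist (snd y) (snd y + u) + dist (snd y + u) z" by (rule dist_triangle)
    also have "dist (snd y) (snd y + u) = cmod u" by (simp add: dist_norm)
    finally show "z \<in> inn (fst (shift y u))" using z u y(3) by auto
   qed
   ultimately show ?thesis unfolding G_def using r'(1) by blast
  qed
  thus "\<exists>\<epsilon>>0. \<forall>u. cmod u < \<epsilon> --> shift y u \<in> G j" using r'(2) by (intro exI[of _ "r - r'"]) simp
 qed
 have Gsub: "G j \<subseteq> G (Suc j)" for j
 proof -
  have "1 / real (Suc (Suc j)) \<le> 1 / real (Suc j)" by (intro divide_left_mono) auto
  thus ?thesis unfolding G_def by (blast intro: le_less_trans)
 qed
 have emp: "(\<Inter>j. Q - G j) = {}"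
 proof (rule ccontr)
  assume "(\<Inter>j. Q - G j) \<noteq> {}"
  then obtain y where y: "\<And>j. y \<in> Q - G j" by blast
  hence yQ: "y \<in> Q" by blast
  obtain r where r: "r > 0" "ball (snd y) r \<subseteq> inn (fst y)" using Q_ball[OF yQ] by blast
  obtain j where "1 / real (Suc j) < r" using nat_approx_posE[OF r(1)] by blast
  hence "y \<in> G j" unfolding G_def using yQ r(2) by blast
  thus False using y by blast
 qed
 have "(\<lambda>j. emeasure mu (Q - G j)) \<longlonglongrightarrow> emeasure mu (\<Inter>j. Q - G j)"
 proof (rule Lim_emeasure_decseq)
  show "range (\<lambda>j. Q - G j) \<subseteq> sets mu" using Go open_Q by auto
  show "decseq (\<lambda>j. Q - G j)" using Gsub by (intro decseq_SucI) blast
  show "emeasure mu (Q - G j) \<noteq> \<infinity>" for j by (rule Q_fin_measure) blast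
 qed
 hence lim: "(\<lambda>j. emeasure mu (Q - G j)) \<longlonglongrightarrow> 0" unfolding emp by simp
 have "0 < ennreal (c / 10)" using c by simp
 from eventually_happens'[OF sequentially_bot order_tendstoD(2)[OF lim this]]
 obtain j where j: "emeasure mu (Q - G j) < ennreal (c / 10)" by blast
 have G: "G j \<in> sets borel" "G j \<subseteq> Q" using Go by (auto simp: G_def)
 have Gb: "ball (snd y) (1 / real (Suc j)) \<subseteq> inn (fst y)" if "y \<in> G j" for y
 proof -
  obtain r where "1 / real (Suc j) < r" "ball (snd y) r \<subseteq> inn (fst y)" using \<open>y \<in> G j\<close> unfolding G_def by blast
  thus ?thesis using subset_ball[of "1 / real (Suc j)" r "snd y"] by auto
 qed
 have "ennreal (c / 5 * (c / 10)) \<le> emeasure mu2 (Vs th \<kappa> n)" for n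
 proof -
  obtain k :: nat where k: "10 * real n / \<eta> + 1 \<le> real k" using real_arch_simple by blast
  have "0 \<le> 10 * real n / \<eta>" using \<eta>(1) by simp
  hence k0: "0 < real k" "10 * real n / \<eta> \<le> real k" using k by linarith+
  hence k1: "5 * real n \<le> real k * (\<eta> / 2)" using \<eta>(1) by (simp add: pos_divide_le_eq)
  have "0 < ennreal (c / real k)" "0 < 1 / real (Suc j)" using c k0 by simp_all
  from t.shrinking_window[OF this] obtain \<rho> where \<rho>: "0 < \<rho>" "\<rho> < 1 / real (Suc j)" "\<rho> \<le> \<eta>" "emeasure mu (window th x0 \<eta> \<rho>) < ennreal (c / real k)" by blast
  interpret s: tower X th x0 \<eta> \<rho> by unfold_locales (use x0 \<eta> \<rho> in auto)
  define w where "w = measure mu (window th x0 \<eta> \<rho>)"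
  have w: "emeasure mu (window th x0 \<eta> \<rho>) = ennreal w" "0 \<le> w" unfolding w_def
   using Q_fin_measure[OF s.window_Q[OF \<rho>(3)]] by (auto intro: emeasure_eq_ennreal_measure)
  have "w < c / real k" using \<rho>(4) w(2) unfolding w(1) by (simp add: ennreal_less_iff)
  hence "real k * w < c" using k0(1) by (simp add: pos_less_divide_eq mult.commute)
  moreover have "of_nat k * emeasure mu (window th x0 \<eta> \<rho>) = ennreal (real k * w)" unfolding w(1)
   using w(2) by (simp add: ennreal_mult ennreal_of_nat_eq_real_of_nat)
  ultimately have k2: "of_nat k * emeasure mu (window th x0 \<eta> \<rho>) < ennreal c" using c by (simp add: ennreal_lessI)
  show ?thesis by (rule s.strip_pairs[OF erg c_def c G Gb less_imp_le[OF \<rho>(2)] less_imp_le[OF j] k1 k2 \<kappa>(2)])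
 qed
 moreover have "0 < c / 5 * (c / 10)" using c by simp
 ultimately show ?thesis using \<kappa>(1) by blast
qed

section \<open>Near returns are invariant under the flow in both points\<close>

text \<open>Only an unbounded set of constants is needed; the natural numbers keep the union
 countable.\<close>

definition NR :: "real => nat \<times> complex => nat \<times> complex => bool" where
 "NR th x y \<longleftrightarrow> (\<exists>k::nat. \<forall>n. (x, y) \<in> Vs th (real (Suc k)) n)"

lemma NR_I: assumes "\<And>n. (x, y) \<in> Vs th (2 * real (Suc k)) n" shows "NR th x y"
proof -
 have "2 * real (Suc k) = real (Suc (2 * k + 1))" by simp
 thus ?thesis unfolding NR_def using assms by metis
qed

lemma Vs_mono: "\<kappa> \<le> \<kappa>' ==> Vs th \<kappa> n \<subseteq> Vs th \<kappa>' n"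
proof
 fix p assume h: "\<kappa> \<le> \<kappa>'" "p \<in> Vs th \<kappa> n"
 obtain x y where p: "p = (x, y)" by (cases p)
 show "p \<in> Vs th \<kappa>' n" using h(2) less_le_trans[OF _ h(1)] unfolding p Vs_iff by blast
qed

text \<open>Changing a late time by a bounded amount at most doubles it, so twice the constant is
 enough.\<close>

lemma NR_shift:
 assumes k: "\<And>n. (x, y) \<in> Vs th (real (Suc k)) n" and xy: "x' \<in> Q" "y' \<in> Q"
  and step: "\<And>t v. M < t ==> v \<in> Q ==> fl th x t v ==> fst v = fst y ==> t * dist (snd v) (snd y) < real (Suc k) ==>
   \<exists>t' v'. v' \<in> Q \<and> \<bar>t' - t\<bar> \<le> M \<and> fl th x' t' v' \<and> fst v' = fst y' \<and> dist (snd v') (snd y') = dist (snd v) (snd y)"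
 shows "NR th x' y'"
proof (rule NR_I[of _ _ _ k])
 fix n :: nat
 obtain m :: nat where m: "real n + \<bar>M\<bar> \<le> real m" using real_arch_simple by blast
 obtain t v where t: "t > real m" "v \<in> Q" "fl th x t v" "fst v = fst y" "t * dist (snd v) (snd y) < real (Suc k)"
  using k[of m] unfolding Vs_iff by blast
 have "M < t" using t(1) m by linarith
 from step[OF this t(2-5)] obtain t' v' where v': "v' \<in> Q" "\<bar>t' - t\<bar> \<le> M" "fl th x' t' v'" "fst v' = fst y'" "dist (snd v') (snd y') = dist (snd v) (snd y)" by blast
 have t': "real n < t'" "t' \<le> 2 * t" using v'(2) t(1) m by linarith+
 have "t' * dist (snd v') (snd y') \<le> 2 * t * dist (snd v) (snd y)" unfolding v'(5) using t'(2) by (intro mult_right_mono) auto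
 also have "\<dots> < 2 * real (Suc k)" unfolding mult.assoc using t(5) by (rule mult_strict_left_mono) simp
 finally show "(x', y') \<in> Vs th (2 * real (Suc k)) n" unfolding Vs_iff using xy v' t'(1) by blast
qed

lemma NR_left: assumes "x \<in> Q" "x' \<in> Q" "y \<in> Q" "fl th x s x'" shows "NR th x y \<longleftrightarrow> NR th x' y"
proof
 have s: "0 \<le> s" using fl_Qp assms(4) by blast
 assume "NR th x y"
 then obtain k where k: "\<And>n. (x, y) \<in> Vs th (real (Suc k)) n" unfolding NR_def by blast
 show "NR th x' y"
 proof (rule NR_shift[OF k assms(2,3), of s])
  fix t v assume v: "s < t" "v \<in> Q" "fl th x t v" "fst v = fst y"
  have "fl th x' (t - s) v" using fl_cancel[OF assms(4) v(3)] v(1) by simp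
  moreover have "\<bar>t - s - t\<bar> \<le> s" using s by simp
  ultimately show "\<exists>t' v'. v' \<in> Q \<and> \<bar>t' - t\<bar> \<le> s \<and> fl th x' t' v' \<and> fst v' = fst y \<and> dist (snd v') (snd y) = dist (snd v) (snd y)" using v by blast
 qed
next
 have s: "0 \<le> s" using fl_Qp assms(4) by blast
 assume "NR th x' y"
 then obtain k where k: "\<And>n. (x', y) \<in> Vs th (real (Suc k)) n" unfolding NR_def by blast
 show "NR th x y"
 proof (rule NR_shift[OF k assms(1,3), of s])
  fix t v assume v: "s < t" "v \<in> Q" "fl th x' t v" "fst v = fst y"
  have "fl th x (s + t) v" using fl_trans[OF assms(4) v(3)] .
  moreover have "\<bar>s + t - t\<bar> \<le> s" using s by simp
  ultimately show "\<exists>t' v'. v' \<in> Q \<and> \<bar>t' - t\<bar> \<le> s \<and> fl th x t' v' \<and> fst v' = fst y \<and> dist (snd v') (snd y) = dist (snd v) (snd y)" using v by blast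
 qed
qed

text \<open>Late visits are so close to \<open>y\<close> that they follow its orbit for the time
 \<open>s\<close>.\<close>

lemma NR_right: assumes "x \<in> Q" "y \<in> Q" "y' \<in> Q" "fl th y s y'" shows "NR th x y \<longleftrightarrow> NR th x y'"
proof -
 have s: "0 \<le> s" using fl_Qp assms(4) by blast
 obtain e where e: "e > 0" "\<And>w. cmod w < e ==> shift y w \<in> Q \<and> shift y' w \<in> Q \<and> fl th (shift y w) s (shift y' w)"
  using fl_stable[OF assms(2-4)] by blast
 have small: "cmod (snd v - snd z) < e" if "max s (real (Suc k) / e) < t" "t * dist (snd v) (snd z) < real (Suc k)" for t k and v z :: "nat \<times> complex"
 proof -
  have "real (Suc k) / e < t" using that(1) by simp
  hence "real (Suc k) < t * e" using e(1) by (simp only: pos_divide_less_eq)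
  hence "t * dist (snd v) (snd z) < t * e" using that(2) by linarith
  thus ?thesis using that(1) s by (simp add: dist_norm mult_less_cancel_left)
 qed
 have sh: "shift z (snd v - snd z) = v" if "fst v = fst z" for v z :: "nat \<times> complex" using that by (simp add: prod_eq_iff)
 show ?thesis
 proof
  assume "NR th x y"
  then obtain k where k: "\<And>n. (x, y) \<in> Vs th (real (Suc k)) n" unfolding NR_def by blast
  show "NR th x y'"
  proof (rule NR_shift[OF k assms(1,3), of "max s (real (Suc k) / e)"])
   fix t v assume v: "max s (real (Suc k) / e) < t" "v \<in> Q" "fl th x t v" "fst v = fst y" "t * dist (snd v) (snd y) < real (Suc k)"
   let ?w = "snd v - snd y"
   have w: "shift y' ?w \<in> Q" "fl th (shift y ?w) s (shift y' ?w)" using e(2)[OF small[OF v(1,5)]] by blast+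
   have "fl th x (t + s) (shift y' ?w)" using fl_trans[OF v(3)] w(2) unfolding sh[OF v(4)] by blast
   moreover have "\<bar>t + s - t\<bar> \<le> max s (real (Suc k) / e)" using s by simp
   moreover have "dist (snd (shift y' ?w)) (snd y') = dist (snd v) (snd y)" by (simp add: dist_norm)
   moreover have "fst (shift y' ?w) = fst y'" by simp
   ultimately show "\<exists>t' v'. v' \<in> Q \<and> \<bar>t' - t\<bar> \<le> max s (real (Suc k) / e) \<and> fl th x t' v' \<and> fst v' = fst y' \<and> dist (snd v') (snd y') = dist (snd v) (snd y)"
    using w(1) by blast
  qed
 next
  assume "NR th x y'"
  then obtain k where k: "\<And>n. (x, y') \<in> Vs th (real (Suc k)) n" unfolding NR_def by blast
  show "NR th x y"
  proof (rule NR_shift[OF k assms(1,2), of "max s (real (Suc k) / e)"])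
   fix t v assume v: "max s (real (Suc k) / e) < t" "v \<in> Q" "fl th x t v" "fst v = fst y'" "t * dist (snd v) (snd y') < real (Suc k)"
   let ?w = "snd v - snd y'"
   have w: "shift y ?w \<in> Q" "fl th (shift y ?w) s v" using e(2)[OF small[OF v(1,5)]] unfolding sh[OF v(4)] by blast+
   have ts: "0 \<le> t - s" "t - s \<le> t" using v(1) s by auto
   obtain m where m: "fl th x (t - s) m" "fl th m s v" using fl_split[OF v(3) ts] by auto
   have "m = shift y ?w" by (rule fl_inj_Qp[OF m(2) w(2) v(2)])
   hence "fl th x (t - s) (shift y ?w)" using m(1) by simp
   moreover have "\<bar>t - s - t\<bar> \<le> max s (real (Suc k) / e)" using s by simp
   moreover have "dist (snd (shift y ?w)) (snd y) = dist (snd v) (snd y')" by (simp add: dist_norm)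
   moreover have "fst (shift y ?w) = fst y" by simp
   ultimately show "\<exists>t' v'. v' \<in> Q \<and> \<bar>t' - t\<bar> \<le> max s (real (Suc k) / e) \<and> fl th x t' v' \<and> fst v' = fst y \<and> dist (snd v') (snd y) = dist (snd v) (snd y')"
    using w(1) by blast
  qed
 qed
qed

text \<open>For fixed \<open>x\<close> the slice is invariant, so null or conull; which of the two
 is invariant in \<open>x\<close>. As the whole set has positive measure, almost all slices are
 conull.\<close>

theorem near_returns_AE:
 assumes erg: "ergodic_direction X th"
 shows "\<exists>Z\<in>null_sets mu2. \<forall>x\<in>Q. \<forall>y\<in>Q. (x, y) \<notin> Z --> NR th x y"
proof -
 let ?M = "mu2" and ?G = "Gam th \<times> Gam th"
 define I where "I \<kappa> = (\<Inter>n. Vs th \<kappa> n)" for \<kappa>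
 have Is: "I \<kappa> \<in> sets ?M" for \<kappa> unfolding I_def using Vs_sets by (intro sets.countable_INT) auto
 have Gs: "?G \<in> sets ?M" using borel_Gam by (intro pair_measureI) auto
 define V where "V = {(x, y). x \<in> Gam th \<and> y \<in> Gam th \<and> NR th x y}"
 have Veq: "V = ?G \<inter> (\<Union>k. I (real (Suc k)))" unfolding V_def NR_def I_def by auto
 have Vs: "V \<in> sets ?M" unfolding Veq using Gs Is by (intro sets.Int sets.countable_UN) auto
 have VsQ: "Vs th \<kappa> n \<subseteq> Q \<times> Q" for \<kappa> n using Vs_iff by auto
 have QQ: "emeasure ?M (Q \<times> Q) < \<infinity>"
  using open_Q mu_Q_finite by (subst mu.emeasure_pair_measure_Times) (auto simp: ennreal_mult_less_top)
 have QQs: "Q \<times> Q \<in> sets ?M" using open_Q by (intro pair_measureI) auto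
 have pos: "0 < emeasure ?M V"
 proof -
  obtain \<kappa> c where \<kappa>: "0 < c" "\<And>n. ennreal c \<le> emeasure ?M (Vs th \<kappa> n)" using near_returns_positive[OF erg] by blast
  obtain k :: nat where "\<kappa> \<le> real k" using real_arch_simple by blast
  hence k: "\<kappa> \<le> real (Suc k)" by simp
  have "emeasure ?M (I \<kappa>) = (INF n. emeasure ?M (Vs th \<kappa> n))" unfolding I_def
  proof (rule INF_emeasure_decseq[symmetric])
   show "range (Vs th \<kappa>) \<subseteq> sets ?M" using Vs_sets by blast
   show "decseq (Vs th \<kappa>)"
   proof (rule decseq_SucI)
    fix n
    have "{real (Suc n)<..} \<subseteq> {real n<..}" by auto
    thus "Vs th \<kappa> (Suc n) \<subseteq> Vs th \<kappa> n" unfolding Vs_def by (rule UN_mono) simp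
   qed
   show "emeasure ?M (Vs th \<kappa> n) \<noteq> \<infinity>" for n
    using emeasure_mono[OF VsQ QQs, of \<kappa> n] QQ by (auto simp: top_unique)
  qed
  hence "ennreal c \<le> emeasure ?M (I \<kappa>)" using \<kappa>(2) by (simp add: le_INF_iff)
  moreover have "I \<kappa> \<subseteq> I (real (Suc k))" unfolding I_def using Vs_mono[OF k] by blast
  ultimately have c: "ennreal c \<le> emeasure ?M (I (real (Suc k)))" using Is by (meson emeasure_mono order_trans)
  have n1: "(Q - Gam th) \<times> Q \<in> null_sets ?M" "Q \<times> (Q - Gam th) \<in> null_sets ?M"
   using Gam_conull[of th] open_Q borel_Gam[of th]
   by (auto intro!: null_setsI pair_measureI simp: mu.emeasure_pair_measure_Times null_sets_def)
  have "I (real (Suc k)) \<subseteq> V \<union> ((Q - Gam th) \<times> Q \<union> Q \<times> (Q - Gam th))"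
  proof
   fix p assume p: "p \<in> I (real (Suc k))"
   hence "p \<in> Q \<times> Q" using VsQ unfolding I_def by blast
   thus "p \<in> V \<union> ((Q - Gam th) \<times> Q \<union> Q \<times> (Q - Gam th))" using p unfolding Veq by blast
  qed
  hence "emeasure ?M (I (real (Suc k))) \<le> emeasure ?M (V \<union> ((Q - Gam th) \<times> Q \<union> Q \<times> (Q - Gam th)))"
   by (rule emeasure_mono) (rule sets.Un[OF Vs sets.Un[OF null_setsD2[OF n1(1)] null_setsD2[OF n1(2)]]])
  also have "\<dots> = emeasure ?M V" using Vs n1 by (intro emeasure_Un_null_set null_sets.Un)
  finally have "ennreal c \<le> emeasure ?M V" using c by (rule order_trans[rotated])
  moreover have "0 < ennreal c" using \<kappa>(1) by simp
  ultimately show ?thesis by (rule less_le_trans[rotated])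
 qed
 let ?V = "\<lambda>x. Pair x -` V"
 have Vb: "?V x \<in> sets borel" for x using sets_Pair1[OF Vs, of x] by simp
 have slice: "?V x \<in> null_sets mu \<or> Q - ?V x \<in> null_sets mu" if x: "x \<in> Gam th" for x
 proof (rule ergodic_dichotomy[OF erg Vb])
  show "?V x \<subseteq> Gam th" by (auto simp: V_def)
  fix y y' t assume h: "y \<in> Q" "y' \<in> Q" "fl th y t y'"
  have "x \<in> Q" using x Gam_Q by blast
  thus "y \<in> ?V x \<longleftrightarrow> y' \<in> ?V x" using NR_right[OF _ h] Gam_inv[OF h] unfolding V_def by simp
 qed
 define F where "F = {x \<in> Gam th. emeasure mu (?V x) \<noteq> 0}"
 have mF: "(\<lambda>x. emeasure mu (?V x)) \<in> borel_measurable mu" by (rule mu.measurable_emeasure_Pair[OF Vs])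
 have "F \<in> sets borel"
 proof -
  have "{x \<in> space mu. emeasure mu (?V x) \<noteq> 0} \<in> sets mu" using mF by measurable
  hence "Gam th \<inter> {x. emeasure mu (?V x) \<noteq> 0} \<in> sets borel" using borel_Gam by simp
  thus ?thesis unfolding F_def by (simp add: Int_def)
 qed
 moreover have "F \<subseteq> Gam th" by (auto simp: F_def)
 moreover have "x \<in> F \<longleftrightarrow> x' \<in> F" if h: "x \<in> Q" "x' \<in> Q" "fl th x t x'" for x x' t
 proof -
  have "?V x = ?V x'" if g: "x \<in> Gam th" "x' \<in> Gam th"
   using NR_left[OF h(1,2) _ h(3)] g Gam_Q[of th] unfolding V_def by blast
  thus ?thesis using Gam_inv[OF h] unfolding F_def by auto
 qed
 ultimately consider "F \<in> null_sets mu" | "Q - F \<in> null_sets mu" using ergodic_dichotomy[OF erg] by blast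
 thus ?thesis
 proof cases
  case 1
  have "AE x in mu. emeasure mu (?V x) = 0"
  proof (rule AE_I'[OF 1])
   show "{x \<in> space mu. emeasure mu (?V x) \<noteq> 0} \<subseteq> F"
   proof
    fix x assume "x \<in> {x \<in> space mu. emeasure mu (?V x) \<noteq> 0}"
    hence x: "emeasure mu (?V x) \<noteq> 0" by blast
    have "?V x \<noteq> {}" using x by (intro notI) simp
    hence "x \<in> Gam th" unfolding V_def by blast
    thus "x \<in> F" using x unfolding F_def by blast
   qed
  qed
  hence "(\<integral>\<^sup>+x. emeasure mu (?V x) \<partial>mu) = 0" using mF by (simp add: nn_integral_0_iff_AE)
  thus ?thesis using pos by (simp add: mu.emeasure_pair_measure_alt[OF Vs])
 next
  case 2
  define Z where "Z = Q \<times> Q - V"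
  have Zs: "Z \<in> sets ?M" unfolding Z_def using QQs Vs by (rule sets.Diff)
  have "AE x in mu. emeasure mu (Pair x -` Z) = 0"
  proof (rule AE_I'[OF 2])
   show "{x \<in> space mu. emeasure mu (Pair x -` Z) \<noteq> 0} \<subseteq> Q - F"
   proof
    fix x assume "x \<in> {x \<in> space mu. emeasure mu (Pair x -` Z) \<noteq> 0}"
    hence x: "emeasure mu (Pair x -` Z) \<noteq> 0" by blast
    have "Pair x -` Z \<noteq> {}" using x by (intro notI) simp
    hence xQ: "x \<in> Q" unfolding Z_def by blast
    have "x \<notin> F"
    proof
     assume "x \<in> F"
     hence "x \<in> Gam th" "?V x \<notin> null_sets mu" unfolding F_def by (auto simp: null_sets_def)
     hence "Q - ?V x \<in> null_sets mu" using slice by blast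
     moreover have "Pair x -` Z = Q - ?V x" unfolding Z_def using xQ by blast
     ultimately show False using x by (simp add: null_setsD1)
    qed
    thus "x \<in> Q - F" using xQ by blast
   qed
  qed
  hence "(\<integral>\<^sup>+x. emeasure mu (Pair x -` Z) \<partial>mu) = 0" using mu.measurable_emeasure_Pair[OF Zs] by (simp add: nn_integral_0_iff_AE)
  hence "Z \<in> null_sets ?M" using Zs by (intro null_setsI) (simp_all add: mu.emeasure_pair_measure_alt)
  moreover have "NR th x y" if "x \<in> Q" "y \<in> Q" "(x, y) \<notin> Z" for x y using that unfolding Z_def V_def by blast
  ultimately show ?thesis by blast
 qed
qed

theorem hitting_exponent_AE:
 assumes erg: "ergodic_direction X th"
 shows "AE (p, p') in area \<Otimes>\<^sub>M area. lower_hitting_exponent X th p p' = 1"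
proof -
 have "\<forall>k::nat. \<exists>Z\<in>null_sets mu2. \<forall>x\<in>Q - Hit th. \<forall>y\<in>Q. (x, y) \<notin> Z -->
  ereal (1 - 1 / real (k + 2)) \<le> lower_hitting_exponent X th (proj X x) (proj X y)"
  by (intro allI hitting_exponent_ge) auto
 then obtain Z where Z: "\<And>k::nat. Z k \<in> null_sets mu2"
  "\<And>k x y. x \<in> Q - Hit th ==> y \<in> Q ==> (x, y) \<notin> Z k ==> ereal (1 - 1 / real (k + 2)) \<le> lower_hitting_exponent X th (proj X x) (proj X y)"
  by metis
 obtain H where H: "H \<in> null_sets mu" "Hit th \<subseteq> H" using Hit_null by blast
 obtain V where V: "V \<in> null_sets mu2" "\<And>x y. x \<in> Q ==> y \<in> Q ==> (x, y) \<notin> V ==> NR th x y" using near_returns_AE[OF erg] by blast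
 have Hn: "H \<times> UNIV \<in> null_sets mu2"
 proof (rule null_setsI)
  have Hb: "H \<in> sets mu" using H(1) by blast
  thus "H \<times> UNIV \<in> sets mu2" by (intro pair_measureI) auto
  have "emeasure mu2 (H \<times> UNIV) = emeasure mu H * emeasure mu UNIV" using Hb by (intro mu.emeasure_pair_measure_Times) auto
  thus "emeasure mu2 (H \<times> UNIV) = 0" using null_setsD1[OF H(1)] by simp
 qed
 show ?thesis
 proof (rule AE_area_pair)
  show "(\<Union>k. Z k) \<union> V \<union> H \<times> UNIV \<in> null_sets mu2"
   by (intro null_sets.Un null_sets_UN Z(1) V(1) Hn)
  fix x y assume x: "x \<in> Q" and y: "y \<in> Q" and n: "(x, y) \<notin> (\<Union>k. Z k) \<union> V \<union> H \<times> UNIV"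
  let ?E = "lower_hitting_exponent X th (proj X x) (proj X y)"
  have xH: "x \<in> Q - Hit th" using n H(2) x by blast
  have ge: "ereal (1 - 1 / real (k + 2)) \<le> ?E" for k by (rule Z(2)[OF xH y]) (use n in blast)
  have "NR th x y" using V(2)[OF x y] n by blast
  then obtain k where "\<And>n. (x, y) \<in> Vs th (real (Suc k)) n" unfolding NR_def by blast
  from hitting_exponent_le[OF x y _ this] have le: "?E \<le> 1" by simp
  show "?E = 1"
  proof (rule antisym[OF le], rule ccontr)
   assume "\<not> 1 \<le> ?E"
   hence "?E < 1" by simp
   then obtain e where e: "?E < ereal e" "ereal e < 1" using ereal_dense2 by blast
   have "0 < 1 - e" using e(2) by (simp add: one_ereal_def)
   then obtain k where k: "1 / real (Suc k) < 1 - e" using nat_approx_posE by blast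
   have "1 / real (k + 2) \<le> 1 / real (Suc k)" by (intro divide_left_mono) auto
   hence "e \<le> 1 - 1 / real (k + 2)" using k by linarith
   hence "ereal e \<le> ?E" using ge[of k] by (meson ereal_less_eq(3) order_trans)
   thus False using e(1) by simp
  qed
 qed
qed

end

theorem proposition4p6:
  fixes X :: gluing and \<theta> :: real
  assumes "translation_surface X"
    and "ergodic_direction X \<theta>"
  shows "AE (p, p') in area_measure X \<Otimes>\<^sub>M area_measure X. lower_hitting_exponent X \<theta> p p' = 1"
proof -
  interpret tsurf X by unfold_locales (rule assms(1))
  show ?thesis by (rule hitting_exponent_AE[OF assms(2)])
qed

end
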